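(* Let $r>0$ and let $\Omega:=B(0,r)$ be the open disk in $\mathbb R^2$ of radius $r$ centred at the origin. For $i=1,2,3$ let $A_i$ be the set of all points of $\Omega$ of the form $(\rho\cos\theta,\rho\sin\theta)$ with $\frac23\pi(i-1)\le\theta<\frac23\pi i$. Let $a_1<a_2<a_3$ be real numbers such that $$a_{i+1}-a_i\ge\sqrt{2r}\qquad\text{for } i=1,2,$$ and let $u:\Omega\to\mathbb R$ be defined by $u:=a_i$ on $A_i$. Then $u$ is a Dirichlet minimizer of $$F_0(v):=\int_{\Omega}|\nabla v|^2\,dx+\mathcal H^{1}(Sv),\qquad v\in SBV(\Omega),$$ that is, $F_0(u)\le F_0(v)$ for every $v\in SBV(\Omega)$ with the same trace as $u$ on $\partial\Omega$.
   Context: For $v\in BV(\Omega)$: $Sv$ is the set of points of $\Omega$ where $v$ has no approximate limit, where $v$ has approximate limit $a$ at $x$ if $\lim_{r\to0}r^{-2}\int_{B(x,r)}|v(y)-a|\,dy=0$; $\nabla v$ is the approximate gradient (density of $Dv$ with respect to Lebesgue measure $\mathcal L^2$). $SBV(\Omega)$ is the space of $v\in BV(\Omega)$ such that $Dv=\nabla v\cdot\mathcal L^2+(v^+-v^-)\nu_v\cdot\mathcal H^{1}\llcorner Sv$, with $v^\pm$ the approximate one-sided limits on $Sv$ and $\nu_v$ the approximate unit normal to $Sv$ pointing from the side of $v^-$ to that of $v^+$ (i.e. the Cantor part of $Dv$ vanishes). (The values of $u$ at the single point $0$ are irrelevant.) *)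

theory Defs
  imports "HOL-Analysis.Analysis"
begin

type_synonym plane = "real^2"

subsection \<open>The one-dimensional Hausdorff measure\<close>

(* The library diameter is only meaningful on bounded sets, hence the side condition.
   In dimension one the usual normalising constant equals 1. *)
definition hausdorff1_pre :: "real \<Rightarrow> 'a::metric_space set \<Rightarrow> ennreal" where
  "hausdorff1_pre \<delta> A =
     (INF C \<in> {C :: nat \<Rightarrow> 'a set. A \<subseteq> (\<Union>n. C n) \<and> (\<forall>n. bounded (C n) \<and> diameter (C n) \<le> \<delta>)}.
        (\<Sum>n. ennreal (diameter (C n))))"

definition hausdorff1_outer :: "'a::metric_space set \<Rightarrow> ennreal" where
  "hausdorff1_outer A = (SUP \<delta> \<in> {0<..}. hausdorff1_pre \<delta> A)"

(* hausdorff1_outer is a metric outer measure, hence countably additive on Borel sets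
   by the Caratheodory criterion. *)
definition hausdorff1 :: "'a::metric_space measure" where
  "hausdorff1 = measure_of UNIV (sets borel) hausdorff1_outer"


subsection \<open>Approximate limits, jump points, traces\<close>

definition approx_limit :: "(plane \<Rightarrow> real) \<Rightarrow> plane \<Rightarrow> real \<Rightarrow> bool" where
  "approx_limit v x a \<longleftrightarrow>
     ((\<lambda>\<rho>. (LINT y:ball x \<rho>|lebesgue. \<bar>v y - a\<bar>) / \<rho>\<^sup>2) \<longlongrightarrow> 0) (at_right 0)"

definition approx_discont :: "plane set \<Rightarrow> (plane \<Rightarrow> real) \<Rightarrow> plane set" where
  "approx_discont \<Omega> v = {x \<in> \<Omega>. \<not> (\<exists>a. approx_limit v x a)}"

definition approx_limit_side :: "(plane \<Rightarrow> real) \<Rightarrow> plane \<Rightarrow> plane \<Rightarrow> real \<Rightarrow> bool" where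
  "approx_limit_side v x n a \<longleftrightarrow>
     ((\<lambda>\<rho>. (LINT y:(ball x \<rho> \<inter> {y. (y - x) \<bullet> n > 0})|lebesgue. \<bar>v y - a\<bar>) / \<rho>\<^sup>2)
        \<longlongrightarrow> 0) (at_right 0)"

(* n points from the side of vm to the side of vp. The triple is determined up to the
   exchange of (vp, vm, n) with (vm, vp, -n), which leaves (vp - vm) n unchanged. *)
definition jump_triple :: "(plane \<Rightarrow> real) \<Rightarrow> plane \<Rightarrow> real \<Rightarrow> real \<Rightarrow> plane \<Rightarrow> bool" where
  "jump_triple v x vp vm n \<longleftrightarrow>
     norm n = 1 \<and> vp \<noteq> vm \<and> approx_limit_side v x n vp \<and> approx_limit_side v x (- n) vm"

definition is_trace :: "plane set \<Rightarrow> (plane \<Rightarrow> real) \<Rightarrow> (plane \<Rightarrow> real) \<Rightarrow> bool" where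
  "is_trace \<Omega> v T \<longleftrightarrow>
     (AE x in hausdorff1. x \<in> frontier \<Omega> \<longrightarrow>
        ((\<lambda>\<rho>. (LINT y:(\<Omega> \<inter> ball x \<rho>)|lebesgue. \<bar>v y - T x\<bar>) / \<rho>\<^sup>2) \<longlongrightarrow> 0) (at_right 0))"

definition same_trace :: "plane set \<Rightarrow> (plane \<Rightarrow> real) \<Rightarrow> (plane \<Rightarrow> real) \<Rightarrow> bool" where
  "same_trace \<Omega> u v \<longleftrightarrow> (\<exists>T. is_trace \<Omega> u T \<and> is_trace \<Omega> v T)"


subsection \<open>Functions of bounded variation\<close>

(* phi is of class C^1 with gradient g and compact support in Omega. *)
definition test_function :: "plane set \<Rightarrow> (plane \<Rightarrow> real) \<Rightarrow> (plane \<Rightarrow> plane) \<Rightarrow> bool" where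
  "test_function \<Omega> \<phi> g \<longleftrightarrow>
     (\<forall>x. GDERIV \<phi> x :> g x) \<and> continuous_on UNIV g \<and>
     (\<exists>K. compact K \<and> K \<subseteq> \<Omega> \<and> (\<forall>x. x \<notin> K \<longrightarrow> \<phi> x = 0))"

(* D is a finite vector measure on the Borel subsets of Omega, written as D = s mu with a finite
   positive measure mu and a mu-integrable density s, and D is the distributional
   gradient of v. *)
definition is_derivative_measure ::
    "plane set \<Rightarrow> (plane \<Rightarrow> real) \<Rightarrow> (plane set \<Rightarrow> plane) \<Rightarrow> bool" where
  "is_derivative_measure \<Omega> v D \<longleftrightarrow>
     (\<exists>\<mu> s. finite_measure \<mu> \<and> sets \<mu> = sets borel \<and> integrable \<mu> s \<and>
        (\<forall>B\<in>sets borel. B \<subseteq> \<Omega> \<longrightarrow> D B = (LINT x:B|\<mu>. s x)) \<and>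
        (\<forall>\<phi> g. test_function \<Omega> \<phi> g \<longrightarrow>
           (LINT x:\<Omega>|lebesgue. v x *\<^sub>R g x) = - (LINT x:\<Omega>|\<mu>. \<phi> x *\<^sub>R s x)))"

definition BV :: "plane set \<Rightarrow> (plane \<Rightarrow> real) set" where
  "BV \<Omega> = {v. set_integrable lebesgue \<Omega> v \<and> (\<exists>D. is_derivative_measure \<Omega> v D)}"

(* Unique on the Borel subsets of Omega. *)
definition derivative_measure :: "plane set \<Rightarrow> (plane \<Rightarrow> real) \<Rightarrow> plane set \<Rightarrow> plane" where
  "derivative_measure \<Omega> v = (SOME D. is_derivative_measure \<Omega> v D)"

(* The density of the absolutely continuous part of Dv in its Lebesgue decomposition:
   the singular part is concentrated on the null set N. Unique up to null sets. *)
definition approx_gradient :: "plane set \<Rightarrow> (plane \<Rightarrow> real) \<Rightarrow> plane \<Rightarrow> plane" where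
  "approx_gradient \<Omega> v =
     (SOME g. set_integrable lebesgue \<Omega> g \<and>
        (\<exists>N\<in>null_sets lborel. \<forall>B\<in>sets borel. B \<subseteq> \<Omega> - N \<longrightarrow>
           derivative_measure \<Omega> v B = (LINT x:B|lebesgue. g x)))"

(* The one-sided limits and the normal exist only almost everywhere on the discontinuity set
   with respect to the Hausdorff measure; vp, vm, n are arbitrary on the exceptional set. *)
definition SBV :: "plane set \<Rightarrow> (plane \<Rightarrow> real) set" where
  "SBV \<Omega> = {v \<in> BV \<Omega>. \<exists>vp vm n.
      (AE x in hausdorff1. x \<in> approx_discont \<Omega> v \<longrightarrow> jump_triple v x (vp x) (vm x) (n x)) \<and>
      set_integrable hausdorff1 (approx_discont \<Omega> v) (\<lambda>x. (vp x - vm x) *\<^sub>R n x) \<and>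
      (\<forall>B\<in>sets borel. B \<subseteq> \<Omega> \<longrightarrow>
         derivative_measure \<Omega> v B =
           (LINT x:B|lebesgue. approx_gradient \<Omega> v x) +
           (LINT x:(B \<inter> approx_discont \<Omega> v)|hausdorff1. (vp x - vm x) *\<^sub>R n x))}"


subsection \<open>The functional and its Dirichlet minimizers\<close>

definition F0 :: "plane set \<Rightarrow> (plane \<Rightarrow> real) \<Rightarrow> ennreal" where
  "F0 \<Omega> v = (\<integral>\<^sup>+x\<in>\<Omega>. ennreal ((norm (approx_gradient \<Omega> v x))\<^sup>2) \<partial>lebesgue)
             + hausdorff1_outer (approx_discont \<Omega> v)"

definition dirichlet_minimizer :: "plane set \<Rightarrow> (plane \<Rightarrow> real) \<Rightarrow> bool" where
  "dirichlet_minimizer \<Omega> u \<longleftrightarrow>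
     u \<in> SBV \<Omega> \<and> (\<forall>v\<in>SBV \<Omega>. same_trace \<Omega> u v \<longrightarrow> F0 \<Omega> u \<le> F0 \<Omega> v)"

definition sector :: "real \<Rightarrow> nat \<Rightarrow> plane set" where
  "sector r i = {x \<in> ball 0 r. \<exists>\<rho> \<theta>. 0 \<le> \<rho> \<and>
      2 / 3 * pi * (real i - 1) \<le> \<theta> \<and> \<theta> < 2 / 3 * pi * real i \<and>
      x = vector [\<rho> * cos \<theta>, \<rho> * sin \<theta>]}"

end

theory Submission
  imports Defs "HOL-Probability.Distribution_Functions" "HOL-Real_Asymp.Real_Asymp"
begin

text \<open>
  The proof is a calibration argument. Put \<open>c = 1 / sqrt (2 r)\<close> and \<open>h = sqrt (2 r) / 4\<close>, let \<open>\<nu>\<^sub>1\<close>,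
  \<open>\<nu>\<^sub>2\<close> be the unit normals of the two rays separating \<open>A\<^sub>1\<close> from \<open>A\<^sub>2\<close> and \<open>A\<^sub>2\<close> from \<open>A\<^sub>3\<close>, and consider
  in \<open>\<Omega> \<times> \<real>\<close> the two bands \<open>\<bar>t - l\<^sub>i x\<bar> < h\<close> with \<open>l\<^sub>i x = (c / 2) \<nu>\<^sub>i \<bullet> x + (a\<^sub>i + a\<^sub>i\<^sub>+\<^sub>1) / 2\<close>. The
  hypothesis on the gaps places them between the graphs of consecutive values of \<open>u\<close>, so they are disjoint.
  The field with horizontal part \<open>2 c \<nu>\<^sub>i\<close> and vertical part \<open>c\<^sup>2\<close> on the \<open>i\<close>-th band and zero elsewhere
  is divergence free. Completing the square bounds its flux through the absolutely continuous part of the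
  graph of \<open>v\<close> by the Dirichlet integral, and \<open>4 c h = 1\<close> together with the angle of 120 degrees between
  \<open>\<nu>\<^sub>1\<close> and \<open>\<nu>\<^sub>2\<close> bounds its flux through the vertical part by the length of the jump set. For \<open>u\<close> the total
  flux is \<open>3 r\<close>, and the flux depends on the trace only.

  The indicator functions of the bands are replaced by continuous trapezoids of slope \<open>1 / \<eta>\<close>, and the
  flux is computed against a cutoff. The necessary chain rule for \<open>\<Psi> (v x - l x)\<close> in \<open>BV\<close> is obtained by
  mollifying \<open>v\<close> and identifying the limit of the derivative at points of approximate continuity and at jump
  points through blow-ups; this avoids both the coarea formula and the rectifiability of the jump set.
\<close>

section \<open>The one-dimensional Hausdorff measure\<close>

text \<open>The constants are forced. Across the boundary of a band, whose normal is
  \<open>(- (c / 2) \<nu>, 1)\<close>, the flux of \<open>(2 c \<nu>, c\<^sup>2)\<close> vanishes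
  exactly because the slope is \<open>c / 2\<close>. A jump over a whole band of height
  \<open>2 h\<close> collects \<open>2 c\<close> times \<open>2 h\<close>, hence
  \<open>4 c h = 1\<close>. A tilted band fits between two values of \<open>u\<close> if
  \<open>c r / 2 + h\<close> is at most half their gap; with \<open>h = 1 / (4 c)\<close> the left
  side is least at \<open>c = 1 / sqrt (2 r)\<close>, where both terms are
  \<open>sqrt (2 r) / 4\<close>. This is the origin of the gap \<open>sqrt (2 r)\<close>. Two bands
  serve three interfaces because the jump at the third ray crosses both, and
  \<open>\<nu>\<^sub>1 + \<nu>\<^sub>2\<close> is a unit normal of that ray. The derivative measure
  and the approximate gradient are defined by choice, so existence and uniqueness are proved before
  anything is computed for \<open>u\<close>. The discontinuity set of a competitor is controlled
  only in outer measure, and the trace only at almost every single point of the circle; both have to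
  be converted into statements about integrals.\<close>

lemma hausdorff1_pre_le:
  assumes "A \<subseteq> (\<Union>n. C n)" "\<And>n. bounded (C n)" "\<And>n. diameter (C n) \<le> \<delta>"
  shows "hausdorff1_pre \<delta> A \<le> (\<Sum>n. ennreal (diameter (C n)))"
  unfolding hausdorff1_pre_def by (rule INF_lower) (use assms in auto)

lemma hausdorff1_pre_cover:
  assumes "hausdorff1_pre \<delta> A < c"
  obtains C where "A \<subseteq> (\<Union>n. C n)" "\<And>n. bounded (C n)" "\<And>n. diameter (C n) \<le> \<delta>"
    "(\<Sum>n. ennreal (diameter (C n))) < c"
  using assms unfolding hausdorff1_pre_def INF_less_iff by auto

lemma hausdorff1_pre_mono: "A \<subseteq> B \<Longrightarrow> hausdorff1_pre \<delta> A \<le> hausdorff1_pre \<delta> B"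
  unfolding hausdorff1_pre_def by (rule INF_superset_mono) auto

lemma hausdorff1_pre_antimono: "\<delta> \<le> \<delta>' \<Longrightarrow> hausdorff1_pre \<delta>' A \<le> hausdorff1_pre \<delta> A"
  unfolding hausdorff1_pre_def by (rule INF_superset_mono) (auto intro: order_trans)

lemma hausdorff1_pre_le_outer: "0 < \<delta> \<Longrightarrow> hausdorff1_pre \<delta> A \<le> hausdorff1_outer A"
  unfolding hausdorff1_outer_def by (rule SUP_upper) auto

lemma hausdorff1_outer_least:
  "(\<And>\<delta>. 0 < \<delta> \<Longrightarrow> hausdorff1_pre \<delta> A \<le> c) \<Longrightarrow> hausdorff1_outer A \<le> c"
  unfolding hausdorff1_outer_def by (rule SUP_least) auto

lemma hausdorff1_outer_mono: "A \<subseteq> B \<Longrightarrow> hausdorff1_outer A \<le> hausdorff1_outer B"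
  unfolding hausdorff1_outer_def by (intro SUP_mono) (auto intro: hausdorff1_pre_mono)

lemma hausdorff1_outer_empty [simp]: "hausdorff1_outer {} = 0"
proof -
  have "hausdorff1_outer ({}::'a set) \<le> 0"
  proof (rule hausdorff1_outer_least)
    fix \<delta> :: real assume "0 < \<delta>"
    then show "hausdorff1_pre \<delta> ({}::'a set) \<le> 0"
      using hausdorff1_pre_le[of "{}::'a set" "\<lambda>_. {}" \<delta>] by simp
  qed
  then show ?thesis by simp
qed

text \<open>Near-optimal covers of the sets \<open>A n\<close>, each with excess
  \<open>e / 2 ^ (n + 1)\<close>, are merged into a single sequence by pairing the two
  indices.\<close>

lemma hausdorff1_pre_UN: "hausdorff1_pre \<delta> (\<Union>i. A i) \<le> (\<Sum>i::nat. hausdorff1_pre \<delta> (A i))"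
proof (rule ennreal_le_epsilon)
  fix e :: real assume e: "0 < e" and fin: "(\<Sum>n. hausdorff1_pre \<delta> (A n)) < top"
  have *: "hausdorff1_pre \<delta> (A n) < hausdorff1_pre \<delta> (A n) + ennreal (e * (1/2)^Suc n)" for n
    using e fin by (auto simp add: less_top dest!: ennreal_suminf_lessD)
  have "\<exists>C. A n \<subseteq> (\<Union>i. C i) \<and> (\<forall>i. bounded (C i)) \<and> (\<forall>i. diameter (C i) \<le> \<delta>) \<and>
      (\<Sum>i. ennreal (diameter (C i))) \<le> hausdorff1_pre \<delta> (A n) + ennreal (e * (1/2)^Suc n)" for n
    by (rule hausdorff1_pre_cover[OF *[of n]]) (metis less_imp_le)
  then obtain B where B: "\<And>n. A n \<subseteq> (\<Union>i. B n i)" "\<And>n i. bounded (B n i)"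
      "\<And>n i. diameter (B n i) \<le> \<delta>"
      "\<And>n. (\<Sum>i. ennreal (diameter (B n i))) \<le> hausdorff1_pre \<delta> (A n) + ennreal (e * (1/2)^Suc n)"
    by metis
  define C where "C = case_prod B o prod_decode"
  have A_C: "(\<Union>i. A i) \<subseteq> (\<Union>i. C i)"
    using B(1) by (auto simp add: C_def subset_eq) (metis prod.case prod_encode_inverse)
  have "hausdorff1_pre \<delta> (\<Union>i. A i) \<le> (\<Sum>i. ennreal (diameter (C i)))"
    by (rule hausdorff1_pre_le[OF A_C]) (auto simp: C_def split_def B)
  also have "\<dots> = (\<Sum>n. \<Sum>i. ennreal (diameter (B n i)))"
    unfolding C_def comp_def by (rule suminf_ennreal_2dimen[where f="\<lambda>p. ennreal (diameter (case_prod B p))"]) auto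
  also have "\<dots> \<le> (\<Sum>n. hausdorff1_pre \<delta> (A n) + ennreal (e * (1/2) ^ Suc n))"
    by (intro suminf_le B) auto
  also have "... = (\<Sum>n. hausdorff1_pre \<delta> (A n)) + (\<Sum>n. ennreal e * ennreal ((1/2) ^ Suc n))"
    using \<open>0 < e\<close> by (subst suminf_add[symmetric])
                     (auto simp del: ennreal_suminf_cmult simp add: ennreal_mult[symmetric])
  also have "\<dots> = (\<Sum>n. hausdorff1_pre \<delta> (A n)) + e"
    unfolding ennreal_suminf_cmult
    by (subst suminf_ennreal_eq[OF zero_le_power power_half_series]) auto
  finally show "hausdorff1_pre \<delta> (\<Union>i. A i) \<le> (\<Sum>n. hausdorff1_pre \<delta> (A n)) + e" .
qed

lemma hausdorff1_outer_UN: "hausdorff1_outer (\<Union>i. A i) \<le> (\<Sum>i::nat. hausdorff1_outer (A i))"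
proof (rule hausdorff1_outer_least)
  fix \<delta> :: real assume "0 < \<delta>"
  have "hausdorff1_pre \<delta> (\<Union>i. A i) \<le> (\<Sum>i. hausdorff1_pre \<delta> (A i))"
    by (rule hausdorff1_pre_UN)
  also have "\<dots> \<le> (\<Sum>i. hausdorff1_outer (A i))"
    by (intro suminf_le hausdorff1_pre_le_outer \<open>0 < \<delta>\<close>) auto
  finally show "hausdorff1_pre \<delta> (\<Union>i. A i) \<le> (\<Sum>i. hausdorff1_outer (A i))" .
qed

lemma hausdorff1_outer_Un: "hausdorff1_outer (A \<union> B) \<le> hausdorff1_outer A + hausdorff1_outer B"
proof -
  have "hausdorff1_outer (\<Union>i. binaryset A B i) \<le> (\<Sum>i. hausdorff1_outer (binaryset A B i))"
    by (rule hausdorff1_outer_UN)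
  also have "\<dots> = hausdorff1_outer A + hausdorff1_outer B"
    by (rule suminf_binaryset_eq) simp
  finally show ?thesis by (simp add: UN_binaryset_eq)
qed

text \<open>A covering set of diameter at most \<open>\<delta> < d\<close> cannot meet both
  \<open>A\<close> and \<open>B\<close>. Splitting a cover of the union according to which of the
  two sets is met therefore costs nothing.\<close>

lemma hausdorff1_pre_separated:
  fixes A B :: "'a::metric_space set"
  assumes "\<And>x y. x \<in> A \<Longrightarrow> y \<in> B \<Longrightarrow> d \<le> dist x y" "\<delta> < d" "0 \<le> \<delta>"
  shows "hausdorff1_pre \<delta> A + hausdorff1_pre \<delta> B \<le> hausdorff1_pre \<delta> (A \<union> B)"
  unfolding hausdorff1_pre_def[of \<delta> "A \<union> B"]
proof (rule INF_greatest, safe)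
  fix C :: "nat \<Rightarrow> 'a set"
  assume C: "A \<union> B \<subseteq> (\<Union>n. C n)" "\<forall>n. bounded (C n) \<and> diameter (C n) \<le> \<delta>"
  define CA where "CA n = (if C n \<inter> A = {} then {} else C n)" for n
  define CB where "CB n = (if C n \<inter> B = {} then {} else C n)" for n
  have disj: "CA n = {} \<or> CB n = {}" for n
  proof (rule ccontr)
    assume "\<not> ?thesis"
    then obtain x y where "x \<in> C n" "x \<in> A" "y \<in> C n" "y \<in> B"
      by (auto simp: CA_def CB_def split: if_splits)
    with assms(1,2) diameter_bounded_bound[of "C n" x y] C(2) show False
      by (smt (verit))
  qed
  have le: "ennreal (diameter (CA n)) + ennreal (diameter (CB n)) \<le> ennreal (diameter (C n))" for n
    using disj[of n]
  proof
    assume "CA n = {}" then show ?thesis by (simp add: CB_def)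
  next
    assume "CB n = {}" then show ?thesis by (simp add: CA_def)
  qed
  have "hausdorff1_pre \<delta> A \<le> (\<Sum>n. ennreal (diameter (CA n)))"
  proof (rule hausdorff1_pre_le)
    show "A \<subseteq> (\<Union>n. CA n)" using C(1) by (fastforce simp: CA_def)
  qed (use C assms in \<open>auto simp: CA_def\<close>)
  moreover have "hausdorff1_pre \<delta> B \<le> (\<Sum>n. ennreal (diameter (CB n)))"
  proof (rule hausdorff1_pre_le)
    show "B \<subseteq> (\<Union>n. CB n)" using C(1) by (fastforce simp: CB_def)
  qed (use C assms in \<open>auto simp: CB_def\<close>)
  ultimately have "hausdorff1_pre \<delta> A + hausdorff1_pre \<delta> B
      \<le> (\<Sum>n. ennreal (diameter (CA n))) + (\<Sum>n. ennreal (diameter (CB n)))"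
    by (rule add_mono)
  also have "\<dots> = (\<Sum>n. ennreal (diameter (CA n)) + ennreal (diameter (CB n)))"
    by (rule suminf_add) auto
  also have "\<dots> \<le> (\<Sum>n. ennreal (diameter (C n)))"
    by (intro suminf_le le) auto
  finally show "hausdorff1_pre \<delta> A + hausdorff1_pre \<delta> B \<le> (\<Sum>n. ennreal (diameter (C n)))" .
qed

text \<open>Two scales can be replaced by their minimum with \<open>d / 2\<close>, which only
  enlarges both premeasures; the suprema over the scales are then taken one after the other.\<close>

lemma hausdorff1_outer_separated:
  fixes A B :: "'a::metric_space set"
  assumes "\<And>x y. x \<in> A \<Longrightarrow> y \<in> B \<Longrightarrow> d \<le> dist x y" "0 < d"
  shows "hausdorff1_outer A + hausdorff1_outer B \<le> hausdorff1_outer (A \<union> B)"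
proof -
  have *: "hausdorff1_pre \<delta>1 A + hausdorff1_pre \<delta>2 B \<le> hausdorff1_outer (A \<union> B)"
    if "0 < \<delta>1" "0 < \<delta>2" for \<delta>1 \<delta>2
  proof -
    define \<delta> where "\<delta> = min (min \<delta>1 \<delta>2) (d/2)"
    have d: "0 < \<delta>" "\<delta> < d" "\<delta> \<le> \<delta>1" "\<delta> \<le> \<delta>2" using that assms(2) by (auto simp: \<delta>_def)
    have "hausdorff1_pre \<delta>1 A + hausdorff1_pre \<delta>2 B \<le> hausdorff1_pre \<delta> A + hausdorff1_pre \<delta> B"
      by (intro add_mono hausdorff1_pre_antimono d)
    also have "\<dots> \<le> hausdorff1_pre \<delta> (A \<union> B)"
      by (rule hausdorff1_pre_separated[OF assms(1)]) (use d in auto)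
    also have "\<dots> \<le> hausdorff1_outer (A \<union> B)"
      by (rule hausdorff1_pre_le_outer) fact
    finally show ?thesis .
  qed
  have **: "hausdorff1_outer A + hausdorff1_pre \<delta>2 B \<le> hausdorff1_outer (A \<union> B)" if "0 < \<delta>2" for \<delta>2
    unfolding hausdorff1_outer_def[of A]
    by (subst ennreal_SUP_add_left[symmetric]) (auto intro!: SUP_least *[OF _ that] exI[of _ 1])
  show ?thesis
    unfolding hausdorff1_outer_def[of B]
    by (subst ennreal_SUP_add_right) (auto intro!: SUP_least ** exI[of _ 1])
qed

section \<open>Caratheodory's criterion and Borel measurability\<close>

lemma ennreal_suminf_tail_small:
  fixes f :: "nat \<Rightarrow> ennreal" and e :: real
  assumes "suminf f < top" "0 < e"
  shows "\<exists>m. (\<Sum>i. f (i + m)) \<le> e"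
proof -
  have f: "f = (\<lambda>i. ennreal (enn2real (f i)))"
    using ennreal_suminf_lessD[OF assms(1)] by (intro ext) simp
  have s: "summable (\<lambda>i. enn2real (f i))"
    by (rule summable_suminf_not_top) (use assms(1) f in \<open>auto simp: less_top\<close>)
  obtain m where "norm (\<Sum>i. enn2real (f (i + m))) < e"
    using suminf_exist_split[OF assms(2) s] by blast
  moreover have "(\<Sum>i. f (i + m)) = ennreal (\<Sum>i. enn2real (f (i + m)))"
    using s summable_iff_shift[of "\<lambda>i. enn2real (f i)" m] by (subst f, intro suminf_ennreal2) auto
  ultimately show ?thesis
    by (intro exI[of _ m]) (auto intro!: ennreal_leI)
qed

text \<open>The part of \<open>T\<close> outside \<open>F\<close> is exhausted by the sets
  \<open>U n\<close> at positive distance from \<open>F\<close>. What is left decomposes into shells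
  \<open>R k\<close>; shells with indices of equal parity are separated from each other, so the
  measures of each parity class sum up to at most the measure of \<open>T\<close>. Hence the tail of
  the series is small, and the additivity known for \<open>U n\<close> passes to the limit.\<close>

lemma hausdorff1_outer_closed:
  fixes F T :: "'a::metric_space set"
  assumes "closed F"
  shows "hausdorff1_outer (T \<inter> F) + hausdorff1_outer (T - F) \<le> hausdorff1_outer T"
proof (cases "F = {} \<or> hausdorff1_outer T = top")
  case True then show ?thesis by auto
next
  case False
  then have F: "F \<noteq> {}" and fin: "hausdorff1_outer T < top" by (auto simp: less_top)
  define U where "U n = {x \<in> T. 1 / (real n + 1) \<le> infdist x F}" for n
  define R where "R n = {x \<in> T. 1 / (real n + 2) \<le> infdist x F \<and> infdist x F < 1 / (real n + 1)}" for n
  have sep: "hausdorff1_outer A + hausdorff1_outer B \<le> hausdorff1_outer (A \<union> B)"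
    if "\<And>x. x \<in> A \<Longrightarrow> s \<le> infdist x F" "\<And>x. x \<in> B \<Longrightarrow> infdist x F \<le> t" "t < s" for A B s t
  proof (rule hausdorff1_outer_separated[of _ _ "s - t"])
    fix x y assume "x \<in> A" "y \<in> B"
    with that infdist_triangle[of x F y] show "s - t \<le> dist x y" by fastforce
  qed (use that in auto)
  have U: "hausdorff1_outer (T \<inter> F) + hausdorff1_outer (U n) \<le> hausdorff1_outer T" for n
  proof -
    have "hausdorff1_outer (U n) + hausdorff1_outer (T \<inter> F) \<le> hausdorff1_outer (U n \<union> (T \<inter> F))"
      by (rule sep[of _ "1 / (real n + 1)" _ 0]) (auto simp: U_def)
    also have "\<dots> \<le> hausdorff1_outer T" by (rule hausdorff1_outer_mono) (auto simp: U_def)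
    finally show ?thesis by (simp add: add.commute)
  qed
  have "(\<Sum>k<n. hausdorff1_outer (R (2 * k + b))) \<le> hausdorff1_outer (\<Union>k<n. R (2 * k + b))" for n b
  proof (induction n)
    case (Suc n)
    have "(\<Sum>k<Suc n. hausdorff1_outer (R (2 * k + b)))
        \<le> hausdorff1_outer (\<Union>k<n. R (2 * k + b)) + hausdorff1_outer (R (2 * n + b))"
      using Suc by (auto intro: add_right_mono)
    \<comment> \<open>The upper separating level takes \<open>1 / 2\<close> as a value between 0 and
      1: with \<open>2 n + b\<close> alone the denominator would vanish for
      \<open>n = b = 0\<close>, and the strict inequality between the levels would fail.\<close>
    also have "\<dots> \<le> hausdorff1_outer ((\<Union>k<n. R (2 * k + b)) \<union> R (2 * n + b))"
    proof (rule sep[of _ "1 / (2 * real n + real b + 1 / 2)" _ "1 / (2 * real n + real b + 1)"])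
      fix x assume "x \<in> (\<Union>k<n. R (2 * k + b))"
      then obtain k where k: "k < n" and x: "1 / (2 * real k + real b + 2) \<le> infdist x F" by (auto simp: R_def)
      have "1 / (2 * real n + real b + 1 / 2) \<le> 1 / (2 * real k + real b + 2)"
        by (rule divide_left_mono) (use k in auto)
      with x show "1 / (2 * real n + real b + 1 / 2) \<le> infdist x F" by simp
    next
      show "1 / (2 * real n + real b + 1) < 1 / (2 * real n + real b + 1 / 2)"
        by (simp add: frac_less2)
    qed (auto simp: R_def)
    also have "(\<Union>k<n. R (2 * k + b)) \<union> R (2 * n + b) = (\<Union>k<Suc n. R (2 * k + b))"
      by (auto simp: less_Suc_eq)
    finally show ?case .
  qed simp
  then have "(\<Sum>k<n. hausdorff1_outer (R (2 * k + b))) \<le> hausdorff1_outer T" for n b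
    by (rule order_trans) (auto intro!: hausdorff1_outer_mono simp: R_def)
  then have Rb: "(\<Sum>k. hausdorff1_outer (R (2 * k + b))) \<le> hausdorff1_outer T" for b
    unfolding suminf_eq_SUP by (intro SUP_least)
  define f where "f k = hausdorff1_outer (R (2 * k + 0)) + hausdorff1_outer (R (2 * k + 1))" for k
  have "suminf f \<le> hausdorff1_outer T + hausdorff1_outer T"
    unfolding f_def by (subst suminf_add[symmetric]) (auto intro!: add_mono Rb[of 1, simplified] Rb[of 0, simplified])
  then have ff: "suminf f < top" using fin by (meson ennreal_add_less_top le_less_trans)
  show ?thesis
  proof (rule ennreal_le_epsilon)
    fix e :: real assume "0 < e"
    then obtain m where m: "(\<Sum>i. f (i + m)) \<le> e" using ennreal_suminf_tail_small[OF ff] by blast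
    have "T - F \<subseteq> U (2 * m) \<union> (\<Union>i. R (2 * (i + m) + 0) \<union> R (2 * (i + m) + 1))"
    proof
      fix x assume x: "x \<in> T - F"
      then have pos: "0 < infdist x F"
        using assms F infdist_pos_not_in_closed by blast
      show "x \<in> U (2 * m) \<union> (\<Union>i. R (2 * (i + m) + 0) \<union> R (2 * (i + m) + 1))"
      proof (cases "x \<in> U (2 * m)")
        case False
        define P where "P n \<longleftrightarrow> 1 / (real n + 1) \<le> infdist x F" for n
        obtain n0 where "P n0"
          using pos reals_Archimedean[of "infdist x F"] unfolding P_def
          by (metis Suc_eq_plus1 add.commute inverse_eq_divide less_imp_le of_nat_Suc)
        \<comment> \<open>The first threshold \<open>1 / (n + 1)\<close> not exceeding the distance;
          the preceding threshold still exceeds it, so \<open>x\<close> lies in the shell of index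
          \<open>n - 1\<close>.\<close>
        define n where "n = (LEAST n. P n)"
        have Pn: "P n" using \<open>P n0\<close> unfolding n_def by (rule LeastI)
        have nP: "\<not> P k" if "k < n" for k using that unfolding n_def by (rule not_less_Least)
        have "\<not> P (2 * m)" using False x by (auto simp: U_def P_def)
        then have "2 * m < n"
        proof -
          have "P k" if "n \<le> k" for k
          proof -
            have "1 / (real k + 1) \<le> 1 / (real n + 1)"
              by (rule divide_left_mono) (use that in auto)
            with Pn show ?thesis unfolding P_def by linarith
          qed
          with \<open>\<not> P (2 * m)\<close> show ?thesis by (meson not_less)
        qed
        then obtain j where j: "n = Suc j" "2 * m \<le> j" by (cases n) auto
        have "x \<in> R j" using x Pn nP[of j] j by (auto simp: R_def P_def add.commute)
        moreover obtain i where "j = 2 * (i + m) + 0 \<or> j = 2 * (i + m) + 1"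
        proof
          show "j = 2 * ((j div 2 - m) + m) + 0 \<or> j = 2 * ((j div 2 - m) + m) + 1"
            using j(2) by presburger
        qed
        ultimately show ?thesis by blast
      qed auto
    qed
    then have "hausdorff1_outer (T - F)
        \<le> hausdorff1_outer (U (2 * m) \<union> (\<Union>i. R (2 * (i + m) + 0) \<union> R (2 * (i + m) + 1)))"
      by (rule hausdorff1_outer_mono)
    also have "\<dots> \<le> hausdorff1_outer (U (2 * m)) + (\<Sum>i. hausdorff1_outer (R (2 * (i + m) + 0) \<union> R (2 * (i + m) + 1)))"
      by (rule order_trans[OF hausdorff1_outer_Un]) (intro add_left_mono hausdorff1_outer_UN)
    also have "\<dots> \<le> hausdorff1_outer (U (2 * m)) + (\<Sum>i. f (i + m))"
      unfolding f_def by (intro add_left_mono suminf_le hausdorff1_outer_Un) auto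
    also have "\<dots> \<le> hausdorff1_outer (U (2 * m)) + e"
      by (intro add_left_mono m)
    finally have "hausdorff1_outer (T \<inter> F) + hausdorff1_outer (T - F)
        \<le> hausdorff1_outer (T \<inter> F) + (hausdorff1_outer (U (2 * m)) + e)"
      by (rule add_left_mono)
    also have "\<dots> \<le> hausdorff1_outer T + e"
      using U[of "2 * m"] by (simp add: add.assoc[symmetric] add_right_mono)
    finally show "hausdorff1_outer (T \<inter> F) + hausdorff1_outer (T - F) \<le> hausdorff1_outer T + e" .
  qed
qed

text \<open>The sets that split every test set additively form a sigma algebra on which the outer
  measure is a measure. It contains the closed sets, hence the Borel sets.\<close>

lemma measure_space_hausdorff1_outer:
  "measure_space UNIV (sets borel) (hausdorff1_outer :: 'a::metric_space set \<Rightarrow> ennreal)"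
proof -
  let ?f = "hausdorff1_outer :: 'a set \<Rightarrow> ennreal"
  let ?L = "lambda_system UNIV (Pow UNIV) ?f"
  have "outer_measure_space (Pow UNIV) ?f"
    unfolding outer_measure_space_def positive_def increasing_def countably_subadditive_def
    by (auto intro: hausdorff1_outer_mono hausdorff1_outer_UN)
  then have L: "measure_space UNIV ?L ?f"
    by (rule sigma_algebra.caratheodory_lemma[OF sigma_algebra_Pow])
  have "F \<in> ?L" if "closed F" for F :: "'a set"
    unfolding lambda_system_def
  proof (safe, simp)
    fix T :: "'a set"
    have "?f T \<le> ?f (F \<inter> T) + ?f ((UNIV - F) \<inter> T)"
      by (rule order_trans[OF hausdorff1_outer_mono hausdorff1_outer_Un]) auto
    moreover have "F \<inter> T = T \<inter> F" "(UNIV - F) \<inter> T = T - F" by auto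
    ultimately show "?f (F \<inter> T) + ?f ((UNIV - F) \<inter> T) = ?f T"
      using hausdorff1_outer_closed[OF that, of T] by (intro antisym) auto
  qed
  then have "sets borel \<subseteq> ?L"
    unfolding borel_eq_closed using L
    by (subst sets_measure_of) (simp, intro sigma_algebra.sigma_sets_subset, auto simp: measure_space_def)
  then show ?thesis
    using L by (rule measure_down[rotated 2]) (metis sets.sigma_algebra_axioms space_borel)
qed

lemma sets_hausdorff1 [simp, measurable_cong]: "sets hausdorff1 = sets borel"
  unfolding hausdorff1_def using sets.sets_measure_of_eq[of borel] by simp

lemma space_hausdorff1 [simp]: "space hausdorff1 = UNIV"
  unfolding hausdorff1_def by (simp add: space_measure_of_conv)

lemma emeasure_hausdorff1:
  assumes "B \<in> sets borel"
  shows "emeasure hausdorff1 B = hausdorff1_outer B"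
  unfolding hausdorff1_def
  by (rule emeasure_measure_of_sigma)
    (use measure_space_hausdorff1_outer assms in \<open>auto simp: measure_space_def\<close>)

lemma AE_hausdorff1_E:
  assumes "AE x in hausdorff1. P x"
  obtains N where "N \<in> sets borel" "hausdorff1_outer N = 0" "\<And>x. x \<notin> N \<Longrightarrow> P x"
proof -
  obtain N where "{x \<in> space hausdorff1. \<not> P x} \<subseteq> N" "emeasure hausdorff1 N = 0" "N \<in> sets hausdorff1"
    using assms by (rule AE_E)
  then show ?thesis
    by (intro that[of N]) (auto simp: emeasure_hausdorff1)
qed

section \<open>Lipschitz images, segments and lines\<close>

text \<open>A set of diameter \<open>d\<close> has its image in a closed interval of length at most
  \<open>d\<close>. The image of \<open>S\<close> may fail to be measurable, hence the Borel cover
  \<open>U\<close>.\<close>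

lemma lipschitz_image_cover:
  fixes f :: "'a::metric_space \<Rightarrow> real"
  assumes lip: "\<And>x y. \<bar>f x - f y\<bar> \<le> dist x y" and S: "hausdorff1_outer S < c"
  obtains U where "U \<in> sets borel" "f ` S \<subseteq> U" "emeasure lborel U \<le> c"
proof -
  have "hausdorff1_pre 1 S < c" using hausdorff1_pre_le_outer[of 1 S] S by simp
  then obtain C where C: "S \<subseteq> (\<Union>n. C n)" "\<And>n. bounded (C n)" "(\<Sum>n. ennreal (diameter (C n))) < c"
    by (rule hausdorff1_pre_cover) blast
  define I where "I n = (if C n = {} then {} else {Inf (f ` C n)..Sup (f ` C n)})" for n
  have le: "f x \<le> f y + diameter (C n)" if "x \<in> C n" "y \<in> C n" for x y n
    using diameter_bounded_bound[of "C n" x y] C(2) lip[of x y] that by force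
  have bdd: "bdd_above (f ` C n)" "bdd_below (f ` C n)" if "C n \<noteq> {}" for n
  proof -
    obtain y where y: "y \<in> C n" using \<open>C n \<noteq> {}\<close> by blast
    show "bdd_above (f ` C n)"
      by (rule bdd_aboveI2[of _ _ "f y + diameter (C n)"]) (use le y in auto)
    show "bdd_below (f ` C n)"
      by (rule bdd_belowI2[of _ "f y - diameter (C n)"]) (use le[OF y] in \<open>force simp: algebra_simps\<close>)
  qed
  have sub: "f ` C n \<subseteq> I n" for n
    using bdd[of n] by (cases "C n = {}") (auto simp: I_def intro: cSUP_upper cINF_lower)
  have em: "emeasure lborel (I n) \<le> ennreal (diameter (C n))" for n
  proof (cases "C n = {}")
    case False
    have "Sup (f ` C n) \<le> f y + diameter (C n)" if "y \<in> C n" for y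
      by (rule cSUP_least) (use False le that in auto)
    then have "Sup (f ` C n) - diameter (C n) \<le> Inf (f ` C n)"
      by (intro cINF_greatest False) (auto simp: algebra_simps)
    moreover have "Inf (f ` C n) \<le> Sup (f ` C n)"
    proof -
      obtain y where "y \<in> C n" using False by blast
      then show ?thesis
        using cINF_lower[OF bdd(2)[OF False], of y] cSUP_upper[OF _ bdd(1)[OF False], of y] by linarith
    qed
    ultimately show ?thesis using False by (simp add: I_def ennreal_leI)
  qed (simp add: I_def)
  have "f ` S \<subseteq> (\<Union>n. f ` C n)" using image_mono[OF C(1), of f] by (simp add: image_UN)
  also have "\<dots> \<subseteq> (\<Union>n. I n)" by (rule UN_mono[OF subset_refl sub])
  finally have "f ` S \<subseteq> (\<Union>n. I n)" .
  moreover have "emeasure lborel (\<Union>n. I n) \<le> c"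
  proof -
    have "emeasure lborel (\<Union>n. I n) \<le> (\<Sum>n. emeasure lborel (I n))"
      by (rule emeasure_subadditive_countably) (auto simp: I_def)
    also have "\<dots> \<le> (\<Sum>n. ennreal (diameter (C n)))" by (intro suminf_le em) auto
    finally show ?thesis using C(3) by simp
  qed
  moreover have "(\<Union>n. I n) \<in> sets borel" by (auto simp: I_def)
  ultimately show ?thesis by (rule that[rotated])
qed

text \<open>Lower bounds for the Hausdorff measure come from here: a map that does not increase
  distances does not increase length.\<close>

lemma emeasure_lborel_le_hausdorff1_outer:
  fixes f :: "'a::metric_space \<Rightarrow> real"
  assumes lip: "\<And>x y. \<bar>f x - f y\<bar> \<le> dist x y" and A: "A \<in> sets borel" "A \<subseteq> f ` S"
  shows "emeasure lborel A \<le> hausdorff1_outer S"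
proof (rule dense_ge)
  fix c assume "hausdorff1_outer S < c"
  from lipschitz_image_cover[OF lip this] obtain U where U: "U \<in> sets borel" "f ` S \<subseteq> U" "emeasure lborel U \<le> c" .
  have "emeasure lborel A \<le> emeasure lborel U" using U A(2) by (intro emeasure_mono) auto
  then show "emeasure lborel A \<le> c" using U(3) by (rule order_trans)
qed

text \<open>Cutting the segment into \<open>N + 1\<close> equal pieces of length at most
  \<open>\<delta>\<close> gives a cover whose diameters add up to at most \<open>b - a\<close>, at
  every scale.\<close>

lemma hausdorff1_outer_segment:
  fixes p :: "'a::real_normed_vector"
  assumes "norm p = 1" "a \<le> b"
  shows "hausdorff1_outer ((\<lambda>t. t *\<^sub>R p) ` {a..b}) \<le> ennreal (b - a)"
proof (rule hausdorff1_outer_least)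
  fix \<delta> :: real assume "0 < \<delta>"
  obtain N where N: "(b - a) / \<delta> < real N" using reals_Archimedean2 by blast
  define h where "h = (b - a) / (real N + 1)"
  have "0 \<le> h" using assms by (simp add: h_def)
  have "h \<le> \<delta>"
  proof -
    have "b - a \<le> \<delta> * (real N + 1)" using N \<open>0 < \<delta>\<close> by (simp add: field_simps)
    then show ?thesis by (simp add: h_def field_simps)
  qed
  define C where "C n = (if n < Suc N then (\<lambda>t. t *\<^sub>R p) ` {a + real n * h..a + real (Suc n) * h} else {})" for n
  have dist: "dist (s *\<^sub>R p) (t *\<^sub>R p) = \<bar>s - t\<bar>" for s t
    using assms by (simp add: dist_norm scaleR_diff_left[symmetric])
  have bd: "bounded (C n)" for n
    unfolding C_def by (auto intro!: compact_imp_bounded compact_continuous_image continuous_intros)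
  have dm: "diameter (C n) \<le> (if n < Suc N then h else 0)" for n
    unfolding C_def using \<open>0 \<le> h\<close>
    by (auto intro!: diameter_le simp: dist[unfolded dist_norm]) (auto simp: algebra_simps)
  have cov: "(\<lambda>t. t *\<^sub>R p) ` {a..b} \<subseteq> (\<Union>n. C n)"
  proof clarify
    fix t assume t: "t \<in> {a..b}"
    show "t *\<^sub>R p \<in> (\<Union>n. C n)"
    proof (cases "h = 0")
      case True
      then have "t = a" using t assms by (auto simp: h_def)
      then show ?thesis using True by (auto simp: C_def intro!: exI[of _ 0])
    next
      case False
      then have "0 < h" using \<open>0 \<le> h\<close> by simp
      \<comment> \<open>The floor would send the right end point to the nonexistent piece
        \<open>N + 1\<close>; it belongs to piece \<open>N\<close>.\<close>
      define n where "n = (if t = b then N else nat \<lfloor>(t - a) / h\<rfloor>)"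
      have bh: "b = a + (real N + 1) * h" by (simp add: h_def)
      have "real n * h \<le> t - a \<and> t - a \<le> (real n + 1) * h \<and> n \<le> N"
      proof (cases "t = b")
        case True then show ?thesis using bh \<open>0 < h\<close> by (simp add: n_def algebra_simps)
      next
        case False
        have n: "real n = of_int \<lfloor>(t - a) / h\<rfloor>" using False t \<open>0 < h\<close> by (simp add: n_def)
        have 1: "real n \<le> (t - a) / h" "(t - a) / h < real n + 1" unfolding n by linarith+
        have "(t - a) / h < real N + 1" using False t bh \<open>0 < h\<close> by (simp add: field_simps)
        with 1 have "n \<le> N" by linarith
        with 1 \<open>0 < h\<close> show ?thesis by (simp add: field_simps)
      qed
      then show ?thesis by (auto simp: C_def intro!: exI[of _ n] imageI) (auto simp: algebra_simps)
    qed
  qed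
  have "hausdorff1_pre \<delta> ((\<lambda>t. t *\<^sub>R p) ` {a..b}) \<le> (\<Sum>n. ennreal (diameter (C n)))"
    by (rule hausdorff1_pre_le[OF cov bd]) (use dm \<open>h \<le> \<delta>\<close> \<open>0 < \<delta>\<close> in \<open>smt (verit)\<close>)
  also have "\<dots> \<le> (\<Sum>n. ennreal (if n < Suc N then h else 0))"
    by (intro suminf_le ennreal_leI dm) auto
  also have "\<dots> = (\<Sum>n<Suc N. ennreal (if n < Suc N then h else 0))"
    by (rule suminf_finite) auto
  also have "\<dots> = ennreal (\<Sum>n<Suc N. h)"
    using \<open>0 \<le> h\<close> by (subst sum_ennreal) auto
  also have "(\<Sum>n<Suc N. h) = b - a" by (simp add: h_def field_simps)
  finally show "hausdorff1_pre \<delta> ((\<lambda>t. t *\<^sub>R p) ` {a..b}) \<le> ennreal (b - a)" .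
qed

text \<open>Both measures agree on open intervals. Subdivision bounds the length of a segment from
  above; from below, the coordinate along the unit vector \<open>p\<close>, which does not increase
  distances, recovers the interval. Integrals over rays thereby become ordinary integrals.\<close>

lemma lborel_eq_hausdorff1_line:
  fixes p :: "'a::euclidean_space"
  assumes "norm p = 1"
  shows "lborel = distr (density hausdorff1 (indicator (range (\<lambda>t. t *\<^sub>R p)))) borel (\<lambda>x. x \<bullet> p)"
proof (rule lborel_eqI)
  have pp: "p \<bullet> p = 1" using assms by (simp add: dot_square_norm)
  have R: "range (\<lambda>t. t *\<^sub>R p) \<in> sets borel"
  proof -
    have "range (\<lambda>t. t *\<^sub>R p) = {x. x = (x \<bullet> p) *\<^sub>R p}" using pp by (auto simp: image_iff)
    moreover have "closed {x. x = (x \<bullet> p) *\<^sub>R p}" by (intro closed_Collect_eq continuous_intros)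
    ultimately show ?thesis by simp
  qed
  fix l u :: real assume "\<And>b. b \<in> Basis \<Longrightarrow> l \<bullet> b \<le> u \<bullet> b"
  then have lu: "l \<le> u" by simp
  let ?S = "(\<lambda>t. t *\<^sub>R p) ` {l<..<u}"
  have eq: "range (\<lambda>t. t *\<^sub>R p) \<inter> (\<lambda>x. x \<bullet> p) -` {l<..<u} = ?S"
    using pp by auto
  have V: "(\<lambda>x. x \<bullet> p) -` {l<..<u} \<in> sets borel"
    by (rule measurable_sets_borel[OF borel_measurable_inner]) auto
  have "emeasure (distr (density hausdorff1 (indicator (range (\<lambda>t. t *\<^sub>R p)))) borel (\<lambda>x. x \<bullet> p)) {l<..<u}
      = emeasure (density hausdorff1 (indicator (range (\<lambda>t. t *\<^sub>R p)))) ((\<lambda>x. x \<bullet> p) -` {l<..<u})"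
    by (subst emeasure_distr) (auto simp: measurable_cong_sets[OF sets_density refl] measurable_cong_sets[OF sets_hausdorff1 refl])
  also have "\<dots> = emeasure hausdorff1 (range (\<lambda>t. t *\<^sub>R p) \<inter> (\<lambda>x. x \<bullet> p) -` {l<..<u})"
    using R V by (subst emeasure_density) (auto simp: nn_integral_indicator[symmetric] indicator_inter_arith simp del: nn_integral_indicator intro!: nn_integral_cong)
  also have "\<dots> = hausdorff1_outer ?S"
    using R V eq by (metis emeasure_hausdorff1 sets.Int)
  also have "\<dots> = ennreal (u - l)"
  proof (rule antisym)
    show "hausdorff1_outer ?S \<le> ennreal (u - l)"
      by (rule order_trans[OF hausdorff1_outer_mono hausdorff1_outer_segment[OF assms lu]]) auto
    have "emeasure lborel {l<..<u} \<le> hausdorff1_outer ?S"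
    proof (rule emeasure_lborel_le_hausdorff1_outer[of "\<lambda>x. x \<bullet> p"])
      show "\<bar>x \<bullet> p - y \<bullet> p\<bar> \<le> dist x y" for x y
        using Cauchy_Schwarz_ineq2[of "x - y" p] assms by (simp add: inner_diff_left dist_norm)
      show "{l<..<u} \<subseteq> (\<lambda>x. x \<bullet> p) ` ?S" using pp by (force simp: image_image)
    qed auto
    then show "ennreal (u - l) \<le> hausdorff1_outer ?S" using lu by simp
  qed
  finally show "emeasure (distr (density hausdorff1 (indicator (range (\<lambda>t. t *\<^sub>R p)))) borel (\<lambda>x. x \<bullet> p)) (box l u)
      = (\<Prod>b\<in>Basis. (u - l) \<bullet> b)" by simp
qed simp

lemma line_borel:
  fixes p :: "'a::euclidean_space"
  shows "range (\<lambda>t. t *\<^sub>R p) \<in> sets borel"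
proof -
  have "closed (span {p})" by simp
  then show ?thesis unfolding span_singleton by simp
qed

lemma hausdorff1_line:
  fixes p :: "'a::euclidean_space" and f :: "'a \<Rightarrow> 'b::{banach,second_countable_topology}"
  assumes "norm p = 1" and [measurable]: "f \<in> borel_measurable borel"
  shows set_integrable_hausdorff1_line:
      "set_integrable hausdorff1 (range (\<lambda>t. t *\<^sub>R p)) f \<longleftrightarrow> integrable lborel (\<lambda>t. f (t *\<^sub>R p))" (is ?A)
    and integral_hausdorff1_line:
      "(LINT x:range (\<lambda>t. t *\<^sub>R p)|hausdorff1. f x) = (LINT t|lborel. f (t *\<^sub>R p))" (is ?B)
proof -
  let ?L = "range (\<lambda>t. t *\<^sub>R p)"
  have pp: "p \<bullet> p = 1" using assms by (simp add: dot_square_norm)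
  have L[measurable]: "?L \<in> sets borel" by (rule line_borel)
  have m[measurable]: "(\<lambda>x. x \<bullet> p) \<in> density hausdorff1 (indicator ?L) \<rightarrow>\<^sub>M borel"
    by (auto simp: measurable_cong_sets[OF sets_density refl] measurable_cong_sets[OF sets_hausdorff1 refl])
  have d: "density hausdorff1 (indicator ?L) = density hausdorff1 (\<lambda>x. ennreal (indicator ?L x :: real))"
    by (intro arg_cong[where f="density hausdorff1"] ext) (simp add: indicator_def)
  have eq: "indicator ?L x *\<^sub>R f ((x \<bullet> p) *\<^sub>R p) = (indicator ?L x *\<^sub>R f x :: 'b)" for x
    using pp by (auto simp: indicator_def)
  have im[measurable]: "(indicator ?L :: 'a \<Rightarrow> real) \<in> borel_measurable hausdorff1"
    by (subst measurable_cong_sets[OF sets_hausdorff1 refl]) measurable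
  have fm[measurable]: "(\<lambda>x. f ((x \<bullet> p) *\<^sub>R p)) \<in> borel_measurable hausdorff1"
    by (subst measurable_cong_sets[OF sets_hausdorff1 refl]) measurable
  have fm'[measurable]: "(\<lambda>t. f (t *\<^sub>R p)) \<in> borel_measurable borel" by measurable
  have "integrable lborel (\<lambda>t. f (t *\<^sub>R p)) \<longleftrightarrow> integrable (density hausdorff1 (indicator ?L)) (\<lambda>x. f ((x \<bullet> p) *\<^sub>R p))"
    by (subst lborel_eq_hausdorff1_line[OF assms(1)]) (rule integrable_distr_eq[OF m fm'])
  also have "\<dots> \<longleftrightarrow> set_integrable hausdorff1 ?L f"
    unfolding d set_integrable_def by (subst integrable_density[OF fm im]) (simp_all only: eq, auto)
  finally show ?A by simp
  have "(LINT t|lborel. f (t *\<^sub>R p)) = integral\<^sup>L (density hausdorff1 (indicator ?L)) (\<lambda>x. f ((x \<bullet> p) *\<^sub>R p))"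
    by (subst lborel_eq_hausdorff1_line[OF assms(1)]) (rule integral_distr[OF m fm'])
  also have "\<dots> = (LINT x:?L|hausdorff1. f x)"
    unfolding d set_lebesgue_integral_def by (subst integral_density[OF fm im]) (simp_all only: eq, auto)
  finally show ?B by simp
qed

text \<open>A set of diameter \<open>d \<le> \<delta>\<close> lies in a disk of area
  \<open>pi * d\<^sup>2 \<le> pi * \<delta> * d\<close>. A cover of total diameter below
  \<open>M\<close> thus gives area at most \<open>pi * \<delta> * M\<close>, which tends to 0. For a
  competitor of finite energy this makes the discontinuity set negligible.\<close>

lemma null_sets_lebesgue_if_hausdorff1_finite:
  fixes S :: "plane set"
  assumes "hausdorff1_outer S < top"
  shows "S \<in> null_sets lebesgue"
proof -
  define M where "M = enn2real (hausdorff1_outer S) + 1"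
  have M: "hausdorff1_outer S < ennreal M" "0 < M"
    using assms unfolding M_def
    by (cases "hausdorff1_outer S"; auto simp: ennreal_less_iff)+
  have "\<exists>U\<in>sets borel. S \<subseteq> U \<and> emeasure lborel U \<le> ennreal (pi * M / real (Suc k))" for k
  proof -
    define \<delta> where "\<delta> = 1 / real (Suc k)"
    have \<delta>: "0 < \<delta>" by (simp add: \<delta>_def)
    have "hausdorff1_pre \<delta> S < M" using hausdorff1_pre_le_outer[OF \<delta>] M(1) by (rule le_less_trans)
    then obtain C where C: "S \<subseteq> (\<Union>n. C n)" "\<And>n. bounded (C n)" "\<And>n. diameter (C n) \<le> \<delta>"
      "(\<Sum>n. ennreal (diameter (C n))) < M" by (rule hausdorff1_pre_cover) blast
    define B where "B n = (if C n = {} then {} else cball (SOME x. x \<in> C n) (diameter (C n)))" for n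
    have sub: "C n \<subseteq> B n" for n
    proof
      fix x assume "x \<in> C n"
      then have "(SOME x. x \<in> C n) \<in> C n" by (metis someI)
      with \<open>x \<in> C n\<close> show "x \<in> B n" using diameter_bounded_bound[OF C(2)] by (auto simp: B_def)
    qed
    have em: "emeasure lborel (B n) \<le> ennreal (pi * \<delta>) * ennreal (diameter (C n))" for n
    proof (cases "C n = {}")
      case False
      have d: "0 \<le> diameter (C n)" using C(2) by (rule diameter_ge_0)
      have "emeasure lborel (B n) = ennreal (pi * (diameter (C n))\<^sup>2)"
        using False d by (simp add: B_def emeasure_cball unit_ball_vol_2)
      also have "\<dots> \<le> ennreal ((pi * \<delta>) * diameter (C n))"
        using C(3)[of n] d by (intro ennreal_leI) (simp add: power2_eq_square mult_mono)
      finally show ?thesis using \<delta> d by (simp add: ennreal_mult)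
    qed (simp add: B_def)
    have "emeasure lborel (\<Union>n. B n) \<le> (\<Sum>n. emeasure lborel (B n))"
      by (rule emeasure_subadditive_countably) (auto simp: B_def)
    also have "\<dots> \<le> (\<Sum>n. ennreal (pi * \<delta>) * ennreal (diameter (C n)))"
      by (intro suminf_le em) auto
    also have "\<dots> \<le> ennreal (pi * \<delta>) * ennreal M"
      unfolding ennreal_suminf_cmult using C(4) by (intro mult_left_mono) auto
    also have "\<dots> = ennreal (pi * M / real (Suc k))"
      using M \<delta> by (subst ennreal_mult[symmetric]) (auto simp: \<delta>_def)
    finally show ?thesis
      using order_trans[OF C(1) UN_mono[OF subset_refl sub]]
      by (intro bexI[of _ "\<Union>n. B n"] conjI) (auto simp: B_def)
  qed
  then obtain U where U: "\<And>k. U k \<in> sets borel" "\<And>k. S \<subseteq> U k"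
    "\<And>k. emeasure lborel (U k) \<le> ennreal (pi * M / real (Suc k))" by metis
  have "emeasure lborel (\<Inter>k. U k) \<le> ennreal (pi * M / real (Suc k))" for k
    using U(1) by (intro order_trans[OF emeasure_mono U(3)]) auto
  moreover have "(\<lambda>k. ennreal (pi * M / real (Suc k))) \<longlonglongrightarrow> ennreal 0"
    by (intro tendsto_ennrealI) real_asymp
  ultimately have "emeasure lborel (\<Inter>k. U k) \<le> 0"
    by (intro LIMSEQ_le_const[where X="\<lambda>k. ennreal (pi * M / real (Suc k))"]) auto
  then have "(\<Inter>k. U k) \<in> null_sets lborel" using U(1) by (intro null_setsI) auto
  moreover have "S \<subseteq> (\<Inter>k. U k)" using U(2) by auto
  ultimately show ?thesis unfolding null_sets_completion_iff2 by (rule bexI[rotated])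
qed

section \<open>Translations and dilations of the Lebesgue measure\<close>

lemma nn_integral_lborel_translate:
  fixes f :: "'a::euclidean_space \<Rightarrow> ennreal"
  assumes [measurable]: "f \<in> borel_measurable borel"
  shows "(\<integral>\<^sup>+x. f (h + x) \<partial>lborel) = (\<integral>\<^sup>+x. f x \<partial>lborel)"
proof -
  have "(\<integral>\<^sup>+x. f x \<partial>lborel) = (\<integral>\<^sup>+x. f x \<partial>distr lborel borel ((+) h))"
    by (simp add: lborel_distr_plus)
  also have "\<dots> = (\<integral>\<^sup>+x. f (h + x) \<partial>lborel)"
    by (subst nn_integral_distr) auto
  finally show ?thesis by simp
qed

lemma
  fixes f :: "'a::euclidean_space \<Rightarrow> 'b::{banach,second_countable_topology}"
  assumes [measurable]: "f \<in> borel_measurable borel" and "c \<noteq> 0"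
  shows integrable_lborel_affine: "integrable lborel (\<lambda>z. f (t + c *\<^sub>R z)) \<longleftrightarrow> integrable lborel f"
    and integral_lborel_affine:
      "(\<integral>x. f x \<partial>lborel) = \<bar>c\<bar> ^ DIM('a) *\<^sub>R (\<integral>z. f (t + c *\<^sub>R z) \<partial>lborel)"
proof -
  have m: "(\<lambda>x. t + c *\<^sub>R x) \<in> lborel \<rightarrow>\<^sub>M (borel :: 'a measure)" by measurable
  have eq: "(lborel :: 'a measure) = density (distr lborel borel (\<lambda>x. t + c *\<^sub>R x)) (\<lambda>_. ennreal (\<bar>c\<bar>^DIM('a)))"
    using lborel_affine[OF assms(2), of t] by (simp add: ennreal_power)
  have "integrable lborel f \<longleftrightarrow> integrable (distr lborel borel (\<lambda>x. t + c *\<^sub>R x)) (\<lambda>x. \<bar>c\<bar>^DIM('a) *\<^sub>R f x)"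
    by (subst eq) (subst integrable_density, auto)
  also have "\<dots> \<longleftrightarrow> integrable lborel (\<lambda>z. \<bar>c\<bar>^DIM('a) *\<^sub>R f (t + c *\<^sub>R z))"
    by (subst integrable_distr_eq[OF m]) auto
  also have "\<dots> \<longleftrightarrow> integrable lborel (\<lambda>z. f (t + c *\<^sub>R z))"
  proof
    assume "integrable lborel (\<lambda>z. \<bar>c\<bar>^DIM('a) *\<^sub>R f (t + c *\<^sub>R z))"
    from integrable_scaleR_right[OF this, of "inverse (\<bar>c\<bar>^DIM('a))"] assms(2)
    show "integrable lborel (\<lambda>z. f (t + c *\<^sub>R z))" by simp
  qed simp
  finally show "integrable lborel (\<lambda>z. f (t + c *\<^sub>R z)) \<longleftrightarrow> integrable lborel f" by simp
  have "(\<integral>x. f x \<partial>lborel) = (\<integral>x. \<bar>c\<bar>^DIM('a) *\<^sub>R f x \<partial>distr lborel borel (\<lambda>x. t + c *\<^sub>R x))"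
    by (subst eq) (subst integral_density, auto)
  also have "\<dots> = (\<integral>z. \<bar>c\<bar>^DIM('a) *\<^sub>R f (t + c *\<^sub>R z) \<partial>lborel)"
    by (subst integral_distr[OF m]) auto
  finally show "(\<integral>x. f x \<partial>lborel) = \<bar>c\<bar> ^ DIM('a) *\<^sub>R (\<integral>z. f (t + c *\<^sub>R z) \<partial>lborel)" by simp
qed

text \<open>A closed inner approximation is made compact by intersecting it with a large ball; since
  \<open>A\<close> has finite measure, the part cut off tends to measure 0.\<close>

lemma compact_open_approx_lborel:
  fixes A :: "'a::euclidean_space set"
  assumes A: "A \<in> sets borel" "emeasure lborel A < \<infinity>" and "0 < (e::real)"
  obtains K U where "compact K" "open U" "K \<subseteq> A" "A \<subseteq> U" "emeasure lborel (U - K) \<le> e"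
proof -
  obtain U where U: "open U" "A \<subseteq> U" "emeasure lborel (U - A) < e / 3"
    using outer_regular_lborel[OF A(1), of "e / 3"] assms(3) by (metis divide_pos_pos zero_less_numeral)
  obtain T where T: "closed T" "T \<subseteq> A" "emeasure lebesgue (A - T) < e / 3"
    using sets_lebesgue_inner_closed[of A "e / 3"] A(1) assms(3)
    by (metis divide_pos_pos zero_less_numeral sets_completionI_sets sets_lborel)
  have T': "emeasure lborel (A - T) < e / 3"
    using T A by (subst (asm) emeasure_completion) auto
  define R where "R n = T - ball 0 (real n)" for n
  have "(\<lambda>n. emeasure lborel (R n)) \<longlonglongrightarrow> emeasure lborel (\<Inter>n. R n)"
  proof (rule Lim_emeasure_decseq)
    show "range R \<subseteq> sets lborel" using T by (auto simp: R_def)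
    show "decseq R" by (auto simp: R_def decseq_def)
    show "emeasure lborel (R n) \<noteq> \<infinity>" for n
    proof -
      have "R n \<subseteq> A" using T(2) by (auto simp: R_def)
      then have "emeasure lborel (R n) \<le> emeasure lborel A" using A by (intro emeasure_mono) auto
      with A(2) show ?thesis by auto
    qed
  qed
  moreover have "(\<Inter>n. R n) = {}"
    using reals_Archimedean2 by (fastforce simp: R_def)
  ultimately have "(\<lambda>n. emeasure lborel (R n)) \<longlonglongrightarrow> 0" by simp
  then have "eventually (\<lambda>n. emeasure lborel (R n) < e / 3) sequentially"
    using assms(3) by (intro order_tendstoD) auto
  then obtain n where n: "emeasure lborel (R n) < e / 3" by (auto simp: eventually_sequentially)
  show ?thesis
  proof (rule that[of "T \<inter> cball 0 (real n)" U])
    show "compact (T \<inter> cball 0 (real n))" using T by (intro closed_Int_compact) auto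
    have "U - T \<inter> cball 0 (real n) \<subseteq> (U - A) \<union> (A - T) \<union> R n" by (auto simp: R_def)
    then have "emeasure lborel (U - T \<inter> cball 0 (real n)) \<le> emeasure lborel ((U - A) \<union> (A - T) \<union> R n)"
      using U T A by (intro emeasure_mono) (auto simp: R_def)
    also have "\<dots> \<le> emeasure lborel (U - A) + emeasure lborel (A - T) + emeasure lborel (R n)"
      using U T A by (intro order_trans[OF emeasure_subadditive] add_right_mono emeasure_subadditive) (auto simp: R_def)
    also have "\<dots> \<le> ennreal (e / 3) + ennreal (e / 3) + ennreal (e / 3)"
      using U T' n by (intro add_mono) auto
    also have "\<dots> = e" using assms(3) by (simp add: ennreal_plus[symmetric] del: ennreal_plus)
    finally show "emeasure lborel (U - T \<inter> cball 0 (real n)) \<le> e" .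
  qed (use U T in auto)
qed

text \<open>For an indicator, a translation by less than the distance from \<open>K\<close> to the
  complement of \<open>U\<close> changes the value at \<open>x\<close> only if \<open>x\<close> or
  its translate lies in \<open>U - K\<close>, a set of small measure. Sums and limits in the mean
  preserve the property.\<close>

lemma L1_translation_continuous:
  fixes f :: "'a::euclidean_space \<Rightarrow> real"
  assumes "integrable lborel f" "0 < e"
  shows "\<exists>d>0. \<forall>h. norm h < d \<longrightarrow> (\<integral>\<^sup>+x. ennreal \<bar>f (h + x) - f x\<bar> \<partial>lborel) \<le> ennreal e"
  using assms
proof (induction arbitrary: e rule: integrable_induct)
  case (base A c)
  then have A: "A \<in> sets borel" "emeasure lborel A < \<infinity>" by auto
  define e' where "e' = e / (2 * (\<bar>c\<bar> + 1))"
  have "0 < e'" using base by (simp add: e'_def)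
  then obtain K U where KU: "compact K" "open U" "K \<subseteq> A" "A \<subseteq> U" "emeasure lborel (U - K) \<le> e'"
    using compact_open_approx_lborel[OF A] by blast
  obtain d where d: "0 < d" "\<And>x y. x \<in> K \<Longrightarrow> y \<notin> U \<Longrightarrow> d \<le> dist x y"
    using separate_compact_closed[of K "- U"] KU by (metis ComplI closed_Compl disjoint_eq_subset_Compl double_complement order_trans)
  have [measurable]: "A \<in> sets borel" "U - K \<in> sets borel" using A KU by (auto simp: compact_imp_closed)
  show ?case
  proof (intro exI[of _ d] conjI allI impI d)
    fix h :: 'a assume h: "norm h < d"
    have le: "\<bar>indicator A (h + x) *\<^sub>R c - indicator A x *\<^sub>R c\<bar> \<le> \<bar>c\<bar> * (indicator (U - K) x + indicator (U - K) (h + x))" for x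
    proof -
      have "x \<in> K \<Longrightarrow> h + x \<in> U" "h + x \<in> K \<Longrightarrow> x \<in> U"
        using d(2)[of x "h + x"] d(2)[of "h + x" x] h by (force simp: dist_norm)+
      moreover have "x \<in> K \<Longrightarrow> x \<in> A" "x \<in> A \<Longrightarrow> x \<in> U" "h + x \<in> K \<Longrightarrow> h + x \<in> A" "h + x \<in> A \<Longrightarrow> h + x \<in> U"
        using KU(3,4) by auto
      ultimately show ?thesis
        by (cases "x \<in> A"; cases "h + x \<in> A"; cases "x \<in> K"; cases "h + x \<in> K"; simp add: indicator_def)
    qed
    have "ennreal \<bar>indicator A (h + x) *\<^sub>R c - indicator A x *\<^sub>R c\<bar>
        \<le> ennreal \<bar>c\<bar> * (indicator (U - K) x + indicator (U - K) (h + x))" for x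
      using ennreal_leI[OF le[of x]] by (simp add: ennreal_mult ennreal_indicator)
    then have "(\<integral>\<^sup>+x. ennreal \<bar>indicator A (h + x) *\<^sub>R c - indicator A x *\<^sub>R c\<bar> \<partial>lborel)
        \<le> (\<integral>\<^sup>+x. ennreal \<bar>c\<bar> * (indicator (U - K) x + indicator (U - K) (h + x)) \<partial>lborel)"
      by (intro nn_integral_mono)
    also have "\<dots> = ennreal \<bar>c\<bar> * ((\<integral>\<^sup>+x. indicator (U - K) x \<partial>lborel) + (\<integral>\<^sup>+x. indicator (U - K) (h + x) \<partial>lborel))"
      by (subst nn_integral_cmult) (auto simp: nn_integral_add)
    also have "(\<integral>\<^sup>+x. indicator (U - K) (h + x) \<partial>lborel) = (\<integral>\<^sup>+x. indicator (U - K) x \<partial>lborel)"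
      by (rule nn_integral_lborel_translate) measurable
    also have "(\<integral>\<^sup>+x. indicator (U - K) x \<partial>lborel) = emeasure lborel (U - K)" by simp
    also have "ennreal \<bar>c\<bar> * (emeasure lborel (U - K) + emeasure lborel (U - K)) \<le> ennreal \<bar>c\<bar> * (ennreal e' + ennreal e')"
      using KU by (intro mult_left_mono add_mono) auto
    also have "\<dots> = ennreal (\<bar>c\<bar> * (e' + e'))"
      using \<open>0 < e'\<close> by (simp add: ennreal_mult ennreal_plus[symmetric] del: ennreal_plus)
    also have "\<dots> \<le> ennreal e"
    proof (rule ennreal_leI)
      define x where "x = \<bar>c\<bar> + 1"
      have "0 < x" by (simp add: x_def)
      then have "(\<bar>c\<bar> + 1) * (e' + e') = e" unfolding e'_def x_def[symmetric] by simp
      moreover have "\<bar>c\<bar> * (e' + e') \<le> (\<bar>c\<bar> + 1) * (e' + e')"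
        using \<open>0 < e'\<close> by (intro mult_right_mono) auto
      ultimately show "\<bar>c\<bar> * (e' + e') \<le> e" by simp
    qed
    finally show "(\<integral>\<^sup>+x. ennreal \<bar>indicator A (h + x) *\<^sub>R c - indicator A x *\<^sub>R c\<bar> \<partial>lborel) \<le> ennreal e" .
  qed
next
  case (add f g)
  have [measurable]: "f \<in> borel_measurable borel" "g \<in> borel_measurable borel" using add by auto
  obtain d1 where d1: "d1 > 0" "\<And>h. norm h < d1 \<Longrightarrow> (\<integral>\<^sup>+x. ennreal \<bar>f (h + x) - f x\<bar> \<partial>lborel) \<le> ennreal (e/2)"
    using add(3)[of "e/2"] add.prems by auto
  obtain d2 where d2: "d2 > 0" "\<And>h. norm h < d2 \<Longrightarrow> (\<integral>\<^sup>+x. ennreal \<bar>g (h + x) - g x\<bar> \<partial>lborel) \<le> ennreal (e/2)"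
    using add(4)[of "e/2"] add.prems by auto
  show ?case
  proof (intro exI[of _ "min d1 d2"] conjI allI impI)
    fix h :: 'a assume h: "norm h < min d1 d2"
    have "(\<integral>\<^sup>+x. ennreal \<bar>f (h + x) + g (h + x) - (f x + g x)\<bar> \<partial>lborel)
       \<le> (\<integral>\<^sup>+x. ennreal \<bar>f (h + x) - f x\<bar> + ennreal \<bar>g (h + x) - g x\<bar> \<partial>lborel)"
      by (intro nn_integral_mono) (auto simp: ennreal_plus[symmetric] simp del: ennreal_plus intro!: ennreal_leI)
    also have "\<dots> = (\<integral>\<^sup>+x. ennreal \<bar>f (h + x) - f x\<bar> \<partial>lborel) + (\<integral>\<^sup>+x. ennreal \<bar>g (h + x) - g x\<bar> \<partial>lborel)"
      by (rule nn_integral_add) auto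
    also have "\<dots> \<le> ennreal (e/2) + ennreal (e/2)" using d1 d2 h by (intro add_mono) auto
    also have "\<dots> = ennreal e" using add.prems by (simp add: ennreal_plus[symmetric] del: ennreal_plus)
    finally show "(\<integral>\<^sup>+x. ennreal \<bar>f (h + x) + g (h + x) - (f x + g x)\<bar> \<partial>lborel) \<le> ennreal e" .
  qed (use d1 d2 in auto)
next
  case (lim f s)
  have [measurable]: "f \<in> borel_measurable borel" "\<And>i. s i \<in> borel_measurable borel" using lim by auto
  have "(\<lambda>i. \<integral>\<^sup>+x. norm (f x - s i x) \<partial>lborel) \<longlonglongrightarrow> 0"
  proof (rule nn_integral_dominated_convergence_norm[where w="\<lambda>x. 2 * norm (f x)"])
    show "(\<integral>\<^sup>+ x. ennreal (2 * norm (f x)) \<partial>lborel) < \<infinity>"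
      using integrable_mult_right[OF integrable_norm[OF \<open>integrable lborel f\<close>], of 2]
      unfolding integrable_iff_bounded by simp
  qed (use lim in auto)
  then have "eventually (\<lambda>i. (\<integral>\<^sup>+x. norm (f x - s i x) \<partial>lborel) < e / 3) sequentially"
    using lim.prems by (intro order_tendstoD) auto
  then obtain i where i: "(\<integral>\<^sup>+x. norm (f x - s i x) \<partial>lborel) < e / 3" by (auto simp: eventually_sequentially)
  obtain d where d: "d > 0" "\<And>h. norm h < d \<Longrightarrow> (\<integral>\<^sup>+x. ennreal \<bar>s i (h + x) - s i x\<bar> \<partial>lborel) \<le> ennreal (e/3)"
    using lim.IH[of "e/3" i] lim.prems by auto
  show ?case
  proof (intro exI[of _ d] conjI allI impI d)
    fix h :: 'a assume h: "norm h < d"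
    have "(\<integral>\<^sup>+x. ennreal \<bar>f (h + x) - f x\<bar> \<partial>lborel)
       \<le> (\<integral>\<^sup>+x. ennreal \<bar>f (h + x) - s i (h + x)\<bar> + (ennreal \<bar>s i (h + x) - s i x\<bar> + ennreal \<bar>f x - s i x\<bar>) \<partial>lborel)"
      by (intro nn_integral_mono) (auto simp: ennreal_plus[symmetric] simp del: ennreal_plus intro!: ennreal_leI)
    also have "\<dots> = (\<integral>\<^sup>+x. ennreal \<bar>f (h + x) - s i (h + x)\<bar> \<partial>lborel)
        + ((\<integral>\<^sup>+x. ennreal \<bar>s i (h + x) - s i x\<bar> \<partial>lborel) + (\<integral>\<^sup>+x. ennreal \<bar>f x - s i x\<bar> \<partial>lborel))"
      by (simp add: nn_integral_add)
    also have "(\<integral>\<^sup>+x. ennreal \<bar>f (h + x) - s i (h + x)\<bar> \<partial>lborel) = (\<integral>\<^sup>+x. ennreal \<bar>f x - s i x\<bar> \<partial>lborel)"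
      by (rule nn_integral_lborel_translate) measurable
    also have "\<dots> + ((\<integral>\<^sup>+x. ennreal \<bar>s i (h + x) - s i x\<bar> \<partial>lborel) + (\<integral>\<^sup>+x. ennreal \<bar>f x - s i x\<bar> \<partial>lborel))
        \<le> ennreal (e/3) + (ennreal (e/3) + ennreal (e/3))"
      using d(2)[OF h] i by (intro add_mono) auto
    also have "\<dots> = ennreal e" using lim.prems by (simp add: ennreal_plus[symmetric] del: ennreal_plus)
    finally show "(\<integral>\<^sup>+x. ennreal \<bar>f (h + x) - f x\<bar> \<partial>lborel) \<le> ennreal e" .
  qed
qed

text \<open>Integrating the difference quotients of a compactly supported function gives zero for
  every step, because Lebesgue measure is translation invariant.\<close>

lemma integral_directional_derivative_eq_0:
  fixes F G :: "'a::euclidean_space \<Rightarrow> real"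
  assumes int: "integrable lborel F"
    and supp: "\<And>x. R < norm x \<Longrightarrow> F x = 0"
    and lip: "\<And>x t. \<bar>F (x + t *\<^sub>R \<nu>) - F x\<bar> \<le> L * \<bar>t\<bar>"
    and deriv: "\<And>x. ((\<lambda>t. F (x + t *\<^sub>R \<nu>)) has_real_derivative G x) (at 0)"
  shows "(\<integral>x. G x \<partial>lborel) = 0"
proof -
  define t where "t n = 1 / real (Suc n)" for n
  have t: "0 < t n" "t n \<le> 1" for n by (auto simp: t_def)
  have "t \<longlonglongrightarrow> 0" unfolding t_def by real_asymp
  have L: "0 \<le> L" using lip[of 0 1] by linarith
  have [measurable]: "F \<in> borel_measurable borel" using int by auto
  define q where "q n x = (F (x + t n *\<^sub>R \<nu>) - F x) / t n" for n x
  have lim: "(\<lambda>n. q n x) \<longlonglongrightarrow> G x" for x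
  proof -
    have "((\<lambda>h. (F (x + h *\<^sub>R \<nu>) - F x) / h) \<longlongrightarrow> G x) (at 0)"
      using deriv[of x] by (simp add: DERIV_def)
    then have "((\<lambda>h. (F (x + h *\<^sub>R \<nu>) - F x) / h) \<circ> t) \<longlonglongrightarrow> G x"
      unfolding tendsto_at_iff_sequentially using \<open>t \<longlonglongrightarrow> 0\<close> t by (auto simp: less_imp_neq[symmetric])
    then show ?thesis by (simp add: q_def comp_def)
  qed
  have [measurable]: "q n \<in> borel_measurable borel" for n unfolding q_def by measurable
  have [measurable]: "G \<in> borel_measurable borel"
    by (rule borel_measurable_LIMSEQ_metric[OF _ lim]) measurable
  have "(\<lambda>n. \<integral>x. q n x \<partial>lborel) \<longlonglongrightarrow> (\<integral>x. G x \<partial>lborel)"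
  proof (rule integral_dominated_convergence[where w="\<lambda>x. L * indicator (cball 0 (R + norm \<nu>)) x"])
    show "integrable lborel (\<lambda>x. L * indicator (cball 0 (R + norm \<nu>)) x)"
      by (intro integrable_mult_right integrable_real_indicator) (auto simp: emeasure_lborel_cball_finite[unfolded infinity_ennreal_def])
    show "AE x in lborel. norm (q n x) \<le> L * indicator (cball 0 (R + norm \<nu>)) x" for n
    proof (intro AE_I2)
      fix x
      show "norm (q n x) \<le> L * indicator (cball 0 (R + norm \<nu>)) x"
      proof (cases "norm x \<le> R + norm \<nu>")
        case True
        have "norm (q n x) = \<bar>F (x + t n *\<^sub>R \<nu>) - F x\<bar> / t n" using t[of n] by (simp add: q_def)
        also have "\<dots> \<le> L" using lip[of x "t n"] t[of n] by (simp add: divide_le_eq)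
        finally show ?thesis using True by simp
      next
        case False
        have "norm (x + t n *\<^sub>R \<nu>) \<ge> norm x - t n * norm \<nu>"
          using norm_triangle_ineq2[of x "- (t n *\<^sub>R \<nu>)"] t[of n] by simp
        moreover have "t n * norm \<nu> \<le> norm \<nu>" using t[of n] by (simp add: mult_left_le_one_le)
        ultimately have "F (x + t n *\<^sub>R \<nu>) = 0" using False by (intro supp) linarith
        moreover have "F x = 0" using False norm_ge_zero[of \<nu>] by (intro supp) linarith
        ultimately show ?thesis using L by (simp add: q_def)
      qed
    qed
  qed (use lim in auto)
  moreover have "(\<integral>x. q n x \<partial>lborel) = 0" for n
  proof -
    have eq: "(\<lambda>x. F (x + t n *\<^sub>R \<nu>)) = (\<lambda>x. F (t n *\<^sub>R \<nu> + 1 *\<^sub>R x))" by (simp add: add.commute)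
    have "integrable lborel (\<lambda>x. F (x + t n *\<^sub>R \<nu>))"
      unfolding eq using int by (subst integrable_lborel_affine) auto
    moreover have "(\<integral>x. F (x + t n *\<^sub>R \<nu>) \<partial>lborel) = (\<integral>x. F x \<partial>lborel)"
      unfolding eq using integral_lborel_affine[of F 1 "t n *\<^sub>R \<nu>"] by simp
    ultimately show ?thesis using int by (simp add: q_def)
  qed
  ultimately show ?thesis by (simp add: LIMSEQ_const_iff)
qed

section \<open>The distribution of the cumulative distribution function\<close>

text \<open>The probability integral transform: without atoms the distribution function is
  continuous and carries \<open>M\<close> to the uniform measure on the unit interval. The integral
  then becomes that of a derivative.\<close>

lemma (in real_distribution) integral_cdf_continuous:
  fixes \<psi> X :: "real \<Rightarrow> real"
  assumes atomless: "\<And>x. measure M {x} = 0"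
    and X: "\<And>s. (X has_real_derivative \<psi> s) (at s)" and \<psi>: "continuous_on UNIV \<psi>"
  shows "b * (\<integral>s. \<psi> (a + b * cdf M s) \<partial>M) = X (a + b) - X a"
proof -
  have cont: "continuous_on UNIV (cdf M)"
    using atomless isCont_cdf by (simp add: continuous_at_imp_continuous_on)
  have cm[measurable]: "cdf M \<in> borel_measurable borel" using cont by (rule borel_measurable_continuous_onI)
  have cmM[measurable]: "cdf M \<in> M \<rightarrow>\<^sub>M borel"
    using cm by (simp add: measurable_def)
  have chm[measurable]: "\<psi> \<in> borel_measurable borel" using \<psi> by (rule borel_measurable_continuous_onI)
  let ?N = "distr M borel (cdf M)"
  interpret N: real_distribution ?N by (rule real_distribution_distr) (rule cmM)
  have surj: "\<exists>s. cdf M s = t" if "0 < t" "t < 1" for t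
  proof -
    have "eventually (\<lambda>s. cdf M s < t) at_bot" using cdf_lim_at_bot that by (intro order_tendstoD)
    then obtain s1 where s1: "cdf M s1 < t" by (auto simp: eventually_at_bot_linorder)
    have "eventually (\<lambda>s. cdf M s > t) at_top" using cdf_lim_at_top_prob that by (intro order_tendstoD)
    then obtain s2 where s2: "cdf M s2 > t" by (auto simp: eventually_at_top_linorder)
    have "s1 \<le> s2" using s1 s2 cdf_nondecreasing[of s2 s1] by linarith
    then show ?thesis
      using IVT'[of "cdf M" s1 t s2] s1 s2 continuous_on_subset[OF cont] by force
  qed
  have N: "cdf ?N t = measure M {s. cdf M s \<le> t}" for t
    unfolding cdf_def2[of ?N] by (subst measure_distr[OF cmM]) (auto simp: vimage_def)
  have meas: "{s. cdf M s \<le> t} \<in> events" for t by simp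
  \<comment> \<open>The comparison uses a level \<open>t'\<close> above \<open>t\<close> because the
    distribution function may be constant on intervals: a point where it equals \<open>t\<close>
    need not bound the set where it is at most \<open>t\<close>.\<close>
  have upper: "cdf ?N t \<le> t'" if tt: "t < t'" "0 < t'" "t' < 1" for t t'
  proof -
    obtain s where s: "cdf M s = t'" using surj[OF tt(2,3)] by blast
    have "{s. cdf M s \<le> t} \<subseteq> {..s}"
    proof
      fix x assume "x \<in> {s. cdf M s \<le> t}"
      then have "cdf M x < cdf M s" using s tt by auto
      then show "x \<in> {..s}" using cdf_nondecreasing[of s x] by force
    qed
    then have "measure M {s. cdf M s \<le> t} \<le> measure M {..s}" by (intro finite_measure_mono) auto
    then show ?thesis using s N by (simp add: cdf_def2)
  qed
  have lower: "t \<le> cdf ?N t" if t: "0 < t" "t < 1" for t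
  proof -
    obtain s where s: "cdf M s = t" using surj[OF t] by blast
    have "{..s} \<subseteq> {x. cdf M x \<le> t}" using s cdf_nondecreasing by auto
    then have "measure M {..s} \<le> measure M {x. cdf M x \<le> t}" by (intro finite_measure_mono meas)
    then show ?thesis using s N by (simp add: cdf_def2)
  qed
  have eq: "cdf ?N t = max 0 (min 1 t)" for t
  proof -
    consider "t \<le> 0" | "0 < t" "t < 1" | "1 \<le> t" by linarith
    then show ?thesis
    proof cases
      case 1
      have "cdf ?N t \<le> e" if "0 < e" for e
      proof (cases "e < 1")
        case True then show ?thesis using upper[of t e] 1 that by auto
      next
        case False then show ?thesis using N.cdf_bounded_prob[of t] by linarith
      qed
      then have "cdf ?N t \<le> 0" by (rule dense_ge)
      then show ?thesis using N.cdf_nonneg[of t] 1 by simp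
    next
      case 2
      have "cdf ?N t \<le> t" by (rule dense_ge_bounded[of t 1]) (use 2 upper in auto)
      then show ?thesis using lower[OF 2] 2 by simp
    next
      case 3
      have "cdf M s \<le> t" for s using cdf_bounded_prob[of s] 3 by linarith
      then have "{s. cdf M s \<le> t} = space M" by simp
      then show ?thesis using 3 N[of t] prob_space by simp
    qed
  qed
  let ?U = "density lborel (indicator {0..1::real})"
  have U: "emeasure ?U A = emeasure lborel ({0..1} \<inter> A)" if "A \<in> sets borel" for A
    using that by (subst emeasure_density) (auto simp: nn_integral_indicator[symmetric] indicator_inter_arith simp del: nn_integral_indicator)
  have "emeasure ?U (space ?U) = 1" using U[of UNIV] by simp
  then interpret U: prob_space ?U by (rule prob_spaceI)
  have "real_distribution ?U"
    by unfold_locales simp_all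
  moreover have "cdf ?U t = max 0 (min 1 t)" for t
  proof -
    have "{0..1} \<inter> {..t} = {0..min 1 t}" by auto
    moreover have "enn2real (emeasure lborel {0..min 1 t}) = max 0 (min 1 t)"
      by (cases "0 \<le> t") auto
    ultimately show ?thesis by (simp add: cdf_def2 measure_def U)
  qed
  ultimately have NU: "?N = ?U"
    by (intro cdf_unique N.real_distribution_axioms) (auto simp: eq)
  have "(\<integral>s. \<psi> (a + b * cdf M s) \<partial>M) = (\<integral>\<tau>. \<psi> (a + b * \<tau>) \<partial>?N)"
    by (subst integral_distr[OF cmM]) auto
  also have "\<dots> = (\<integral>\<tau>. indicator {0..1} \<tau> *\<^sub>R \<psi> (a + b * \<tau>) \<partial>lborel)"
  proof -
    have "?U = density lborel (\<lambda>\<tau>. ennreal (indicator {0..1} \<tau>))"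
      by (intro arg_cong[where f="density lborel"] ext) (simp add: ennreal_indicator)
    then show ?thesis unfolding NU by (simp only:) (subst integral_density, auto)
  qed
  finally have "b * (\<integral>s. \<psi> (a + b * cdf M s) \<partial>M) = (\<integral>\<tau>. (b * \<psi> (a + b * \<tau>)) * indicator {0..1} \<tau> \<partial>lborel)"
    by (simp flip: integral_mult_right_zero add: ac_simps)
  also have "\<dots> = X (a + b * 1) - X (a + b * 0)"
  proof (rule integral_FTC_Icc_real)
    fix \<tau> :: real
    show "((\<lambda>\<tau>. X (a + b * \<tau>)) has_real_derivative b * \<psi> (a + b * \<tau>)) (at \<tau>)"
      by (rule DERIV_chain2[OF X, THEN DERIV_cong]) (auto intro!: derivative_eq_intros)
    have "continuous_on UNIV (\<lambda>\<tau>. b * \<psi> (a + b * \<tau>))"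
      by (intro continuous_intros continuous_on_compose2[OF \<psi>]) simp_all
    then show "isCont (\<lambda>\<tau>. b * \<psi> (a + b * \<tau>)) \<tau>"
      by (simp add: continuous_on_eq_continuous_at)
  qed simp
  finally show ?thesis by simp
qed

section \<open>A mollifier of class \<open>C\<^sup>1\<close>\<close>

text \<open>The squared positive part is of class \<open>C\<^sup>1\<close>, the regularity asked of
  test functions. The mollifier, the cutoffs and the primitives of the trapezoids are all assembled
  from it.\<close>

definition pos_sq :: "real \<Rightarrow> real" where "pos_sq t = (max 0 t)\<^sup>2"

lemma pos_sq_eq: "t \<le> 0 \<Longrightarrow> pos_sq t = 0" "0 \<le> t \<Longrightarrow> pos_sq t = t\<^sup>2"
  by (auto simp: pos_sq_def)

lemma pos_sq_nonneg [simp]: "0 \<le> pos_sq t"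
  by (simp add: pos_sq_def)

lemma DERIV_pos_sq: "(pos_sq has_real_derivative 2 * max 0 t) (at t)"
proof -
  consider "t < 0" | "t = 0" | "0 < t" by linarith
  then show ?thesis
  proof cases
    case 1
    have "((\<lambda>t. 0) has_real_derivative 2 * max 0 t) (at t)" using 1 by simp
    then show ?thesis
      by (rule has_field_derivative_transform_within_open[where S="{..<0}"])
        (use 1 in \<open>auto simp: pos_sq_def\<close>)
  next
    case 2
    have "((\<lambda>h. pos_sq h / h) \<longlongrightarrow> 0) (at 0)"
    proof (rule tendsto_0_le[where K=1])
      show "((\<lambda>h::real. h) \<longlongrightarrow> 0) (at 0)" by (rule tendsto_ident_at)
      show "eventually (\<lambda>h. norm (pos_sq h / h) \<le> norm h * 1) (at (0::real))"
        by (auto simp: pos_sq_def max_def power2_eq_square intro!: always_eventually)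
    qed
    then show ?thesis using 2 by (simp add: DERIV_def pos_sq_def[of 0])
  next
    case 3
    have "((\<lambda>t. t\<^sup>2) has_real_derivative 2 * max 0 t) (at t)"
      using 3 by (auto intro!: derivative_eq_intros)
    then show ?thesis
      by (rule has_field_derivative_transform_within_open[where S="{0<..}"])
        (use 3 in \<open>auto simp: pos_sq_def\<close>)
  qed
qed

lemma continuous_on_pos_sq [continuous_intros]:
  "continuous_on S f \<Longrightarrow> continuous_on S (\<lambda>x. pos_sq (f x))"
  unfolding pos_sq_def by (intro continuous_intros)

lemma GDERIV_dot: "GDERIV (\<lambda>x. x \<bullet> x) x :> 2 *\<^sub>R x"
  unfolding gderiv_def by (auto intro!: derivative_eq_intros simp: inner_commute)

text \<open>The squared positive part of \<open>1 - z \<bullet> z\<close> is a radial bump supported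
  in the unit disk; its piecewise polynomial form keeps the gradient explicit.\<close>

definition bump_mass :: real where
  "bump_mass = (\<integral>z. pos_sq (1 - z \<bullet> z) \<partial>(lborel :: plane measure))"

definition kern :: "plane \<Rightarrow> real" where
  "kern z = pos_sq (1 - z \<bullet> z) / bump_mass"

definition kern_grad :: "plane \<Rightarrow> plane" where
  "kern_grad z = (- 4 * max 0 (1 - z \<bullet> z) / bump_mass) *\<^sub>R z"

lemma dot_ge_1: "1 \<le> norm z \<Longrightarrow> 1 \<le> z \<bullet> z"
  by (metis dot_square_norm one_le_power)

lemma bump_eq_0: "1 \<le> norm z \<Longrightarrow> pos_sq (1 - z \<bullet> z) = 0"
  using dot_ge_1[of z] by (simp add: pos_sq_eq)

lemma integrable_bump: "integrable lborel (\<lambda>z::plane. pos_sq (1 - z \<bullet> z))"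
proof -
  have "integrable lborel (\<lambda>z::plane. indicator (cball 0 1) z *\<^sub>R pos_sq (1 - z \<bullet> z))"
    by (rule borel_integrable_compact) (auto intro!: continuous_intros)
  also have "(\<lambda>z::plane. indicator (cball 0 1) z *\<^sub>R pos_sq (1 - z \<bullet> z)) = (\<lambda>z. pos_sq (1 - z \<bullet> z))"
    by (auto simp: indicator_def fun_eq_iff bump_eq_0)
  finally show ?thesis .
qed

lemma bump_mass_pos: "0 < bump_mass"
proof -
  have "0 < measure lborel (ball (0::plane) (1/2))" by (simp add: content_ball_pos)
  then have "0 < 1 / 4 * measure lborel (ball (0::plane) (1/2))" by simp
  also have "\<dots> = (\<integral>z. 1 / 4 * indicator (ball (0::plane) (1/2)) z \<partial>lborel)" by simp
  also have "\<dots> \<le> bump_mass"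
    unfolding bump_mass_def
  proof (rule integral_mono)
    show "integrable lborel (\<lambda>z. 1 / 4 * indicator (ball (0::plane) (1/2)) z :: real)"
      by (intro integrable_mult_right integrable_real_indicator)
        (auto simp: emeasure_lborel_ball_finite[unfolded infinity_ennreal_def])
    fix z :: plane
    show "1 / 4 * indicator (ball 0 (1/2)) z \<le> pos_sq (1 - z \<bullet> z)"
    proof (cases "norm z < 1 / 2")
      case True
      have "(norm z)\<^sup>2 \<le> (1 / 2)\<^sup>2" using True by (intro power_mono) auto
      then have "1 / 2 \<le> 1 - z \<bullet> z" by (simp add: dot_square_norm power2_eq_square)
      then have "(1 / 2)\<^sup>2 \<le> (1 - z \<bullet> z)\<^sup>2" by (intro power_mono) auto
      then show ?thesis using True \<open>1 / 2 \<le> 1 - z \<bullet> z\<close> by (simp add: pos_sq_eq power2_eq_square)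
    qed auto
  qed (rule integrable_bump)
  finally show ?thesis .
qed

lemma kern_nonneg [simp]: "0 \<le> kern z"
  using bump_mass_pos by (simp add: kern_def)

lemma kern_eq_0: "1 \<le> norm z \<Longrightarrow> kern z = 0"
  by (simp add: kern_def bump_eq_0)

lemma kern_le: "kern z \<le> 1 / bump_mass"
proof -
  have "max 0 (1 - z \<bullet> z) \<le> 1" by auto
  then have "pos_sq (1 - z \<bullet> z) \<le> 1" by (simp add: pos_sq_def power_le_one)
  then show ?thesis using bump_mass_pos by (simp add: kern_def divide_right_mono)
qed

lemma kern_minus [simp]: "kern (- z) = kern z"
  by (simp add: kern_def)

lemma kern_commute: "kern (x - y) = kern (y - x)"
  using kern_minus[of "x - y"] by simp

lemma continuous_on_kern: "continuous_on S kern"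
  using bump_mass_pos unfolding kern_def by (intro continuous_intros) auto

lemma kern_measurable [measurable]: "kern \<in> borel_measurable borel"
  by (rule borel_measurable_continuous_onI[OF continuous_on_kern])

lemma integrable_kern: "integrable lborel kern"
  unfolding kern_def by (intro integrable_divide integrable_bump)

lemma integral_kern: "(\<integral>z. kern z \<partial>lborel) = 1"
  using bump_mass_pos unfolding kern_def by (simp add: bump_mass_def)

lemma GDERIV_kern: "GDERIV kern z :> kern_grad z"
proof -
  have "GDERIV (\<lambda>z. 1 - z \<bullet> z) z :> 0 - 2 *\<^sub>R z"
    by (intro GDERIV_diff GDERIV_const GDERIV_dot)
  moreover have "((\<lambda>t. pos_sq t / bump_mass) has_real_derivative 2 * max 0 (1 - z \<bullet> z) / bump_mass) (at (1 - z \<bullet> z))"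
    by (intro DERIV_cdivide DERIV_pos_sq)
  ultimately have "GDERIV (\<lambda>z. pos_sq (1 - z \<bullet> z) / bump_mass) z
      :> (2 * max 0 (1 - z \<bullet> z) / bump_mass) *\<^sub>R (0 - 2 *\<^sub>R z)"
    by (rule GDERIV_DERIV_compose)
  then show ?thesis
    unfolding kern_def[abs_def] by (rule GDERIV_subst) (simp add: kern_grad_def)
qed

lemma continuous_on_kern_grad: "continuous_on S kern_grad"
  using bump_mass_pos unfolding kern_grad_def by (intro continuous_intros) auto

lemma norm_kern_grad: "norm (kern_grad z) \<le> 4 / bump_mass"
proof (cases "norm z \<le> 1")
  case True
  have "max 0 (1 - z \<bullet> z) * norm z \<le> 1 * 1"
    using True by (intro mult_mono) auto
  then show ?thesis
    using bump_mass_pos by (simp add: kern_grad_def abs_mult divide_right_mono)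
next
  case False
  then show ?thesis using dot_ge_1[of z] bump_mass_pos by (simp add: kern_grad_def)
qed

lemma kern_lipschitz: "\<bar>kern x - kern y\<bar> \<le> 4 / bump_mass * norm (x - y)"
proof -
  have "norm (kern x - kern y) \<le> 4 / bump_mass * norm (x - y)"
  proof (rule differentiable_bound[of UNIV kern "\<lambda>z h. h \<bullet> kern_grad z"])
    show "(kern has_derivative (\<lambda>h. h \<bullet> kern_grad z)) (at z within UNIV)" for z
      using GDERIV_kern[of z] by (simp add: gderiv_def)
    show "onorm (\<lambda>h. h \<bullet> kern_grad z) \<le> 4 / bump_mass" for z
    proof (rule onorm_le)
      fix h
      have "norm (h \<bullet> kern_grad z) \<le> norm h * norm (kern_grad z)"
        by (simp add: Cauchy_Schwarz_ineq2)
      also have "\<dots> \<le> norm h * (4 / bump_mass)" by (intro mult_left_mono norm_kern_grad) auto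
      finally show "norm (h \<bullet> kern_grad z) \<le> 4 / bump_mass * norm h" by (simp add: mult.commute)
    qed
  qed auto
  then show ?thesis by simp
qed

section \<open>Rescaled kernels and convolution\<close>

definition moll :: "real \<Rightarrow> plane \<Rightarrow> real" where
  "moll \<epsilon> z = kern ((1 / \<epsilon>) *\<^sub>R z) / \<epsilon>\<^sup>2"

definition moll_grad :: "real \<Rightarrow> plane \<Rightarrow> plane" where
  "moll_grad \<epsilon> z = (1 / \<epsilon> ^ 3) *\<^sub>R kern_grad ((1 / \<epsilon>) *\<^sub>R z)"

lemma moll_nonneg [simp]: "0 \<le> moll \<epsilon> z"
  by (simp add: moll_def)

lemma moll_le: "moll \<epsilon> z \<le> 1 / (bump_mass * \<epsilon>\<^sup>2)"
  using divide_right_mono[OF kern_le[of "(1 / \<epsilon>) *\<^sub>R z"], of "\<epsilon>\<^sup>2"] by (simp add: moll_def)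

lemma moll_eq_0: "0 < \<epsilon> \<Longrightarrow> \<epsilon> \<le> norm z \<Longrightarrow> moll \<epsilon> z = 0"
  by (simp add: moll_def kern_eq_0)

lemma moll_measurable [measurable]: "moll \<epsilon> \<in> borel_measurable borel"
  unfolding moll_def by measurable

lemma moll_lipschitz:
  assumes "0 < \<epsilon>"
  shows "\<bar>moll \<epsilon> x - moll \<epsilon> y\<bar> \<le> 4 / (bump_mass * \<epsilon> ^ 3) * norm (x - y)"
proof -
  have "\<bar>moll \<epsilon> x - moll \<epsilon> y\<bar> = \<bar>kern ((1 / \<epsilon>) *\<^sub>R x) - kern ((1 / \<epsilon>) *\<^sub>R y)\<bar> / \<epsilon>\<^sup>2"
    by (simp add: moll_def diff_divide_distrib[symmetric])
  also have "\<dots> \<le> (4 / bump_mass * norm ((1 / \<epsilon>) *\<^sub>R x - (1 / \<epsilon>) *\<^sub>R y)) / \<epsilon>\<^sup>2"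
    by (intro divide_right_mono kern_lipschitz) auto
  also have "norm ((1 / \<epsilon>) *\<^sub>R x - (1 / \<epsilon>) *\<^sub>R y) = norm (x - y) / \<epsilon>"
    using assms by (simp add: scaleR_diff_right[symmetric])
  finally show ?thesis using assms by (simp add: power2_eq_square power3_eq_cube ac_simps)
qed

lemma GDERIV_moll:
  assumes "0 < \<epsilon>"
  shows "GDERIV (moll \<epsilon>) z :> moll_grad \<epsilon> z"
proof -
  have k: "(kern has_derivative (\<lambda>h. h \<bullet> kern_grad ((1 / \<epsilon>) *\<^sub>R z))) (at ((1 / \<epsilon>) *\<^sub>R z))"
    using GDERIV_kern by (simp add: gderiv_def)
  have "((\<lambda>z. kern ((1 / \<epsilon>) *\<^sub>R z)) has_derivative (\<lambda>h. ((1 / \<epsilon>) *\<^sub>R h) \<bullet> kern_grad ((1 / \<epsilon>) *\<^sub>R z))) (at z)"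
    by (rule has_derivative_compose[where f="\<lambda>z. (1 / \<epsilon>) *\<^sub>R z" and f'="\<lambda>h. (1 / \<epsilon>) *\<^sub>R h" and x=z, OF _ k]) (auto intro!: derivative_eq_intros)
  then have "((\<lambda>z. kern ((1 / \<epsilon>) *\<^sub>R z) / \<epsilon>\<^sup>2) has_derivative
      (\<lambda>h. (((1 / \<epsilon>) *\<^sub>R h) \<bullet> kern_grad ((1 / \<epsilon>) *\<^sub>R z)) / \<epsilon>\<^sup>2)) (at z)"
    by (rule bounded_linear.has_derivative[OF bounded_linear_divide])
  moreover have "(((1 / \<epsilon>) *\<^sub>R h) \<bullet> kern_grad ((1 / \<epsilon>) *\<^sub>R z)) / \<epsilon>\<^sup>2 = h \<bullet> moll_grad \<epsilon> z" for h
    by (simp add: moll_grad_def power2_eq_square power3_eq_cube)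
  ultimately show ?thesis unfolding gderiv_def moll_def[abs_def] by simp
qed

lemma continuous_on_moll_grad: "continuous_on S (moll_grad \<epsilon>)"
  unfolding moll_grad_def
  by (intro continuous_intros continuous_on_compose2[OF continuous_on_kern_grad[of UNIV]]) auto

lemma moll_grad_measurable [measurable]: "moll_grad \<epsilon> \<in> borel_measurable borel"
  by (rule borel_measurable_continuous_onI[OF continuous_on_moll_grad])

definition conv :: "real \<Rightarrow> (plane \<Rightarrow> real) \<Rightarrow> plane \<Rightarrow> real" where
  "conv \<epsilon> V x = (\<integral>y. V y * moll \<epsilon> (x - y) \<partial>lborel)"

lemma integrable_mult_bounded:
  fixes f :: "'a \<Rightarrow> 'b::{banach,second_countable_topology}" and g :: "'a \<Rightarrow> real"
  assumes "integrable M f" "g \<in> borel_measurable M" "\<And>x. \<bar>g x\<bar> \<le> B"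
  shows "integrable M (\<lambda>x. g x *\<^sub>R f x)"
proof (rule Bochner_Integration.integrable_bound[where f="\<lambda>x. B *\<^sub>R f x"])
  show "integrable M (\<lambda>x. B *\<^sub>R f x)" using assms by simp
  show "(\<lambda>x. g x *\<^sub>R f x) \<in> borel_measurable M" using assms by measurable
  show "AE x in M. norm (g x *\<^sub>R f x) \<le> norm (B *\<^sub>R f x)"
  proof (rule AE_I2)
    fix x
    have "\<bar>g x\<bar> \<le> \<bar>B\<bar>" using assms(3)[of x] by linarith
    then show "norm (g x *\<^sub>R f x) \<le> norm (B *\<^sub>R f x)" by (simp add: mult_right_mono)
  qed
qed

lemma integrable_conv:
  assumes "integrable lborel V"
  shows "integrable lborel (\<lambda>y. V y * moll \<epsilon> (x - y))"
proof -
  have "integrable lborel (\<lambda>y. moll \<epsilon> (x - y) *\<^sub>R V y)"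
    by (rule integrable_mult_bounded[OF assms, where B="1 / (bump_mass * \<epsilon>\<^sup>2)"])
      (use moll_le in auto)
  then show ?thesis by (simp add: mult.commute)
qed

text \<open>Substituting \<open>y + \<epsilon> *\<^sub>R \<xi>\<close> absorbs the factor
  \<open>1 / \<epsilon>\<^sup>2\<close>, so that convolution at scale \<open>\<epsilon>\<close> acts
  on the rescaled function with a fixed kernel. The blow-up argument starts from this form.\<close>

lemma conv_scaled:
  assumes [measurable]: "V \<in> borel_measurable borel" and "0 < \<epsilon>"
  shows "conv \<epsilon> V (y + \<epsilon> *\<^sub>R z) = (\<integral>\<xi>. V (y + \<epsilon> *\<^sub>R \<xi>) * kern (z - \<xi>) \<partial>lborel)"
proof -
  have "conv \<epsilon> V (y + \<epsilon> *\<^sub>R z)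
      = \<bar>\<epsilon>\<bar> ^ DIM(plane) *\<^sub>R (\<integral>\<xi>. V (y + \<epsilon> *\<^sub>R \<xi>) * moll \<epsilon> (y + \<epsilon> *\<^sub>R z - (y + \<epsilon> *\<^sub>R \<xi>)) \<partial>lborel)"
    unfolding conv_def using assms(2) by (intro integral_lborel_affine) auto
  also have "\<dots> = (\<integral>\<xi>. V (y + \<epsilon> *\<^sub>R \<xi>) * (\<epsilon>\<^sup>2 * moll \<epsilon> (\<epsilon> *\<^sub>R (z - \<xi>))) \<partial>lborel)"
    using assms(2) by (simp flip: integral_mult_right_zero add: scaleR_diff_right power2_eq_square ac_simps)
  also have "\<dots> = (\<integral>\<xi>. V (y + \<epsilon> *\<^sub>R \<xi>) * kern (z - \<xi>) \<partial>lborel)"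
    using assms(2) by (simp add: moll_def)
  finally show ?thesis .
qed

lemma conv_lipschitz:
  assumes V: "integrable lborel V" and "0 < \<epsilon>"
  obtains L where "0 \<le> L" "\<And>x x'. \<bar>conv \<epsilon> V x - conv \<epsilon> V x'\<bar> \<le> L * norm (x - x')"
proof
  let ?K = "4 / (bump_mass * \<epsilon> ^ 3)"
  have K: "0 \<le> ?K" using bump_mass_pos assms by simp
  show "0 \<le> ?K * (\<integral>y. \<bar>V y\<bar> \<partial>lborel)" using K by (intro mult_nonneg_nonneg) auto
  fix x x'
  have "conv \<epsilon> V x - conv \<epsilon> V x' = (\<integral>y. V y * moll \<epsilon> (x - y) - V y * moll \<epsilon> (x' - y) \<partial>lborel)"
    unfolding conv_def by (intro Bochner_Integration.integral_diff[symmetric] integrable_conv V)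
  also have "\<bar>\<dots>\<bar> \<le> (\<integral>y. \<bar>V y\<bar> * (?K * norm (x - x')) \<partial>lborel)"
  proof (rule integral_abs_bound_integral)
    show "integrable lborel (\<lambda>y. V y * moll \<epsilon> (x - y) - V y * moll \<epsilon> (x' - y))"
      by (intro Bochner_Integration.integrable_diff integrable_conv V)
    show "integrable lborel (\<lambda>y. \<bar>V y\<bar> * (?K * norm (x - x')))" using V by auto
    fix y
    have "\<bar>V y * moll \<epsilon> (x - y) - V y * moll \<epsilon> (x' - y)\<bar> = \<bar>V y\<bar> * \<bar>moll \<epsilon> (x - y) - moll \<epsilon> (x' - y)\<bar>"
      by (simp add: right_diff_distrib[symmetric] abs_mult)
    also have "\<dots> \<le> \<bar>V y\<bar> * (?K * norm ((x - y) - (x' - y)))"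
      by (intro mult_left_mono moll_lipschitz assms) auto
    finally show "\<bar>V y * moll \<epsilon> (x - y) - V y * moll \<epsilon> (x' - y)\<bar> \<le> \<bar>V y\<bar> * (?K * norm (x - x'))" by simp
  qed
  also have "\<dots> = ?K * (\<integral>y. \<bar>V y\<bar> \<partial>lborel) * norm (x - x')" by simp
  finally show "\<bar>conv \<epsilon> V x - conv \<epsilon> V x'\<bar> \<le> ?K * (\<integral>y. \<bar>V y\<bar> \<partial>lborel) * norm (x - x')" .
qed

lemma continuous_on_conv:
  assumes "integrable lborel V" "0 < \<epsilon>"
  shows "continuous_on S (conv \<epsilon> V)"
proof -
  obtain L where "0 \<le> L" "\<And>x x'. \<bar>conv \<epsilon> V x - conv \<epsilon> V x'\<bar> \<le> L * norm (x - x')"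
    using conv_lipschitz[OF assms] by blast
  then have "L-lipschitz_on S (conv \<epsilon> V)"
    by (intro lipschitz_onI) (auto simp: dist_norm)
  then show ?thesis by (rule lipschitz_on_continuous_on)
qed

text \<open>The difference quotients of the kernel are bounded by its Lipschitz constant, which
  gives an integrable majorant for differentiating under the integral.\<close>

lemma conv_directional_derivative:
  assumes V: "integrable lborel V" and "0 < \<epsilon>"
  shows "((\<lambda>t. conv \<epsilon> V (x + t *\<^sub>R \<nu>)) has_real_derivative
    (\<integral>y. V y * (moll_grad \<epsilon> (x - y) \<bullet> \<nu>) \<partial>lborel)) (at 0)"
  unfolding DERIV_def tendsto_at_iff_sequentially
proof (intro allI impI)
  fix t :: "nat \<Rightarrow> real" assume t: "\<forall>i. t i \<in> UNIV - {0}" "t \<longlonglongrightarrow> 0"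
  have [measurable]: "V \<in> borel_measurable borel" using V by auto
  define q where "q n y = V y * ((moll \<epsilon> (x + t n *\<^sub>R \<nu> - y) - moll \<epsilon> (x - y)) / t n)" for n y
  let ?K = "4 / (bump_mass * \<epsilon> ^ 3)"
  have "(\<lambda>n. \<integral>y. q n y \<partial>lborel) \<longlonglongrightarrow> (\<integral>y. V y * (moll_grad \<epsilon> (x - y) \<bullet> \<nu>) \<partial>lborel)"
  proof (rule integral_dominated_convergence[where w="\<lambda>y. \<bar>V y\<bar> * (?K * norm \<nu>)"])
    show "integrable lborel (\<lambda>y. \<bar>V y\<bar> * (?K * norm \<nu>))" using V by auto
    show "(\<lambda>y. V y * (moll_grad \<epsilon> (x - y) \<bullet> \<nu>)) \<in> borel_measurable lborel" by measurable
    show "q n \<in> borel_measurable lborel" for n unfolding q_def by measurable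
    show "AE y in lborel. norm (q n y) \<le> \<bar>V y\<bar> * (?K * norm \<nu>)" for n
    proof (rule AE_I2)
      fix y
      have "\<bar>moll \<epsilon> (x + t n *\<^sub>R \<nu> - y) - moll \<epsilon> (x - y)\<bar> \<le> ?K * norm ((x + t n *\<^sub>R \<nu> - y) - (x - y))"
        by (rule moll_lipschitz) fact
      also have "(x + t n *\<^sub>R \<nu> - y) - (x - y) = t n *\<^sub>R \<nu>" by simp
      finally have "\<bar>moll \<epsilon> (x + t n *\<^sub>R \<nu> - y) - moll \<epsilon> (x - y)\<bar> / \<bar>t n\<bar> \<le> ?K * norm \<nu>"
        using t(1) by (simp add: divide_le_eq ac_simps)
      then show "norm (q n y) \<le> \<bar>V y\<bar> * (?K * norm \<nu>)"
        unfolding q_def by (simp only: real_norm_def abs_mult abs_divide) (intro mult_left_mono, auto)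
    qed
    show "AE y in lborel. (\<lambda>n. q n y) \<longlonglongrightarrow> V y * (moll_grad \<epsilon> (x - y) \<bullet> \<nu>)"
    proof (rule AE_I2)
      fix y
      have m: "(moll \<epsilon> has_derivative (\<lambda>h. h \<bullet> moll_grad \<epsilon> (x - y))) (at (x + 0 *\<^sub>R \<nu> - y))"
        using GDERIV_moll[OF assms(2), of "x - y"] by (simp add: gderiv_def)
      have "((\<lambda>s. moll \<epsilon> (x + s *\<^sub>R \<nu> - y)) has_derivative (\<lambda>s. (s *\<^sub>R \<nu>) \<bullet> moll_grad \<epsilon> (x - y))) (at 0)"
        by (rule has_derivative_compose[where f="\<lambda>s. x + s *\<^sub>R \<nu> - y" and f'="\<lambda>s. s *\<^sub>R \<nu>" and x=0, OF _ m]) (auto intro!: derivative_eq_intros)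
      then have "((\<lambda>s. moll \<epsilon> (x + s *\<^sub>R \<nu> - y)) has_real_derivative (\<nu> \<bullet> moll_grad \<epsilon> (x - y))) (at 0)"
        by (simp add: has_field_derivative_def mult_commute_abs)
      then have "((\<lambda>s. (moll \<epsilon> (x + s *\<^sub>R \<nu> - y) - moll \<epsilon> (x - y)) / s) \<longlongrightarrow> \<nu> \<bullet> moll_grad \<epsilon> (x - y)) (at 0)"
        by (simp add: DERIV_def)
      then have "((\<lambda>s. (moll \<epsilon> (x + s *\<^sub>R \<nu> - y) - moll \<epsilon> (x - y)) / s) \<circ> t) \<longlonglongrightarrow> \<nu> \<bullet> moll_grad \<epsilon> (x - y)"
        unfolding tendsto_at_iff_sequentially using t by blast
      then show "(\<lambda>n. q n y) \<longlonglongrightarrow> V y * (moll_grad \<epsilon> (x - y) \<bullet> \<nu>)"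
        unfolding q_def comp_def inner_commute[of \<nu>] by (rule tendsto_mult_left)
    qed
  qed
  moreover have "(\<integral>y. q n y \<partial>lborel) = (conv \<epsilon> V (x + t n *\<^sub>R \<nu>) - conv \<epsilon> V x) / t n" for n
  proof -
    have "q n = (\<lambda>y. (V y * moll \<epsilon> (x + t n *\<^sub>R \<nu> - y) - V y * moll \<epsilon> (x - y)) / t n)"
      by (simp add: q_def fun_eq_iff right_diff_distrib)
    then show ?thesis
      by (simp add: conv_def Bochner_Integration.integral_diff integrable_conv V)
  qed
  ultimately show "((\<lambda>h. (conv \<epsilon> V (x + (0 + h) *\<^sub>R \<nu>) - conv \<epsilon> V (x + 0 *\<^sub>R \<nu>)) / h) \<circ> t)
      \<longlonglongrightarrow> (\<integral>y. V y * (moll_grad \<epsilon> (x - y) \<bullet> \<nu>) \<partial>lborel)"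
    by (simp add: comp_def)
qed

text \<open>In rescaled form \<open>conv \<epsilon> V - V\<close> averages the differences between
  \<open>V\<close> and its translates by vectors shorter than \<open>\<epsilon>\<close>. Exchanging
  the integrals reduces the claim to continuity of translations in the mean.\<close>

lemma conv_L1_convergence:
  assumes V: "integrable lborel V" and "0 < e"
  obtains d where "0 < d" "\<And>\<epsilon>. 0 < \<epsilon> \<Longrightarrow> \<epsilon> < d \<Longrightarrow> (\<integral>\<^sup>+x. ennreal \<bar>conv \<epsilon> V x - V x\<bar> \<partial>lborel) \<le> ennreal e"
proof -
  obtain d where d: "0 < d" "\<And>h. norm h < d \<Longrightarrow> (\<integral>\<^sup>+x. ennreal \<bar>V (h + x) - V x\<bar> \<partial>lborel) \<le> ennreal e"
    using L1_translation_continuous[OF assms] by blast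
  have [measurable]: "V \<in> borel_measurable borel" using V by auto
  have "(\<integral>\<^sup>+x. ennreal \<bar>conv \<epsilon> V x - V x\<bar> \<partial>lborel) \<le> ennreal e" if \<epsilon>: "0 < \<epsilon>" "\<epsilon> < d" for \<epsilon>
  proof -
    have "ennreal \<bar>conv \<epsilon> V x - V x\<bar> \<le> (\<integral>\<^sup>+\<xi>. ennreal (\<bar>V (\<epsilon> *\<^sub>R \<xi> + x) - V x\<bar> * kern \<xi>) \<partial>lborel)" for x
    proof -
      have "conv \<epsilon> V x = (\<integral>\<xi>. V (x + \<epsilon> *\<^sub>R \<xi>) * kern \<xi> \<partial>lborel)"
        using conv_scaled[of V \<epsilon> x 0] \<epsilon> by simp
      moreover have i: "integrable lborel (\<lambda>\<xi>. V (x + \<epsilon> *\<^sub>R \<xi>) * kern \<xi>)"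
      proof -
        have "integrable lborel (\<lambda>\<xi>. V (x + \<epsilon> *\<^sub>R \<xi>))"
          using V \<epsilon> by (subst integrable_lborel_affine) auto
        then have "integrable lborel (\<lambda>\<xi>. kern \<xi> *\<^sub>R V (x + \<epsilon> *\<^sub>R \<xi>))"
          by (rule integrable_mult_bounded[where B="1 / bump_mass"]) (use kern_le in auto)
        then show ?thesis by (simp add: mult.commute)
      qed
      moreover have "V x = (\<integral>\<xi>. V x * kern \<xi> \<partial>lborel)" by (simp add: integral_kern)
      ultimately have "conv \<epsilon> V x - V x = (\<integral>\<xi>. V (x + \<epsilon> *\<^sub>R \<xi>) * kern \<xi> - V x * kern \<xi> \<partial>lborel)"
        using integrable_kern by (subst Bochner_Integration.integral_diff) auto
      also have "ennreal (norm \<dots>) \<le> (\<integral>\<^sup>+\<xi>. ennreal (norm (V (x + \<epsilon> *\<^sub>R \<xi>) * kern \<xi> - V x * kern \<xi>)) \<partial>lborel)"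
        using i integrable_kern by (intro integral_norm_bound_ennreal) auto
      also have "\<dots> = (\<integral>\<^sup>+\<xi>. ennreal (\<bar>V (\<epsilon> *\<^sub>R \<xi> + x) - V x\<bar> * kern \<xi>) \<partial>lborel)"
        by (intro nn_integral_cong) (simp add: left_diff_distrib[symmetric] abs_mult add.commute)
      finally show ?thesis by simp
    qed
    then have "(\<integral>\<^sup>+x. ennreal \<bar>conv \<epsilon> V x - V x\<bar> \<partial>lborel)
        \<le> (\<integral>\<^sup>+x. \<integral>\<^sup>+\<xi>. ennreal (\<bar>V (\<epsilon> *\<^sub>R \<xi> + x) - V x\<bar> * kern \<xi>) \<partial>lborel \<partial>lborel)"
      by (intro nn_integral_mono)
    also have "\<dots> = (\<integral>\<^sup>+\<xi>. \<integral>\<^sup>+x. ennreal (\<bar>V (\<epsilon> *\<^sub>R \<xi> + x) - V x\<bar> * kern \<xi>) \<partial>lborel \<partial>lborel)"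
      by (rule lborel_pair.Fubini') measurable
    also have "\<dots> \<le> (\<integral>\<^sup>+\<xi>. ennreal e * ennreal (kern \<xi>) \<partial>lborel)"
    proof (rule nn_integral_mono)
      fix \<xi> :: plane
      show "(\<integral>\<^sup>+x. ennreal (\<bar>V (\<epsilon> *\<^sub>R \<xi> + x) - V x\<bar> * kern \<xi>) \<partial>lborel) \<le> ennreal e * ennreal (kern \<xi>)"
      proof (cases "1 \<le> norm \<xi>")
        case False
        have "\<epsilon> * norm \<xi> \<le> \<epsilon> * 1" using False \<epsilon> by (intro mult_left_mono) auto
        then have "\<epsilon> * norm \<xi> < d" using \<epsilon> by linarith
        then have "norm (\<epsilon> *\<^sub>R \<xi>) < d" using \<epsilon> by simp
        have "(\<integral>\<^sup>+x. ennreal (\<bar>V (\<epsilon> *\<^sub>R \<xi> + x) - V x\<bar> * kern \<xi>) \<partial>lborel)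
          = (\<integral>\<^sup>+x. ennreal \<bar>V (\<epsilon> *\<^sub>R \<xi> + x) - V x\<bar> * ennreal (kern \<xi>) \<partial>lborel)"
          by (intro nn_integral_cong) (simp add: ennreal_mult)
        also have "\<dots> = (\<integral>\<^sup>+x. ennreal \<bar>V (\<epsilon> *\<^sub>R \<xi> + x) - V x\<bar> \<partial>lborel) * ennreal (kern \<xi>)"
          by (rule nn_integral_multc) measurable
        also have "\<dots> \<le> ennreal e * ennreal (kern \<xi>)"
          using d(2)[OF \<open>norm (\<epsilon> *\<^sub>R \<xi>) < d\<close>] by (rule mult_right_mono) simp
        finally show ?thesis .
      qed (simp add: kern_eq_0)
    qed
    also have "\<dots> = ennreal e * (\<integral>\<^sup>+\<xi>. ennreal (kern \<xi>) \<partial>lborel)"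
      by (rule nn_integral_cmult) measurable
    also have "(\<integral>\<^sup>+\<xi>. ennreal (kern \<xi>) \<partial>lborel) = 1"
      using integrable_kern by (subst nn_integral_eq_integral) (auto simp: integral_kern)
    finally show ?thesis by simp
  qed
  then show ?thesis using d(1) that by blast
qed

section \<open>Blow-up of mollifications\<close>

text \<open>Homogeneity of degree zero makes \<open>\<sigma>\<close> invariant under dilations, so
  the hypothesis says that the rescalings of \<open>V\<close> around \<open>y\<close> converge to
  \<open>\<sigma>\<close> in the mean on bounded sets; a bounded kernel of compact support carries
  this over to the convolution.\<close>

lemma conv_blow_up:
  assumes V: "integrable lborel V" and \<sigma>[measurable]: "\<sigma> \<in> borel_measurable borel"
    and bd: "\<And>z. \<bar>\<sigma> z\<bar> \<le> B" and hom: "\<And>c z. 0 < c \<Longrightarrow> \<sigma> (c *\<^sub>R z) = \<sigma> z"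
    and lim: "((\<lambda>\<rho>. (\<integral>x. indicator (ball y \<rho>) x * \<bar>V x - \<sigma> (x - y)\<bar> \<partial>lborel) / \<rho>\<^sup>2) \<longlongrightarrow> 0) (at_right 0)"
    and \<epsilon>: "\<And>n. 0 < \<epsilon> n" "\<epsilon> \<longlonglongrightarrow> 0"
  shows "(\<lambda>n. conv (\<epsilon> n) V (y + \<epsilon> n *\<^sub>R z)) \<longlonglongrightarrow> (\<integral>\<xi>. \<sigma> \<xi> * kern (z - \<xi>) \<partial>lborel)"
proof -
  have [measurable]: "V \<in> borel_measurable borel" using V by auto
  \<comment> \<open>The kernel centred at \<open>z\<close> vanishes outside the disk of radius 1
    around \<open>z\<close>, which lies in the disk of radius \<open>R\<close> around 0.\<close>
  define R where "R = norm z + 1"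
  have [measurable]: "ball x \<rho> \<in> sets borel" for x :: plane and \<rho> by simp
  have R: "0 < R" unfolding R_def by (smt (verit) norm_ge_zero)
  define Q where "Q \<rho> = (\<integral>x. indicator (ball y \<rho>) x * \<bar>V x - \<sigma> (x - y)\<bar> \<partial>lborel) / \<rho>\<^sup>2" for \<rho>
  have kz: "integrable lborel (\<lambda>\<xi>. kern (z - \<xi>))"
    using integrable_lborel_affine[of kern "-1" z] integrable_kern by simp
  have i\<sigma>: "integrable lborel (\<lambda>\<xi>. \<sigma> \<xi> * kern (z - \<xi>))"
    using integrable_mult_bounded[OF kz, of \<sigma> B] bd by simp
  have bound: "norm (conv (\<epsilon> n) V (y + \<epsilon> n *\<^sub>R z) - (\<integral>\<xi>. \<sigma> \<xi> * kern (z - \<xi>) \<partial>lborel))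
      \<le> (R\<^sup>2 / bump_mass) * Q (\<epsilon> n * R)" for n
  proof -
    let ?e = "\<epsilon> n"
    have e: "0 < ?e" by (rule \<epsilon>)
    have iV: "integrable lborel (\<lambda>\<xi>. V (y + ?e *\<^sub>R \<xi>))"
      using V e by (subst integrable_lborel_affine) auto
    have iVk: "integrable lborel (\<lambda>\<xi>. V (y + ?e *\<^sub>R \<xi>) * kern (z - \<xi>))"
      using integrable_mult_bounded[OF iV, of "\<lambda>\<xi>. kern (z - \<xi>)" "1 / bump_mass"] kern_le
      by (simp add: mult.commute)
    have ind: "integrable lborel (\<lambda>\<xi>. indicator (ball 0 R) \<xi> * \<bar>V (y + ?e *\<^sub>R \<xi>) - \<sigma> \<xi>\<bar>)"
    proof (rule Bochner_Integration.integrable_bound[where f="\<lambda>\<xi>. \<bar>V (y + ?e *\<^sub>R \<xi>)\<bar> + B * indicator (ball 0 R) \<xi>"])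
      show "integrable lborel (\<lambda>\<xi>. \<bar>V (y + ?e *\<^sub>R \<xi>)\<bar> + B * indicator (ball 0 R) \<xi>)"
        using iV by (intro Bochner_Integration.integrable_add integrable_abs integrable_mult_right integrable_real_indicator)
          (auto simp: emeasure_lborel_ball_finite[unfolded infinity_ennreal_def])
      show "AE \<xi> in lborel. norm (indicator (ball 0 R) \<xi> * \<bar>V (y + ?e *\<^sub>R \<xi>) - \<sigma> \<xi>\<bar>)
          \<le> norm (\<bar>V (y + ?e *\<^sub>R \<xi>)\<bar> + B * indicator (ball 0 R) \<xi>)"
      proof (rule AE_I2)
        fix \<xi>
        show "norm (indicator (ball 0 R) \<xi> * \<bar>V (y + ?e *\<^sub>R \<xi>) - \<sigma> \<xi>\<bar>)
          \<le> norm (\<bar>V (y + ?e *\<^sub>R \<xi>)\<bar> + B * indicator (ball 0 R) \<xi>)"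
          using bd[of \<xi>] by (auto simp: indicator_def)
      qed
    qed measurable
    have "conv ?e V (y + ?e *\<^sub>R z) - (\<integral>\<xi>. \<sigma> \<xi> * kern (z - \<xi>) \<partial>lborel)
        = (\<integral>\<xi>. V (y + ?e *\<^sub>R \<xi>) * kern (z - \<xi>) - \<sigma> \<xi> * kern (z - \<xi>) \<partial>lborel)"
      by (subst conv_scaled) (use e iVk i\<sigma> in auto)
    also have "\<bar>\<dots>\<bar> \<le> (\<integral>\<xi>. (1 / bump_mass) * (indicator (ball 0 R) \<xi> * \<bar>V (y + ?e *\<^sub>R \<xi>) - \<sigma> \<xi>\<bar>) \<partial>lborel)"
    proof (rule integral_abs_bound_integral)
      show "integrable lborel (\<lambda>\<xi>. V (y + ?e *\<^sub>R \<xi>) * kern (z - \<xi>) - \<sigma> \<xi> * kern (z - \<xi>))"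
        using iVk i\<sigma> by auto
      show "integrable lborel (\<lambda>\<xi>. (1 / bump_mass) * (indicator (ball 0 R) \<xi> * \<bar>V (y + ?e *\<^sub>R \<xi>) - \<sigma> \<xi>\<bar>))"
        using ind by (rule integrable_mult_right)
      fix \<xi>
      show "\<bar>V (y + ?e *\<^sub>R \<xi>) * kern (z - \<xi>) - \<sigma> \<xi> * kern (z - \<xi>)\<bar>
        \<le> (1 / bump_mass) * (indicator (ball 0 R) \<xi> * \<bar>V (y + ?e *\<^sub>R \<xi>) - \<sigma> \<xi>\<bar>)"
      proof (cases "norm \<xi> < R")
        case True
        have "\<bar>V (y + ?e *\<^sub>R \<xi>) * kern (z - \<xi>) - \<sigma> \<xi> * kern (z - \<xi>)\<bar> = kern (z - \<xi>) * \<bar>V (y + ?e *\<^sub>R \<xi>) - \<sigma> \<xi>\<bar>"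
          by (simp add: left_diff_distrib[symmetric] abs_mult)
        also have "\<dots> \<le> (1 / bump_mass) * \<bar>V (y + ?e *\<^sub>R \<xi>) - \<sigma> \<xi>\<bar>"
          by (intro mult_right_mono kern_le) auto
        finally show ?thesis using True by simp
      next
        case False
        have "norm \<xi> \<le> norm z + norm (z - \<xi>)" using norm_triangle_ineq4[of z "z - \<xi>"] by simp
        then have "kern (z - \<xi>) = 0" using False by (intro kern_eq_0) (simp add: R_def)
        then show ?thesis using False by simp
      qed
    qed
    also have "\<dots> = (1 / bump_mass) * (\<integral>\<xi>. indicator (ball 0 R) \<xi> * \<bar>V (y + ?e *\<^sub>R \<xi>) - \<sigma> \<xi>\<bar> \<partial>lborel)"
      by (rule integral_mult_right_zero)
    also have "(\<integral>\<xi>. indicator (ball 0 R) \<xi> * \<bar>V (y + ?e *\<^sub>R \<xi>) - \<sigma> \<xi>\<bar> \<partial>lborel) = R\<^sup>2 * Q (?e * R)"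
    proof -
      have "(\<integral>x. indicator (ball y (?e * R)) x * \<bar>V x - \<sigma> (x - y)\<bar> \<partial>lborel)
          = \<bar>?e\<bar> ^ DIM(plane) *\<^sub>R (\<integral>\<xi>. indicator (ball y (?e * R)) (y + ?e *\<^sub>R \<xi>) * \<bar>V (y + ?e *\<^sub>R \<xi>) - \<sigma> (y + ?e *\<^sub>R \<xi> - y)\<bar> \<partial>lborel)"
        by (rule integral_lborel_affine, measurable) (use e in simp)
      also have "(\<lambda>\<xi>. indicator (ball y (?e * R)) (y + ?e *\<^sub>R \<xi>) * \<bar>V (y + ?e *\<^sub>R \<xi>) - \<sigma> (y + ?e *\<^sub>R \<xi> - y)\<bar>)
          = (\<lambda>\<xi>. indicator (ball 0 R) \<xi> * \<bar>V (y + ?e *\<^sub>R \<xi>) - \<sigma> \<xi>\<bar>)"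
        using e by (auto simp: indicator_def dist_norm hom fun_eq_iff)
      finally show ?thesis using e R by (simp add: Q_def field_simps power2_eq_square)
    qed
    finally show ?thesis by simp
  qed
  have "filterlim (\<lambda>n. \<epsilon> n * R) (at_right 0) sequentially"
    unfolding filterlim_at using \<epsilon> R
    by (auto intro!: tendsto_mult_left_zero always_eventually simp: less_imp_neq[symmetric])
  then have "(\<lambda>n. Q (\<epsilon> n * R)) \<longlonglongrightarrow> 0"
    using lim unfolding Q_def by (rule filterlim_compose[rotated])
  then have "(\<lambda>n. (R\<^sup>2 / bump_mass) * Q (\<epsilon> n * R)) \<longlonglongrightarrow> 0" by (rule tendsto_mult_right_zero)
  then show ?thesis
    by (rule LIM_zero_cancel[OF Lim_null_comparison[OF always_eventually[OF allI[OF bound]]]])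
qed

text \<open>In the blown-up variable the continuous factor \<open>\<phi>\<close> tends to its value
  at \<open>y\<close> and the mollified function to its profile \<open>W\<close>. The integral in
  question is the weight that Fubini's theorem puts on the derivative measure at
  \<open>y\<close>.\<close>

lemma mollified_product_limit:
  fixes w :: "nat \<Rightarrow> plane \<Rightarrow> real" and \<phi> :: "plane \<Rightarrow> real" and \<psi> :: "real \<Rightarrow> real"
  assumes \<phi>: "continuous_on UNIV \<phi>" "\<And>x. \<bar>\<phi> x\<bar> \<le> B" and \<psi>: "continuous_on UNIV \<psi>" "\<And>x. \<bar>\<psi> x\<bar> \<le> B'"
    and w: "\<And>n. continuous_on UNIV (w n)"
    and \<epsilon>: "\<And>n. 0 < \<epsilon> n" "\<epsilon> \<longlonglongrightarrow> 0"
    and lim: "\<And>z. (\<lambda>n. w n (y + \<epsilon> n *\<^sub>R z)) \<longlonglongrightarrow> W z"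
  shows "(\<lambda>n. \<integral>x. \<phi> x * \<psi> (w n x) * moll (\<epsilon> n) (x - y) \<partial>lborel) \<longlonglongrightarrow> \<phi> y * (\<integral>z. \<psi> (W z) * kern z \<partial>lborel)"
proof -
  have [measurable]: "\<phi> \<in> borel_measurable borel" "\<psi> \<in> borel_measurable borel" "\<And>n. w n \<in> borel_measurable borel"
    by (intro borel_measurable_continuous_onI \<phi> \<psi> w)+
  have Wm[measurable]: "W \<in> borel_measurable borel"
    by (rule borel_measurable_LIMSEQ_metric[where f="\<lambda>n z. w n (y + \<epsilon> n *\<^sub>R z)"]) (use lim in auto)
  have eq: "(\<integral>x. \<phi> x * \<psi> (w n x) * moll (\<epsilon> n) (x - y) \<partial>lborel)
      = (\<integral>z. \<phi> (y + \<epsilon> n *\<^sub>R z) * \<psi> (w n (y + \<epsilon> n *\<^sub>R z)) * kern z \<partial>lborel)" for n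
  proof -
    have "(\<integral>x. \<phi> x * \<psi> (w n x) * moll (\<epsilon> n) (x - y) \<partial>lborel)
      = \<bar>\<epsilon> n\<bar> ^ DIM(plane) *\<^sub>R (\<integral>z. \<phi> (y + \<epsilon> n *\<^sub>R z) * \<psi> (w n (y + \<epsilon> n *\<^sub>R z)) * moll (\<epsilon> n) (y + \<epsilon> n *\<^sub>R z - y) \<partial>lborel)"
      using \<epsilon>(1)[of n] by (intro integral_lborel_affine) auto
    also have "\<dots> = (\<integral>z. (\<epsilon> n)\<^sup>2 * (\<phi> (y + \<epsilon> n *\<^sub>R z) * \<psi> (w n (y + \<epsilon> n *\<^sub>R z)) * moll (\<epsilon> n) (\<epsilon> n *\<^sub>R z)) \<partial>lborel)"
      by (simp add: power2_eq_square)
    also have "\<dots> = (\<integral>z. \<phi> (y + \<epsilon> n *\<^sub>R z) * \<psi> (w n (y + \<epsilon> n *\<^sub>R z)) * kern z \<partial>lborel)"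
      using \<epsilon>(1)[of n] by (intro Bochner_Integration.integral_cong) (auto simp: moll_def)
    finally show ?thesis .
  qed
  have "(\<lambda>n. \<integral>z. \<phi> (y + \<epsilon> n *\<^sub>R z) * \<psi> (w n (y + \<epsilon> n *\<^sub>R z)) * kern z \<partial>lborel)
      \<longlonglongrightarrow> (\<integral>z. \<phi> y * \<psi> (W z) * kern z \<partial>lborel)"
  proof (rule integral_dominated_convergence[where w="\<lambda>z. B * B' * kern z"])
    show "integrable lborel (\<lambda>z. B * B' * kern z)" using integrable_kern by simp
    show "AE z in lborel. (\<lambda>n. \<phi> (y + \<epsilon> n *\<^sub>R z) * \<psi> (w n (y + \<epsilon> n *\<^sub>R z)) * kern z) \<longlonglongrightarrow> \<phi> y * \<psi> (W z) * kern z"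
    proof (rule AE_I2)
      fix z :: plane
      have "(\<lambda>n. y + \<epsilon> n *\<^sub>R z) \<longlonglongrightarrow> y + 0 *\<^sub>R z" by (intro tendsto_intros \<epsilon>)
      then have "(\<lambda>n. \<phi> (y + \<epsilon> n *\<^sub>R z)) \<longlonglongrightarrow> \<phi> (y + 0 *\<^sub>R z)"
        by (intro continuous_on_tendsto_compose[OF \<phi>(1)]) auto
      moreover have "(\<lambda>n. \<psi> (w n (y + \<epsilon> n *\<^sub>R z))) \<longlonglongrightarrow> \<psi> (W z)"
        by (intro continuous_on_tendsto_compose[OF \<psi>(1)] lim) auto
      ultimately show "(\<lambda>n. \<phi> (y + \<epsilon> n *\<^sub>R z) * \<psi> (w n (y + \<epsilon> n *\<^sub>R z)) * kern z) \<longlonglongrightarrow> \<phi> y * \<psi> (W z) * kern z"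
        by (intro tendsto_mult tendsto_const) auto
    qed
    show "AE z in lborel. norm (\<phi> (y + \<epsilon> n *\<^sub>R z) * \<psi> (w n (y + \<epsilon> n *\<^sub>R z)) * kern z) \<le> B * B' * kern z" for n
    proof (rule AE_I2)
      fix z
      have "0 \<le> B" using \<phi>(2)[of 0] by linarith
      have "norm (\<phi> (y + \<epsilon> n *\<^sub>R z) * \<psi> (w n (y + \<epsilon> n *\<^sub>R z)) * kern z)
          = \<bar>\<phi> (y + \<epsilon> n *\<^sub>R z)\<bar> * \<bar>\<psi> (w n (y + \<epsilon> n *\<^sub>R z))\<bar> * kern z" by (simp add: abs_mult)
      also have "\<dots> \<le> B * B' * kern z"
        by (intro mult_right_mono mult_mono \<phi> \<psi>) (use \<open>0 \<le> B\<close> in auto)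
      finally show "norm (\<phi> (y + \<epsilon> n *\<^sub>R z) * \<psi> (w n (y + \<epsilon> n *\<^sub>R z)) * kern z) \<le> B * B' * kern z" .
    qed
  qed measurable
  moreover have "(\<integral>z. \<phi> y * \<psi> (W z) * kern z \<partial>lborel) = \<phi> y * (\<integral>z. \<psi> (W z) * kern z \<partial>lborel)"
    by (simp add: mult.assoc)
  ultimately show ?thesis by (simp add: eq)
qed

lemma hyperplane_null_sets_lborel:
  fixes n :: "'a::euclidean_space"
  assumes "n \<noteq> 0"
  shows "{z. z \<bullet> n = s} \<in> null_sets lborel"
proof -
  have "negligible {z. n \<bullet> z = s}" using assms by (intro negligible_hyperplane) auto
  then have "{z. z \<bullet> n = s} \<in> null_sets lebesgue" by (simp add: negligible_iff_null_sets inner_commute)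
  moreover have "closed {z. z \<bullet> n = s}" by (intro closed_Collect_eq continuous_intros)
  ultimately show ?thesis by (simp add: null_sets_completion_iff)
qed

text \<open>The mollification of a step function takes values that are uniformly distributed between
  the two heights with respect to the kernel, because its profile is the cumulative distribution
  function of the projected kernel.\<close>

lemma kern_jump_profile:
  fixes \<psi> \<Psi> :: "real \<Rightarrow> real" and n :: plane
  assumes n: "norm n = 1"
    and \<Psi>: "\<And>s. (\<Psi> has_real_derivative \<psi> s) (at s)" and \<psi>: "continuous_on UNIV \<psi>"
  shows "(vp - vm) * (\<integral>z. \<psi> ((\<integral>\<xi>. (if 0 < \<xi> \<bullet> n then vp else vm) * kern (z - \<xi>) \<partial>lborel) - l) * kern z \<partial>lborel)
    = \<Psi> (vp - l) - \<Psi> (vm - l)"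
proof -
  define P where "P = density lborel (\<lambda>z. ennreal (kern z))"
  have Psets[measurable_cong, simp]: "sets P = sets borel" by (simp add: P_def)
  have Pspace [simp]: "space P = UNIV" by (simp add: P_def)
  have "emeasure P (space P) = 1"
    using integrable_kern unfolding P_def
    by (subst emeasure_density) (auto simp: nn_integral_eq_integral integral_kern)
  then interpret P: prob_space P by (rule prob_spaceI)
  have nm[measurable]: "(\<lambda>z. z \<bullet> n) \<in> P \<rightarrow>\<^sub>M borel"
    by (simp add: measurable_cong_sets[OF Psets refl])
  have [measurable]: "\<psi> \<in> borel_measurable borel" using \<psi> by (rule borel_measurable_continuous_onI)
  let ?Q = "distr P borel (\<lambda>z. z \<bullet> n)"
  interpret Q: real_distribution ?Q by (rule P.real_distribution_distr) (rule nm)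
  have null: "measure ?Q {s} = 0" for s
  proof -
    have "n \<noteq> 0" using n by auto
    then have N: "{z. z \<bullet> n = s} \<in> null_sets lborel" by (rule hyperplane_null_sets_lborel)
    have "absolutely_continuous lborel P" unfolding P_def by (rule absolutely_continuousI_density) auto
    then have "{z. z \<bullet> n = s} \<in> null_sets P" using N by (auto simp: absolutely_continuous_def)
    then have "measure P {z. z \<bullet> n = s} = 0" by (rule measure_eq_0_null_sets)
    then show ?thesis by (subst measure_distr[OF nm]) (auto simp: vimage_def)
  qed
  have cdf: "cdf ?Q (z \<bullet> n) = (\<integral>\<zeta>. indicator {\<zeta>. \<zeta> \<bullet> n < z \<bullet> n} \<zeta> * kern \<zeta> \<partial>lborel)" for z
  proof -
    \<comment> \<open>Since \<open>?Q\<close> has no atoms, the closed half line of the distribution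
      function may be replaced by the open one, which matches the strict inequality in the step
      function.\<close>
    have "cdf ?Q (z \<bullet> n) = measure ?Q {..<z \<bullet> n} + measure ?Q {z \<bullet> n}"
      unfolding cdf_def2 by (subst Q.finite_measure_Union[symmetric]) (auto intro!: arg_cong[where f="measure ?Q"])
    also have "\<dots> = measure P {\<zeta>. \<zeta> \<bullet> n < z \<bullet> n}"
      by (simp add: null) (subst measure_distr[OF nm], auto simp: vimage_def)
    also have "\<dots> = (\<integral>\<zeta>. indicator {\<zeta>. \<zeta> \<bullet> n < z \<bullet> n} \<zeta> \<partial>P)" by simp
    also have "\<dots> = (\<integral>\<zeta>. kern \<zeta> *\<^sub>R indicator {\<zeta>. \<zeta> \<bullet> n < z \<bullet> n} \<zeta> \<partial>lborel)"
      unfolding P_def by (rule integral_density) auto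
    finally show ?thesis by (simp add: mult.commute)
  qed
  \<comment> \<open>Substituting \<open>z - \<zeta>\<close> for \<open>\<xi>\<close> turns the
    condition on \<open>\<xi>\<close> into \<open>\<zeta> \<bullet> n < z \<bullet> n\<close>; the
    profile is therefore the affine function of the distribution function that runs from
    \<open>vm\<close> to \<open>vp\<close>.\<close>
  have step: "(\<integral>\<xi>. (if 0 < \<xi> \<bullet> n then vp else vm) * kern (z - \<xi>) \<partial>lborel) = vm + (vp - vm) * cdf ?Q (z \<bullet> n)" for z
  proof -
    have "(\<integral>\<xi>. (if 0 < \<xi> \<bullet> n then vp else vm) * kern (z - \<xi>) \<partial>lborel)
        = \<bar>-1\<bar> ^ DIM(plane) *\<^sub>R (\<integral>\<zeta>. (if 0 < (z + (-1) *\<^sub>R \<zeta>) \<bullet> n then vp else vm) * kern (z - (z + (-1) *\<^sub>R \<zeta>)) \<partial>lborel)"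
      by (rule integral_lborel_affine) auto
    also have "\<dots> = (\<integral>\<zeta>. vm * kern \<zeta> + (vp - vm) * (indicator {\<zeta>. \<zeta> \<bullet> n < z \<bullet> n} \<zeta> * kern \<zeta>) \<partial>lborel)"
      by (simp, intro Bochner_Integration.integral_cong) (auto simp: indicator_def inner_diff_left algebra_simps)
    also have "\<dots> = vm * (\<integral>\<zeta>. kern \<zeta> \<partial>lborel) + (vp - vm) * (\<integral>\<zeta>. indicator {\<zeta>. \<zeta> \<bullet> n < z \<bullet> n} \<zeta> * kern \<zeta> \<partial>lborel)"
    proof -
      have "integrable lborel (\<lambda>\<zeta>. indicator {\<zeta>. \<zeta> \<bullet> n < z \<bullet> n} \<zeta> * kern \<zeta>)"
        using integrable_mult_bounded[OF integrable_kern, of "indicator {\<zeta>. \<zeta> \<bullet> n < z \<bullet> n}" 1] by simp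
      then show ?thesis using integrable_kern by simp
    qed
    finally show ?thesis by (simp add: integral_kern cdf)
  qed
  have "(\<integral>z. \<psi> ((\<integral>\<xi>. (if 0 < \<xi> \<bullet> n then vp else vm) * kern (z - \<xi>) \<partial>lborel) - l) * kern z \<partial>lborel)
      = (\<integral>z. kern z *\<^sub>R \<psi> ((vm - l) + (vp - vm) * cdf ?Q (z \<bullet> n)) \<partial>lborel)"
    unfolding step by (simp add: algebra_simps)
  also have cm: "cdf ?Q \<in> borel_measurable borel"
    using Q.isCont_cdf null by (intro borel_measurable_continuous_onI continuous_at_imp_continuous_on) auto
  have "(\<integral>z. kern z *\<^sub>R \<psi> ((vm - l) + (vp - vm) * cdf ?Q (z \<bullet> n)) \<partial>lborel)
      = (\<integral>z. \<psi> ((vm - l) + (vp - vm) * cdf ?Q (z \<bullet> n)) \<partial>P)"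
    unfolding P_def using cm[unfolded P_def] by (intro integral_density[symmetric]) auto
  also have "\<dots> = (\<integral>s. \<psi> ((vm - l) + (vp - vm) * cdf ?Q s) \<partial>?Q)"
    using cm by (intro integral_distr[OF nm, symmetric]) measurable
  finally show ?thesis
    using Q.integral_cdf_continuous[OF null \<Psi> \<psi>, of "vp - vm" "vm - l"] by simp
qed

section \<open>The chain rule for truncations\<close>

text \<open>An identity between vector measures, known on Borel sets, extends to bounded Borel
  weights through simple functions. The three measures may live on different sigma algebras; each is
  only asked to make the identity map measurable into the Borel sets.\<close>

lemma integral_weighted_decomposition:
  fixes f1 :: "'a::topological_space \<Rightarrow> 'b::{banach,second_countable_topology}"
  assumes int: "integrable M1 f1" "integrable M2 f2" "integrable M3 f3"
    and id: "(\<lambda>x. x) \<in> M1 \<rightarrow>\<^sub>M borel" "(\<lambda>x. x) \<in> M2 \<rightarrow>\<^sub>M borel" "(\<lambda>x. x) \<in> M3 \<rightarrow>\<^sub>M borel"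
    and eq: "\<And>B. B \<in> sets borel \<Longrightarrow> (\<integral>x. indicator B x *\<^sub>R f1 x \<partial>M1)
        = (\<integral>x. indicator B x *\<^sub>R f2 x \<partial>M2) + (\<integral>x. indicator B x *\<^sub>R f3 x \<partial>M3)"
    and K: "K \<in> borel_measurable borel" "\<And>x. \<bar>K x\<bar> \<le> C"
  shows "(\<integral>x. K x *\<^sub>R f1 x \<partial>M1) = (\<integral>x. K x *\<^sub>R f2 x \<partial>M2) + (\<integral>x. K x *\<^sub>R f3 x \<partial>M3)"
proof -
  obtain F where F: "\<And>i. simple_function borel (F i)" "\<And>x. (\<lambda>i. F i x) \<longlonglongrightarrow> K x"
      "\<And>i x. dist (F i x) 0 \<le> 2 * dist (K x) 0"
    using borel_measurable_implies_sequence_metric[OF K(1), of 0] by auto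
  have Fb: "\<bar>F i x\<bar> \<le> 2 * C" for i x using F(3)[of i x] K(2)[of x] by (simp add: dist_norm)
  have Fm: "F i \<in> borel_measurable borel" for i using F(1) by (rule borel_measurable_simple_function)
  have lim: "(\<lambda>i. \<integral>x. F i x *\<^sub>R f x \<partial>M) \<longlonglongrightarrow> (\<integral>x. K x *\<^sub>R f x \<partial>M)"
    if "integrable M f" and id: "(\<lambda>x. x) \<in> M \<rightarrow>\<^sub>M borel" for M and f :: "'a \<Rightarrow> 'b"
  proof (rule integral_dominated_convergence[where w="\<lambda>x. 2 * C * norm (f x)"])
    have Km: "K \<in> borel_measurable M" "\<And>i. F i \<in> borel_measurable M"
      using measurable_compose[OF id K(1)] measurable_compose[OF id Fm] by auto
    show "(\<lambda>x. K x *\<^sub>R f x) \<in> borel_measurable M" "\<And>i. (\<lambda>x. F i x *\<^sub>R f x) \<in> borel_measurable M"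
      using Km that by measurable
    show "integrable M (\<lambda>x. 2 * C * norm (f x))" using that by auto
    show "AE x in M. (\<lambda>i. F i x *\<^sub>R f x) \<longlonglongrightarrow> K x *\<^sub>R f x"
      by (intro AE_I2 tendsto_scaleR F tendsto_const)
    show "AE x in M. norm (F i x *\<^sub>R f x) \<le> 2 * C * norm (f x)" for i
      using Fb by (intro AE_I2) (simp add: mult_right_mono)
  qed
  have simple: "(\<integral>x. F i x *\<^sub>R f x \<partial>M) = (\<Sum>c\<in>range (F i). c *\<^sub>R (\<integral>x. indicator (F i -` {c}) x *\<^sub>R f x \<partial>M))"
    if f: "integrable M f" and id: "(\<lambda>x. x) \<in> M \<rightarrow>\<^sub>M borel" for M i and f :: "'a \<Rightarrow> 'b"
  proof -
    have fin: "finite (range (F i))" using F(1)[of i] by (simp add: simple_function_def)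
    have rep: "F i x = (\<Sum>c\<in>range (F i). c * indicator (F i -` {c}) x)" for x
    proof -
      have "(\<Sum>c\<in>range (F i). c * indicator (F i -` {c}) x) = (\<Sum>c\<in>range (F i). if c = F i x then c else 0)"
        by (intro sum.cong) (auto simp: indicator_def)
      also have "\<dots> = F i x" using fin by (subst sum.delta) auto
      finally show ?thesis by simp
    qed
    have "(\<lambda>x. F i x *\<^sub>R f x) = (\<lambda>x. \<Sum>c\<in>range (F i). c *\<^sub>R indicator (F i -` {c}) x *\<^sub>R f x)"
    proof
      fix x
      show "F i x *\<^sub>R f x = (\<Sum>c\<in>range (F i). c *\<^sub>R indicator (F i -` {c}) x *\<^sub>R f x)"
        by (subst rep) (simp add: scaleR_sum_left)
    qed
    moreover have "integrable M (\<lambda>x. indicator (F i -` {c}) x *\<^sub>R f x)" for c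
    proof (rule integrable_mult_bounded[OF f, of _ 1])
      have "F i -` {c} \<in> sets borel" using F(1)[of i] by (auto simp: simple_function_def intro: measurable_sets_borel[OF Fm])
      then show "indicator (F i -` {c}) \<in> borel_measurable M"
        using measurable_compose[OF id borel_measurable_indicator] by blast
    qed (simp add: indicator_def)
    ultimately show ?thesis
      by (simp only:) (subst Bochner_Integration.integral_sum, auto simp del: scaleR_scaleR)
  qed
  have Fs: "F i -` {c} \<in> sets borel" for i c
    by (rule measurable_sets_borel[OF Fm]) simp
  have "(\<integral>x. F i x *\<^sub>R f1 x \<partial>M1) = (\<integral>x. F i x *\<^sub>R f2 x \<partial>M2) + (\<integral>x. F i x *\<^sub>R f3 x \<partial>M3)" for i
    unfolding simple[OF int(1) id(1)] simple[OF int(2) id(2)] simple[OF int(3) id(3)] eq[OF Fs]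
    by (simp add: scaleR_add_right sum.distrib)
  then have "(\<lambda>i. \<integral>x. F i x *\<^sub>R f1 x \<partial>M1) \<longlonglongrightarrow> (\<integral>x. K x *\<^sub>R f2 x \<partial>M2) + (\<integral>x. K x *\<^sub>R f3 x \<partial>M3)"
    using tendsto_add[OF lim[OF int(2) id(2)] lim[OF int(3) id(3)]] by simp
  then show ?thesis using lim[OF int(1) id(1)] by (rule LIMSEQ_unique[rotated])
qed

section \<open>The product and chain rules for mollified functions\<close>

text \<open>Off \<open>K\<close> the function vanishes on an open set, hence so does its gradient;
  bounds on the compact set \<open>K\<close> are therefore global.\<close>

lemma test_function_bounds:
  assumes "test_function \<Omega> \<phi> g"
  obtains K B where "compact K" "K \<subseteq> \<Omega>" "\<And>x. x \<notin> K \<Longrightarrow> \<phi> x = 0" "\<And>x. x \<notin> K \<Longrightarrow> g x = 0"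
    "0 \<le> B" "\<And>x. \<bar>\<phi> x\<bar> \<le> B" "\<And>x. norm (g x) \<le> B" "\<And>x y. \<bar>\<phi> x - \<phi> y\<bar> \<le> B * norm (x - y)"
    "continuous_on UNIV \<phi>"
proof -
  have D: "(\<phi> has_derivative (\<lambda>h. h \<bullet> g x)) (at x)" and g: "continuous_on UNIV g" for x
    using assms by (auto simp: test_function_def gderiv_def)
  obtain K where K: "compact K" "K \<subseteq> \<Omega>" "\<And>x. x \<notin> K \<Longrightarrow> \<phi> x = 0"
    using assms by (auto simp: test_function_def)
  have g0: "g x = 0" if "x \<notin> K" for x
  proof -
    have "((\<lambda>_. 0) has_derivative (\<lambda>h. h \<bullet> g x)) (at x)"
      by (rule has_derivative_transform_within_open[OF D[of x], of "- K"])
        (use K that in \<open>auto simp: open_Compl compact_imp_closed\<close>)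
    then have "(\<lambda>h. h \<bullet> g x) = (\<lambda>h. 0)" by (rule has_derivative_unique) simp
    then have "g x \<bullet> g x = 0" by metis
    then show ?thesis by simp
  qed
  have cont: "continuous_on UNIV \<phi>"
    using D has_derivative_continuous by (blast intro: continuous_at_imp_continuous_on)
  have "bounded (\<phi> ` K)" "bounded (g ` K)"
    using K(1) continuous_on_subset[OF cont] continuous_on_subset[OF g]
    by (auto intro!: compact_imp_bounded compact_continuous_image)
  then obtain B1 B2 where B: "\<And>x. x \<in> K \<Longrightarrow> \<bar>\<phi> x\<bar> \<le> B1" "\<And>x. x \<in> K \<Longrightarrow> norm (g x) \<le> B2"
    by (auto simp: bounded_iff)
  define B where "B = max 0 (max B1 B2)"
  have b1: "\<bar>\<phi> x\<bar> \<le> B" for x using B(1)[of x] K(3)[of x] by (cases "x \<in> K") (auto simp: B_def)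
  have b2: "norm (g x) \<le> B" for x using B(2)[of x] g0[of x] by (cases "x \<in> K") (auto simp: B_def)
  have "norm (\<phi> x - \<phi> y) \<le> B * norm (x - y)" for x y
  proof (rule differentiable_bound[of UNIV \<phi> "\<lambda>z h. h \<bullet> g z"])
    show "(\<phi> has_derivative (\<lambda>h. h \<bullet> g z)) (at z within UNIV)" for z using D by simp
    show "onorm (\<lambda>h. h \<bullet> g z) \<le> B" for z
    proof (rule onorm_le)
      fix h
      have "norm (h \<bullet> g z) \<le> norm h * norm (g z)" by (simp add: Cauchy_Schwarz_ineq2)
      also have "\<dots> \<le> norm h * B" by (intro mult_left_mono b2) auto
      finally show "norm (h \<bullet> g z) \<le> B * norm h" by (simp add: mult.commute)
    qed
  qed auto
  then show ?thesis using that[OF K g0 _ b1 b2 _ cont] by (simp add: B_def)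
qed

lemma integrable_pair_mult:
  fixes f :: "'a \<Rightarrow> real" and g :: "'b \<Rightarrow> real"
  assumes "sigma_finite_measure M1" "sigma_finite_measure M2" and fg: "integrable M1 f" "integrable M2 g"
  shows "integrable (M1 \<Otimes>\<^sub>M M2) (\<lambda>(x, y). f x * g y)"
proof -
  interpret pair_sigma_finite M1 M2 using assms by (simp add: pair_sigma_finite_def)
  show ?thesis
  proof (rule Fubini_integrable)
    show "(\<lambda>(x, y). f x * g y) \<in> borel_measurable (M1 \<Otimes>\<^sub>M M2)" using fg by measurable
  qed (use fg in \<open>auto simp: abs_mult\<close>)
qed

lemma test_function_moll:
  assumes "0 < \<epsilon>" "cball x \<epsilon> \<subseteq> \<Omega>"
  shows "test_function \<Omega> (\<lambda>y. moll \<epsilon> (x - y)) (\<lambda>y. - moll_grad \<epsilon> (x - y))"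
  unfolding test_function_def
proof (intro conjI allI exI[of _ "cball x \<epsilon>"] impI)
  fix y
  have m: "(moll \<epsilon> has_derivative (\<lambda>h. h \<bullet> moll_grad \<epsilon> (x - y))) (at (x - y))"
    using GDERIV_moll[OF assms(1)] by (simp add: gderiv_def)
  have "((\<lambda>y. moll \<epsilon> (x - y)) has_derivative (\<lambda>h. (- h) \<bullet> moll_grad \<epsilon> (x - y))) (at y)"
    by (rule has_derivative_compose[where f="\<lambda>y. x - y" and f'="\<lambda>h. - h" and x=y, OF _ m]) (auto intro!: derivative_eq_intros)
  then show "GDERIV (\<lambda>y. moll \<epsilon> (x - y)) y :> - moll_grad \<epsilon> (x - y)"
    by (simp add: gderiv_def)
next
  show "continuous_on UNIV (\<lambda>y. - moll_grad \<epsilon> (x - y))"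
    by (intro continuous_intros continuous_on_compose2[OF continuous_on_moll_grad[of UNIV]]) auto
next
  fix y assume "y \<notin> cball x \<epsilon>"
  then show "moll \<epsilon> (x - y) = 0" using assms by (intro moll_eq_0) (auto simp: dist_norm)
qed (use assms in auto)

lemma norm_moll_grad: "0 < \<epsilon> \<Longrightarrow> norm (moll_grad \<epsilon> z) \<le> 4 / bump_mass / \<epsilon> ^ 3"
  using divide_right_mono[OF norm_kern_grad[of "(1 / \<epsilon>) *\<^sub>R z"], of "\<epsilon> ^ 3"] by (simp add: moll_grad_def)

text \<open>The mollifier centred at \<open>x\<close> is itself an admissible test function as soon
  as its disk lies in \<open>\<Omega>\<close>. The minus sign in the definition of the derivative
  cancels the one from differentiating in \<open>y\<close>.\<close>

lemma conv_gradient: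
  assumes V: "integrable lborel V" and s: "integrable \<mu> s"
    and sets[measurable_cong, simp]: "sets \<mu> = sets borel"
    and test: "\<And>\<phi> g. test_function \<Omega> \<phi> g \<Longrightarrow> (\<integral>x. V x *\<^sub>R g x \<partial>lborel) = - (\<integral>x. \<phi> x *\<^sub>R s x \<partial>\<mu>)"
    and \<epsilon>: "0 < \<epsilon>" "cball x \<epsilon> \<subseteq> \<Omega>"
  shows "(\<integral>y. V y * (moll_grad \<epsilon> (x - y) \<bullet> \<nu>) \<partial>lborel) = (\<integral>y. moll \<epsilon> (x - y) * (s y \<bullet> \<nu>) \<partial>\<mu>)"
proof -
  have [measurable]: "V \<in> borel_measurable borel" using V by auto
  have i1: "integrable lborel (\<lambda>y. V y *\<^sub>R moll_grad \<epsilon> (x - y))"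
  proof (rule Bochner_Integration.integrable_bound[where f="\<lambda>y. (4 / bump_mass / \<epsilon> ^ 3) * V y"])
    show "AE y in lborel. norm (V y *\<^sub>R moll_grad \<epsilon> (x - y)) \<le> norm (4 / bump_mass / \<epsilon> ^ 3 * V y)"
    proof (rule AE_I2)
      fix y
      have "norm (V y *\<^sub>R moll_grad \<epsilon> (x - y)) \<le> \<bar>V y\<bar> * (4 / bump_mass / \<epsilon> ^ 3)"
        unfolding norm_scaleR by (intro mult_left_mono norm_moll_grad \<epsilon>) auto
      also have "\<dots> = norm (4 / bump_mass / \<epsilon> ^ 3 * V y)"
        using bump_mass_pos \<epsilon> by (simp add: abs_mult)
      finally show "norm (V y *\<^sub>R moll_grad \<epsilon> (x - y)) \<le> norm (4 / bump_mass / \<epsilon> ^ 3 * V y)" .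
    qed
  qed (use V in auto)
  have i2: "integrable \<mu> (\<lambda>y. moll \<epsilon> (x - y) *\<^sub>R s y)"
    by (rule integrable_mult_bounded[OF s, where B="1 / (bump_mass * \<epsilon>\<^sup>2)"]) (use moll_le in auto)
  have "(\<integral>y. V y *\<^sub>R (- moll_grad \<epsilon> (x - y)) \<partial>lborel) = - (\<integral>y. moll \<epsilon> (x - y) *\<^sub>R s y \<partial>\<mu>)"
    by (rule test[OF test_function_moll[OF \<epsilon>]])
  then have "(\<integral>y. V y *\<^sub>R moll_grad \<epsilon> (x - y) \<partial>lborel) \<bullet> \<nu> = (\<integral>y. moll \<epsilon> (x - y) *\<^sub>R s y \<partial>\<mu>) \<bullet> \<nu>"
    by simp
  then show ?thesis
    by (simp flip: integral_inner_left[OF i1] integral_inner_left[OF i2])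
qed

text \<open>The product \<open>\<phi> x * \<Psi> (w x)\<close> is Lipschitz with compact support, so
  its directional derivative integrates to zero. In the product rule the derivative of the
  mollification is an integral against \<open>\<mu>\<close>, and Fubini's theorem moves the
  mollification onto the factor \<open>\<phi> x * \<psi> (w x)\<close>.\<close>

lemma mollified_chain_rule:
  fixes \<psi> \<Psi> :: "real \<Rightarrow> real"
  assumes V: "integrable lborel V" and \<mu>: "finite_measure \<mu>" and s: "integrable \<mu> s"
    and sets[measurable_cong, simp]: "sets \<mu> = sets borel"
    and test: "\<And>\<phi> g. test_function \<Omega> \<phi> g \<Longrightarrow> (\<integral>x. V x *\<^sub>R g x \<partial>lborel) = - (\<integral>x. \<phi> x *\<^sub>R s x \<partial>\<mu>)"
    and tf: "test_function \<Omega> \<phi> g"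
    and K: "compact K" "\<And>x. x \<notin> K \<Longrightarrow> \<phi> x = 0" "\<And>x. x \<in> K \<Longrightarrow> cball x \<epsilon> \<subseteq> \<Omega>"
    and \<epsilon>: "0 < \<epsilon>"
    and \<Psi>: "\<And>t. (\<Psi> has_real_derivative \<psi> t) (at t)" "\<And>t. \<bar>\<Psi> t\<bar> \<le> M"
    and \<psi>: "continuous_on UNIV \<psi>" "\<And>t. \<bar>\<psi> t\<bar> \<le> 1"
    and w_def: "\<And>x. w x = conv \<epsilon> V x - (c \<bullet> x + d)"
  shows "- (\<integral>x. (g x \<bullet> \<nu>) * \<Psi> (w x) \<partial>lborel) =
      (\<integral>y. (\<integral>x. \<phi> x * \<psi> (w x) * moll \<epsilon> (x - y) \<partial>lborel) * (s y \<bullet> \<nu>) \<partial>\<mu>) - (c \<bullet> \<nu>) * (\<integral>x. \<phi> x * \<psi> (w x) \<partial>lborel)"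
proof -
  obtain B K' where B: "0 \<le> B" "\<And>x. \<bar>\<phi> x\<bar> \<le> B" "\<And>x. norm (g x) \<le> B" "\<And>x y. \<bar>\<phi> x - \<phi> y\<bar> \<le> B * norm (x - y)"
    and K': "compact K'" "\<And>x. x \<notin> K' \<Longrightarrow> g x = 0" and \<phi>c: "continuous_on UNIV \<phi>"
    using test_function_bounds[OF tf] by metis
  have gc: "continuous_on UNIV g" and gd: "\<And>x. (\<phi> has_derivative (\<lambda>h. h \<bullet> g x)) (at x)"
    using tf by (auto simp: test_function_def gderiv_def)
  obtain L where L: "0 \<le> L" "\<And>x x'. \<bar>conv \<epsilon> V x - conv \<epsilon> V x'\<bar> \<le> L * norm (x - x')"
    using conv_lipschitz[OF V \<epsilon>] by blast
  have \<Psi>c: "continuous_on UNIV \<Psi>" using \<Psi>(1) by (meson DERIV_isCont continuous_at_imp_continuous_on)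
  have \<Psi>l: "\<bar>\<Psi> t - \<Psi> t'\<bar> \<le> \<bar>t - t'\<bar>" for t t'
  proof -
    have "norm (\<Psi> t - \<Psi> t') \<le> 1 * norm (t - t')"
      by (rule field_differentiable_bound[of UNIV \<Psi> \<psi>]) (use \<Psi>(1) \<psi>(2) in auto)
    then show ?thesis by simp
  qed
  have wc: "continuous_on UNIV w"
    unfolding w_def by (intro continuous_intros continuous_on_conv V \<epsilon>)
  have wl: "\<bar>w x - w x'\<bar> \<le> (L + norm c) * norm (x - x')" for x x'
  proof -
    have "w x - w x' = (conv \<epsilon> V x - conv \<epsilon> V x') - c \<bullet> (x - x')" by (simp add: w_def inner_diff_right)
    moreover have "\<bar>c \<bullet> (x - x')\<bar> \<le> norm c * norm (x - x')" by (rule Cauchy_Schwarz_ineq2)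
    ultimately show ?thesis using L(2)[of x x'] by (simp add: distrib_right)
  qed
  have [measurable]: "\<phi> \<in> borel_measurable borel" "g \<in> borel_measurable borel" "\<Psi> \<in> borel_measurable borel"
      "\<psi> \<in> borel_measurable borel" "w \<in> borel_measurable borel" "V \<in> borel_measurable borel"
    using V by (auto intro!: borel_measurable_continuous_onI \<phi>c gc \<Psi>c \<psi> wc)
  have [measurable]: "s \<in> borel_measurable \<mu>" using s by auto
  have [measurable]: "K \<in> sets borel" "K' \<in> sets borel" using K K' by (auto simp: compact_imp_closed)
  have finK: "integrable lborel (indicator K :: plane \<Rightarrow> real)" "integrable lborel (indicator K' :: plane \<Rightarrow> real)"
    using K K' emeasure_compact_finite by (auto intro!: integrable_real_indicator simp: less_top)
  have M: "0 \<le> M" using \<Psi>(2)[of 0] by linarith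
  define D where "D x = (\<integral>y. V y * (moll_grad \<epsilon> (x - y) \<bullet> \<nu>) \<partial>lborel)" for x
  define E where "E x = (\<integral>y. moll \<epsilon> (x - y) * (s y \<bullet> \<nu>) \<partial>\<mu>)" for x
  \<comment> \<open>\<open>E\<close> represents the derivative of the mollification where the disk
    of radius \<open>\<epsilon>\<close> stays in \<open>\<Omega>\<close>, in particular on
    \<open>K\<close>; off \<open>K\<close> the factor \<open>\<phi> x\<close> vanishes.\<close>
  have DE: "\<phi> x * \<psi> (w x) * D x = \<phi> x * \<psi> (w x) * E x" for x
    using conv_gradient[OF V s sets test \<epsilon> K(3), of x \<nu>] K(2)[of x] by (cases "x \<in> K") (auto simp: D_def E_def)
  obtain R where R: "\<And>x. x \<in> K \<Longrightarrow> norm x \<le> R" using compact_imp_bounded[OF K(1)] by (auto simp: bounded_iff)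
  have bnd: "integrable lborel h" if "h \<in> borel_measurable lborel" "\<And>x. \<bar>h x\<bar> \<le> C * indicator A x" "integrable lborel (indicator A :: plane \<Rightarrow> real)"
    for h :: "plane \<Rightarrow> real" and C A
  proof (rule Bochner_Integration.integrable_bound[where f="\<lambda>x. C * indicator A x"])
    show "AE x in lborel. norm (h x) \<le> norm (C * indicator A x)"
      using that(2) by (intro AE_I2) (smt (verit) real_norm_def)
  qed (use that in auto)
  have i1: "integrable lborel (\<lambda>x. (g x \<bullet> \<nu>) * \<Psi> (w x))"
  proof (rule bnd[where C="B * norm \<nu> * M" and A=K', OF _ _ finK(2)])
    fix x
    have "\<bar>g x \<bullet> \<nu>\<bar> \<le> B * norm \<nu>"
      by (rule order_trans[OF Cauchy_Schwarz_ineq2]) (intro mult_right_mono B, auto)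
    then have "\<bar>g x \<bullet> \<nu>\<bar> * \<bar>\<Psi> (w x)\<bar> \<le> B * norm \<nu> * M" using B(1) by (intro mult_mono \<Psi>) auto
    then show "\<bar>(g x \<bullet> \<nu>) * \<Psi> (w x)\<bar> \<le> B * norm \<nu> * M * indicator K' x"
      using K'(2)[of x] by (cases "x \<in> K'") (auto simp: abs_mult)
  qed measurable
  have pw: "\<bar>\<phi> x * \<psi> (w x)\<bar> \<le> B * indicator K x" for x
  proof -
    have "\<bar>\<phi> x\<bar> * \<bar>\<psi> (w x)\<bar> \<le> B * 1" using B(1) by (intro mult_mono B \<psi>) auto
    then show ?thesis using K(2)[of x] by (cases "x \<in> K") (auto simp: abs_mult)
  qed
  have i2: "integrable lborel (\<lambda>x. \<phi> x * \<psi> (w x))"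
    by (rule bnd[OF _ pw finK(1)]) measurable
  interpret \<mu>: finite_measure \<mu> by (rule \<mu>)
  interpret pair_sigma_finite lborel \<mu> ..
  let ?f = "\<lambda>x y. \<phi> x * \<psi> (w x) * moll \<epsilon> (x - y) * (s y \<bullet> \<nu>)"
  have if2: "integrable (lborel \<Otimes>\<^sub>M \<mu>) (\<lambda>(x, y). ?f x y)"
  proof (rule Bochner_Integration.integrable_bound)
    show "integrable (lborel \<Otimes>\<^sub>M \<mu>) (\<lambda>(x, y). (B * (1 / (bump_mass * \<epsilon>\<^sup>2)) * indicator K x) * (norm (s y) * norm \<nu>))"
      by (rule integrable_pair_mult) (use finK s lborel.sigma_finite_measure_axioms \<mu>.sigma_finite_measure_axioms in auto)
    show "AE p in lborel \<Otimes>\<^sub>M \<mu>. norm (case p of (x, y) \<Rightarrow> ?f x y)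
        \<le> norm (case p of (x, y) \<Rightarrow> (B * (1 / (bump_mass * \<epsilon>\<^sup>2)) * indicator K x) * (norm (s y) * norm \<nu>))"
    proof (rule AE_I2)
      fix p :: "plane \<times> plane"
      obtain x y where p: "p = (x, y)" by (cases p)
      have "norm (?f x y) = \<bar>\<phi> x * \<psi> (w x)\<bar> * moll \<epsilon> (x - y) * \<bar>s y \<bullet> \<nu>\<bar>" by (simp add: abs_mult)
      also have "\<dots> \<le> (B * indicator K x) * (1 / (bump_mass * \<epsilon>\<^sup>2)) * (norm (s y) * norm \<nu>)"
        using B(1) by (intro mult_mono pw moll_le Cauchy_Schwarz_ineq2) (auto intro!: mult_nonneg_nonneg divide_nonneg_nonneg simp: less_imp_le[OF bump_mass_pos])
      also have "\<dots> \<le> norm ((B * (1 / (bump_mass * \<epsilon>\<^sup>2)) * indicator K x) * (norm (s y) * norm \<nu>))"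
        unfolding real_norm_def by (rule order_trans[OF _ abs_ge_self]) (simp add: ac_simps)
      finally show "norm (case p of (x, y) \<Rightarrow> ?f x y)
        \<le> norm (case p of (x, y) \<Rightarrow> (B * (1 / (bump_mass * \<epsilon>\<^sup>2)) * indicator K x) * (norm (s y) * norm \<nu>))"
        unfolding p prod.case .
    qed
    show "(\<lambda>(x, y). ?f x y) \<in> borel_measurable (lborel \<Otimes>\<^sub>M \<mu>)"
      by measurable
  qed
  have fE: "(\<integral>y. ?f x y \<partial>\<mu>) = \<phi> x * \<psi> (w x) * E x" for x
    by (simp add: E_def mult.assoc)
  have i3: "integrable lborel (\<lambda>x. \<phi> x * \<psi> (w x) * E x)"
    using integrable_fst[OF if2] by (simp add: fE)
  have fub: "(\<integral>x. \<phi> x * \<psi> (w x) * E x \<partial>lborel) = (\<integral>y. (\<integral>x. \<phi> x * \<psi> (w x) * moll \<epsilon> (x - y) \<partial>lborel) * (s y \<bullet> \<nu>) \<partial>\<mu>)"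
    using Fubini_integral[OF if2] by (simp add: fE)
  have "(\<integral>x. (g x \<bullet> \<nu>) * \<Psi> (w x) + (\<phi> x * \<psi> (w x) * D x - (c \<bullet> \<nu>) * (\<phi> x * \<psi> (w x))) \<partial>lborel) = 0"
  proof (rule integral_directional_derivative_eq_0[where F="\<lambda>x. \<phi> x * \<Psi> (w x)" and \<nu>=\<nu> and R=R
        and L="(B * M + B * (L + norm c)) * norm \<nu>"])
    show "integrable lborel (\<lambda>x. \<phi> x * \<Psi> (w x))"
    proof (rule bnd[OF _ _ finK(1), where C="B * M"])
      fix x
      have "\<bar>\<phi> x\<bar> * \<bar>\<Psi> (w x)\<bar> \<le> B * M" using B(1) by (intro mult_mono B \<Psi>) auto
      then show "\<bar>\<phi> x * \<Psi> (w x)\<bar> \<le> B * M * indicator K x"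
        using K(2)[of x] by (cases "x \<in> K") (auto simp: abs_mult)
    qed measurable
    show "\<phi> x * \<Psi> (w x) = 0" if "R < norm x" for x
      using K(2)[of x] R[of x] that by fastforce
    fix x
    show "\<bar>\<phi> (x + t *\<^sub>R \<nu>) * \<Psi> (w (x + t *\<^sub>R \<nu>)) - \<phi> x * \<Psi> (w x)\<bar> \<le> (B * M + B * (L + norm c)) * norm \<nu> * \<bar>t\<bar>" for t
    proof -
      let ?x = "x + t *\<^sub>R \<nu>"
      have "\<phi> ?x * \<Psi> (w ?x) - \<phi> x * \<Psi> (w x) = (\<phi> ?x - \<phi> x) * \<Psi> (w ?x) + \<phi> x * (\<Psi> (w ?x) - \<Psi> (w x))"
        by (simp add: algebra_simps)
      then have "\<bar>\<phi> ?x * \<Psi> (w ?x) - \<phi> x * \<Psi> (w x)\<bar>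
          \<le> \<bar>\<phi> ?x - \<phi> x\<bar> * \<bar>\<Psi> (w ?x)\<bar> + \<bar>\<phi> x\<bar> * \<bar>\<Psi> (w ?x) - \<Psi> (w x)\<bar>"
        by (metis abs_mult abs_triangle_ineq)
      also have "\<dots> \<le> (B * norm (?x - x)) * M + B * ((L + norm c) * norm (?x - x))"
        using B(1) L(1) by (intro add_mono mult_mono B \<Psi> order_trans[OF \<Psi>l wl]) auto
      also have "norm (?x - x) = norm \<nu> * \<bar>t\<bar>" by (simp add: mult.commute)
      finally show ?thesis by (simp add: algebra_simps)
    qed
    have "((\<lambda>t. \<phi> (x + t *\<^sub>R \<nu>)) has_derivative (\<lambda>t. (t *\<^sub>R \<nu>) \<bullet> g x)) (at 0)"
      by (rule has_derivative_compose[where f="\<lambda>t. x + t *\<^sub>R \<nu>" and f'="\<lambda>t. t *\<^sub>R \<nu>" and x=0 and g=\<phi>])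
        (use gd[of x] in \<open>auto intro!: derivative_eq_intros\<close>)
    then have 1: "((\<lambda>t. \<phi> (x + t *\<^sub>R \<nu>)) has_real_derivative (g x \<bullet> \<nu>)) (at 0)"
      by (simp add: has_field_derivative_def mult_commute_abs inner_commute)
    have "((\<lambda>t. conv \<epsilon> V (x + t *\<^sub>R \<nu>) - (c \<bullet> (x + t *\<^sub>R \<nu>) + d)) has_real_derivative (D x - c \<bullet> \<nu>)) (at 0)"
      unfolding D_def inner_add_right inner_scaleR_right
      by (rule derivative_eq_intros conv_directional_derivative[OF V \<epsilon>] refl)+ (auto intro!: derivative_eq_intros)
    then have 2: "((\<lambda>t. w (x + t *\<^sub>R \<nu>)) has_real_derivative (D x - c \<bullet> \<nu>)) (at 0)"
      unfolding w_def .
    have 3: "((\<lambda>t. \<Psi> (w (x + t *\<^sub>R \<nu>))) has_real_derivative \<psi> (w x) * (D x - c \<bullet> \<nu>)) (at 0)"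
      using DERIV_chain2[OF \<Psi>(1) 2] by simp
    show "((\<lambda>t. \<phi> (x + t *\<^sub>R \<nu>) * \<Psi> (w (x + t *\<^sub>R \<nu>))) has_real_derivative
        (g x \<bullet> \<nu>) * \<Psi> (w x) + (\<phi> x * \<psi> (w x) * D x - (c \<bullet> \<nu>) * (\<phi> x * \<psi> (w x)))) (at 0)"
      by (rule DERIV_cong[OF DERIV_mult[OF 1 3]]) (simp add: algebra_simps)
  qed
  then have "(\<integral>x. (g x \<bullet> \<nu>) * \<Psi> (w x) \<partial>lborel) + ((\<integral>x. \<phi> x * \<psi> (w x) * E x \<partial>lborel) - (c \<bullet> \<nu>) * (\<integral>x. \<phi> x * \<psi> (w x) \<partial>lborel)) = 0"
    unfolding DE using i1 i2 i3 by simp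
  then show ?thesis using fub by linarith
qed

section \<open>Passage to the limit in the chain rule\<close>

text \<open>One notion covers both kinds of points: \<open>\<sigma>\<close> is constant at a point
  of approximate continuity and takes two values, one on each side of a line, at a jump
  point.\<close>

definition has_blow_up :: "(plane \<Rightarrow> real) \<Rightarrow> plane \<Rightarrow> (plane \<Rightarrow> real) \<Rightarrow> bool" where
  "has_blow_up V y \<sigma> \<longleftrightarrow>
    ((\<lambda>\<rho>. (\<integral>x. indicator (ball y \<rho>) x * \<bar>V x - \<sigma> (x - y)\<bar> \<partial>lborel) / \<rho>\<^sup>2) \<longlongrightarrow> 0) (at_right 0)"

lemma
  assumes "0 < \<epsilon>"
  shows integrable_moll: "integrable lborel (\<lambda>x. moll \<epsilon> (x - y))"
    and integral_moll: "(\<integral>x. moll \<epsilon> (x - y) \<partial>lborel) = 1"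
proof -
  have eq: "moll \<epsilon> (y + \<epsilon> *\<^sub>R z - y) = kern z / \<epsilon>\<^sup>2" for z using assms by (simp add: moll_def)
  have "integrable lborel (\<lambda>z. moll \<epsilon> (y + \<epsilon> *\<^sub>R z - y)) \<longleftrightarrow> integrable lborel (\<lambda>x. moll \<epsilon> (x - y))"
    by (rule integrable_lborel_affine, measurable) (use assms in simp)
  then show "integrable lborel (\<lambda>x. moll \<epsilon> (x - y))" unfolding eq using integrable_kern by simp
  have "(\<integral>x. moll \<epsilon> (x - y) \<partial>lborel) = \<bar>\<epsilon>\<bar> ^ DIM(plane) *\<^sub>R (\<integral>z. moll \<epsilon> (y + \<epsilon> *\<^sub>R z - y) \<partial>lborel)"
    by (rule integral_lborel_affine, measurable) (use assms in simp)
  then show "(\<integral>x. moll \<epsilon> (x - y) \<partial>lborel) = 1"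
    unfolding eq using assms by (simp add: integral_kern power2_eq_square)
qed

text \<open>The weights \<open>KK i\<close> obtained by mollification are uniformly bounded and
  converge at every point of \<open>\<Omega> - S\<close> and of \<open>J\<close>. The former points
  carry the Lebesgue integrals and the latter the jump density, so one limit \<open>K\<close> serves
  in all terms. At a jump point \<open>K\<close> is described through its product with the height of
  the jump, which is the form in which it meets the jump density.\<close>

lemma chain_rule:
  fixes \<psi> \<Psi> :: "real \<Rightarrow> real"
  assumes \<Omega>: "open \<Omega>"
    and V: "integrable lborel V" and \<mu>: "finite_measure \<mu>" and s: "integrable \<mu> s"
    and sets[measurable_cong, simp]: "sets \<mu> = sets borel"
    and test: "\<And>\<phi> g. test_function \<Omega> \<phi> g \<Longrightarrow> (\<integral>x. V x *\<^sub>R g x \<partial>lborel) = - (\<integral>x. \<phi> x *\<^sub>R s x \<partial>\<mu>)"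
    and G: "integrable lebesgue G" "\<And>x. x \<notin> \<Omega> \<Longrightarrow> G x = 0"
    and j: "integrable hausdorff1 j" "AE x in hausdorff1. j x \<noteq> 0 \<longrightarrow> x \<in> J"
    and decomp: "\<And>B. B \<in> sets borel \<Longrightarrow> (\<integral>x. indicator B x *\<^sub>R s x \<partial>\<mu>)
        = (\<integral>x. indicator B x *\<^sub>R G x \<partial>lebesgue) + (\<integral>x. indicator B x *\<^sub>R j x \<partial>hausdorff1)"
    and S: "S \<in> null_sets lebesgue"
    and a: "\<And>x. x \<in> \<Omega> - S \<Longrightarrow> has_blow_up V x (\<lambda>_. a x)"
    and J: "J \<subseteq> \<Omega>" "\<And>x. x \<in> J \<Longrightarrow> norm (n x) = 1 \<and> has_blow_up V x (\<lambda>z. if 0 < z \<bullet> n x then vp x else vm x)"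
    and tf: "test_function \<Omega> \<phi> g"
    and \<Psi>: "\<And>t. (\<Psi> has_real_derivative \<psi> t) (at t)" "\<And>t. \<bar>\<Psi> t\<bar> \<le> M"
    and \<psi>: "continuous_on UNIV \<psi>" "\<And>t. \<bar>\<psi> t\<bar> \<le> 1"
  obtains K C where "K \<in> borel_measurable borel" "\<And>x. \<bar>K x\<bar> \<le> C" "\<And>x. x \<notin> \<Omega> \<Longrightarrow> K x = 0"
    "\<And>x. x \<in> \<Omega> - S \<Longrightarrow> K x = \<phi> x * \<psi> (a x - (c \<bullet> x + d))"
    "\<And>x. x \<in> J \<Longrightarrow> (vp x - vm x) * K x = \<phi> x * (\<Psi> (vp x - (c \<bullet> x + d)) - \<Psi> (vm x - (c \<bullet> x + d)))"
    "- (\<integral>x. (g x \<bullet> \<nu>) * \<Psi> (V x - (c \<bullet> x + d)) \<partial>lborel)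
      = (\<integral>x. K x * (G x \<bullet> \<nu>) \<partial>lebesgue) + (\<integral>x. K x * (j x \<bullet> \<nu>) \<partial>hausdorff1) - (c \<bullet> \<nu>) * (\<integral>x. K x \<partial>lebesgue)"
proof -
  obtain A B where A: "compact A" "A \<subseteq> \<Omega>" "\<And>x. x \<notin> A \<Longrightarrow> \<phi> x = 0" "\<And>x. x \<notin> A \<Longrightarrow> g x = 0"
    and B: "0 \<le> B" "\<And>x. \<bar>\<phi> x\<bar> \<le> B" "\<And>x. norm (g x) \<le> B"
    and \<phi>c: "continuous_on UNIV \<phi>"
    using test_function_bounds[OF tf] by metis
  have gc: "continuous_on UNIV g" using tf by (auto simp: test_function_def)
  have "A \<inter> - \<Omega> = {}" using A(2) by auto
  then obtain \<delta> where \<delta>: "0 < \<delta>" "\<And>x y. x \<in> A \<Longrightarrow> y \<notin> \<Omega> \<Longrightarrow> \<delta> \<le> dist x y"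
    using separate_compact_closed[OF A(1), of "- \<Omega>"] \<Omega> by (metis ComplI closed_Compl)
  \<comment> \<open>Radii below \<open>\<delta>\<close> keep all closed disks centred in
    \<open>A\<close> inside \<open>\<Omega>\<close>.\<close>
  define \<epsilon> where "\<epsilon> i = \<delta> / (real i + 2)" for i
  have \<epsilon>: "0 < \<epsilon> i" "\<epsilon> i < \<delta>" for i
    using \<delta>(1) by (auto simp: \<epsilon>_def divide_less_eq)
  have \<epsilon>0: "\<epsilon> \<longlonglongrightarrow> 0" unfolding \<epsilon>_def by real_asymp
  have cb: "cball x (\<epsilon> i) \<subseteq> \<Omega>" if "x \<in> A" for x i
    using \<delta>(2)[OF that] \<epsilon>(2)[of i] by fastforce
  define w where "w i x = conv (\<epsilon> i) V x - (c \<bullet> x + d)" for i x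
  define KK where "KK i y = (\<integral>x. \<phi> x * \<psi> (w i x) * moll (\<epsilon> i) (x - y) \<partial>lborel)" for i y
  have wc: "continuous_on UNIV (w i)" for i
    unfolding w_def by (intro continuous_intros continuous_on_conv V \<epsilon>)
  have \<Psi>c: "continuous_on UNIV \<Psi>" using \<Psi>(1) by (meson DERIV_isCont continuous_at_imp_continuous_on)
  have \<Psi>l: "\<bar>\<Psi> t - \<Psi> t'\<bar> \<le> \<bar>t - t'\<bar>" for t t'
  proof -
    have "norm (\<Psi> t - \<Psi> t') \<le> 1 * norm (t - t')"
      by (rule field_differentiable_bound[of UNIV \<Psi> \<psi>]) (use \<Psi>(1) \<psi>(2) in auto)
    then show ?thesis by simp
  qed
  have [measurable]: "\<phi> \<in> borel_measurable borel" "g \<in> borel_measurable borel" "\<Psi> \<in> borel_measurable borel"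
      "\<psi> \<in> borel_measurable borel" "\<And>i. w i \<in> borel_measurable borel" "V \<in> borel_measurable borel"
    using V by (auto intro!: borel_measurable_continuous_onI \<phi>c gc \<Psi>c \<psi> wc)
  have [measurable]: "A \<in> sets borel" "\<Omega> \<in> sets borel" using A \<Omega> by (auto simp: compact_imp_closed)
  have KKm[measurable]: "KK i \<in> borel_measurable borel" for i
    unfolding KK_def by measurable
  have \<phi>\<psi>: "\<bar>\<phi> x * \<psi> t\<bar> \<le> B" for x t
  proof -
    have "\<bar>\<phi> x\<bar> * \<bar>\<psi> t\<bar> \<le> B * 1" using B(1) by (intro mult_mono B \<psi>) auto
    then show ?thesis by (simp add: abs_mult)
  qed
  have KKb: "\<bar>KK i y\<bar> \<le> B" for i y
  proof -
    have "\<bar>KK i y\<bar> \<le> (\<integral>x. B * moll (\<epsilon> i) (x - y) \<partial>lborel)"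
      unfolding KK_def
    proof (rule integral_abs_bound_integral)
      show "integrable lborel (\<lambda>x. \<phi> x * \<psi> (w i x) * moll (\<epsilon> i) (x - y))"
        using integrable_mult_bounded[OF integrable_moll[OF \<epsilon>(1)], of "\<lambda>x. \<phi> x * \<psi> (w i x)" B i y] \<phi>\<psi> by simp
      show "integrable lborel (\<lambda>x. B * moll (\<epsilon> i) (x - y))"
        using integrable_moll[OF \<epsilon>(1)] by simp
      show "\<bar>\<phi> x * \<psi> (w i x) * moll (\<epsilon> i) (x - y)\<bar> \<le> B * moll (\<epsilon> i) (x - y)" for x
        using \<phi>\<psi>[of x "w i x"] by (simp add: abs_mult[of _ "moll _ _"] mult_right_mono)
    qed
    also have "\<dots> = B" using integral_moll[OF \<epsilon>(1)] by simp
    finally show ?thesis .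
  qed
  have ident: "- (\<integral>x. (g x \<bullet> \<nu>) * \<Psi> (w i x) \<partial>lborel)
      = (\<integral>y. KK i y * (s y \<bullet> \<nu>) \<partial>\<mu>) - (c \<bullet> \<nu>) * (\<integral>x. \<phi> x * \<psi> (w i x) \<partial>lborel)" for i
    unfolding KK_def
    by (rule mollified_chain_rule[OF V \<mu> s sets test tf A(1,3) cb \<epsilon>(1) \<Psi> \<psi> w_def])
  have split: "(\<integral>y. KK i y * (s y \<bullet> \<nu>) \<partial>\<mu>) = (\<integral>y. KK i y * (G y \<bullet> \<nu>) \<partial>lebesgue) + (\<integral>y. KK i y * (j y \<bullet> \<nu>) \<partial>hausdorff1)" for i
  proof -
    have m: "KK i \<in> borel_measurable \<mu>" "KK i \<in> borel_measurable lebesgue" "KK i \<in> borel_measurable hausdorff1"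
      using KKm by (auto simp: measurable_completion cong: measurable_cong_sets)
    have "(\<integral>y. KK i y *\<^sub>R s y \<partial>\<mu>) = (\<integral>y. KK i y *\<^sub>R G y \<partial>lebesgue) + (\<integral>y. KK i y *\<^sub>R j y \<partial>hausdorff1)"
      by (rule integral_weighted_decomposition[OF s G(1) j(1) _ _ _ decomp KKm KKb])
        (auto simp: measurable_completion cong: measurable_cong_sets)
    then have "(\<integral>y. KK i y *\<^sub>R s y \<partial>\<mu>) \<bullet> \<nu> = (\<integral>y. KK i y *\<^sub>R G y \<partial>lebesgue) \<bullet> \<nu> + (\<integral>y. KK i y *\<^sub>R j y \<partial>hausdorff1) \<bullet> \<nu>"
      by (simp add: inner_add_left)
    then show ?thesis
      by (simp flip: integral_inner_left[OF integrable_mult_bounded[OF s m(1) KKb]]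
          integral_inner_left[OF integrable_mult_bounded[OF G(1) m(2) KKb]]
          integral_inner_left[OF integrable_mult_bounded[OF j(1) m(3) KKb]])
  qed
  have wlim: "(\<lambda>i. w i (y + \<epsilon> i *\<^sub>R z)) \<longlonglongrightarrow> (\<integral>\<xi>. \<sigma> \<xi> * kern (z - \<xi>) \<partial>lborel) - (c \<bullet> y + d)"
    if "has_blow_up V y \<sigma>" "\<sigma> \<in> borel_measurable borel" "\<And>z. \<bar>\<sigma> z\<bar> \<le> B'" "\<And>c z. 0 < c \<Longrightarrow> \<sigma> (c *\<^sub>R z) = \<sigma> z"
    for y z \<sigma> B'
  proof -
    have "(\<lambda>i. conv (\<epsilon> i) V (y + \<epsilon> i *\<^sub>R z)) \<longlonglongrightarrow> (\<integral>\<xi>. \<sigma> \<xi> * kern (z - \<xi>) \<partial>lborel)"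
      by (rule conv_blow_up[OF V that(2-4) that(1)[unfolded has_blow_up_def] \<epsilon>(1) \<epsilon>0])
    moreover have "(\<lambda>i. c \<bullet> (y + \<epsilon> i *\<^sub>R z) + d) \<longlonglongrightarrow> c \<bullet> (y + 0 *\<^sub>R z) + d"
      by (intro tendsto_intros \<epsilon>0)
    ultimately show ?thesis unfolding w_def by (auto intro: tendsto_diff)
  qed
  have ak: "(\<integral>\<xi>. kern (z - \<xi>) \<partial>lborel) = 1" for z
    using integral_lborel_affine[of kern "-1" z] by (simp add: integral_kern)
  have wa: "(\<lambda>i. w i (y + \<epsilon> i *\<^sub>R z)) \<longlonglongrightarrow> a y - (c \<bullet> y + d)" if "y \<in> \<Omega> - S" for y z
    using wlim[OF a[OF that], of "\<bar>a y\<bar>" z] by (simp add: ak)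
  have lima: "(\<lambda>i. KK i y) \<longlonglongrightarrow> \<phi> y * \<psi> (a y - (c \<bullet> y + d))" if "y \<in> \<Omega> - S" for y
    using mollified_product_limit[where \<epsilon>=\<epsilon> and w=w, OF \<phi>c B(2) \<psi> wc \<epsilon>(1) \<epsilon>0 wa[OF that]]
    by (simp add: KK_def integral_kern)
  define step where "step y z = (\<integral>\<xi>. (if 0 < \<xi> \<bullet> n y then vp y else vm y) * kern (z - \<xi>) \<partial>lborel)" for y z
  have limJ: "(\<lambda>i. KK i y) \<longlonglongrightarrow> \<phi> y * (\<integral>z. \<psi> (step y z - (c \<bullet> y + d)) * kern z \<partial>lborel)" if "y \<in> J" for y
  proof -
    have "(\<lambda>i. w i (y + \<epsilon> i *\<^sub>R z)) \<longlonglongrightarrow> step y z - (c \<bullet> y + d)" for z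
      unfolding step_def
    proof (rule wlim)
      show "has_blow_up V y (\<lambda>z. if 0 < z \<bullet> n y then vp y else vm y)" using J(2)[OF that] by blast
      show "\<bar>if 0 < z \<bullet> n y then vp y else vm y\<bar> \<le> max \<bar>vp y\<bar> \<bar>vm y\<bar>" for z by auto
    qed (auto simp: zero_less_mult_iff)
    from mollified_product_limit[where \<epsilon>=\<epsilon> and w=w, OF \<phi>c B(2) \<psi> wc \<epsilon>(1) \<epsilon>0 this]
    show ?thesis by (simp add: KK_def)
  qed
  \<comment> \<open>Where the weights do not converge, \<open>lim\<close> is some unspecified value;
    clipping at \<open>B\<close> keeps \<open>K\<close> bounded there without affecting genuine
    limits, and the whole expression stays Borel.\<close>
  define K where "K y = indicator \<Omega> y * max (- B) (min B (lim (\<lambda>i. KK i y)))" for y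
  have Km[measurable]: "K \<in> borel_measurable borel" unfolding K_def by measurable
  have Kb: "\<bar>K y\<bar> \<le> B" for y using B(1) by (auto simp: K_def indicator_def)
  have K0: "K y = 0" if "y \<notin> \<Omega>" for y using that by (simp add: K_def)
  have Klim: "K y = t" if "y \<in> \<Omega>" "(\<lambda>i. KK i y) \<longlonglongrightarrow> t" for y t
  proof -
    have b: "KK i y \<le> B" "- B \<le> KK i y" for i using KKb[of i y] by linarith+
    have "t \<le> B" by (rule LIMSEQ_le_const2[OF that(2)]) (use b in blast)
    moreover have "- B \<le> t" by (rule LIMSEQ_le_const[OF that(2)]) (use b in blast)
    ultimately show ?thesis using that(1) limI[OF that(2)] by (simp add: K_def)
  qed
  have Ka: "K y = \<phi> y * \<psi> (a y - (c \<bullet> y + d))" if "y \<in> \<Omega> - S" for y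
    using Klim[OF _ lima] that by blast
  have KJ: "K y = \<phi> y * (\<integral>z. \<psi> (step y z - (c \<bullet> y + d)) * kern z \<partial>lborel)" if "y \<in> J" for y
    using Klim[OF _ limJ] that J(1) by blast
  have AES: "AE y in lebesgue. y \<notin> S" using S by (rule AE_not_in)
  have L1: "(\<lambda>i. \<integral>y. KK i y * (G y \<bullet> \<nu>) \<partial>lebesgue) \<longlonglongrightarrow> (\<integral>y. K y * (G y \<bullet> \<nu>) \<partial>lebesgue)"
  proof (rule integral_dominated_convergence[where w="\<lambda>y. B * (norm (G y) * norm \<nu>)"])
    have [measurable]: "G \<in> borel_measurable lebesgue" using G by auto
    have [measurable]: "K \<in> borel_measurable lebesgue" "\<And>i. KK i \<in> borel_measurable lebesgue"
      using KKm Km by (auto simp: measurable_completion)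
    show "(\<lambda>y. K y * (G y \<bullet> \<nu>)) \<in> borel_measurable lebesgue" "\<And>i. (\<lambda>y. KK i y * (G y \<bullet> \<nu>)) \<in> borel_measurable lebesgue"
      by measurable
    show "integrable lebesgue (\<lambda>y. B * (norm (G y) * norm \<nu>))" using G(1) by auto
    show "AE y in lebesgue. norm (KK i y * (G y \<bullet> \<nu>)) \<le> B * (norm (G y) * norm \<nu>)" for i
      unfolding real_norm_def abs_mult using B(1) by (intro AE_I2 mult_mono KKb Cauchy_Schwarz_ineq2) auto
    show "AE y in lebesgue. (\<lambda>i. KK i y * (G y \<bullet> \<nu>)) \<longlonglongrightarrow> K y * (G y \<bullet> \<nu>)"
      using AES
    proof eventually_elim
      case (elim y)
      then show ?case using lima[of y] Ka[of y] G(2)[of y] by (cases "y \<in> \<Omega>") (auto intro!: tendsto_mult_right)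
    qed
  qed
  have L2: "(\<lambda>i. \<integral>y. KK i y * (j y \<bullet> \<nu>) \<partial>hausdorff1) \<longlonglongrightarrow> (\<integral>y. K y * (j y \<bullet> \<nu>) \<partial>hausdorff1)"
  proof (rule integral_dominated_convergence[where w="\<lambda>y. B * (norm (j y) * norm \<nu>)"])
    have [measurable]: "j \<in> borel_measurable hausdorff1" using j by auto
    have [measurable]: "K \<in> borel_measurable hausdorff1" "\<And>i. KK i \<in> borel_measurable hausdorff1"
      using KKm Km by (auto cong: measurable_cong_sets)
    show "(\<lambda>y. K y * (j y \<bullet> \<nu>)) \<in> borel_measurable hausdorff1" "\<And>i. (\<lambda>y. KK i y * (j y \<bullet> \<nu>)) \<in> borel_measurable hausdorff1"
      by measurable
    show "integrable hausdorff1 (\<lambda>y. B * (norm (j y) * norm \<nu>))" using j(1) by auto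
    show "AE y in hausdorff1. norm (KK i y * (j y \<bullet> \<nu>)) \<le> B * (norm (j y) * norm \<nu>)" for i
      unfolding real_norm_def abs_mult using B(1) by (intro AE_I2 mult_mono KKb Cauchy_Schwarz_ineq2) auto
    show "AE y in hausdorff1. (\<lambda>i. KK i y * (j y \<bullet> \<nu>)) \<longlonglongrightarrow> K y * (j y \<bullet> \<nu>)"
      using j(2)
    proof eventually_elim
      case (elim y)
      then show ?case using limJ[of y] KJ[of y] by (cases "j y = 0") (auto intro!: tendsto_mult_right)
    qed
  qed
  have L3: "(\<lambda>i. \<integral>x. \<phi> x * \<psi> (w i x) \<partial>lborel) \<longlonglongrightarrow> (\<integral>x. K x \<partial>lebesgue)"
  proof -
    have "(\<lambda>i. \<integral>x. \<phi> x * \<psi> (w i x) \<partial>lebesgue) \<longlonglongrightarrow> (\<integral>x. K x \<partial>lebesgue)"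
    proof (rule integral_dominated_convergence[where w="\<lambda>x. B * indicator A x"])
      show "K \<in> borel_measurable lebesgue" "\<And>i. (\<lambda>x. \<phi> x * \<psi> (w i x)) \<in> borel_measurable lebesgue"
        by (auto intro!: measurable_completion)
      have "emeasure lebesgue A < \<infinity>" using emeasure_compact_finite[OF A(1)] by (simp add: less_top)
      then show "integrable lebesgue (\<lambda>x. B * indicator A x :: real)"
        by (intro integrable_mult_right integrable_real_indicator) auto
      show "AE x in lebesgue. norm (\<phi> x * \<psi> (w i x)) \<le> B * indicator A x" for i
      proof (rule AE_I2)
        fix x show "norm (\<phi> x * \<psi> (w i x)) \<le> B * indicator A x"
          using \<phi>\<psi>[of x "w i x"] A(3)[of x] by (cases "x \<in> A") auto
      qed
      show "AE x in lebesgue. (\<lambda>i. \<phi> x * \<psi> (w i x)) \<longlonglongrightarrow> K x"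
        using AES
      proof eventually_elim
        case (elim x)
        show ?case
        proof (cases "x \<in> \<Omega>")
          case True
          have "(\<lambda>i. w i x) \<longlonglongrightarrow> a x - (c \<bullet> x + d)" using wa[of x 0] True elim by simp
          then have "(\<lambda>i. \<psi> (w i x)) \<longlonglongrightarrow> \<psi> (a x - (c \<bullet> x + d))"
            by (intro continuous_on_tendsto_compose[OF \<psi>(1)]) auto
          then show ?thesis using Ka[of x] True elim by (auto intro!: tendsto_mult_left)
        next
          case False
          then show ?thesis using A(2,3) K0 by (auto simp: subset_eq)
        qed
      qed
    qed
    moreover have "(\<integral>x. \<phi> x * \<psi> (w i x) \<partial>lebesgue) = (\<integral>x. \<phi> x * \<psi> (w i x) \<partial>lborel)" for i
      by (rule integral_completion) measurable
    ultimately show ?thesis by simp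
  qed
  \<comment> \<open>Convergence in the mean suffices here: \<open>\<Psi>\<close> does not increase
    distances, and the mollifications converge to \<open>V\<close> in the mean.\<close>
  have L0: "(\<lambda>i. \<integral>x. (g x \<bullet> \<nu>) * \<Psi> (w i x) \<partial>lborel) \<longlonglongrightarrow> (\<integral>x. (g x \<bullet> \<nu>) * \<Psi> (V x - (c \<bullet> x + d)) \<partial>lborel)"
  proof (rule LIMSEQ_I)
    fix e :: real assume "0 < e"
    define C where "C = B * norm \<nu> + 1"
    have C: "0 < C" using B(1) by (simp add: C_def add_nonneg_pos)
    have gn: "\<bar>g x \<bullet> \<nu>\<bar> \<le> C" for x
    proof -
      have "\<bar>g x \<bullet> \<nu>\<bar> \<le> norm (g x) * norm \<nu>" by (rule Cauchy_Schwarz_ineq2)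
      also have "\<dots> \<le> B * norm \<nu>" by (intro mult_right_mono B) auto
      finally show ?thesis by (simp add: C_def)
    qed
    have iA: "integrable lborel (\<lambda>x. C * M * indicator A x :: real)"
      using emeasure_compact_finite[OF A(1)] by (intro integrable_mult_right integrable_real_indicator) (auto simp: less_top)
    have ig: "integrable lborel (\<lambda>x. (g x \<bullet> \<nu>) * \<Psi> (h x))" if [measurable]: "h \<in> borel_measurable borel" for h
    proof (rule Bochner_Integration.integrable_bound[OF iA])
      show "AE x in lborel. norm ((g x \<bullet> \<nu>) * \<Psi> (h x)) \<le> norm (C * M * indicator A x)"
      proof (rule AE_I2)
        fix x
        have "\<bar>g x \<bullet> \<nu>\<bar> * \<bar>\<Psi> (h x)\<bar> \<le> C * M" using C by (intro mult_mono gn \<Psi>) auto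
        also have "\<dots> \<le> \<bar>C\<bar> * \<bar>M\<bar>" unfolding abs_mult[symmetric] by (rule abs_ge_self)
        finally have "\<bar>g x \<bullet> \<nu>\<bar> * \<bar>\<Psi> (h x)\<bar> \<le> \<bar>C\<bar> * \<bar>M\<bar>" .
        then show "norm ((g x \<bullet> \<nu>) * \<Psi> (h x)) \<le> norm (C * M * indicator A x)"
          using A(4)[of x] by (cases "x \<in> A") (auto simp: abs_mult)
      qed
    qed measurable
    have eC: "0 < e / (2 * C)" using \<open>0 < e\<close> C by simp
    obtain d' where d': "0 < d'" "\<And>\<epsilon>. 0 < \<epsilon> \<Longrightarrow> \<epsilon> < d' \<Longrightarrow> (\<integral>\<^sup>+x. ennreal \<bar>conv \<epsilon> V x - V x\<bar> \<partial>lborel) \<le> ennreal (e / (2 * C))"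
      by (rule conv_L1_convergence[OF V eC]) blast
    obtain N where N: "\<And>i. N \<le> i \<Longrightarrow> \<epsilon> i < d'"
      using order_tendstoD(2)[OF \<epsilon>0 d'(1)] by (auto simp: eventually_sequentially)
    show "\<exists>no. \<forall>i\<ge>no. norm ((\<integral>x. (g x \<bullet> \<nu>) * \<Psi> (w i x) \<partial>lborel) - (\<integral>x. (g x \<bullet> \<nu>) * \<Psi> (V x - (c \<bullet> x + d)) \<partial>lborel)) < e"
    proof (intro exI allI impI)
      fix i assume "N \<le> i"
      have m1: "(\<lambda>x. V x - (c \<bullet> x + d)) \<in> borel_measurable borel" by measurable
      have [measurable]: "conv (\<epsilon> i) V \<in> borel_measurable borel"
        by (intro borel_measurable_continuous_onI continuous_on_conv V \<epsilon>)
      let ?D = "\<lambda>x. (g x \<bullet> \<nu>) * \<Psi> (w i x) - (g x \<bullet> \<nu>) * \<Psi> (V x - (c \<bullet> x + d))"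
      have "ennreal (norm (\<integral>x. ?D x \<partial>lborel)) \<le> (\<integral>\<^sup>+x. ennreal (norm (?D x)) \<partial>lborel)"
        by (intro integral_norm_bound_ennreal Bochner_Integration.integrable_diff ig m1) measurable
      also have "\<dots> \<le> (\<integral>\<^sup>+x. ennreal C * ennreal \<bar>conv (\<epsilon> i) V x - V x\<bar> \<partial>lborel)"
      proof (rule nn_integral_mono)
        fix x
        have "norm (?D x) = \<bar>g x \<bullet> \<nu>\<bar> * \<bar>\<Psi> (w i x) - \<Psi> (V x - (c \<bullet> x + d))\<bar>"
          by (simp add: right_diff_distrib[symmetric] abs_mult)
        also have "\<dots> \<le> C * \<bar>w i x - (V x - (c \<bullet> x + d))\<bar>"
          using C by (intro mult_mono gn \<Psi>l) auto
        also have "\<dots> = C * \<bar>conv (\<epsilon> i) V x - V x\<bar>" by (simp add: w_def)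
        finally show "ennreal (norm (?D x)) \<le> ennreal C * ennreal \<bar>conv (\<epsilon> i) V x - V x\<bar>"
          using C by (simp add: ennreal_mult[symmetric] ennreal_leI)
      qed
      also have "\<dots> = ennreal C * (\<integral>\<^sup>+x. ennreal \<bar>conv (\<epsilon> i) V x - V x\<bar> \<partial>lborel)"
        by (rule nn_integral_cmult) measurable
      also have "\<dots> \<le> ennreal C * ennreal (e / (2 * C))"
        by (intro mult_left_mono d' \<epsilon> N \<open>N \<le> i\<close>) auto
      also have "\<dots> = ennreal (e / 2)" using C \<open>0 < e\<close> by (simp add: ennreal_mult[symmetric])
      finally have "norm (\<integral>x. ?D x \<partial>lborel) \<le> e / 2" using \<open>0 < e\<close> by simp
      moreover have "(\<integral>x. ?D x \<partial>lborel) = (\<integral>x. (g x \<bullet> \<nu>) * \<Psi> (w i x) \<partial>lborel) - (\<integral>x. (g x \<bullet> \<nu>) * \<Psi> (V x - (c \<bullet> x + d)) \<partial>lborel)"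
        by (rule Bochner_Integration.integral_diff) (auto intro!: ig m1)
      ultimately show "norm ((\<integral>x. (g x \<bullet> \<nu>) * \<Psi> (w i x) \<partial>lborel) - (\<integral>x. (g x \<bullet> \<nu>) * \<Psi> (V x - (c \<bullet> x + d)) \<partial>lborel)) < e"
        using \<open>0 < e\<close> by simp
    qed
  qed
  show ?thesis
  proof (rule that[OF Km Kb K0 Ka])
    show "(vp x - vm x) * K x = \<phi> x * (\<Psi> (vp x - (c \<bullet> x + d)) - \<Psi> (vm x - (c \<bullet> x + d)))" if "x \<in> J" for x
      using kern_jump_profile[OF conjunct1[OF J(2)[OF that]] \<Psi>(1) \<psi>(1), of "vp x" "vm x" "c \<bullet> x + d"] KJ[OF that]
      by (simp add: step_def mult.left_commute)
    have "(\<lambda>i. - (\<integral>x. (g x \<bullet> \<nu>) * \<Psi> (w i x) \<partial>lborel)) \<longlonglongrightarrow>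
        (\<integral>x. K x * (G x \<bullet> \<nu>) \<partial>lebesgue) + (\<integral>x. K x * (j x \<bullet> \<nu>) \<partial>hausdorff1) - (c \<bullet> \<nu>) * (\<integral>x. K x \<partial>lebesgue)"
      unfolding ident split by (intro tendsto_diff tendsto_add tendsto_mult_left L1 L2 L3)
    with tendsto_minus[OF L0] show "- (\<integral>x. (g x \<bullet> \<nu>) * \<Psi> (V x - (c \<bullet> x + d)) \<partial>lborel)
      = (\<integral>x. K x * (G x \<bullet> \<nu>) \<partial>lebesgue) + (\<integral>x. K x * (j x \<bullet> \<nu>) \<partial>hausdorff1) - (c \<bullet> \<nu>) * (\<integral>x. K x \<partial>lebesgue)"
      by (rule LIMSEQ_unique)
  qed
qed

section \<open>The divergence theorem on a cone\<close>

definition cross2 :: "plane \<Rightarrow> plane \<Rightarrow> real" where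
  "cross2 p q = p $ 1 * q $ 2 - p $ 2 * q $ 1"

definition perp :: "plane \<Rightarrow> plane" where
  "perp p = vector [- p $ 2, p $ 1]"

text \<open>For \<open>0 < cross2 p q\<close> this is the open sector swept counterclockwise from
  \<open>p\<close> to \<open>q\<close>; sign conditions describe it without angles.\<close>

definition cone2 :: "plane \<Rightarrow> plane \<Rightarrow> plane set" where
  "cone2 p q = {x. 0 < cross2 x q \<and> 0 < cross2 p x}"

lemma perp_inner: "perp p \<bullet> q = cross2 p q"
  by (simp add: perp_def cross2_def inner_vec_def sum_2)

lemma perp_simps [simp]: "perp p $ 1 = - p $ 2" "perp p $ 2 = p $ 1"
  by (simp_all add: perp_def)

lemma norm_perp [simp]: "norm (perp p) = norm p"
  by (simp add: norm_vec_def L2_set_def sum_2 add.commute)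

lemma continuous_on_cross2 [continuous_intros]:
  "continuous_on S f \<Longrightarrow> continuous_on S g \<Longrightarrow> continuous_on S (\<lambda>x. cross2 (f x) (g x))"
  unfolding cross2_def by (intro continuous_intros)

lemma open_cone2: "open (cone2 p q)"
  unfolding cone2_def by (intro open_Collect_conj open_Collect_less continuous_intros)

lemma cone2_borel [measurable]: "cone2 p q \<in> sets borel"
  using open_cone2 by simp

text \<open>Cramer's rule for the coordinates of \<open>x\<close> along \<open>p\<close> and
  \<open>q\<close>, multiplied out by the determinant.\<close>

lemma cross2_eq: "cross2 p q *\<^sub>R x = cross2 x q *\<^sub>R p + cross2 p x *\<^sub>R q"
  by (simp add: vec_eq_iff forall_2 cross2_def algebra_simps)

lemma Basis_plane: "(Basis :: plane set) = {axis 1 1, axis 2 1}"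
  by (auto simp: Basis_vec_def) (metis exhaust_2)+

text \<open>Both measures give a box the product of its side lengths. This makes Fubini's theorem on
  the product available for the plane.\<close>

lemma lborel_plane: "(lborel :: plane measure) = distr (lborel \<Otimes>\<^sub>M lborel) borel (\<lambda>(s, t). vector [s, t])"
proof (rule lborel_eqI)
  have m: "(\<lambda>(s, t). vector [s, t] :: plane) \<in> (lborel \<Otimes>\<^sub>M lborel) \<rightarrow>\<^sub>M borel"
  proof -
    have "(\<lambda>p. vector [fst p, snd p] :: plane) = (\<lambda>p. fst p *\<^sub>R axis 1 1 + snd p *\<^sub>R axis 2 1)"
      by (simp add: fun_eq_iff vec_eq_iff forall_2 axis_def)
    then show ?thesis unfolding split_def by simp
  qed
  fix l u :: plane assume lu: "\<And>b. b \<in> Basis \<Longrightarrow> l \<bullet> b \<le> u \<bullet> b"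
  have le: "l $ 1 \<le> u $ 1" "l $ 2 \<le> u $ 2"
    using lu[of "axis 1 1"] lu[of "axis 2 1"] by (auto simp: Basis_plane inner_axis)
  have "(\<lambda>(s, t). vector [s, t] :: plane) -` box l u = {l $ 1<..<u $ 1} \<times> {l $ 2<..<u $ 2}"
    by (auto simp: mem_box_cart forall_2)
  then have "emeasure (distr (lborel \<Otimes>\<^sub>M lborel) borel (\<lambda>(s, t). vector [s, t])) (box l u)
      = emeasure (lborel \<Otimes>\<^sub>M lborel) ({l $ 1<..<u $ 1} \<times> {l $ 2<..<u $ 2})"
    by (subst emeasure_distr[OF m]) (auto simp: space_pair_measure)
  also have "\<dots> = ennreal (u $ 1 - l $ 1) * ennreal (u $ 2 - l $ 2)"
    using le by (subst lborel.emeasure_pair_measure_Times) auto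
  also have "\<dots> = (\<Prod>b\<in>Basis. (u - l) \<bullet> b)"
    using le by (simp add: Basis_plane axis_eq_axis inner_axis ennreal_mult)
  finally show "emeasure (distr (lborel \<Otimes>\<^sub>M lborel) borel (\<lambda>(s, t). vector [s, t])) (box l u) = (\<Prod>b\<in>Basis. (u - l) \<bullet> b)" .
qed simp

lemma vector_measurable [measurable]: "(\<lambda>(s, t). vector [s, t] :: plane) \<in> (lborel \<Otimes>\<^sub>M lborel) \<rightarrow>\<^sub>M borel"
proof -
  have "(\<lambda>p. vector [fst p, snd p] :: plane) = (\<lambda>p. fst p *\<^sub>R axis 1 1 + snd p *\<^sub>R axis 2 1)"
    by (simp add: fun_eq_iff vec_eq_iff forall_2 axis_def)
  then show ?thesis unfolding split_def by simp
qed

text \<open>The fundamental theorem of calculus on a segment long enough to leave the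
  support.\<close>

lemma integral_half_line:
  fixes p :: plane
  assumes tf: "test_function \<Omega> \<phi> g" and p: "p \<noteq> 0"
  shows "(\<integral>s. indicator {0<..} s * (g (x + s *\<^sub>R p) \<bullet> p) \<partial>lborel) = - \<phi> x"
proof -
  obtain A where A: "compact A" "\<And>x. x \<notin> A \<Longrightarrow> \<phi> x = 0" "\<And>x. x \<notin> A \<Longrightarrow> g x = 0"
    using test_function_bounds[OF tf] by metis
  have gc: "continuous_on UNIV g" and gd: "\<And>x. (\<phi> has_derivative (\<lambda>h. h \<bullet> g x)) (at x)"
    using tf by (auto simp: test_function_def gderiv_def)
  obtain R where R: "\<And>x. x \<in> A \<Longrightarrow> norm x \<le> R" using compact_imp_bounded[OF A(1)] by (auto simp: bounded_iff)
  define b where "b = (\<bar>R\<bar> + norm x + 1) / norm p"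
  have b: "0 \<le> b" using p by (simp add: b_def)
  have out: "x + s *\<^sub>R p \<notin> A" if "b \<le> s" for s
  proof
    assume "x + s *\<^sub>R p \<in> A"
    then have "norm (x + s *\<^sub>R p) \<le> R" by (rule R)
    moreover have "norm (s *\<^sub>R p) \<le> norm (x + s *\<^sub>R p) + norm x"
      using norm_triangle_ineq4[of "x + s *\<^sub>R p" x] by simp
    moreover have "norm (s *\<^sub>R p) = s * norm p" using that b by simp
    moreover have "\<bar>R\<bar> + norm x + 1 \<le> s * norm p" using that p by (simp add: b_def divide_le_eq)
    ultimately show False by linarith
  qed
  have d: "((\<lambda>s. \<phi> (x + s *\<^sub>R p)) has_real_derivative (g (x + s *\<^sub>R p) \<bullet> p)) (at s)" for s
  proof -
    have "((\<lambda>t. \<phi> (x + t *\<^sub>R p)) has_derivative (\<lambda>t. (t *\<^sub>R p) \<bullet> g (x + s *\<^sub>R p))) (at s)"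
      by (rule has_derivative_compose[where f="\<lambda>t. x + t *\<^sub>R p" and f'="\<lambda>t. t *\<^sub>R p" and x=s and g=\<phi>])
        (use gd[of "x + s *\<^sub>R p"] in \<open>auto intro!: derivative_eq_intros\<close>)
    then show ?thesis by (simp add: has_field_derivative_def mult_commute_abs inner_commute)
  qed
  have c: "continuous_on UNIV (\<lambda>s. g (x + s *\<^sub>R p) \<bullet> p)"
    by (intro continuous_intros continuous_on_compose2[OF gc]) auto
  then have cm: "(\<lambda>s. g (x + s *\<^sub>R p) \<bullet> p) \<in> borel_measurable borel" by (rule borel_measurable_continuous_onI)
  have "(\<integral>s. indicator {0<..} s * (g (x + s *\<^sub>R p) \<bullet> p) \<partial>lborel)
      = (\<integral>s. (g (x + s *\<^sub>R p) \<bullet> p) * indicator {0..b} s \<partial>lborel)"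
  proof (rule integral_cong_AE)
    show "AE s in lborel. indicator {0<..} s * (g (x + s *\<^sub>R p) \<bullet> p) = (g (x + s *\<^sub>R p) \<bullet> p) * indicator {0..b} s"
      using AE_lborel_singleton[of 0]
    proof eventually_elim
      case (elim s)
      show ?case using out[of s] A(3)[of "x + s *\<^sub>R p"] elim by (cases "s \<le> b") (auto simp: indicator_def)
    qed
  qed (use cm in auto)
  also have "\<dots> = \<phi> (x + b *\<^sub>R p) - \<phi> (x + 0 *\<^sub>R p)"
    by (rule integral_FTC_Icc_real[OF b d]) (use c in \<open>simp add: continuous_on_eq_continuous_at\<close>)
  finally show ?thesis using A(2)[OF out[of b]] by simp
qed

text \<open>The linear map that sends the positive quadrant onto the cone has determinant
  \<open>cross2 p q\<close>, so an integral over the cone becomes a double integral in the oblique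
  coordinates \<open>s\<close> and \<open>t\<close>.\<close>

lemma cone_integral:
  fixes f :: "plane \<Rightarrow> plane"
  assumes f: "integrable lborel f" and D: "0 < cross2 p q"
  shows integrable_cone: "integrable (lborel \<Otimes>\<^sub>M lborel) (\<lambda>(s, t). (indicator {0<..} s * indicator {0<..} t) *\<^sub>R f (s *\<^sub>R p + t *\<^sub>R q))"
    and integral_cone: "(\<integral>x. indicator (cone2 p q) x *\<^sub>R f x \<partial>lborel)
      = cross2 p q *\<^sub>R (\<integral>z. (case z of (s, t) \<Rightarrow> (indicator {0<..} s * indicator {0<..} t) *\<^sub>R f (s *\<^sub>R p + t *\<^sub>R q)) \<partial>(lborel \<Otimes>\<^sub>M lborel))"
proof -
  have fm[measurable]: "f \<in> borel_measurable borel" using f by auto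
  define L where "L y = y $ 1 *\<^sub>R p + y $ 2 *\<^sub>R q" for y :: plane
  have L: "linear L" unfolding L_def by (auto intro!: linearI simp: algebra_simps)
  have Lm[measurable]: "L \<in> borel_measurable borel"
    by (intro borel_measurable_continuous_onI linear_continuous_on linear_conv_bounded_linear[THEN iffD1] L)
  have det: "det (matrix L) = cross2 p q"
    by (simp add: det_2 matrix_def L_def axis_def cross2_def)
  define Q where "Q = {y :: plane. 0 < y $ 1 \<and> 0 < y $ 2}"
  have Qo: "open Q" unfolding Q_def by (intro open_Collect_conj open_Collect_less continuous_intros)
  have [measurable]: "Q \<in> sets borel" using Qo by simp
  have LQ: "L ` Q = cone2 p q"
  proof (intro set_eqI iffI)
    fix x assume "x \<in> L ` Q"
    then obtain y where y: "0 < y $ 1" "0 < y $ 2" "x = L y" by (auto simp: Q_def)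
    have "cross2 x q = y $ 1 * cross2 p q" "cross2 p x = y $ 2 * cross2 p q"
      by (simp_all add: y L_def cross2_def algebra_simps)
    then show "x \<in> cone2 p q" using y D by (simp add: cone2_def)
  next
    fix x assume x: "x \<in> cone2 p q"
    let ?y = "vector [cross2 x q / cross2 p q, cross2 p x / cross2 p q] :: plane"
    have "cross2 p q *\<^sub>R L ?y = cross2 p q *\<^sub>R x"
      unfolding cross2_eq[of p q x] using D by (simp add: L_def scaleR_add_right)
    then have "L ?y = x" using D by simp
    moreover have "?y \<in> Q" using x D by (simp add: Q_def cone2_def)
    ultimately show "x \<in> L ` Q" by (metis image_eqI)
  qed
  have fl: "integrable lebesgue f" using f by (simp add: integrable_completion)
  have fa: "f absolutely_integrable_on (L ` Q)"
    unfolding LQ set_integrable_def using integrable_mult_bounded[OF fl, of "indicator (cone2 p q)" 1]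
    by (simp add: indicator_def measurable_completion)
  then have fLa: "(f \<circ> L) absolutely_integrable_on Q"
    using absolutely_integrable_on_linear_image[OF L, where f=f and S=Q] det D by simp
  have "(\<integral>x. indicator (cone2 p q) x *\<^sub>R f x \<partial>lborel) = (\<integral>x. indicator (cone2 p q) x *\<^sub>R f x \<partial>lebesgue)"
    by (rule integral_completion[symmetric]) measurable
  also have "\<dots> = integral (L ` Q) f"
    using set_lebesgue_integral_eq_integral(2)[OF fa] by (simp add: LQ set_lebesgue_integral_def)
  also have "\<dots> = cross2 p q *\<^sub>R integral Q (f \<circ> L)"
    using integral_change_of_variables_linear[OF L disjI1[OF fa]] D by (simp add: det)
  also have "integral Q (f \<circ> L) = (\<integral>y. indicator Q y *\<^sub>R f (L y) \<partial>lebesgue)"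
    using set_lebesgue_integral_eq_integral(2)[OF fLa] by (simp add: set_lebesgue_integral_def)
  also have "\<dots> = (\<integral>y. indicator Q y *\<^sub>R f (L y) \<partial>lborel)"
    by (rule integral_completion) measurable
  also have "\<dots> = (\<integral>z. (case z of (s, t) \<Rightarrow> (indicator {0<..} s * indicator {0<..} t) *\<^sub>R f (s *\<^sub>R p + t *\<^sub>R q)) \<partial>(lborel \<Otimes>\<^sub>M lborel))"
    by (subst lborel_plane, subst integral_distr[OF vector_measurable])
      (auto intro!: Bochner_Integration.integral_cong simp: Q_def L_def indicator_def)
  finally show "(\<integral>x. indicator (cone2 p q) x *\<^sub>R f x \<partial>lborel)
      = cross2 p q *\<^sub>R (\<integral>z. (case z of (s, t) \<Rightarrow> (indicator {0<..} s * indicator {0<..} t) *\<^sub>R f (s *\<^sub>R p + t *\<^sub>R q)) \<partial>(lborel \<Otimes>\<^sub>M lborel))" .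
  have "integrable lborel (\<lambda>y. indicator Q y *\<^sub>R f (L y))"
    using fLa by (simp add: set_integrable_def integrable_completion)
  then have "integrable (lborel \<Otimes>\<^sub>M lborel) (\<lambda>z. indicator Q (case z of (s, t) \<Rightarrow> vector [s, t]) *\<^sub>R f (L (case z of (s, t) \<Rightarrow> vector [s, t])))"
    by (subst (asm) lborel_plane, subst (asm) integrable_distr_eq[OF vector_measurable]) auto
  also have "(\<lambda>z. indicator Q (case z of (s, t) \<Rightarrow> vector [s, t]) *\<^sub>R f (L (case z of (s, t) \<Rightarrow> vector [s, t])))
      = (\<lambda>(s, t). (indicator {0<..} s * indicator {0<..} t) *\<^sub>R f (s *\<^sub>R p + t *\<^sub>R q))"
    by (auto simp: Q_def L_def indicator_def fun_eq_iff)
  finally show "integrable (lborel \<Otimes>\<^sub>M lborel) (\<lambda>(s, t). (indicator {0<..} s * indicator {0<..} t) *\<^sub>R f (s *\<^sub>R p + t *\<^sub>R q))" .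
qed

lemma integrable_test_function:
  assumes tf: "test_function \<Omega> \<phi> g"
  shows "integrable lborel \<phi>" "integrable lborel g"
proof -
  obtain A where A: "compact A" "\<And>x. x \<notin> A \<Longrightarrow> \<phi> x = 0" "\<And>x. x \<notin> A \<Longrightarrow> g x = 0" and \<phi>c: "continuous_on UNIV \<phi>"
    using test_function_bounds[OF tf] by metis
  have gc: "continuous_on UNIV g" using tf by (auto simp: test_function_def)
  have "integrable lborel (\<lambda>x. indicator A x *\<^sub>R \<phi> x)" "integrable lborel (\<lambda>x. indicator A x *\<^sub>R g x)"
    by (intro borel_integrable_compact A continuous_on_subset[OF \<phi>c] continuous_on_subset[OF gc] subset_UNIV)+
  moreover have "(\<lambda>x. indicator A x *\<^sub>R \<phi> x) = \<phi>" "(\<lambda>x. indicator A x *\<^sub>R g x) = g"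
    using A by (auto simp: fun_eq_iff indicator_def)
  ultimately show "integrable lborel \<phi>" "integrable lborel g" by simp_all
qed

definition ray_integral :: "(plane \<Rightarrow> real) \<Rightarrow> plane \<Rightarrow> real" where
  "ray_integral \<phi> p = (\<integral>t. indicator {0<..} t * \<phi> (t *\<^sub>R p) \<partial>lborel)"

text \<open>In oblique coordinates the component of the gradient along \<open>p\<close> integrates
  out on each half line parallel to \<open>p\<close> and leaves an integral of \<open>\<phi>\<close>
  over the edge spanned by \<open>q\<close>; the same holds with \<open>p\<close> and
  \<open>q\<close> exchanged. The two components determine the vector.\<close>

lemma cone_gradient:
  assumes tf: "test_function \<Omega> \<phi> g" and D: "0 < cross2 p q"
  shows "(\<integral>x. indicator (cone2 p q) x *\<^sub>R g x \<partial>lborel) = ray_integral \<phi> q *\<^sub>R perp q - ray_integral \<phi> p *\<^sub>R perp p"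
proof -
  have p: "p \<noteq> 0" "q \<noteq> 0" using D by (auto simp: cross2_def)
  note gi = integrable_test_function(2)[OF tf]
  let ?F = "\<lambda>s t. (indicator {0<..} s * indicator {0<..} t) *\<^sub>R g (s *\<^sub>R p + t *\<^sub>R q)"
  let ?V = "\<integral>x. indicator (cone2 p q) x *\<^sub>R g x \<partial>lborel"
  have F: "integrable (lborel \<Otimes>\<^sub>M lborel) (\<lambda>(s, t). ?F s t)" by (rule integrable_cone[OF gi D])
  define X where "X = (\<integral>z. (case z of (s, t) \<Rightarrow> ?F s t) \<partial>(lborel \<Otimes>\<^sub>M lborel))"
  have V: "?V = cross2 p q *\<^sub>R X" unfolding X_def by (rule integral_cone[OF gi D])
  have Fi: "integrable (lborel \<Otimes>\<^sub>M lborel) (\<lambda>(s, t). ?F s t \<bullet> v)" for v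
    using integrable_inner_left[OF F, of v] by (simp add: split_def)
  have inn: "X \<bullet> v = (\<integral>z. (case z of (s, t) \<Rightarrow> ?F s t \<bullet> v) \<partial>(lborel \<Otimes>\<^sub>M lborel))" for v
    unfolding X_def using integral_inner_left[OF F, of v] by (simp add: split_def)
  have "?V \<bullet> p = cross2 p q * (X \<bullet> p)" by (simp add: V)
  also have "X \<bullet> p = (\<integral>t. (\<integral>s. ?F s t \<bullet> p \<partial>lborel) \<partial>lborel)"
    using inn[of p] lborel_pair.integral_snd[OF Fi[of p]] by (rule trans[OF _ sym])
  also have "(\<lambda>t. \<integral>s. ?F s t \<bullet> p \<partial>lborel) = (\<lambda>t. - (indicator {0<..} t * \<phi> (t *\<^sub>R q)))"
  proof
    fix t
    have "(\<integral>s. ?F s t \<bullet> p \<partial>lborel) = (\<integral>s. indicator {0<..} t * (indicator {0<..} s * (g (t *\<^sub>R q + s *\<^sub>R p) \<bullet> p)) \<partial>lborel)"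
      by (intro Bochner_Integration.integral_cong) (auto simp: ac_simps)
    also have "\<dots> = indicator {0<..} t * (- \<phi> (t *\<^sub>R q))"
      by (simp only: integral_mult_right_zero integral_half_line[OF tf p(1)])
    finally show "(\<integral>s. ?F s t \<bullet> p \<partial>lborel) = - (indicator {0<..} t * \<phi> (t *\<^sub>R q))" by simp
  qed
  finally have Vp: "?V \<bullet> p = - cross2 p q * ray_integral \<phi> q"
    by (simp add: ray_integral_def)
  have "?V \<bullet> q = cross2 p q * (X \<bullet> q)" by (simp add: V)
  also have "X \<bullet> q = (\<integral>s. (\<integral>t. ?F s t \<bullet> q \<partial>lborel) \<partial>lborel)"
    using inn[of q] lborel_pair.integral_fst[OF Fi[of q]] by (rule trans[OF _ sym])
  also have "(\<lambda>s. \<integral>t. ?F s t \<bullet> q \<partial>lborel) = (\<lambda>s. - (indicator {0<..} s * \<phi> (s *\<^sub>R p)))"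
  proof
    fix s
    have "(\<integral>t. ?F s t \<bullet> q \<partial>lborel) = (\<integral>t. indicator {0<..} s * (indicator {0<..} t * (g (s *\<^sub>R p + t *\<^sub>R q) \<bullet> q)) \<partial>lborel)"
      by (intro Bochner_Integration.integral_cong) (auto simp: ac_simps)
    also have "\<dots> = indicator {0<..} s * (- \<phi> (s *\<^sub>R p))"
      by (simp only: integral_mult_right_zero integral_half_line[OF tf p(2)])
    finally show "(\<integral>t. ?F s t \<bullet> q \<partial>lborel) = - (indicator {0<..} s * \<phi> (s *\<^sub>R p))" by simp
  qed
  finally have Vq: "?V \<bullet> q = - cross2 p q * ray_integral \<phi> p"
    by (simp add: ray_integral_def)
  let ?W = "ray_integral \<phi> q *\<^sub>R perp q - ray_integral \<phi> p *\<^sub>R perp p"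
  have c: "cross2 q p = - cross2 p q" "cross2 p p = 0" "cross2 q q = 0" by (simp_all add: cross2_def)
  have "(?V - ?W) \<bullet> p = 0" "(?V - ?W) \<bullet> q = 0"
    by (simp_all add: inner_diff_left Vp Vq perp_inner c)
  \<comment> \<open>A vector orthogonal to both \<open>p\<close> and \<open>q\<close> is orthogonal
    to its own expansion in these two vectors.\<close>
  then have "(?V - ?W) \<bullet> (cross2 p q *\<^sub>R (?V - ?W)) = 0"
    by (subst cross2_eq) (simp only: inner_add_right inner_scaleR_right mult_zero_right add_0)
  then have "?V - ?W = 0" using D by simp
  then show ?thesis by simp
qed

section \<open>Cutoff functions\<close>

text \<open>A quadratic spline with knots 0, 1/2 and 1: it rises from 0 to 1, and its continuous
  derivative \<open>smooth_step'\<close> is a tent of height 2.\<close>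

definition smooth_step :: "real \<Rightarrow> real" where
  "smooth_step t = 2 * (pos_sq t - 2 * pos_sq (t - 1/2) + pos_sq (t - 1))"

definition smooth_step' :: "real \<Rightarrow> real" where
  "smooth_step' t = 4 * (max 0 t - 2 * max 0 (t - 1/2) + max 0 (t - 1))"

lemma smooth_step_eq:
  "t \<le> 0 \<Longrightarrow> smooth_step t = 0"
  "0 \<le> t \<Longrightarrow> t \<le> 1/2 \<Longrightarrow> smooth_step t = 2 * t\<^sup>2"
  "1/2 \<le> t \<Longrightarrow> t \<le> 1 \<Longrightarrow> smooth_step t = 1 - 2 * (1 - t)\<^sup>2"
  "1 \<le> t \<Longrightarrow> smooth_step t = 1"
  by (simp_all add: smooth_step_def pos_sq_eq power2_eq_square algebra_simps)

lemma smooth_step_bounds: "0 \<le> smooth_step t" "smooth_step t \<le> 1"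
proof -
  consider "t \<le> 0" | "0 \<le> t" "t \<le> 1/2" | "1/2 \<le> t" "t \<le> 1" | "1 \<le> t" by linarith
  then have "0 \<le> smooth_step t \<and> smooth_step t \<le> 1"
  proof cases
    case 2
    have "t\<^sup>2 \<le> (1/2)\<^sup>2" using 2 by (intro power_mono) auto
    then show ?thesis using 2 by (simp add: smooth_step_eq power2_eq_square)
  next
    case 3
    have "(1 - t)\<^sup>2 \<le> (1/2)\<^sup>2" using 3 by (intro power_mono) auto
    then show ?thesis using 3 by (simp add: smooth_step_eq power2_eq_square)
  qed (simp_all add: smooth_step_eq)
  then show "0 \<le> smooth_step t" "smooth_step t \<le> 1" by auto
qed

lemma smooth_step'_bound: "\<bar>smooth_step' t\<bar> \<le> 2"
  by (auto simp: smooth_step'_def max_def)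

lemma smooth_step'_eq_0: "t \<le> 0 \<or> 1 \<le> t \<Longrightarrow> smooth_step' t = 0"
  by (auto simp: smooth_step'_def max_def)

lemma DERIV_smooth_step: "(smooth_step has_real_derivative smooth_step' t) (at t)"
proof -
  have "((\<lambda>t. pos_sq (t - c)) has_real_derivative 2 * max 0 (t - c) * (1 - 0)) (at t)" for c
    by (rule DERIV_chain2[OF DERIV_pos_sq]) (intro DERIV_diff DERIV_ident DERIV_const)
  note d = this[of 0] this[of "1/2"] this[of 1]
  have "(smooth_step has_real_derivative 2 * (2 * max 0 (t - 0) * (1 - 0) - 2 * (2 * max 0 (t - 1/2) * (1 - 0)) + 2 * max 0 (t - 1) * (1 - 0))) (at t)"
    unfolding smooth_step_def
    by (intro DERIV_cmult DERIV_add DERIV_diff d(2,3)) (use d(1) in simp)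
  then show ?thesis by (rule DERIV_cong) (simp add: smooth_step'_def algebra_simps)
qed

lemma continuous_on_smooth_step' [continuous_intros]:
  "continuous_on S f \<Longrightarrow> continuous_on S (\<lambda>x. smooth_step' (f x))"
  unfolding smooth_step'_def by (intro continuous_intros)

text \<open>A function of \<open>x \<bullet> x\<close> stays differentiable at the origin, where the
  norm is not. The condition on \<open>m / k\<close> places the support inside the open
  disk.\<close>

lemma test_function_radial:
  assumes "0 < r" "0 < k" "m / k < r\<^sup>2"
  shows "test_function (ball 0 r) (\<lambda>x. smooth_step (m - k * (x \<bullet> x)))
    (\<lambda>x. (- 2 * k * smooth_step' (m - k * (x \<bullet> x))) *\<^sub>R x)"
  unfolding test_function_def
proof (intro conjI allI exI[of _ "{x. x \<bullet> x \<le> m / k}"] impI)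
  fix x :: plane
  have "GDERIV (\<lambda>x. m - k * (x \<bullet> x)) x :> 0 - (k *\<^sub>R (2 *\<^sub>R x) + (x \<bullet> x) *\<^sub>R 0)"
    by (intro GDERIV_diff GDERIV_mult GDERIV_const GDERIV_dot)
  from GDERIV_DERIV_compose[OF this DERIV_smooth_step]
  show "GDERIV (\<lambda>x. smooth_step (m - k * (x \<bullet> x))) x :> (- 2 * k * smooth_step' (m - k * (x \<bullet> x))) *\<^sub>R x"
    by (rule GDERIV_subst) simp
next
  show "continuous_on UNIV (\<lambda>x::plane. (- 2 * k * smooth_step' (m - k * (x \<bullet> x))) *\<^sub>R x)"
    by (intro continuous_intros)
next
  have "closed {x::plane. x \<bullet> x \<le> m / k}" by (intro closed_Collect_le continuous_intros)
  moreover have "{x::plane. x \<bullet> x \<le> m / k} \<subseteq> cball 0 r"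
  proof clarify
    fix x :: plane assume "x \<bullet> x \<le> m / k"
    then have "(norm x)\<^sup>2 \<le> r\<^sup>2" using assms(3) unfolding dot_square_norm by linarith
    then show "x \<in> cball 0 r" using power2_le_imp_le[of "norm x" r] assms(1) by simp
  qed
  ultimately show "compact {x::plane. x \<bullet> x \<le> m / k}"
    using bounded_subset[OF bounded_cball] by (simp add: compact_eq_bounded_closed) blast
next
  fix x :: plane assume "x \<notin> {x. x \<bullet> x \<le> m / k}"
  then have "m - k * (x \<bullet> x) \<le> 0" using assms by (simp add: divide_le_eq not_le divide_less_eq mult.commute)
  then show "smooth_step (m - k * (x \<bullet> x)) = 0" by (rule smooth_step_eq)
next
  show "{x::plane. x \<bullet> x \<le> m / k} \<subseteq> ball 0 r"
  proof clarify
    fix x :: plane assume "x \<bullet> x \<le> m / k"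
    then have "(norm x)\<^sup>2 < r\<^sup>2" using assms(3) unfolding dot_square_norm by linarith
    then show "x \<in> ball 0 r" using assms(1) power2_less_imp_less[of "norm x" r] by simp
  qed
qed

lemma test_function_mult:
  assumes tf: "test_function \<Omega> \<phi> g" and h: "\<And>x. GDERIV \<psi> x :> h x" "continuous_on UNIV h"
  shows "test_function \<Omega> (\<lambda>x. \<psi> x * \<phi> x) (\<lambda>x. \<psi> x *\<^sub>R g x + \<phi> x *\<^sub>R h x)"
proof -
  have "continuous_on UNIV \<psi>"
    using h(1) has_derivative_continuous unfolding gderiv_def by (blast intro: continuous_at_imp_continuous_on)
  moreover have "continuous_on UNIV \<phi>" using test_function_bounds[OF tf] by metis
  ultimately have "continuous_on UNIV (\<lambda>x. \<psi> x *\<^sub>R g x + \<phi> x *\<^sub>R h x)"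
    using tf h(2) by (auto simp: test_function_def intro!: continuous_intros)
  moreover obtain K where "compact K" "K \<subseteq> \<Omega>" "\<And>x. x \<notin> K \<Longrightarrow> \<phi> x = 0"
    using tf by (auto simp: test_function_def)
  ultimately show ?thesis
    using tf GDERIV_mult[OF h(1)] unfolding test_function_def by (metis mult_zero_right)
qed

lemma smooth_step_sequence_limit: "(\<lambda>n. smooth_step (real n * t)) \<longlonglongrightarrow> indicator {0<..} t"
proof (cases "0 < t")
  case True
  have "eventually (\<lambda>n. 1 \<le> real n * t) sequentially"
    using True by real_asymp
  then have "eventually (\<lambda>n. smooth_step (real n * t) = 1) sequentially"
    by eventually_elim (rule smooth_step_eq)
  then show ?thesis using True by (simp add: tendsto_eventually)
next
  case False
  then have "smooth_step (real n * t) = 0" for n by (intro smooth_step_eq) (simp add: mult_nonneg_nonpos)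
  then show ?thesis using False by simp
qed

section \<open>Uniqueness of the derivative measure\<close>

text \<open>Products of a radial cutoff with smooth steps in the coordinates are test functions and
  converge on the disk to indicators of boxes. Equality on boxes, which are stable under
  intersection and generate the Borel sets, propagates to all Borel sets.\<close>

lemma derivative_measure_unique_aux:
  assumes s: "integrable \<mu> s" "integrable \<mu>' s'"
    and sets[measurable_cong, simp]: "sets \<mu> = sets borel" "sets \<mu>' = sets borel"
    and zero: "\<And>x. x \<notin> ball 0 r \<Longrightarrow> s x = 0" "\<And>x. x \<notin> ball 0 r \<Longrightarrow> s' x = 0"
    and eq: "\<And>\<phi> g. test_function (ball 0 r) \<phi> g \<Longrightarrow> (\<integral>x. \<phi> x *\<^sub>R s x \<partial>\<mu>) = (\<integral>x. \<phi> x *\<^sub>R (s' x :: plane) \<partial>\<mu>')"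
    and r: "0 < r" and B: "B \<in> sets borel"
  shows "(LINT x:B|\<mu>. s x) = (LINT x:B|\<mu>'. s' x)"
proof -
  \<comment> \<open>This local \<open>F0\<close> is a sequence of radial cutoffs tending to 1 on the
    disk, not the functional.\<close>
  define F0 where "F0 n x = smooth_step ((real n * r\<^sup>2 - 1) - real n * (x \<bullet> x))" for n and x :: plane
  have F0l: "(\<lambda>n. F0 n x) \<longlonglongrightarrow> 1" if "x \<in> ball 0 r" for x
  proof -
    have "(norm x)\<^sup>2 < r\<^sup>2" using that by (intro power_strict_mono) auto
    then have t: "0 < r\<^sup>2 - x \<bullet> x" by (simp add: dot_square_norm)
    define t where "t = r\<^sup>2 - x \<bullet> x"
    have "0 < t" using \<open>0 < r\<^sup>2 - x \<bullet> x\<close> by (simp add: t_def)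
    then have "eventually (\<lambda>n. 2 \<le> real n * t) sequentially" by real_asymp
    then have "eventually (\<lambda>n. F0 n x = 1) sequentially"
      by eventually_elim (simp add: F0_def t_def smooth_step_eq algebra_simps)
    then show ?thesis by (simp add: tendsto_eventually)
  qed
  \<comment> \<open>The shift to \<open>Suc n\<close> keeps the factor of
    \<open>x \<bullet> x\<close> positive, as \<open>test_function_radial\<close> demands.\<close>
  have F0t: "\<exists>g. test_function (ball 0 r) (F0 (Suc n)) g" for n
    unfolding F0_def by (rule exI, rule test_function_radial) (use r in \<open>auto simp: field_simps\<close>)
  have lim: "(LINT x:C|\<mu>. s x) = (LINT x:C|\<mu>'. s' x)"
    if F: "\<And>n. \<exists>g. test_function (ball 0 r) (F n) g" "\<And>n x. \<bar>F n x\<bar> \<le> 1"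
      "\<And>x. x \<in> ball 0 r \<Longrightarrow> (\<lambda>n. F n x) \<longlonglongrightarrow> indicator C x" and C: "C \<in> sets borel" for F :: "nat \<Rightarrow> plane \<Rightarrow> real" and C
  proof -
    have Fm: "F n \<in> borel_measurable borel" for n
    proof -
      obtain g where "test_function (ball 0 r) (F n) g" using F(1) by blast
      then have "continuous_on UNIV (F n)" using test_function_bounds by metis
      then show ?thesis by (rule borel_measurable_continuous_onI)
    qed
    have l: "(\<lambda>n. \<integral>x. F n x *\<^sub>R t x \<partial>M) \<longlonglongrightarrow> (LINT x:C|M. t x)"
      if t: "integrable M t" "\<And>x. x \<notin> ball 0 r \<Longrightarrow> t x = 0" and [measurable_cong]: "sets M = sets borel" for M and t :: "plane \<Rightarrow> plane"
      unfolding set_lebesgue_integral_def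
    proof (rule integral_dominated_convergence[where w="\<lambda>x. norm (t x)"])
      have [measurable]: "t \<in> borel_measurable M" using t by auto
      have [measurable]: "F n \<in> borel_measurable M" for n using Fm by (simp cong: measurable_cong_sets add: that)
      have [measurable]: "C \<in> sets M" using C that by simp
      show "(\<lambda>x. indicator C x *\<^sub>R t x) \<in> borel_measurable M" "\<And>n. (\<lambda>x. F n x *\<^sub>R t x) \<in> borel_measurable M" by measurable
      show "integrable M (\<lambda>x. norm (t x))" using t by auto
      show "AE x in M. norm (F n x *\<^sub>R t x) \<le> norm (t x)" for n
        using F(2) by (intro AE_I2) (simp add: mult_left_le_one_le)
      show "AE x in M. (\<lambda>n. F n x *\<^sub>R t x) \<longlonglongrightarrow> indicator C x *\<^sub>R t x"
      proof (rule AE_I2)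
        fix x show "(\<lambda>n. F n x *\<^sub>R t x) \<longlonglongrightarrow> indicator C x *\<^sub>R t x"
          using F(3)[of x] t(2)[of x] by (cases "x \<in> ball 0 r") (auto intro!: tendsto_scaleR)
      qed
    qed
    have "(\<integral>x. F n x *\<^sub>R s x \<partial>\<mu>) = (\<integral>x. F n x *\<^sub>R s' x \<partial>\<mu>')" for n
      using F(1)[of n] eq by blast
    then show ?thesis
      using l[OF s(1) zero(1) sets(1)] l[OF s(2) zero(2) sets(2)] LIMSEQ_unique by simp
  qed
  have UNIV: "(LINT x:UNIV|\<mu>. s x) = (LINT x:UNIV|\<mu>'. s' x)"
  proof (rule lim[where F="\<lambda>n. F0 (Suc n)"])
    show "\<bar>F0 (Suc n) x\<bar> \<le> 1" for n x unfolding F0_def using smooth_step_bounds by (simp add: abs_le_iff order_trans[of "- _" 0])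
    show "(\<lambda>n. F0 (Suc n) x) \<longlonglongrightarrow> indicator UNIV x" if "x \<in> ball 0 r" for x
      using LIMSEQ_Suc[OF F0l[OF that]] by simp
  qed (use F0t in auto)
  have box: "(LINT x:box a b|\<mu>. s x) = (LINT x:box a b|\<mu>'. s' x)" for a b
  proof -
    define f1 where "f1 n x = smooth_step (real n * (x $ 1 - a $ 1))" for n and x :: plane
    define f2 where "f2 n x = smooth_step (real n * (b $ 1 - x $ 1))" for n and x :: plane
    define f3 where "f3 n x = smooth_step (real n * (x $ 2 - a $ 2))" for n and x :: plane
    define f4 where "f4 n x = smooth_step (real n * (b $ 2 - x $ 2))" for n and x :: plane
    let ?F = "\<lambda>n x. f1 n x * (f2 n x * (f3 n x * (f4 n x * F0 n x)))"
    have aff: "\<exists>g. test_function (ball 0 r) (\<lambda>x. smooth_step (real n * (e * x $ i + d)) * \<phi> x) g"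
      if "\<exists>g. test_function (ball 0 r) \<phi> g" for n \<phi> i e d
    proof -
      obtain g where g: "test_function (ball 0 r) \<phi> g" using \<open>\<exists>g. test_function (ball 0 r) \<phi> g\<close> by blast
      have D: "GDERIV (\<lambda>x. smooth_step (real n * (e * x $ i + d))) x :> smooth_step' (real n * (e * x $ i + d)) *\<^sub>R ((real n * e) *\<^sub>R axis i 1)" for x :: plane
      proof (rule GDERIV_DERIV_compose[OF _ DERIV_smooth_step])
        have "((\<lambda>x. real n * (e * x $ i + d)) has_derivative (\<lambda>h. real n * (e * h $ i))) (at x)"
          by (auto intro!: derivative_eq_intros bounded_linear.has_derivative[OF bounded_linear_vec_nth])
        then show "GDERIV (\<lambda>x. real n * (e * x $ i + d)) x :> (real n * e) *\<^sub>R axis i 1"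
          unfolding gderiv_def by (simp add: inner_axis mult.assoc)
      qed
      have "continuous_on UNIV (\<lambda>x::plane. smooth_step' (real n * (e * x $ i + d)) *\<^sub>R ((real n * e) *\<^sub>R axis i (1::real)))"
        by (intro continuous_intros)
      then show ?thesis using test_function_mult[OF g D] by blast
    qed
    have aff': "\<exists>g. test_function (ball 0 r) (\<lambda>x. f1 n x * \<phi> x) g" "\<exists>g. test_function (ball 0 r) (\<lambda>x. f2 n x * \<phi> x) g"
      "\<exists>g. test_function (ball 0 r) (\<lambda>x. f3 n x * \<phi> x) g" "\<exists>g. test_function (ball 0 r) (\<lambda>x. f4 n x * \<phi> x) g"
      if "\<exists>g. test_function (ball 0 r) \<phi> g" for n \<phi>
      using aff[OF that, of n 1 1 "- a $ 1"] aff[OF that, of n "-1" 1 "b $ 1"] aff[OF that, of n 1 2 "- a $ 2"] aff[OF that, of n "-1" 2 "b $ 2"]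
      by (simp_all add: f1_def f2_def f3_def f4_def)
    have b01: "0 \<le> f1 n x" "f1 n x \<le> 1" "0 \<le> f2 n x" "f2 n x \<le> 1" "0 \<le> f3 n x" "f3 n x \<le> 1" "0 \<le> f4 n x" "f4 n x \<le> 1"
        "0 \<le> F0 n x" "F0 n x \<le> 1" for n x
      unfolding f1_def f2_def f3_def f4_def F0_def by (rule smooth_step_bounds)+
    show ?thesis
    proof (rule lim[where F="\<lambda>n. ?F (Suc n)"])
      show "\<exists>g. test_function (ball 0 r) (?F (Suc n)) g" for n
        by (intro aff' F0t)
      show "\<bar>?F (Suc n) x\<bar> \<le> 1" for n x
      proof -
        have "0 \<le> ?F (Suc n) x" by (intro mult_nonneg_nonneg b01)
        moreover have "?F (Suc n) x \<le> 1" by (intro mult_le_one b01 mult_nonneg_nonneg)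
        ultimately show ?thesis by simp
      qed
      fix x :: plane assume x: "x \<in> ball 0 r"
      have "(\<lambda>n. ?F n x) \<longlonglongrightarrow> indicator {0<..} (x $ 1 - a $ 1) * (indicator {0<..} (b $ 1 - x $ 1) *
          (indicator {0<..} (x $ 2 - a $ 2) * (indicator {0<..} (b $ 2 - x $ 2) * 1)))"
        unfolding f1_def f2_def f3_def f4_def by (intro tendsto_mult smooth_step_sequence_limit F0l x)
      also have "indicator {0<..} (x $ 1 - a $ 1) * (indicator {0<..} (b $ 1 - x $ 1) *
          (indicator {0<..} (x $ 2 - a $ 2) * (indicator {0<..} (b $ 2 - x $ 2) * 1))) = (indicator (box a b) x :: real)"
        by (auto simp: indicator_def mem_box_cart forall_2)
      finally show "(\<lambda>n. ?F (Suc n) x) \<longlonglongrightarrow> indicator (box a b) x" by (rule LIMSEQ_Suc)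
    qed simp
  qed
  let ?G = "range (\<lambda>(a, b). box a b :: plane set)"
  have ints: "set_integrable \<mu> A s" "set_integrable \<mu>' A s'" if "A \<in> sets borel" for A
    using that s unfolding set_integrable_def by (auto intro!: integrable_mult_indicator)
  have "Int_stable ?G" by (auto simp: Int_stable_def box_Int_box)
  moreover have "?G \<subseteq> Pow UNIV" by simp
  moreover have "B \<in> sigma_sets UNIV ?G" using B by (simp add: borel_eq_box)
  ultimately show ?thesis
  proof (induction rule: sigma_sets_induct_disjoint)
    case (basic A) then show ?case using box by auto
  next
    case empty show ?case by (simp add: set_lebesgue_integral_def)
  next
    case (compl A)
    then have A: "A \<in> sets borel" by (simp add: borel_eq_box)
    have *: "(LINT x:UNIV - A|M. t x) = (LINT x:UNIV|M. t x) - (LINT x:A|M. t x)"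
      if "set_integrable M UNIV t" "set_integrable M A t" "A \<in> sets M" for M and t :: "plane \<Rightarrow> plane"
    proof -
      have "(LINT x:UNIV|M. t x) - (LINT x:A|M. t x) = (\<integral>x. indicator UNIV x *\<^sub>R t x - indicator A x *\<^sub>R t x \<partial>M)"
        using that unfolding set_lebesgue_integral_def set_integrable_def by (intro Bochner_Integration.integral_diff[symmetric])
      also have "\<dots> = (LINT x:UNIV - A|M. t x)"
        unfolding set_lebesgue_integral_def by (intro Bochner_Integration.integral_cong) (auto simp: indicator_def)
      finally show ?thesis by simp
    qed
    show ?case using *[OF ints(1)[of UNIV] ints(1)[OF A]] *[OF ints(2)[of UNIV] ints(2)[OF A]] A compl UNIV by simp
  next
    case (union A)
    then have A: "A i \<in> sets borel" for i by (auto simp: borel_eq_box)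
    have "(LINT x:(\<Union>i. A i)|\<mu>. s x) = (\<Sum>i. LINT x:A i|\<mu>. s x)"
      by (rule lebesgue_integral_countable_add) (use A union ints[of "\<Union>i. A i"] in \<open>auto simp: disjoint_family_on_def\<close>)
    moreover have "(LINT x:(\<Union>i. A i)|\<mu>'. s' x) = (\<Sum>i. LINT x:A i|\<mu>'. s' x)"
      by (rule lebesgue_integral_countable_add) (use A union ints[of "\<Union>i. A i"] in \<open>auto simp: disjoint_family_on_def\<close>)
    ultimately show ?case using union by simp
  qed
qed

lemma is_derivative_measureE:
  assumes "is_derivative_measure \<Omega> v D"
  obtains \<mu> s where "finite_measure \<mu>" "sets \<mu> = sets borel" "integrable \<mu> s"
    "\<And>B. B \<in> sets borel \<Longrightarrow> B \<subseteq> \<Omega> \<Longrightarrow> D B = (LINT x:B|\<mu>. s x)"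
    "\<And>\<phi> g. test_function \<Omega> \<phi> g \<Longrightarrow> (LINT x:\<Omega>|lebesgue. v x *\<^sub>R g x) = - (LINT x:\<Omega>|\<mu>. \<phi> x *\<^sub>R s x)"
  using assms unfolding is_derivative_measure_def by (elim exE conjE) (rule that, simp_all)

text \<open>Since \<open>derivative_measure\<close> is a choice among all representations,
  uniqueness is what identifies it with an explicitly computed one. The densities are cut off to the
  disk because the underlying measures may have mass outside it.\<close>

lemma is_derivative_measure_unique:
  assumes "is_derivative_measure (ball 0 r) v D" "is_derivative_measure (ball 0 r) v D'" "0 < r"
    and B: "B \<in> sets borel" "B \<subseteq> ball 0 r"
  shows "D B = D' B"
proof -
  obtain \<mu> s where 1: "sets \<mu> = sets borel" "integrable \<mu> s"
      "\<And>B. B \<in> sets borel \<Longrightarrow> B \<subseteq> ball 0 r \<Longrightarrow> D B = (LINT x:B|\<mu>. s x)"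
      "\<And>\<phi> g. test_function (ball 0 r) \<phi> g \<Longrightarrow> (LINT x:ball 0 r|lebesgue. v x *\<^sub>R g x) = - (LINT x:ball 0 r|\<mu>. \<phi> x *\<^sub>R s x)"
    by (rule is_derivative_measureE[OF assms(1)]) blast
  obtain \<mu>' s' where 2: "sets \<mu>' = sets borel" "integrable \<mu>' s'"
      "\<And>B. B \<in> sets borel \<Longrightarrow> B \<subseteq> ball 0 r \<Longrightarrow> D' B = (LINT x:B|\<mu>'. s' x)"
      "\<And>\<phi> g. test_function (ball 0 r) \<phi> g \<Longrightarrow> (LINT x:ball 0 r|lebesgue. v x *\<^sub>R g x) = - (LINT x:ball 0 r|\<mu>'. \<phi> x *\<^sub>R s' x)"
    by (rule is_derivative_measureE[OF assms(2)]) blast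
  let ?s = "\<lambda>x. indicator (ball 0 r) x *\<^sub>R s x" and ?s' = "\<lambda>x. indicator (ball 0 r) x *\<^sub>R s' x"
  have "(LINT x:B|\<mu>. ?s x) = (LINT x:B|\<mu>'. ?s' x)"
  proof (rule derivative_measure_unique_aux[OF _ _ 1(1) 2(1) _ _ _ assms(3) B(1)])
    show "integrable \<mu> ?s" "integrable \<mu>' ?s'" using 1 2 by (auto intro!: integrable_mult_indicator)
    show "(\<integral>x. \<phi> x *\<^sub>R ?s x \<partial>\<mu>) = (\<integral>x. \<phi> x *\<^sub>R ?s' x \<partial>\<mu>')" if "test_function (ball 0 r) \<phi> g" for \<phi> g
      using 1(4)[OF that] 2(4)[OF that] by (simp add: set_lebesgue_integral_def mult.commute)
  qed auto
  moreover have "(LINT x:B|\<mu>. ?s x) = (LINT x:B|\<mu>. s x)" "(LINT x:B|\<mu>'. ?s' x) = (LINT x:B|\<mu>'. s' x)"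
    using B(2) unfolding set_lebesgue_integral_def by (auto intro!: Bochner_Integration.integral_cong simp: indicator_def)
  ultimately show ?thesis using 1(3)[OF B] 2(3)[OF B] by simp
qed

section \<open>Lebesgue decomposition\<close>

text \<open>A null set \<open>N\<close> of maximal \<open>\<mu>\<close> measure is the union of a
  maximising sequence. Off \<open>N\<close> the measure charges no null set, since adding such a set
  to \<open>N\<close> would exceed the maximum; the Radon-Nikodym theorem then gives the
  density.\<close>

lemma lebesgue_decomposition:
  fixes \<mu> :: "'a::euclidean_space measure"
  assumes "finite_measure \<mu>" and sets[measurable_cong, simp]: "sets \<mu> = sets borel"
  obtains N f where "N \<in> null_sets lborel" "f \<in> borel_measurable borel" "\<And>x. 0 \<le> f x"
    "density lborel (\<lambda>x. ennreal (f x)) = density \<mu> (indicator (- N))"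
proof -
  interpret finite_measure \<mu> by fact
  have space [simp]: "space \<mu> = UNIV" using sets_eq_imp_space_eq[OF sets] by simp
  define c where "c = (SUP A\<in>null_sets lborel. measure \<mu> A)"
  have bdd: "bdd_above (measure \<mu> ` null_sets lborel)"
    by (rule bdd_aboveI2[of _ _ "measure \<mu> UNIV"]) (use bounded_measure in simp)
  have "\<exists>A\<in>null_sets lborel. c - 1 / real (Suc n) < measure \<mu> A" for n
  proof -
    have "c - 1 / real (Suc n) < c" by simp
    then show ?thesis unfolding c_def by (subst (asm) less_cSUP_iff) (use bdd in auto)
  qed
  then obtain A where A: "\<And>n. A n \<in> null_sets lborel" "\<And>n. c - 1 / real (Suc n) < measure \<mu> (A n)" by metis
  define N where "N = (\<Union>n. A n)"
  have N: "N \<in> null_sets lborel" unfolding N_def using A(1) by auto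
  have Nb: "N \<in> sets borel" using N by auto
  have "c - 1 / real (Suc n) \<le> measure \<mu> N" for n
  proof -
    have "measure \<mu> (A n) \<le> measure \<mu> N" using Nb by (intro finite_measure_mono) (auto simp: N_def)
    then show ?thesis using A(2)[of n] by linarith
  qed
  moreover have "(\<lambda>n. c - 1 / real (Suc n)) \<longlonglongrightarrow> c - 0" by (intro tendsto_diff tendsto_const) real_asymp
  ultimately have cN: "c \<le> measure \<mu> N" using LIMSEQ_le_const2 by fastforce
  let ?\<mu> = "density \<mu> (indicator (- N))"
  have em: "emeasure ?\<mu> E = emeasure \<mu> (E - N)" if "E \<in> sets borel" for E
    using that Nb by (subst emeasure_density) (auto simp: nn_integral_indicator[symmetric] simp del: nn_integral_indicator
        intro!: nn_integral_cong split: split_indicator)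
  have "absolutely_continuous lborel ?\<mu>"
    unfolding absolutely_continuous_def
  proof
    fix E :: "'a set" assume E: "E \<in> null_sets lborel"
    then have Eb: "E \<in> sets borel" by auto
    have "N \<union> E \<in> null_sets lborel" using N E by auto
    then have "measure \<mu> (N \<union> E) \<le> c" unfolding c_def by (intro cSUP_upper bdd)
    moreover have "measure \<mu> (N \<union> E) = measure \<mu> N + measure \<mu> (E - N)"
      using Nb Eb by (subst finite_measure_Union[symmetric]) (auto intro!: arg_cong[where f="measure \<mu>"])
    ultimately have "measure \<mu> (E - N) = 0" using cN measure_nonneg[of \<mu> "E - N"] by linarith
    then show "E \<in> null_sets ?\<mu>" using Eb em[OF Eb] by (intro null_setsI) (auto simp: emeasure_eq_measure)
  qed
  then obtain f where f: "f \<in> borel_measurable lborel" "density lborel f = ?\<mu>"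
    using sigma_finite_measure.Radon_Nikodym[OF sigma_finite_lborel, of ?\<mu>] by auto
  have "(\<integral>\<^sup>+x. f x \<partial>lborel) = emeasure (density lborel f) UNIV" using f(1) by (subst emeasure_density) auto
  also have "\<dots> \<noteq> \<infinity>" unfolding f(2) using em[of UNIV] by (simp add: emeasure_eq_measure)
  finally have fin: "AE x in lborel. f x \<noteq> \<infinity>" by (intro nn_integral_noteq_infinite f)
  show ?thesis
  proof (rule that[OF N])
    show "(\<lambda>x. enn2real (f x)) \<in> borel_measurable borel" using f(1) by measurable
    have "density lborel (\<lambda>x. ennreal (enn2real (f x))) = density lborel f"
      using f(1) fin by (intro density_cong) (auto elim!: eventually_mono simp: less_top)
    then show "density lborel (\<lambda>x. ennreal (enn2real (f x))) = density \<mu> (indicator (- N))" using f(2) by simp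
  qed simp
qed

text \<open>The density of the part of \<open>\<mu>\<close> off \<open>N\<close>, multiplied by
  \<open>s\<close>, is a gradient of the required kind. Such a witness is what gives content to the
  choice made in \<open>approx_gradient\<close>.\<close>

lemma approx_gradient_exists:
  assumes D: "is_derivative_measure \<Omega> v D" and \<Omega>: "\<Omega> \<in> sets borel"
  shows "\<exists>g. set_integrable lebesgue \<Omega> g \<and>
        (\<exists>N\<in>null_sets lborel. \<forall>B\<in>sets borel. B \<subseteq> \<Omega> - N \<longrightarrow> D B = (LINT x:B|lebesgue. g x))"
proof -
  obtain \<mu> s where \<mu>: "finite_measure \<mu>" "sets \<mu> = sets borel" and s: "integrable \<mu> s"
      and DB: "\<And>B. B \<in> sets borel \<Longrightarrow> B \<subseteq> \<Omega> \<Longrightarrow> D B = (LINT x:B|\<mu>. s x)"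
    by (rule is_derivative_measureE[OF D]) blast
  note [measurable_cong, simp] = \<mu>(2)
  obtain N f where N: "N \<in> null_sets lborel" and f[measurable]: "f \<in> borel_measurable borel" "\<And>x. 0 \<le> f x"
    and eq: "density lborel (\<lambda>x. ennreal (f x)) = density \<mu> (indicator (- N))"
    using lebesgue_decomposition[OF \<mu>] by blast
  have [measurable]: "N \<in> sets borel" using N by auto
  have [measurable]: "s \<in> borel_measurable borel" using s by (simp cong: measurable_cong_sets add: borel_measurable_integrable)
  have eq': "density \<mu> (indicator (- N)) = density \<mu> (\<lambda>x. ennreal (indicator (- N) x))"
    by (intro arg_cong[where f="density \<mu>"] ext) (simp add: ennreal_indicator)
  have "integrable (density \<mu> (\<lambda>x. ennreal (indicator (- N) x))) s"
    using s by (subst integrable_density) (auto intro!: integrable_mult_indicator)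
  then have fs: "integrable lborel (\<lambda>x. f x *\<^sub>R s x)"
    unfolding eq'[symmetric] eq[symmetric] using f(2) by (subst (asm) integrable_density) auto
  have "D B = (LINT x:B|lebesgue. f x *\<^sub>R s x)" if B: "B \<in> sets borel" "B \<subseteq> \<Omega> - N" for B
  proof -
    note [measurable] = B(1)
    have "D B = (LINT x:B|\<mu>. s x)" using B by (intro DB) auto
    also have "\<dots> = (\<integral>x. indicator (- N) x *\<^sub>R (indicator B x *\<^sub>R s x) \<partial>\<mu>)"
      unfolding set_lebesgue_integral_def using B(2) by (intro Bochner_Integration.integral_cong) (auto simp: indicator_def)
    also have "\<dots> = (\<integral>x. indicator B x *\<^sub>R s x \<partial>density \<mu> (indicator (- N)))"
      unfolding eq' by (subst integral_density) auto
    also have "\<dots> = (\<integral>x. f x *\<^sub>R (indicator B x *\<^sub>R s x) \<partial>lborel)"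
      unfolding eq[symmetric] using f(2) by (subst integral_density) auto
    also have "\<dots> = (\<integral>x. f x *\<^sub>R (indicator B x *\<^sub>R s x) \<partial>lebesgue)"
      by (rule integral_completion[symmetric]) measurable
    finally show ?thesis by (simp add: set_lebesgue_integral_def mult.commute)
  qed
  moreover have "set_integrable lebesgue \<Omega> (\<lambda>x. f x *\<^sub>R s x)"
    using fs \<Omega> unfolding set_integrable_def
    by (intro integrable_mult_indicator) (auto simp: integrable_completion)
  ultimately show ?thesis using N by blast
qed

section \<open>Equality of traces\<close>

text \<open>For every \<open>k\<close> the image has a Borel cover of measure at most
  \<open>1 / (k + 1)\<close>; the intersection of these covers is null.\<close>

lemma null_sets_lipschitz_image:
  fixes f :: "'a::metric_space \<Rightarrow> real"
  assumes lip: "\<And>x y. \<bar>f x - f y\<bar> \<le> dist x y" and S: "hausdorff1_outer S = 0"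
  shows "f ` S \<in> null_sets lebesgue"
proof -
  have "\<exists>U\<in>sets borel. f ` S \<subseteq> U \<and> emeasure lborel U \<le> ennreal (1 / real (Suc k))" for k
  proof -
    have "hausdorff1_outer S < ennreal (1 / real (Suc k))" unfolding S by simp
    from lipschitz_image_cover[OF lip this] show ?thesis by metis
  qed
  then obtain U where U: "\<And>k. U k \<in> sets borel" "\<And>k. f ` S \<subseteq> U k"
    "\<And>k. emeasure lborel (U k) \<le> ennreal (1 / real (Suc k))" by metis
  have "emeasure lborel (\<Inter>k. U k) \<le> ennreal (1 / real (Suc k))" for k
    using U(1) by (intro order_trans[OF emeasure_mono U(3)]) auto
  moreover have "(\<lambda>k. ennreal (1 / real (Suc k))) \<longlonglongrightarrow> ennreal 0"
    by (intro tendsto_ennrealI) real_asymp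
  ultimately have "emeasure lborel (\<Inter>k. U k) \<le> 0"
    by (intro LIMSEQ_le_const[where X="\<lambda>k. ennreal (1 / real (Suc k))"]) auto
  then have "(\<Inter>k. U k) \<in> null_sets lborel" using U(1) by (intro null_setsI) auto
  moreover have "f ` S \<subseteq> (\<Inter>k. U k)" using U(2) by auto
  ultimately show ?thesis unfolding null_sets_completion_iff2 by (rule bexI[rotated])
qed

section \<open>Polar coordinates and averages near the circle\<close>

definition circ :: "real \<Rightarrow> real \<Rightarrow> plane" where
  "circ r \<theta> = vector [r * cos \<theta>, r * sin \<theta>]"

lemma circ_simps [simp]: "circ r \<theta> $ 1 = r * cos \<theta>" "circ r \<theta> $ 2 = r * sin \<theta>"
  by (simp_all add: circ_def)

lemma norm_plane: "norm (x :: plane) = sqrt ((x $ 1)\<^sup>2 + (x $ 2)\<^sup>2)"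
  by (simp add: norm_vec_def L2_set_def sum_2)

lemma norm_circ: "norm (circ r \<theta>) = \<bar>r\<bar>"
proof -
  have "(r * cos \<theta>)\<^sup>2 + (r * sin \<theta>)\<^sup>2 = r\<^sup>2 * ((cos \<theta>)\<^sup>2 + (sin \<theta>)\<^sup>2)"
    by (simp only: power_mult_distrib distrib_left)
  then show ?thesis by (simp add: norm_plane)
qed

lemma circ_eq: "circ r \<theta> = r *\<^sub>R circ 1 \<theta>"
  by (simp add: vec_eq_iff forall_2)

lemma continuous_on_circ: "continuous_on S (circ r)"
proof -
  have "circ r = (\<lambda>\<theta>. (r * cos \<theta>) *\<^sub>R axis 1 1 + (r * sin \<theta>) *\<^sub>R axis 2 1)"
    by (simp add: fun_eq_iff vec_eq_iff forall_2 axis_def)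
  then show ?thesis by (simp only:) (intro continuous_intros)
qed

lemma circ_measurable [measurable]: "circ r \<in> borel_measurable borel"
  by (rule borel_measurable_continuous_onI[OF continuous_on_circ])

lemma polar_plane: "\<exists>\<theta>. 0 \<le> \<theta> \<and> \<theta> < 2 * pi \<and> x = circ (norm x) \<theta>"
proof (cases "x = 0")
  case True
  then show ?thesis by (intro exI[of _ 0]) (simp add: vec_eq_iff forall_2)
next
  case False
  then have n: "0 < norm x" by simp
  have *: "(norm x)\<^sup>2 = (x $ 1)\<^sup>2 + (x $ 2)\<^sup>2" by (simp add: norm_plane)
  have "(x $ 1 / norm x)\<^sup>2 + (x $ 2 / norm x)\<^sup>2 = ((x $ 1)\<^sup>2 + (x $ 2)\<^sup>2) / (norm x)\<^sup>2"
    by (simp only: power_divide add_divide_distrib)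
  also have "\<dots> = 1" unfolding *[symmetric] using n by simp
  finally obtain t where "0 \<le> t" "t < 2 * pi" "x $ 1 / norm x = cos t" "x $ 2 / norm x = sin t"
    by (rule sincos_total_2pi) blast
  then have "x $ 1 = norm x * cos t" "x $ 2 = norm x * sin t"
    using n by (metis less_irrefl nonzero_mult_div_cancel_left times_divide_eq_right)+
  then have "x = circ (norm x) t" by (simp add: vec_eq_iff forall_2)
  then show ?thesis using \<open>0 \<le> t\<close> \<open>t < 2 * pi\<close> by blast
qed

lemma dist_circ: "0 \<le> r \<Longrightarrow> dist (circ r \<theta>) (circ r \<theta>') \<le> r * \<bar>\<theta> - \<theta>'\<bar>"
proof -
  assume r: "0 \<le> r"
  define d where "d = (\<theta> - \<theta>') / 2"
  have "(cos \<theta> - cos \<theta>')\<^sup>2 + (sin \<theta> - sin \<theta>')\<^sup>2 = 2 - 2 * cos (\<theta> - \<theta>')"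
    using sin_cos_squared_add[of \<theta>] sin_cos_squared_add[of \<theta>'] by (simp add: cos_diff power2_eq_square algebra_simps)
  also have "\<theta> - \<theta>' = 2 * d" by (simp add: d_def)
  also have "2 - 2 * cos (2 * d) = (2 * sin d)\<^sup>2" by (simp add: cos_double_sin power2_eq_square)
  finally have e: "(cos \<theta> - cos \<theta>')\<^sup>2 + (sin \<theta> - sin \<theta>')\<^sup>2 = (2 * sin d)\<^sup>2" .
  have "dist (circ 1 \<theta>) (circ 1 \<theta>') = sqrt ((cos \<theta> - cos \<theta>')\<^sup>2 + (sin \<theta> - sin \<theta>')\<^sup>2)"
    by (simp add: dist_norm norm_plane)
  also have "\<dots> = \<bar>2 * sin d\<bar>" by (simp only: e real_sqrt_abs)
  also have "\<dots> \<le> 2 * \<bar>d\<bar>" using abs_sin_x_le_abs_x[of d] by (simp add: abs_mult)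
  also have "\<dots> = \<bar>\<theta> - \<theta>'\<bar>" by (simp add: d_def)
  finally have "r * dist (circ 1 \<theta>) (circ 1 \<theta>') \<le> r * \<bar>\<theta> - \<theta>'\<bar>" using r by (rule mult_left_mono)
  then show ?thesis using r by (subst (1 2) circ_eq) (simp add: dist_norm scaleR_diff_right[symmetric])
qed

text \<open>The first coordinates of a Hausdorff null set form a null set of the line. On the open
  upper and lower half circles the angle is a differentiable function of this coordinate, namely
  \<open>arccos\<close> or its reflection, and differentiable images of null sets are null; three
  angles are left over.\<close>

lemma AE_circ_not_in:
  assumes N: "N \<in> sets borel" "hausdorff1_outer N = 0" and r: "0 < r"
  shows "AE \<theta> in lborel. \<theta> \<in> {0..2 * pi} \<longrightarrow> circ r \<theta> \<notin> N"
proof -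
  define T where "T = (\<lambda>x::plane. x $ 1) ` N \<inter> {-r<..<r}"
  have "(\<lambda>x::plane. x $ 1) ` N \<in> null_sets lebesgue"
    by (rule null_sets_lipschitz_image[OF _ N(2)]) (metis component_le_norm_cart dist_norm vector_minus_component)
  then have T: "negligible T"
    unfolding T_def by (intro negligible_Int) (simp add: negligible_iff_null_sets)
  have d: "(\<lambda>t. arccos (t / r)) differentiable_on T" "(\<lambda>t. 2 * pi - arccos (t / r)) differentiable_on T"
  proof -
    have "(\<lambda>t. arccos (t / r)) differentiable (at t)" if "t \<in> T" for t
    proof -
      have "-1 < t / r" "t / r < 1" using that r by (auto simp: T_def field_simps)
      then have "((\<lambda>t. arccos (t / r)) has_real_derivative inverse (- sqrt (1 - (t / r)\<^sup>2)) * (1 / r)) (at t)"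
        by (intro DERIV_chain2[OF DERIV_arccos]) (use r in \<open>auto intro!: derivative_eq_intros\<close>)
      then show ?thesis using real_differentiable_def by blast
    qed
    then have "(\<lambda>t. arccos (t / r)) differentiable (at t within T)" if "t \<in> T" for t
      using that differentiable_at_withinI by blast
    then show 1: "(\<lambda>t. arccos (t / r)) differentiable_on T" by (simp add: differentiable_on_def)
    show "(\<lambda>t. 2 * pi - arccos (t / r)) differentiable_on T"
      by (intro differentiable_on_diff 1) simp
  qed
  let ?E = "{\<theta>. \<theta> \<in> {0..2 * pi} \<and> circ r \<theta> \<in> N}"
  have "negligible ((\<lambda>t. arccos (t / r)) ` T)" "negligible ((\<lambda>t. 2 * pi - arccos (t / r)) ` T)"
    by (rule negligible_differentiable_image_negligible[OF _ T], simp, rule d)+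
  then have "negligible ((\<lambda>t. arccos (t / r)) ` T \<union> (\<lambda>t. 2 * pi - arccos (t / r)) ` T \<union> {0, pi, 2 * pi})"
    by (simp add: negligible_Un negligible_finite)
  moreover have "?E \<subseteq> (\<lambda>t. arccos (t / r)) ` T \<union> (\<lambda>t. 2 * pi - arccos (t / r)) ` T \<union> {0, pi, 2 * pi}"
  proof
    fix \<theta> assume \<theta>: "\<theta> \<in> ?E"
    have T: "r * cos \<theta> \<in> T" if "\<theta> \<noteq> 0" "\<theta> \<noteq> pi" "\<theta> \<noteq> 2 * pi"
    proof -
      have "sin \<theta> \<noteq> 0"
      proof (cases "\<theta> < pi")
        case True then show ?thesis using sin_gt_zero[of \<theta>] \<theta> that by auto
      next
        case False then show ?thesis using sin_lt_zero[of \<theta>] \<theta> that by auto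
      qed
      then have "0 < (sin \<theta>)\<^sup>2" by simp
      then have "(cos \<theta>)\<^sup>2 < 1" using sin_cos_squared_add[of \<theta>] by linarith
      then have "\<bar>cos \<theta>\<bar> < 1" by (simp add: abs_square_less_1)
      then have "r * cos \<theta> \<in> {-r<..<r}" using r by (auto simp: abs_less_iff) (metis minus_less_iff mult.right_neutral mult_less_cancel_left_pos mult_minus_right)
      moreover have "r * cos \<theta> \<in> (\<lambda>x::plane. x $ 1) ` N"
        using \<theta> by (intro image_eqI[of _ _ "circ r \<theta>"]) auto
      ultimately show ?thesis by (simp add: T_def)
    qed
    show "\<theta> \<in> (\<lambda>t. arccos (t / r)) ` T \<union> (\<lambda>t. 2 * pi - arccos (t / r)) ` T \<union> {0, pi, 2 * pi}"
    proof (cases "\<theta> = 0 \<or> \<theta> = pi \<or> \<theta> = 2 * pi")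
      case False
      show ?thesis
      proof (cases "\<theta> < pi")
        case True
        then have "\<theta> = arccos (r * cos \<theta> / r)" using \<theta> r by (simp add: arccos_cos)
        then show ?thesis using T False by blast
      next
        case F2: False
        have "arccos (cos (2 * pi - \<theta>)) = 2 * pi - \<theta>" using \<theta> F2 False by (intro arccos_cos) auto
        then have "\<theta> = 2 * pi - arccos (r * cos \<theta> / r)" using r by simp
        then show ?thesis using T False by blast
      qed
    qed auto
  qed
  ultimately have "negligible ?E" by (rule negligible_subset)
  then have "?E \<in> null_sets lebesgue" by (simp only: negligible_iff_null_sets)
  moreover have "?E \<in> sets borel"
  proof -
    have "?E = {0..2 * pi} \<inter> circ r -` N" by auto
    then show ?thesis using measurable_sets_borel[OF circ_measurable N(1)] by simp
  qed
  ultimately have "?E \<in> null_sets lborel" by (simp add: null_sets_completion_iff)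
  then show ?thesis by (rule AE_I') auto
qed

text \<open>The condition at single boundary points is averaged over the circle. By Fubini's theorem
  each point of the annulus of width \<open>\<rho> n / 2\<close> is counted by a set of angles of
  length at least \<open>\<rho> n / (2 * r)\<close>, so the averaged integrals over small disks
  dominate the annulus integral with the constant \<open>2 * r\<close>.\<close>

lemma annulus_average_tendsto_0:
  fixes f :: "plane \<Rightarrow> real"
  assumes f[measurable]: "f \<in> borel_measurable borel" "\<And>x. 0 \<le> f x" "\<And>x. f x \<le> C" and r: "0 < r"
    and N: "N \<in> sets borel" "hausdorff1_outer N = 0"
    and lim: "\<And>x. norm x = r \<Longrightarrow> x \<notin> N \<Longrightarrow>
      ((\<lambda>\<rho>. (\<integral>y. indicator (ball 0 r \<inter> ball x \<rho>) y * f y \<partial>lborel) / \<rho>\<^sup>2) \<longlongrightarrow> 0) (at_right 0)"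
    and \<rho>: "\<And>n. 0 < \<rho> n" "\<And>n. \<rho> n \<le> r" "\<rho> \<longlonglongrightarrow> 0"
  shows "(\<lambda>n. (\<integral>y. indicator {y. r - \<rho> n / 2 < norm y \<and> norm y < r} y * f y \<partial>lborel) / \<rho> n) \<longlonglongrightarrow> 0"
proof -
  have C: "0 \<le> C" using f(2,3)[of 0] by linarith
  have [measurable]: "ball x e \<in> sets borel" for x :: plane and e by simp
  \<comment> \<open>Membership in the moving disk is expressed through the sign of
    \<open>\<rho> n - dist (circ r \<theta>) y\<close>, a form that is jointly measurable in both
    variables.\<close>
  define F where "F n \<theta> y = indicator {0..2 * pi} \<theta> * (indicator (ball 0 r) y * (indicator {0<..} (\<rho> n - dist (circ r \<theta>) y) * f y))" for n \<theta> y
  have Fle: "\<bar>F n \<theta> y\<bar> \<le> indicator {0..2 * pi} \<theta> * (C * indicator (ball 0 r) y)" for n \<theta> y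
    using f(2,3)[of y] by (auto simp: F_def indicator_def)
  have Fm[measurable]: "(\<lambda>(\<theta>, y). F n \<theta> y) \<in> borel_measurable (lborel \<Otimes>\<^sub>M lborel)" for n
    unfolding F_def by measurable
  have iball: "integrable lborel (indicator (ball x e) :: plane \<Rightarrow> real)" for x e
    by (rule integrable_real_indicator) (auto simp: emeasure_lborel_ball_finite[unfolded infinity_ennreal_def])
  have iI: "integrable lborel (indicator {0..2 * pi} :: real \<Rightarrow> real)"
    by (rule integrable_real_indicator) auto
  have Fi: "integrable (lborel \<Otimes>\<^sub>M lborel) (\<lambda>(\<theta>, y). F n \<theta> y)" for n
  proof (rule Bochner_Integration.integrable_bound)
    show "integrable (lborel \<Otimes>\<^sub>M lborel) (\<lambda>(\<theta>, y :: plane). indicator {0..2 * pi} \<theta> * (C * indicator (ball 0 r) y))"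
      by (rule integrable_pair_mult) (use iI iball[of 0 r] sigma_finite_lborel in auto)
    show "AE p in lborel \<Otimes>\<^sub>M lborel. norm (case p of (\<theta>, y) \<Rightarrow> F n \<theta> y) \<le> norm (case p of (\<theta>, y) \<Rightarrow> indicator {0..2 * pi} \<theta> * (C * indicator (ball 0 r) y))"
    proof (rule AE_I2)
      fix p :: "real \<times> plane"
      obtain \<theta> y where p: "p = (\<theta>, y)" by (cases p)
      show "norm (case p of (\<theta>, y) \<Rightarrow> F n \<theta> y) \<le> norm (case p of (\<theta>, y) \<Rightarrow> indicator {0..2 * pi} \<theta> * (C * indicator (ball 0 r) y))"
        unfolding p prod.case real_norm_def by (rule order_trans[OF Fle abs_ge_self])
    qed
  qed (rule Fm)
  define H where "H n \<theta> = (\<integral>y. F n \<theta> y \<partial>lborel)" for n \<theta>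
  have Heq: "H n \<theta> = indicator {0..2 * pi} \<theta> * (\<integral>y. indicator (ball 0 r \<inter> ball (circ r \<theta>) (\<rho> n)) y * f y \<partial>lborel)" for n \<theta>
  proof -
    have "H n \<theta> = indicator {0..2 * pi} \<theta> * (\<integral>y. indicator (ball 0 r) y * (indicator {0<..} (\<rho> n - dist (circ r \<theta>) y) * f y) \<partial>lborel)"
      by (simp add: H_def F_def)
    also have "(\<lambda>y. indicator (ball 0 r) y * (indicator {0<..} (\<rho> n - dist (circ r \<theta>) y) * f y)) = (\<lambda>y. indicator (ball 0 r \<inter> ball (circ r \<theta>) (\<rho> n)) y * f y)"
      by (auto simp: indicator_def fun_eq_iff)
    finally show ?thesis .
  qed
  have Hm: "H n \<in> borel_measurable lborel" for n
    unfolding H_def using lborel_pair.integrable_fst[OF Fi[of n]] by (rule borel_measurable_integrable)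
  have "(\<lambda>n. \<integral>\<theta>. H n \<theta> / (\<rho> n)\<^sup>2 \<partial>lborel) \<longlonglongrightarrow> (\<integral>\<theta>. 0 \<partial>(lborel :: real measure))"
  proof (rule integral_dominated_convergence[where w="\<lambda>\<theta>. C * pi * indicator {0..2 * pi} \<theta>"])
    show "integrable lborel (\<lambda>\<theta>. C * pi * indicator {0..2 * pi} \<theta> :: real)" using iI by simp
    show "(\<lambda>\<theta>. H n \<theta> / (\<rho> n)\<^sup>2) \<in> borel_measurable lborel" for n using Hm by measurable
    show "AE \<theta> in lborel. norm (H n \<theta> / (\<rho> n)\<^sup>2) \<le> C * pi * indicator {0..2 * pi} \<theta>" for n
    proof (rule AE_I2)
      fix \<theta> :: real
      let ?I = "\<integral>y. indicator (ball 0 r \<inter> ball (circ r \<theta>) (\<rho> n)) y * f y \<partial>lborel"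
      have "?I \<le> (\<integral>y. C * indicator (ball (circ r \<theta>) (\<rho> n)) y \<partial>lborel)"
      proof (rule integral_mono')
        show "integrable lborel (\<lambda>y. C * indicator (ball (circ r \<theta>) (\<rho> n)) y)" using iball by simp
      qed (use f(2,3) C in \<open>auto simp: indicator_def\<close>)
      also have "\<dots> = C * (pi * (\<rho> n)\<^sup>2)"
        using \<rho>(1)[of n] by (simp add: content_ball unit_ball_vol_2)
      finally have "?I \<le> C * (pi * (\<rho> n)\<^sup>2)" .
      moreover have "0 \<le> ?I" using f(2) by (intro Bochner_Integration.integral_nonneg) auto
      ultimately show "norm (H n \<theta> / (\<rho> n)\<^sup>2) \<le> C * pi * indicator {0..2 * pi} \<theta>"
        using \<rho>(1)[of n] by (auto simp: Heq indicator_def divide_le_eq)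
    qed
    show "AE \<theta> in lborel. (\<lambda>n. H n \<theta> / (\<rho> n)\<^sup>2) \<longlonglongrightarrow> 0"
      using AE_circ_not_in[OF N r]
    proof eventually_elim
      case (elim \<theta>)
      show ?case
      proof (cases "\<theta> \<in> {0..2 * pi}")
        case True
        have "((\<lambda>\<rho>. (\<integral>y. indicator (ball 0 r \<inter> ball (circ r \<theta>) \<rho>) y * f y \<partial>lborel) / \<rho>\<^sup>2) \<longlongrightarrow> 0) (at_right 0)"
          using elim True r by (intro lim) (auto simp: norm_circ)
        moreover have "filterlim \<rho> (at_right 0) sequentially"
          unfolding filterlim_at using \<rho> by (auto intro!: always_eventually simp: less_imp_neq[symmetric])
        ultimately have "(\<lambda>n. (\<integral>y. indicator (ball 0 r \<inter> ball (circ r \<theta>) (\<rho> n)) y * f y \<partial>lborel) / (\<rho> n)\<^sup>2) \<longlonglongrightarrow> 0"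
          by (rule filterlim_compose)
        then show ?thesis using True by (simp add: Heq)
      qed (simp add: Heq)
    qed
  qed simp
  then have "(\<lambda>n. (\<integral>\<theta>. H n \<theta> \<partial>lborel) / (\<rho> n)\<^sup>2) \<longlonglongrightarrow> 0" by simp
  then have up: "(\<lambda>n. 2 * r * ((\<integral>\<theta>. H n \<theta> \<partial>lborel) / (\<rho> n)\<^sup>2)) \<longlonglongrightarrow> 0"
    by (rule tendsto_mult_right_zero)
  let ?A = "\<lambda>n. {y::plane. r - \<rho> n / 2 < norm y \<and> norm y < r}"
  have Ab[measurable]: "?A n \<in> sets borel" for n
    by (intro borel_open open_Collect_conj open_Collect_less continuous_intros)
  have low: "(\<integral>y. indicator (?A n) y * f y \<partial>lborel) / \<rho> n \<le> 2 * r * ((\<integral>\<theta>. H n \<theta> \<partial>lborel) / (\<rho> n)\<^sup>2)" for n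
  proof -
    have "(\<integral>y. (\<rho> n / (2 * r)) * (indicator (?A n) y * f y) \<partial>lborel) \<le> (\<integral>y. (\<integral>\<theta>. F n \<theta> y \<partial>lborel) \<partial>lborel)"
    proof (rule integral_mono')
      show "integrable lborel (\<lambda>y. \<integral>\<theta>. F n \<theta> y \<partial>lborel)" by (rule lborel_pair.integrable_snd[OF Fi])
      fix y :: plane
      have pos: "0 \<le> (\<integral>\<theta>. F n \<theta> y \<partial>lborel)" using f(2) by (intro Bochner_Integration.integral_nonneg) (auto simp: F_def)
      then show "0 \<le> (\<integral>\<theta>. F n \<theta> y \<partial>lborel)" .
      show "(\<rho> n / (2 * r)) * (indicator (?A n) y * f y) \<le> (\<integral>\<theta>. F n \<theta> y \<partial>lborel)"
      proof (cases "y \<in> ?A n")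
        case True
        obtain \<theta>0 where \<theta>0: "0 \<le> \<theta>0" "\<theta>0 < 2 * pi" "y = circ (norm y) \<theta>0" using polar_plane by blast
        \<comment> \<open>An arc of angle \<open>d\<close> has length \<open>\<rho> n / 2\<close>,
          and the annulus adds less than \<open>\<rho> n / 2\<close> in the radial direction;
          together they stay below \<open>\<rho> n\<close>.\<close>
        define d where "d = \<rho> n / (2 * r)"
        have d: "0 < d" "d \<le> 1" using \<rho>(1,2)[of n] r by (auto simp: d_def)
        \<comment> \<open>The interval of angles extends to the right or to the left of
          \<open>\<theta>0\<close>, whichever keeps it inside \<open>{0..2 * pi}\<close>.\<close>
        define a where "a = (if \<theta>0 \<le> pi then \<theta>0 else \<theta>0 - d)"
        have dist: "dist (circ r \<theta>) y < \<rho> n" if "\<theta> \<in> {a..a + d}" for \<theta>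
        proof -
          have "\<bar>\<theta> - \<theta>0\<bar> \<le> d" using that d by (auto simp: a_def split: if_splits)
          then have "r * \<bar>\<theta> - \<theta>0\<bar> \<le> r * d" using r by (intro mult_left_mono) auto
          then have 1: "dist (circ r \<theta>) (circ r \<theta>0) \<le> \<rho> n / 2"
            using dist_circ[of r \<theta> \<theta>0] r by (simp add: d_def)
          have "circ r \<theta>0 - y = (r - norm y) *\<^sub>R circ 1 \<theta>0"
            by (subst \<theta>0(3)) (simp add: circ_eq[of r] circ_eq[of "norm y"] scaleR_diff_left)
          then have "dist (circ r \<theta>0) y = r - norm y" using True by (simp add: dist_norm norm_circ)
          then show ?thesis using 1 True dist_triangle[of "circ r \<theta>" y "circ r \<theta>0"] by simp
        qed
        have sub: "{a..a + d} \<subseteq> {0..2 * pi}"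
          using \<theta>0 d pi_gt3 by (auto simp: a_def split: if_splits)
        have "(\<rho> n / (2 * r)) * (indicator (?A n) y * f y) = (\<integral>\<theta>. indicator {a..a + d} \<theta> * f y \<partial>lborel)"
          using True d by (simp add: d_def)
        also have "\<dots> \<le> (\<integral>\<theta>. F n \<theta> y \<partial>lborel)"
        proof (rule integral_mono')
          have [measurable]: "(\<lambda>\<theta>. F n \<theta> y) \<in> borel_measurable lborel" unfolding F_def by measurable
          show "integrable lborel (\<lambda>\<theta>. F n \<theta> y)"
          proof (rule Bochner_Integration.integrable_bound[where f="\<lambda>\<theta>. indicator {0..2 * pi} \<theta> * (C * indicator (ball 0 r) y)"])
            show "AE \<theta> in lborel. norm (F n \<theta> y) \<le> norm (indicator {0..2 * pi} \<theta> * (C * indicator (ball 0 r) y))"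
              unfolding real_norm_def by (intro AE_I2 order_trans[OF Fle abs_ge_self])
          qed (use iI in auto)
          show "indicator {a..a + d} \<theta> * f y \<le> F n \<theta> y" for \<theta>
          proof (cases "\<theta> \<in> {a..a + d}")
            case \<theta>: True
            then have "\<theta> \<in> {0..2 * pi}" "y \<in> ball 0 r" "0 < \<rho> n - dist (circ r \<theta>) y"
              using sub True dist by auto
            then show ?thesis using \<theta> by (simp add: F_def)
          next
            case False
            then show ?thesis using f(2)[of y] by (simp add: F_def)
          qed
          show "0 \<le> F n \<theta> y" for \<theta> using f(2) by (simp add: F_def)
        qed
        finally show ?thesis .
      next
        case False
        then show ?thesis using pos by simp
      qed
    qed
    also have "\<dots> = (\<integral>\<theta>. H n \<theta> \<partial>lborel)"
      unfolding H_def by (rule lborel_pair.Fubini_integral[OF Fi])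
    finally have "(\<rho> n / (2 * r)) * (\<integral>y. indicator (?A n) y * f y \<partial>lborel) \<le> (\<integral>\<theta>. H n \<theta> \<partial>lborel)" by simp
    then show ?thesis using \<rho>(1)[of n] r by (simp add: field_simps power2_eq_square)
  qed
  show ?thesis
  proof (rule Lim_null_comparison[OF always_eventually up], intro allI)
    fix n
    have "0 \<le> (\<integral>y. indicator (?A n) y * f y \<partial>lborel)" using f(2) by (intro Bochner_Integration.integral_nonneg) auto
    then show "norm ((\<integral>y. indicator (?A n) y * f y \<partial>lborel) / \<rho> n) \<le> 2 * r * ((\<integral>\<theta>. H n \<theta> \<partial>lborel) / (\<rho> n)\<^sup>2)"
      using low[of n] \<rho>(1)[of n] by simp
  qed
qed

section \<open>The triple junction\<close>

definition dir :: "nat \<Rightarrow> plane" where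
  "dir k = circ 1 (2 / 3 * pi * real k)"

lemma norm_dir [simp]: "norm (dir k) = 1"
  by (simp add: dir_def norm_circ)

lemma cross2_circ: "cross2 (circ r \<theta>) (circ r' \<theta>') = r * r' * sin (\<theta>' - \<theta>)"
  by (simp add: cross2_def sin_diff algebra_simps)

lemma inner_circ: "circ r \<theta> \<bullet> circ r' \<theta>' = r * r' * cos (\<theta>' - \<theta>)"
  by (simp add: inner_vec_def sum_2 cos_diff algebra_simps)

lemma dir_3: "dir 3 = dir 0"
proof -
  have "cos (2 / 3 * pi * real 3) = cos (2 * pi)" "sin (2 / 3 * pi * real 3) = sin (2 * pi)" by (simp_all add: mult.commute)
  then show ?thesis by (simp add: dir_def vec_eq_iff forall_2)
qed

lemma cross2_dir_Suc: "cross2 (dir k) (dir (Suc k)) = sqrt 3 / 2"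
proof -
  have d: "2 / 3 * pi * real (Suc k) - 2 / 3 * pi * real k = 2 * pi / 3" by (simp add: algebra_simps)
  show ?thesis unfolding dir_def cross2_circ d by (simp add: sin_120)
qed

lemma inner_dir_Suc: "dir k \<bullet> dir (Suc k) = - 1 / 2"
proof -
  have d: "2 / 3 * pi * real (Suc k) - 2 / 3 * pi * real k = 2 * pi / 3" by (simp add: algebra_simps)
  show ?thesis unfolding dir_def inner_circ d by (simp add: cos_120)
qed

lemma perp_inner_perp: "perp p \<bullet> perp q = p \<bullet> q"
  by (simp add: inner_vec_def sum_2)

text \<open>The interior of a sector as an intersection of two half planes, which is possible
  because the opening angle is below 180 degrees.\<close>

definition cone_sector :: "nat \<Rightarrow> plane set" where
  "cone_sector i = cone2 (dir (i - 1)) (dir i)"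

text \<open>Cross products with the unit vectors \<open>dir\<close> are multiples of sines of angle
  differences, and the positivity of two such sines pins down the angle of \<open>x\<close>.\<close>

lemma cone_sector_subset_sector:
  assumes x: "x \<in> cone_sector i" "x \<in> ball 0 r" and i: "i \<in> {1, 2, 3}"
  shows "x \<in> sector r i"
proof -
  obtain \<theta> where \<theta>: "0 \<le> \<theta>" "\<theta> < 2 * pi" "x = circ (norm x) \<theta>" using polar_plane by blast
  define k where "k = i - 1"
  have ik: "i = Suc k" "k \<in> {0, 1, 2}" using i by (auto simp: k_def)
  have c: "0 < cross2 x (dir i)" "0 < cross2 (dir k) x" using x by (auto simp: cone_sector_def cone2_def k_def)
  have n: "0 < norm x" using c by (auto simp: cross2_def)
  have "cross2 x (dir i) = norm x * sin (2 / 3 * pi * real i - \<theta>)"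
    by (subst \<theta>(3)) (simp add: dir_def cross2_circ)
  moreover have "cross2 (dir k) x = norm x * sin (\<theta> - 2 / 3 * pi * real k)"
    by (subst \<theta>(3)) (simp add: dir_def cross2_circ)
  ultimately have s: "0 < sin (2 / 3 * pi * real i - \<theta>)" "0 < sin (\<theta> - 2 / 3 * pi * real k)"
    using c n by (auto simp: zero_less_mult_iff)
  have neg: "\<not> (-pi \<le> t \<and> t \<le> 0)" "\<not> (pi \<le> t \<and> t \<le> 2 * pi)" if "0 < sin t" for t
  proof -
    show "\<not> (-pi \<le> t \<and> t \<le> 0)" using sin_ge_zero[of "- t"] that by auto
    show "\<not> (pi \<le> t \<and> t \<le> 2 * pi)" using sin_le_zero[of t] that by (cases "t = 2 * pi") auto
  qed
  have "2 / 3 * pi * real k \<le> \<theta> \<and> \<theta> < 2 / 3 * pi * real i"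
  proof -
    consider "k = 0" | "k = 1" | "k = 2" using ik by auto
    then show ?thesis
    proof cases
      case 1 then show ?thesis using neg[OF s(1)] neg[OF s(2)] \<theta> ik pi_gt_zero by (auto simp: not_le)
    next
      case 2 then show ?thesis using neg[OF s(1)] neg[OF s(2)] \<theta> ik pi_gt_zero by (auto simp: not_le)
    next
      case 3
      \<comment> \<open>In the last sector the upper angle is a full turn, so that the first sine is
        that of \<open>- \<theta>\<close> and excludes angles up to \<open>pi\<close>.\<close>
      have "sin (2 / 3 * pi * real i - \<theta>) = sin (- \<theta>)"
        using 3 ik sin_periodic[of "- \<theta>"] by (simp add: algebra_simps)
      then have "\<not> (-pi \<le> - \<theta> \<and> - \<theta> \<le> 0)" using neg(1)[of "- \<theta>"] s(1) by simp
      then have "pi < \<theta>" using \<theta> by auto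
      moreover have "\<not> (-pi \<le> \<theta> - 2 / 3 * pi * real k \<and> \<theta> - 2 / 3 * pi * real k \<le> 0)" by (rule neg[OF s(2)])
      ultimately show ?thesis using 3 \<theta> ik pi_gt_zero by auto
    qed
  qed
  moreover have "x = vector [norm x * cos \<theta>, norm x * sin \<theta>]" using \<theta>(3) by (simp add: circ_def)
  moreover have "real i - 1 = real k" using ik by simp
  ultimately show ?thesis
    unfolding sector_def using x(2) by (intro CollectI conjI exI[of _ "norm x"] exI[of _ \<theta>]) simp_all
qed

definition ray :: "real \<Rightarrow> nat \<Rightarrow> plane set" where
  "ray r k = (\<lambda>t. t *\<^sub>R dir k) ` {0<..<r}"

lemma plane_cover:
  assumes "x \<in> ball 0 r" "x \<noteq> 0"
  obtains i where "i \<in> {1, 2, 3}" "x \<in> cone_sector i" | k where "k \<in> {0, 1, 2}" "x \<in> ray r k"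
proof -
  obtain \<theta> where \<theta>: "0 \<le> \<theta>" "\<theta> < 2 * pi" "x = circ (norm x) \<theta>" using polar_plane by blast
  have n: "0 < norm x" "norm x < r" using assms by auto
  have cone: "x \<in> cone_sector (Suc k)" if "2 / 3 * pi * real k < \<theta>" "\<theta> < 2 / 3 * pi * real (Suc k)" for k
  proof -
    have "cross2 x (dir (Suc k)) = norm x * sin (2 / 3 * pi * real (Suc k) - \<theta>)"
      by (subst \<theta>(3)) (simp add: dir_def cross2_circ)
    moreover have "cross2 (dir k) x = norm x * sin (\<theta> - 2 / 3 * pi * real k)"
      by (subst \<theta>(3)) (simp add: dir_def cross2_circ)
    moreover have "2 / 3 * pi * real (Suc k) = 2 / 3 * pi * real k + 2 / 3 * pi" by (simp add: algebra_simps)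
    then have "0 < sin (2 / 3 * pi * real (Suc k) - \<theta>)" "0 < sin (\<theta> - 2 / 3 * pi * real k)"
      using that pi_gt_zero by (intro sin_gt_zero; linarith)+
    ultimately show ?thesis using n by (simp add: cone_sector_def cone2_def)
  qed
  have ray: "x \<in> ray r k" if "\<theta> = 2 / 3 * pi * real k" for k
  proof -
    have "x = norm x *\<^sub>R dir k" using \<theta>(3) that by (simp add: dir_def circ_eq[of "norm x"])
    then show ?thesis using n unfolding ray_def by (intro image_eqI[of _ _ "norm x"]) auto
  qed
  consider "\<theta> = 2 / 3 * pi * real 0" | "2 / 3 * pi * real 0 < \<theta>" "\<theta> < 2 / 3 * pi * real (Suc 0)"
    | "\<theta> = 2 / 3 * pi * real 1" | "2 / 3 * pi * real 1 < \<theta>" "\<theta> < 2 / 3 * pi * real (Suc 1)"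
    | "\<theta> = 2 / 3 * pi * real 2" | "2 / 3 * pi * real 2 < \<theta>" "\<theta> < 2 / 3 * pi * real (Suc 2)"
    using \<theta> by fastforce
  then show ?thesis
  proof cases
    case 1 from ray[OF this] show ?thesis by (intro that(2)[of 0]) auto
  next
    case 2 from cone[OF this] show ?thesis by (intro that(1)[of 1]) auto
  next
    case 3 from ray[OF this] show ?thesis by (intro that(2)[of 1]) auto
  next
    case 4 from cone[OF this] show ?thesis by (intro that(1)[of 2]) (auto simp: numeral_2_eq_2)
  next
    case 5 from ray[OF this] show ?thesis by (intro that(2)[of 2]) auto
  next
    case 6 from cone[OF this] show ?thesis by (intro that(1)[of 3]) (auto simp: numeral_3_eq_3 numeral_2_eq_2)
  qed
qed

lemma cross2_commute: "cross2 p q = - cross2 q p"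
  by (simp add: cross2_def)

lemma cone_sector_disjoint:
  assumes "i \<in> {1, 2, 3}" "j \<in> {1, 2, 3}" "i \<noteq> j" "x \<in> cone_sector i"
  shows "x \<notin> cone_sector j"
proof -
  have 12: "\<not> (x \<in> cone_sector 1 \<and> x \<in> cone_sector 2)"
    using cross2_commute[of x "dir 1"] by (auto simp: cone_sector_def cone2_def)
  have 23: "\<not> (x \<in> cone_sector 2 \<and> x \<in> cone_sector 3)"
    using cross2_commute[of x "dir 2"] by (auto simp: cone_sector_def cone2_def)
  have 31: "\<not> (x \<in> cone_sector 3 \<and> x \<in> cone_sector 1)"
    using cross2_commute[of x "dir 0"] by (auto simp: cone_sector_def cone2_def dir_3)
  show ?thesis using assms 12 23 31 by auto
qed

lemma ray_borel [measurable]: "ray r k \<in> sets borel"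
proof -
  have pp: "dir k \<bullet> dir k = 1" using norm_dir[of k] by (simp add: dot_square_norm)
  have "ray r k = range (\<lambda>t. t *\<^sub>R dir k) \<inter> (\<lambda>x. x \<bullet> dir k) -` {0<..<r}"
    using pp by (auto simp: ray_def)
  moreover have "(\<lambda>x. x \<bullet> dir k) -` {0<..<r} \<in> sets borel"
    by (rule measurable_sets_borel[OF borel_measurable_inner]) auto
  ultimately show ?thesis using line_borel[of "dir k"] by auto
qed

lemma ray_subset: "ray r k \<subseteq> ball 0 r"
  by (auto simp: ray_def)

lemma ray_disjoint:
  assumes "k < 3" "l < 3" "k \<noteq> l" "x \<in> ray r k"
  shows "x \<notin> ray r l"
proof
  assume "x \<in> ray r l"
  then obtain s t where s: "0 < s" "x = s *\<^sub>R dir k" and t: "0 < t" "x = t *\<^sub>R dir l"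
    using assms(4) by (auto simp: ray_def)
  have "norm x = s" unfolding s(2) using s(1) by simp
  moreover have "norm x = t" unfolding t(2) using t(1) by simp
  ultimately have "s = t" by simp
  then have "t *\<^sub>R dir k = t *\<^sub>R dir l" using s(2) t(2) by metis
  then have eq: "dir k = dir l" using t(1) by simp
  have ne: "dir 0 \<noteq> dir 1" "dir 1 \<noteq> dir 2" "dir 2 \<noteq> dir 0"
    using cross2_dir_Suc[of 0] cross2_dir_Suc[of 1] cross2_dir_Suc[of 2] dir_3
    by (auto simp: cross2_def numeral_2_eq_2 numeral_3_eq_3)
  show False using eq ne assms(1-3) by (auto simp: less_Suc_eq numeral_3_eq_3 numeral_2_eq_2)
qed

lemma ray_null: "ray r k \<in> null_sets lborel"
proof -
  have "perp (dir k) \<noteq> 0" using norm_perp[of "dir k"] by (metis norm_dir norm_zero zero_neq_one)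
  then have 1: "{z. z \<bullet> perp (dir k) = 0} \<in> null_sets lborel" by (rule hyperplane_null_sets_lborel)
  have 2: "ray r k \<subseteq> {z. z \<bullet> perp (dir k) = 0}"
    by (auto simp: ray_def inner_commute[of _ "perp _"] perp_inner cross2_def)
  have 3: "ray r k \<in> sets lborel" by simp
  show ?thesis by (rule null_sets_subset[OF 1 3 2])
qed

lemma hausdorff1_outer_singleton: "hausdorff1_outer {x :: plane} = 0"
proof -
  have "hausdorff1_outer {x} \<le> 0"
  proof (rule hausdorff1_outer_least)
    fix \<delta> :: real assume "0 < \<delta>"
    then show "hausdorff1_pre \<delta> {x} \<le> 0"
      using hausdorff1_pre_le[of "{x}" "\<lambda>_. {x}" \<delta>] by simp
  qed
  then show ?thesis by simp
qed

lemma hausdorff1_outer_ray: "0 < r \<Longrightarrow> hausdorff1_outer (ray r k) \<le> ennreal r"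
  unfolding ray_def
  by (rule order_trans[OF hausdorff1_outer_mono hausdorff1_outer_segment[of "dir k" 0 r, simplified]]) auto

section \<open>Discontinuity set and jumps of the three-valued function\<close>

locale triple_junction =
  fixes r :: real and a :: "nat \<Rightarrow> real" and u :: "plane \<Rightarrow> real"
  assumes r: "0 < r" and a12: "a 1 < a 2" and a23: "a 2 < a 3"
    and u: "\<And>i x. i \<in> {1, 2, 3} \<Longrightarrow> x \<in> sector r i \<Longrightarrow> x \<noteq> 0 \<Longrightarrow> u x = a i"
begin

text \<open>The values in cyclic order: \<open>av k\<close> and \<open>av (Suc k)\<close> are those
  on the clockwise and the counterclockwise side of the ray in direction \<open>dir k\<close>, and
  index 0 stands for the third sector.\<close>

definition "av k = (if k = 0 then a 3 else a k)"

lemma u_cone: "i \<in> {1, 2, 3} \<Longrightarrow> x \<in> cone_sector i \<Longrightarrow> x \<in> ball 0 r \<Longrightarrow> u x = a i"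
proof -
  assume i: "i \<in> {1, 2, 3}" "x \<in> cone_sector i" "x \<in> ball 0 r"
  have "x \<noteq> 0" using i(2) by (auto simp: cone_sector_def cone2_def cross2_def)
  then show ?thesis using u[OF i(1)] cone_sector_subset_sector[OF i(2,3,1)] by blast
qed

definition "rays = ray r 0 \<union> ray r 1 \<union> ray r 2"

lemma rays_borel [measurable]: "rays \<in> sets borel"
  unfolding rays_def by measurable

lemma approx_limit_u:
  assumes i: "i \<in> {1, 2, 3}" "x \<in> cone_sector i" "x \<in> ball 0 r"
  shows "approx_limit u x (a i)"
proof -
  have "open (cone_sector i \<inter> ball 0 r)" by (simp add: cone_sector_def open_cone2 open_Int)
  then obtain e where e: "0 < e" "ball x e \<subseteq> cone_sector i \<inter> ball 0 r" using i openE by blast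
  have "eventually (\<lambda>\<rho>. (LINT y:ball x \<rho>|lebesgue. \<bar>u y - a i\<bar>) / \<rho>\<^sup>2 = 0) (at_right 0)"
    using eventually_at_right_less[of 0] eventually_at_right_real[OF e(1)]
  proof eventually_elim
    case (elim \<rho>)
    have z: "indicator (ball x \<rho>) y *\<^sub>R \<bar>u y - a i\<bar> = 0" for y
    proof (cases "y \<in> ball x \<rho>")
      case True
      then have "y \<in> ball x e" using elim by auto
      then have "y \<in> cone_sector i" "y \<in> ball 0 r" using e(2) by blast+
      then show ?thesis using u_cone[OF i(1)] by simp
    qed simp
    show ?case unfolding set_lebesgue_integral_def z by simp
  qed
  then show ?thesis unfolding approx_limit_def by (rule tendsto_eventually)
qed

text \<open>Near a point of the ray the outer edges of the two adjacent sectors are out of reach, so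
  the side of the ray alone decides in which sector a nearby point lies.\<close>

lemma ray_sides:
  assumes k: "k \<in> {0, 1, 2}" "x \<in> ray r k"
  obtains e where "0 < e" "\<And>y. y \<in> ball x e \<Longrightarrow> 0 < (y - x) \<bullet> perp (dir k) \<Longrightarrow> u y = av (Suc k)"
    "\<And>y. y \<in> ball x e \<Longrightarrow> 0 < (y - x) \<bullet> - perp (dir k) \<Longrightarrow> u y = av k" "ball x e \<subseteq> ball 0 r"
proof -
  obtain t where t: "0 < t" "t < r" "x = t *\<^sub>R dir k" using k(2) by (auto simp: ray_def)
  \<comment> \<open>The sector on the clockwise side has index \<open>k\<close>, read cyclically in
    \<open>{1, 2, 3}\<close>, so that the subtraction \<open>k' - 1\<close> is not
    truncated.\<close>
  define k' where "k' = (if k = 0 then 3 else k)"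
  have k': "k' \<in> {1, 2, 3}" "dir k' = dir k" "dir (Suc (k' - 1)) = dir k" "av k = a k'" "Suc k \<in> {1, 2, 3}" "av (Suc k) = a (Suc k)"
    using k(1) dir_3 by (auto simp: k'_def av_def)
  let ?S = "{y. 0 < cross2 y (dir (Suc k))} \<inter> {y. 0 < cross2 (dir (k' - 1)) y} \<inter> ball 0 r"
  have "open ?S" by (intro open_Int open_Collect_less continuous_intros) auto
  moreover have "x \<in> ?S"
  proof -
    have pos: "0 < t * (sqrt 3 / 2)" using t(1) by simp
    have "cross2 x (dir (Suc k)) = t * cross2 (dir k) (dir (Suc k))" by (simp add: t(3) cross2_def algebra_simps)
    then have "0 < cross2 x (dir (Suc k))" unfolding cross2_dir_Suc using pos by linarith
    moreover have "cross2 (dir (k' - 1)) x = t * cross2 (dir (k' - 1)) (dir (Suc (k' - 1)))"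
      unfolding k'(3) by (simp add: t(3) cross2_def algebra_simps)
    then have "0 < cross2 (dir (k' - 1)) x" unfolding cross2_dir_Suc using pos by linarith
    moreover have "norm x < r" unfolding t(3) using t(1,2) by simp
    ultimately show ?thesis by simp
  qed
  ultimately obtain e where e: "0 < e" "ball x e \<subseteq> ?S" using openE by blast
  have px: "x \<bullet> perp (dir k) = 0" by (simp add: t(3) inner_commute[of _ "perp _"] perp_inner cross2_def)
  show ?thesis
  proof (rule that[OF e(1)])
    fix y assume y: "y \<in> ball x e" "0 < (y - x) \<bullet> perp (dir k)"
    then have "0 < cross2 (dir k) y" using px by (simp add: inner_diff_left inner_commute[of y] perp_inner)
    then have "y \<in> cone_sector (Suc k)" using e(2) y by (auto simp: cone_sector_def cone2_def)
    then show "u y = av (Suc k)" using u_cone[OF k'(5), of y] e(2) y k'(6) by auto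
  next
    fix y assume y: "y \<in> ball x e" "0 < (y - x) \<bullet> - perp (dir k)"
    then have "0 < cross2 y (dir k')"
      using px k'(2) cross2_commute[of y "dir k"] by (simp add: inner_diff_left inner_commute[of y] perp_inner)
    then have "y \<in> cone_sector k'" using e(2) y by (auto simp: cone_sector_def cone2_def)
    then show "u y = av k" using u_cone[OF k'(1), of y] e(2) y k'(4) by auto
  qed (use e in auto)
qed

lemma jump_triple_u:
  assumes k: "k \<in> {0, 1, 2}" "x \<in> ray r k"
  shows "jump_triple u x (av (Suc k)) (av k) (perp (dir k))"
proof -
  obtain e where e: "0 < e" "\<And>y. y \<in> ball x e \<Longrightarrow> 0 < (y - x) \<bullet> perp (dir k) \<Longrightarrow> u y = av (Suc k)"
    "\<And>y. y \<in> ball x e \<Longrightarrow> 0 < (y - x) \<bullet> - perp (dir k) \<Longrightarrow> u y = av k"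
    by (rule ray_sides[OF k]) blast
  have side: "approx_limit_side u x n c" if "\<And>y. y \<in> ball x e \<Longrightarrow> 0 < (y - x) \<bullet> n \<Longrightarrow> u y = c" for n c
  proof -
    have "eventually (\<lambda>\<rho>. (LINT y:(ball x \<rho> \<inter> {y. (y - x) \<bullet> n > 0})|lebesgue. \<bar>u y - c\<bar>) / \<rho>\<^sup>2 = 0) (at_right 0)"
      using eventually_at_right_real[OF e(1)]
    proof eventually_elim
      case (elim \<rho>)
      have "(\<lambda>y. indicator (ball x \<rho> \<inter> {y. (y - x) \<bullet> n > 0}) y *\<^sub>R \<bar>u y - c\<bar>) = (\<lambda>_. 0)"
        using that elim by (auto simp: indicator_def fun_eq_iff)
      then show ?case unfolding set_lebesgue_integral_def by (simp only:) simp
    qed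
    then show ?thesis unfolding approx_limit_side_def by (rule tendsto_eventually)
  qed
  have "av (Suc k) \<noteq> av k" using k(1) a12 a23 by (auto simp: av_def numeral_2_eq_2 numeral_3_eq_3)
  moreover have "approx_limit_side u x (perp (dir k)) (av (Suc k))" by (rule side) (rule e(2))
  moreover have "approx_limit_side u x (- perp (dir k)) (av k)" by (rule side) (rule e(3))
  ultimately show ?thesis unfolding jump_triple_def by simp
qed

text \<open>Off the rays and the origin, a Borel null set, the function agrees with a combination of
  indicators of open cones; completeness of Lebesgue measure carries measurability over.\<close>

lemma u_measurable: "(\<lambda>x. indicator (ball 0 r) x * u x) \<in> borel_measurable lebesgue"
  and u_AE: "AE x in lborel. indicator (ball 0 r) x * u x = (\<Sum>i\<in>{1, 2, 3}. a i * indicator (cone_sector i \<inter> ball 0 r) x)"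
proof -
  let ?f = "\<lambda>x. \<Sum>i\<in>{1, 2, 3}. a i * indicator (cone_sector i \<inter> ball 0 r) x"
  have null: "rays \<union> {0} \<in> null_sets lborel"
    unfolding rays_def by (intro null_sets.Un ray_null) (auto simp: null_sets_def)
  have eq: "indicator (ball 0 r) x * u x = ?f x" if "x \<notin> rays \<union> {0}" for x
  proof (cases "x \<in> ball 0 r")
    case True
    have x0: "x \<noteq> 0" "x \<notin> ray r 0" "x \<notin> ray r 1" "x \<notin> ray r 2" using that by (auto simp: rays_def)
    have "\<exists>i\<in>{1, 2, 3}. x \<in> cone_sector i"
      by (rule plane_cover[OF True x0(1)]) (use x0 in auto)
    then obtain i where i: "i \<in> {1, 2, 3}" "x \<in> cone_sector i" by blast
    have "?f x = (\<Sum>j\<in>{1, 2, 3}. if j = i then a i else 0)"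
      using i True cone_sector_disjoint[OF i(1)] by (intro sum.cong) (auto simp: indicator_def)
    also have "\<dots> = a i" using i(1) by (subst sum.delta) auto
    finally show ?thesis using u_cone[OF i] True by simp
  qed simp
  then show AE: "AE x in lborel. indicator (ball 0 r) x * u x = ?f x"
    using AE_not_in[OF null] by (auto elim: eventually_mono)
  have fm: "?f \<in> borel_measurable lebesgue"
    by (intro measurable_completion borel_measurable_sum borel_measurable_times borel_measurable_const
        borel_measurable_indicator) (auto simp: cone_sector_def)
  have "AE x in lebesgue. ?f x = indicator (ball 0 r) x * u x"
    using AE_completion[OF AE] by (auto elim: eventually_mono)
  with fm show "(\<lambda>x. indicator (ball 0 r) x * u x) \<in> borel_measurable lebesgue"
    by (rule borel_measurable_AE)
qed

lemma u_integrable: "set_integrable lebesgue (ball 0 r) u"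
proof -
  let ?f = "\<lambda>x. \<Sum>i\<in>{1, 2, 3}. a i * indicator (cone_sector i \<inter> ball 0 r) x"
  have "integrable lborel ?f"
  proof (intro Bochner_Integration.integrable_sum integrable_mult_right integrable_real_indicator)
    fix i
    show "cone_sector i \<inter> ball 0 r \<in> sets lborel" by (auto simp: cone_sector_def)
    have "emeasure lborel (cone_sector i \<inter> ball 0 r) \<le> emeasure lborel (ball (0::plane) r)" by (intro emeasure_mono) auto
    also have "\<dots> < \<infinity>" by (rule emeasure_lborel_ball_finite)
    finally show "emeasure lborel (cone_sector i \<inter> ball 0 r) < \<infinity>" .
  qed
  then have "integrable lebesgue ?f" by (simp add: integrable_completion)
  then have "integrable lebesgue (\<lambda>x. indicator (ball 0 r) x * u x)"
    by (rule integrable_cong_AE_imp) (use u_measurable AE_completion[OF u_AE] in \<open>auto elim: eventually_mono\<close>)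
  then show ?thesis by (simp add: set_integrable_def)
qed

text \<open>The disk of radius \<open>\<rho> / 2\<close> that touches the dividing line at
  \<open>x\<close> lies in the half disk and has area \<open>pi * \<rho>\<^sup>2 / 4\<close>. If
  \<open>c\<close> differed from \<open>d\<close>, the averages would stay above
  \<open>pi / 4 * \<bar>d - c\<bar>\<close>.\<close>

lemma approx_limit_half_ball:
  assumes lim: "approx_limit u x c" and n: "norm n = 1" and e: "0 < e" "ball x e \<subseteq> ball 0 r"
    and d: "\<And>y. y \<in> ball x e \<Longrightarrow> 0 < (y - x) \<bullet> n \<Longrightarrow> u y = d"
  shows "c = d"
proof (rule ccontr)
  assume "c \<noteq> d"
  have nn: "n \<bullet> n = 1" using n by (simp add: dot_square_norm)
  have ev: "eventually (\<lambda>\<rho>. pi / 4 * \<bar>d - c\<bar> \<le> (LINT y:ball x \<rho>|lebesgue. \<bar>u y - c\<bar>) / \<rho>\<^sup>2) (at_right 0)"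
    using eventually_at_right_real[OF e(1)]
  proof eventually_elim
    case (elim \<rho>)
    then have \<rho>: "0 < \<rho>" "\<rho> < e" by auto
    let ?B = "ball (x + (\<rho> / 2) *\<^sub>R n) (\<rho> / 2)"
    have Bsub: "?B \<subseteq> ball x \<rho>"
    proof
      fix y assume "y \<in> ?B"
      moreover have "dist x (x + (\<rho> / 2) *\<^sub>R n) = \<rho> / 2" using n \<rho> by (simp add: dist_norm)
      ultimately show "y \<in> ball x \<rho>" using dist_triangle[of x y "x + (\<rho> / 2) *\<^sub>R n"] by simp
    qed
    have Bu: "u y = d" if "y \<in> ?B" for y
    proof (rule d)
      show "y \<in> ball x e" using that Bsub \<rho> by auto
      have "\<bar>(y - (x + (\<rho> / 2) *\<^sub>R n)) \<bullet> n\<bar> \<le> norm (y - (x + (\<rho> / 2) *\<^sub>R n))"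
        using Cauchy_Schwarz_ineq2[of "y - (x + (\<rho> / 2) *\<^sub>R n)" n] n by simp
      also have "\<dots> < \<rho> / 2" using that by (simp add: dist_norm norm_minus_commute)
      finally have "\<bar>(y - (x + (\<rho> / 2) *\<^sub>R n)) \<bullet> n\<bar> < \<rho> / 2" .
      moreover have "(y - (x + (\<rho> / 2) *\<^sub>R n)) \<bullet> n = (y - x) \<bullet> n - \<rho> / 2"
        by (simp add: inner_diff_left inner_add_left nn)
      ultimately show "0 < (y - x) \<bullet> n" by linarith
    qed
    have i: "integrable lebesgue (\<lambda>y. indicator (ball x \<rho>) y *\<^sub>R \<bar>u y - c\<bar>)"
    proof -
      have s: "ball x \<rho> \<subseteq> ball 0 r" using e(2) \<rho> by (meson order_trans subset_ball less_imp_le)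
      have fin: "integrable lebesgue (indicator (ball x \<rho>) :: plane \<Rightarrow> real)"
        by (rule integrable_real_indicator) (auto simp: emeasure_lborel_ball_finite[unfolded infinity_ennreal_def])
      have "set_integrable lebesgue (ball x \<rho>) u" by (rule set_integrable_subset[OF u_integrable _ s]) simp
      then have "integrable lebesgue (\<lambda>y. \<bar>indicator (ball x \<rho>) y * u y - indicator (ball x \<rho>) y * c\<bar>)"
        unfolding set_integrable_def using fin by (intro integrable_abs Bochner_Integration.integrable_diff integrable_mult_left) auto
      also have "(\<lambda>y. \<bar>indicator (ball x \<rho>) y * u y - indicator (ball x \<rho>) y * c\<bar>) = (\<lambda>y. indicator (ball x \<rho>) y *\<^sub>R \<bar>u y - c\<bar>)"
        by (auto simp: indicator_def)
      finally show ?thesis .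
    qed
    have "pi / 4 * \<bar>d - c\<bar> * \<rho>\<^sup>2 = (\<integral>y. \<bar>d - c\<bar> * indicator ?B y \<partial>lebesgue)"
      using \<rho> by (simp add: content_ball unit_ball_vol_2 power2_eq_square)
    also have "\<dots> \<le> (\<integral>y. indicator (ball x \<rho>) y *\<^sub>R \<bar>u y - c\<bar> \<partial>lebesgue)"
    proof (rule integral_mono'[OF i])
      fix y
      show "\<bar>d - c\<bar> * indicator ?B y \<le> indicator (ball x \<rho>) y *\<^sub>R \<bar>u y - c\<bar>"
      proof (cases "y \<in> ?B")
        case True
        then have "y \<in> ball x \<rho>" using Bsub by blast
        then show ?thesis using True Bu[OF True] by simp
      qed simp
    qed simp
    finally show ?case using \<rho> by (simp add: set_lebesgue_integral_def le_divide_eq)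
  qed
  have "pi / 4 * \<bar>d - c\<bar> \<le> 0"
    by (rule tendsto_lowerbound[OF lim[unfolded approx_limit_def] ev]) simp
  moreover have "0 < pi / 4 * \<bar>d - c\<bar>" using \<open>c \<noteq> d\<close> by simp
  ultimately show False by linarith
qed

text \<open>An approximate limit at a point of a ray would have to equal the distinct values on both
  sides.\<close>

lemma rays_approx_discont: "rays \<subseteq> approx_discont (ball 0 r) u"
proof
  fix x assume "x \<in> rays"
  then obtain k where k: "k \<in> {0, 1, 2}" "x \<in> ray r k" by (auto simp: rays_def)
  obtain e where e: "0 < e" "\<And>y. y \<in> ball x e \<Longrightarrow> 0 < (y - x) \<bullet> perp (dir k) \<Longrightarrow> u y = av (Suc k)"
    "\<And>y. y \<in> ball x e \<Longrightarrow> 0 < (y - x) \<bullet> - perp (dir k) \<Longrightarrow> u y = av k" "ball x e \<subseteq> ball 0 r"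
    by (rule ray_sides[OF k]) blast
  have "av (Suc k) \<noteq> av k" using jump_triple_u[OF k] by (simp add: jump_triple_def)
  moreover have "c = av (Suc k)" "c = av k" if "approx_limit u x c" for c
    using approx_limit_half_ball[OF that _ e(1,4), of "perp (dir k)" "av (Suc k)"]
      approx_limit_half_ball[OF that _ e(1,4), of "- perp (dir k)" "av k"] e(2,3) by auto
  ultimately show "x \<in> approx_discont (ball 0 r) u"
    using k ray_subset[of r k] by (auto simp: approx_discont_def)
qed

lemma approx_discont_u: "approx_discont (ball 0 r) u \<subseteq> rays \<union> {0}"
proof
  fix x assume x: "x \<in> approx_discont (ball 0 r) u"
  then have b: "x \<in> ball 0 r" by (simp add: approx_discont_def)
  show "x \<in> rays \<union> {0}"
  proof (cases "x = 0")
    case False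
    show ?thesis
    proof (rule plane_cover[OF b False])
      fix i assume "i \<in> {1, 2, 3}" "x \<in> cone_sector i"
      then have "approx_limit u x (a i)" using b by (intro approx_limit_u)
      then show ?thesis using x by (auto simp: approx_discont_def)
    qed (auto simp: rays_def)
  qed simp
qed

text \<open>The origin is the one point in doubt, and the set is Borel whether or not it contains
  the origin.\<close>

lemma approx_discont_u_borel [measurable]: "approx_discont (ball 0 r) u \<in> sets borel"
proof -
  have "approx_discont (ball 0 r) u = rays \<or> approx_discont (ball 0 r) u = rays \<union> {0}"
    using approx_discont_u rays_approx_discont by auto
  then show ?thesis by auto
qed

lemma hausdorff1_approx_discont_u: "hausdorff1_outer (approx_discont (ball 0 r) u) \<le> ennreal (3 * r)"
proof -
  have "hausdorff1_outer (approx_discont (ball 0 r) u) \<le> hausdorff1_outer (((ray r 0 \<union> ray r 1) \<union> ray r 2) \<union> {0})"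
    using approx_discont_u by (intro hausdorff1_outer_mono) (simp add: rays_def)
  also have "\<dots> \<le> ((hausdorff1_outer (ray r 0) + hausdorff1_outer (ray r 1)) + hausdorff1_outer (ray r 2)) + hausdorff1_outer {0::plane}"
    by (intro order_trans[OF hausdorff1_outer_Un] add_mono order_refl)
  also have "\<dots> \<le> ((ennreal r + ennreal r) + ennreal r) + 0"
    using r by (intro add_mono hausdorff1_outer_ray) (simp_all add: hausdorff1_outer_singleton)
  also have "\<dots> = ennreal (3 * r)" using r by (simp add: ennreal_plus[symmetric] del: ennreal_plus)
  finally show ?thesis .
qed

end

section \<open>The derivative measure of the three-valued function\<close>

lemma
  fixes h :: "plane \<Rightarrow> 'b::{banach,second_countable_topology}"
  assumes [measurable]: "h \<in> borel_measurable borel"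
  shows integrable_hausdorff1_ray: "integrable hausdorff1 (\<lambda>x. indicator (ray r k) x *\<^sub>R h x)
      \<longleftrightarrow> integrable lborel (\<lambda>t. indicator {0<..<r} t *\<^sub>R h (t *\<^sub>R dir k))" (is ?A)
    and integral_hausdorff1_ray: "(\<integral>x. indicator (ray r k) x *\<^sub>R h x \<partial>hausdorff1)
      = (\<integral>t. indicator {0<..<r} t *\<^sub>R h (t *\<^sub>R dir k) \<partial>lborel)" (is ?B)
proof -
  have pp: "dir k \<bullet> dir k = 1" using norm_dir[of k] by (simp add: dot_square_norm)
  let ?f = "\<lambda>x. indicator {0<..<r} (x \<bullet> dir k) *\<^sub>R h x"
  have fm: "?f \<in> borel_measurable borel" by measurable
  have eq: "(\<lambda>x. indicator (range (\<lambda>t. t *\<^sub>R dir k)) x *\<^sub>R ?f x) = (\<lambda>x. indicator (ray r k) x *\<^sub>R h x)"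
    using pp by (auto simp: fun_eq_iff indicator_def ray_def)
  have eq2: "(\<lambda>t. ?f (t *\<^sub>R dir k)) = (\<lambda>t. indicator {0<..<r} t *\<^sub>R h (t *\<^sub>R dir k))"
    using pp by simp
  show ?A using set_integrable_hausdorff1_line[OF norm_dir fm, of k] unfolding set_integrable_def eq eq2 .
  show ?B using integral_hausdorff1_line[OF norm_dir fm, of k] unfolding set_lebesgue_integral_def eq eq2 .
qed

text \<open>Each component is replaced by a Borel representative and tested on the sets where this
  is positive or negative.\<close>

lemma AE_eq_0_if_set_integrals_0:
  fixes h :: "plane \<Rightarrow> plane"
  assumes h: "integrable lebesgue h" and zero: "\<And>B. B \<in> sets borel \<Longrightarrow> (LINT x:B|lebesgue. h x) = 0"
  shows "AE x in lebesgue. h x = 0"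
proof -
  have comp: "AE x in lebesgue. h x $ i = 0" for i
  proof -
    have hi: "integrable lebesgue (\<lambda>x. h x $ i)"
      using integrable_inner_left[OF h, of "axis i 1"] by (simp add: inner_axis)
    then obtain h' where h'[measurable]: "h' \<in> borel_measurable borel" and eq: "AE x in lborel. h x $ i = h' x"
      using completion_ex_borel_measurable_real[of "\<lambda>x. h x $ i" lborel] by auto
    have eqc: "AE x in lebesgue. h x $ i = h' x" using eq by (rule AE_completion)
    have h'i: "integrable lebesgue h'"
      by (rule integrable_cong_AE_imp[OF hi]) (use eqc in \<open>auto elim: eventually_mono intro: measurable_completion\<close>)
    have int0: "(\<integral>x. indicator B x * h' x \<partial>lebesgue) = 0" if [measurable]: "B \<in> sets borel" for B
    proof -
      have "(\<integral>x. indicator B x * h' x \<partial>lebesgue) = (\<integral>x. (indicator B x *\<^sub>R h x) \<bullet> axis i 1 \<partial>lebesgue)"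
      proof (rule integral_cong_AE)
        show "(\<lambda>x. indicator B x * h' x) \<in> borel_measurable lebesgue" by (intro measurable_completion) measurable
        show "(\<lambda>x. (indicator B x *\<^sub>R h x) \<bullet> axis i 1) \<in> borel_measurable lebesgue"
          using h by (intro borel_measurable_inner borel_measurable_scaleR borel_measurable_indicator) auto
        show "AE x in lebesgue. indicator B x * h' x = (indicator B x *\<^sub>R h x) \<bullet> axis i 1"
          using eqc by eventually_elim (simp add: inner_axis)
      qed
      also have "\<dots> = (LINT x:B|lebesgue. h x) \<bullet> axis i 1"
        unfolding set_lebesgue_integral_def using h
        by (intro integral_inner_left) (auto intro!: integrable_mult_indicator)
      finally show ?thesis using zero[OF that] by simp
    qed
    have [measurable]: "{x. 0 < h' x} \<in> sets borel" "{x. h' x < 0} \<in> sets borel" by measurable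
    have "(\<integral>x. \<bar>h' x\<bar> \<partial>lebesgue) = (\<integral>x. indicator {x. 0 < h' x} x * h' x - indicator {x. h' x < 0} x * h' x \<partial>lebesgue)"
      by (intro Bochner_Integration.integral_cong) (auto simp: indicator_def)
    also have "\<dots> = 0"
    proof -
      have "integrable lebesgue (\<lambda>x. indicator B x * h' x)" if "B \<in> sets borel" for B
        using integrable_mult_indicator[OF _ h'i, of B] that by simp
      then show ?thesis by (subst Bochner_Integration.integral_diff) (simp_all add: int0)
    qed
    finally have "AE x in lebesgue. \<bar>h' x\<bar> = 0"
      using integral_nonneg_eq_0_iff_AE[of lebesgue "\<lambda>x. \<bar>h' x\<bar>"] h'i by auto
    with eqc show ?thesis by eventually_elim simp
  qed
  from comp[of 1] comp[of 2] show ?thesis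
    by eventually_elim (simp add: vec_eq_iff forall_2)
qed

lemma approx_gradient_props:
  assumes "is_derivative_measure \<Omega> v (derivative_measure \<Omega> v)" "\<Omega> \<in> sets borel"
  shows "set_integrable lebesgue \<Omega> (approx_gradient \<Omega> v) \<and>
        (\<exists>N\<in>null_sets lborel. \<forall>B\<in>sets borel. B \<subseteq> \<Omega> - N \<longrightarrow>
           derivative_measure \<Omega> v B = (LINT x:B|lebesgue. approx_gradient \<Omega> v x))"
  unfolding approx_gradient_def by (rule someI_ex[OF approx_gradient_exists[OF assms]])

lemma BV_derivative_measure:
  "v \<in> BV \<Omega> \<Longrightarrow> is_derivative_measure \<Omega> v (derivative_measure \<Omega> v)"
  unfolding BV_def derivative_measure_def by (intro someI_ex[of "is_derivative_measure \<Omega> v"]) simp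

context triple_junction
begin

text \<open>Off the rays the index takes the default value 2; the formula \<open>jvec_eq\<close>
  masks it by the indicator of \<open>rays\<close>.\<close>

definition "idx x = (if x \<in> ray r 0 then 0 else if x \<in> ray r 1 then 1 else (2::nat))"

definition "jmp k = (av (Suc k) - av k) *\<^sub>R perp (dir k)"

text \<open>The jump density as a sum over the three rays, the form suited to integration;
  \<open>jvec_eq\<close> gives the pointwise form that matches the definition of
  \<open>SBV\<close>.\<close>

definition "jvec x = (\<Sum>k\<in>{0, 1, 2}. indicator (ray r k) x *\<^sub>R jmp k)"

lemma idx_ray: "k \<in> {0, 1, 2} \<Longrightarrow> x \<in> ray r k \<Longrightarrow> idx x = k"
  using ray_disjoint[of k 0 x r] ray_disjoint[of k 1 x r] by (auto simp: idx_def)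

lemma jvec_eq: "jvec x = indicator rays x *\<^sub>R jmp (idx x)"
proof (cases "x \<in> rays")
  case True
  then obtain k where k: "k \<in> {0, 1, 2}" "x \<in> ray r k" by (auto simp: rays_def)
  have "jvec x = (\<Sum>l\<in>{0, 1, 2}. if l = k then jmp k else 0)"
    unfolding jvec_def
  proof (rule sum.cong)
    fix l :: nat assume "l \<in> {0, 1, 2}"
    then show "indicator (ray r l) x *\<^sub>R jmp l = (if l = k then jmp k else 0)"
      using k ray_disjoint[of k l x r] by (cases "l = k") (auto simp: indicator_def)
  qed simp
  also have "\<dots> = jmp k" using k(1) by (subst sum.delta) auto
  finally show ?thesis using True idx_ray[OF k] by simp
next
  case False
  then have "jvec x = 0" unfolding jvec_def by (intro sum.neutral) (auto simp: rays_def)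
  then show ?thesis using False by simp
qed

lemma jvec_measurable [measurable]: "jvec \<in> borel_measurable borel"
  unfolding jvec_def[abs_def] by measurable

lemma hausdorff1_jvec:
  assumes [measurable]: "h \<in> borel_measurable borel" and b: "\<And>x. \<bar>h x\<bar> \<le> B"
  shows "integrable hausdorff1 (\<lambda>x. h x *\<^sub>R jvec x)"
    and "(\<integral>x. h x *\<^sub>R jvec x \<partial>hausdorff1) = (\<Sum>k\<in>{0, 1, 2}. (\<integral>t. indicator {0<..<r} t * h (t *\<^sub>R dir k) \<partial>lborel) *\<^sub>R jmp k)"
proof -
  have eq: "(\<lambda>x. h x *\<^sub>R jvec x) = (\<lambda>x. \<Sum>k\<in>{0, 1, 2}. (indicator (ray r k) x *\<^sub>R h x) *\<^sub>R jmp k)"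
    unfolding jvec_def scaleR_sum_right by (intro ext sum.cong) (simp_all add: mult.commute)
  have i: "integrable hausdorff1 (\<lambda>x. indicator (ray r k) x *\<^sub>R h x)" for k
  proof -
    have "integrable lborel (\<lambda>t. h (t *\<^sub>R dir k) *\<^sub>R (indicator {0<..<r} t :: real))"
    proof (rule integrable_mult_bounded[where B=B])
      show "integrable lborel (indicator {0<..<r} :: real \<Rightarrow> real)" by (rule integrable_real_indicator) (use r in auto)
    qed (use b in auto)
    then show ?thesis by (subst integrable_hausdorff1_ray) (auto simp: mult.commute)
  qed
  show "integrable hausdorff1 (\<lambda>x. h x *\<^sub>R jvec x)"
    unfolding eq using i by (intro Bochner_Integration.integrable_sum integrable_scaleR_left) auto
  show "(\<integral>x. h x *\<^sub>R jvec x \<partial>hausdorff1) = (\<Sum>k\<in>{0, 1, 2}. (\<integral>t. indicator {0<..<r} t * h (t *\<^sub>R dir k) \<partial>lborel) *\<^sub>R jmp k)"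
    unfolding eq using i integral_hausdorff1_ray[of h r]
    by (subst Bochner_Integration.integral_sum) auto
qed

lemma ray_integral_eq:
  assumes "test_function (ball 0 r) \<phi> g"
  shows "(\<integral>t. indicator {0<..<r} t * \<phi> (t *\<^sub>R dir k) \<partial>lborel) = ray_integral \<phi> (dir k)"
proof -
  have "\<phi> x = 0" if "x \<notin> ball 0 r" for x
    using assms that by (auto simp: test_function_def)
  then have z: "\<phi> (t *\<^sub>R dir k) = 0" if "r \<le> t" for t using that r by simp
  have e: "indicator {0<..<r} t * \<phi> (t *\<^sub>R dir k) = indicator {0<..} t * \<phi> (t *\<^sub>R dir k)" for t
    using z[of t] by (cases "t < r") (auto simp: indicator_def)
  show ?thesis unfolding ray_integral_def e ..
qed

lemma sector_gradient:
  assumes tf: "test_function (ball 0 r) \<phi> g" and i: "i \<in> {1, 2, 3}"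
  shows "(\<integral>x. indicator (cone_sector i \<inter> ball 0 r) x *\<^sub>R g x \<partial>lborel)
    = ray_integral \<phi> (dir i) *\<^sub>R perp (dir i) - ray_integral \<phi> (dir (i - 1)) *\<^sub>R perp (dir (i - 1))"
proof -
  obtain A where A: "A \<subseteq> ball 0 r" "\<And>x. x \<notin> A \<Longrightarrow> g x = 0" using test_function_bounds[OF tf] by metis
  have "(\<lambda>x. indicator (cone_sector i \<inter> ball 0 r) x *\<^sub>R g x) = (\<lambda>x. indicator (cone_sector i) x *\<^sub>R g x)"
  proof
    fix x
    show "indicator (cone_sector i \<inter> ball 0 r) x *\<^sub>R g x = indicator (cone_sector i) x *\<^sub>R g x"
    proof (cases "x \<in> ball 0 r")
      case False
      then have "g x = 0" using A by blast
      then show ?thesis by simp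
    qed (simp add: indicator_def)
  qed
  moreover have "Suc (i - 1) = i" using i by auto
  then have "cross2 (dir (i - 1)) (dir i) = sqrt 3 / 2" using cross2_dir_Suc[of "i - 1"] by (simp only:)
  then have "0 < cross2 (dir (i - 1)) (dir i)" by (simp only:) simp
  ultimately show ?thesis unfolding cone_sector_def using cone_gradient[OF tf] by simp
qed

text \<open>The divergence theorem on the three cones produces every ray twice, with opposite
  normals and with the values on its two sides; collecting the terms by rays gives the
  jumps.\<close>

lemma is_derivative_measure_u:
  "is_derivative_measure (ball 0 r) u (\<lambda>B. \<integral>x. indicator B x *\<^sub>R jvec x \<partial>hausdorff1)"
  unfolding is_derivative_measure_def
\<comment> \<open>Hausdorff measure is not finite on the plane, so the representing measure is its
  restriction to the rays.\<close>
proof (intro exI[of _ "density hausdorff1 (\<lambda>x. ennreal (indicator rays x))"] exI[of _ jvec] conjI ballI allI impI)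
  let ?\<mu> = "density hausdorff1 (\<lambda>x. ennreal (indicator rays x))"
  have im[measurable]: "(indicator rays :: plane \<Rightarrow> real) \<in> borel_measurable hausdorff1"
    by (simp cong: measurable_cong_sets)
  have jm[measurable]: "jvec \<in> borel_measurable hausdorff1" using jvec_measurable by (simp cong: measurable_cong_sets)
  have rj: "indicator rays x *\<^sub>R jvec x = jvec x" for x by (cases "x \<in> rays") (simp_all add: jvec_eq)
  show "sets ?\<mu> = sets borel" by simp
  show "finite_measure ?\<mu>"
  proof (rule finite_measureI)
    have "emeasure ?\<mu> (space ?\<mu>) = (\<integral>\<^sup>+x. indicator rays x \<partial>hausdorff1)"
      by (subst emeasure_density) (auto intro!: nn_integral_cong simp: ennreal_indicator)
    also have "\<dots> = hausdorff1_outer rays" by (subst nn_integral_indicator) (auto simp: emeasure_hausdorff1)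
    also have "\<dots> \<le> hausdorff1_outer (approx_discont (ball 0 r) u)" by (rule hausdorff1_outer_mono[OF rays_approx_discont])
    also have "\<dots> \<le> ennreal (3 * r)" by (rule hausdorff1_approx_discont_u)
    finally show "emeasure ?\<mu> (space ?\<mu>) \<noteq> \<infinity>" by (auto simp: top_unique)
  qed
  show "integrable ?\<mu> jvec"
    using hausdorff1_jvec(1)[of "\<lambda>_. 1" 1] by (subst integrable_density) (auto simp: rj)
  have dens: "(\<integral>x. h x *\<^sub>R jvec x \<partial>?\<mu>) = (\<integral>x. h x *\<^sub>R jvec x \<partial>hausdorff1)" if "h \<in> borel_measurable borel" for h
  proof -
    have [measurable]: "h \<in> borel_measurable hausdorff1" using that by (simp cong: measurable_cong_sets)
    have "(\<integral>x. h x *\<^sub>R jvec x \<partial>?\<mu>) = (\<integral>x. indicator rays x *\<^sub>R (h x *\<^sub>R jvec x) \<partial>hausdorff1)"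
      by (rule integral_density) auto
    also have "\<dots> = (\<integral>x. h x *\<^sub>R jvec x \<partial>hausdorff1)"
      by (intro Bochner_Integration.integral_cong refl) (metis rj scaleR_left_commute)
    finally show ?thesis .
  qed
  show "(\<integral>x. indicator B x *\<^sub>R jvec x \<partial>hausdorff1) = (LINT x:B|?\<mu>. jvec x)" if "B \<in> sets borel" for B
    unfolding set_lebesgue_integral_def using that by (intro dens[symmetric]) auto
  fix \<phi> g assume tf: "test_function (ball 0 r) \<phi> g"
  obtain A B where A: "A \<subseteq> ball 0 r" "\<And>x. x \<notin> A \<Longrightarrow> \<phi> x = 0" and B: "\<And>x. \<bar>\<phi> x\<bar> \<le> B" and \<phi>c: "continuous_on UNIV \<phi>"
    using test_function_bounds[OF tf] by metis
  have [measurable]: "\<phi> \<in> borel_measurable borel" using \<phi>c by (rule borel_measurable_continuous_onI)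
  have gi: "integrable lborel g" by (rule integrable_test_function(2)[OF tf])
  have [measurable]: "g \<in> borel_measurable borel" using gi by auto
  have cb[measurable]: "cone_sector i \<inter> ball 0 r \<in> sets borel" for i by (auto simp: cone_sector_def)
  define I where "I k = ray_integral \<phi> (dir k)" for k
  have "(LINT x:ball 0 r|lebesgue. u x *\<^sub>R g x) = (\<integral>x. (indicator (ball 0 r) x * u x) *\<^sub>R g x \<partial>lebesgue)"
    by (simp add: set_lebesgue_integral_def)
  also have "\<dots> = (\<integral>x. (\<Sum>i\<in>{1, 2, 3}. a i * indicator (cone_sector i \<inter> ball 0 r) x) *\<^sub>R g x \<partial>lebesgue)"
  proof (rule integral_cong_AE)
    have [measurable]: "g \<in> borel_measurable lebesgue" by (intro measurable_completion) measurable
    show "(\<lambda>x. (indicator (ball 0 r) x * u x) *\<^sub>R g x) \<in> borel_measurable lebesgue"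
      using u_measurable by measurable
    show "(\<lambda>x. (\<Sum>i\<in>{1, 2, 3}. a i * indicator (cone_sector i \<inter> ball 0 r) x) *\<^sub>R g x) \<in> borel_measurable lebesgue"
      by (intro measurable_completion borel_measurable_scaleR borel_measurable_sum borel_measurable_times
          borel_measurable_const borel_measurable_indicator) auto
    show "AE x in lebesgue. (indicator (ball 0 r) x * u x) *\<^sub>R g x
        = (\<Sum>i\<in>{1, 2, 3}. a i * indicator (cone_sector i \<inter> ball 0 r) x) *\<^sub>R g x"
      using AE_completion[OF u_AE] by eventually_elim simp
  qed
  also have "\<dots> = (\<integral>x. (\<Sum>i\<in>{1, 2, 3}. a i * indicator (cone_sector i \<inter> ball 0 r) x) *\<^sub>R g x \<partial>lborel)"
    by (intro integral_completion borel_measurable_scaleR borel_measurable_sum borel_measurable_times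
          borel_measurable_const borel_measurable_indicator) auto
  also have "\<dots> = (\<integral>x. (\<Sum>i\<in>{1, 2, 3}. a i *\<^sub>R (indicator (cone_sector i \<inter> ball 0 r) x *\<^sub>R g x)) \<partial>lborel)"
    unfolding scaleR_sum_left scaleR_scaleR ..
  also have "\<dots> = (\<Sum>i\<in>{1, 2, 3}. a i *\<^sub>R (\<integral>x. indicator (cone_sector i \<inter> ball 0 r) x *\<^sub>R g x \<partial>lborel))"
  proof -
    have ci: "integrable lborel (\<lambda>x. indicator (cone_sector i \<inter> ball 0 r) x *\<^sub>R g x)" for i
      using integrable_mult_indicator[OF _ gi] cb by simp
    have "(\<integral>x. (\<Sum>i\<in>{1, 2, 3}. a i *\<^sub>R (indicator (cone_sector i \<inter> ball 0 r) x *\<^sub>R g x)) \<partial>lborel)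
        = (\<Sum>i\<in>{1, 2, 3}. \<integral>x. a i *\<^sub>R (indicator (cone_sector i \<inter> ball 0 r) x *\<^sub>R g x) \<partial>lborel)"
      by (intro Bochner_Integration.integral_sum integrable_scaleR_right ci)
    also have "\<dots> = (\<Sum>i\<in>{1, 2, 3}. a i *\<^sub>R (\<integral>x. indicator (cone_sector i \<inter> ball 0 r) x *\<^sub>R g x \<partial>lborel))"
      by (intro sum.cong refl integral_scaleR_right ci)
    finally show ?thesis .
  qed
  also have "\<dots> = (\<Sum>i\<in>{1, 2, 3}. a i *\<^sub>R (I i *\<^sub>R perp (dir i) - I (i - 1) *\<^sub>R perp (dir (i - 1))))"
    by (intro sum.cong refl) (simp only: sector_gradient[OF tf] I_def)
  \<comment> \<open>Summation by parts over the cyclic index; \<open>I 3 = I 0\<close> closes the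
    cycle.\<close>
  also have "\<dots> = - (\<Sum>k\<in>{0, 1, 2}. I k *\<^sub>R jmp k)"
  proof -
    have "I 3 = I 0" by (simp add: I_def dir_3)
    then show ?thesis by (simp add: jmp_def av_def dir_3 algebra_simps numeral_2_eq_2[symmetric] numeral_3_eq_3[symmetric])
  qed
  also have "(\<Sum>k\<in>{0, 1, 2}. I k *\<^sub>R jmp k) = (\<integral>x. \<phi> x *\<^sub>R jvec x \<partial>hausdorff1)"
    unfolding hausdorff1_jvec(2)[OF \<open>\<phi> \<in> borel_measurable borel\<close> B] ray_integral_eq[OF tf] I_def ..
  also have "\<dots> = (\<integral>x. \<phi> x *\<^sub>R jvec x \<partial>?\<mu>)" by (rule dens[symmetric]) measurable
  also have "\<dots> = (LINT x:ball 0 r|?\<mu>. \<phi> x *\<^sub>R jvec x)"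
    unfolding set_lebesgue_integral_def
  proof (intro Bochner_Integration.integral_cong refl)
    fix x
    have "\<phi> x = 0" if "x \<notin> ball 0 r" using A that by blast
    then show "\<phi> x *\<^sub>R jvec x = indicator (ball 0 r) x *\<^sub>R (\<phi> x *\<^sub>R jvec x)" by (cases "x \<in> ball 0 r") auto
  qed
  finally show "(LINT x:ball 0 r|lebesgue. u x *\<^sub>R g x) = - (LINT x:ball 0 r|?\<mu>. \<phi> x *\<^sub>R jvec x)" .
qed

lemma u_BV: "u \<in> BV (ball 0 r)"
  unfolding BV_def using u_integrable is_derivative_measure_u by blast

lemma derivative_measure_u:
  assumes "B \<in> sets borel" "B \<subseteq> ball 0 r"
  shows "derivative_measure (ball 0 r) u B = (\<integral>x. indicator B x *\<^sub>R jvec x \<partial>hausdorff1)"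
proof -
  have "is_derivative_measure (ball 0 r) u (derivative_measure (ball 0 r) u)"
    by (rule BV_derivative_measure[OF u_BV])
  from is_derivative_measure_unique[OF this is_derivative_measure_u r assms] show ?thesis .
qed

text \<open>The approximate gradient is a chosen density, known through its integrals over Borel
  sets off some null set. On the disk without that set and without the rays these integrals vanish
  together with the jump density.\<close>

lemma approx_gradient_u: "AE x in lebesgue. x \<in> ball 0 r \<longrightarrow> approx_gradient (ball 0 r) u x = 0"
  and approx_gradient_u_integrable: "set_integrable lebesgue (ball 0 r) (approx_gradient (ball 0 r) u)"
proof -
  let ?G = "approx_gradient (ball 0 r) u"
  have "is_derivative_measure (ball 0 r) u (derivative_measure (ball 0 r) u)"
    by (rule BV_derivative_measure[OF u_BV])
  then have "set_integrable lebesgue (ball 0 r) ?G \<and>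
        (\<exists>N\<in>null_sets lborel. \<forall>B\<in>sets borel. B \<subseteq> ball 0 r - N \<longrightarrow>
           derivative_measure (ball 0 r) u B = (LINT x:B|lebesgue. ?G x))"
    by (rule approx_gradient_props) simp
  then obtain N where G: "set_integrable lebesgue (ball 0 r) ?G" and N: "N \<in> null_sets lborel"
    and eq: "\<And>B. B \<in> sets borel \<Longrightarrow> B \<subseteq> ball 0 r - N \<Longrightarrow> derivative_measure (ball 0 r) u B = (LINT x:B|lebesgue. ?G x)"
    by blast
  show "set_integrable lebesgue (ball 0 r) ?G" by (rule G)
  define E where "E = ball 0 r - N - rays"
  have Eb: "E \<in> sets borel" using N by (auto simp: E_def)
  have "AE x in lebesgue. indicator E x *\<^sub>R ?G x = 0"
  proof (rule AE_eq_0_if_set_integrals_0)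
    have "set_integrable lebesgue E ?G"
      by (rule set_integrable_subset[OF G]) (use Eb in \<open>auto simp: E_def\<close>)
    then show "integrable lebesgue (\<lambda>x. indicator E x *\<^sub>R ?G x)" by (simp add: set_integrable_def)
    fix B :: "plane set" assume B: "B \<in> sets borel"
    have "(LINT x:B|lebesgue. indicator E x *\<^sub>R ?G x) = (LINT x:B \<inter> E|lebesgue. ?G x)"
      by (simp add: set_lebesgue_integral_def indicator_inter_arith)
    also have "\<dots> = derivative_measure (ball 0 r) u (B \<inter> E)"
      by (rule eq[symmetric]) (use B Eb in \<open>auto simp: E_def\<close>)
    also have "\<dots> = (\<integral>x. indicator (B \<inter> E) x *\<^sub>R jvec x \<partial>hausdorff1)"
      by (rule derivative_measure_u) (use B Eb in \<open>auto simp: E_def\<close>)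
    also have "(\<lambda>x. indicator (B \<inter> E) x *\<^sub>R jvec x) = (\<lambda>x. 0)"
      by (auto simp: jvec_eq E_def indicator_def fun_eq_iff)
    finally show "(LINT x:B|lebesgue. indicator E x *\<^sub>R ?G x) = 0" by simp
  qed
  moreover have "rays \<in> null_sets lborel" unfolding rays_def by (intro null_sets.Un ray_null)
  then have "AE x in lebesgue. x \<notin> rays" by (intro AE_completion AE_not_in)
  moreover have "AE x in lebesgue. x \<notin> N" using N by (intro AE_completion AE_not_in)
  ultimately show "AE x in lebesgue. x \<in> ball 0 r \<longrightarrow> ?G x = 0"
    by eventually_elim (auto simp: E_def indicator_def split: if_splits)
qed

text \<open>The origin has Hausdorff measure zero, so the discontinuity set may be replaced by the
  rays; the gradient term vanishes, and the jump term is the derivative measure already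
  found.\<close>

lemma u_SBV: "u \<in> SBV (ball 0 r)"
proof -
  let ?S = "approx_discont (ball 0 r) u"
  let ?G = "approx_gradient (ball 0 r) u"
  let ?vp = "\<lambda>x. av (Suc (idx x))" and ?vm = "\<lambda>x. av (idx x)" and ?n = "\<lambda>x. perp (dir (idx x))"
  have null0: "{0} \<in> null_sets (hausdorff1 :: plane measure)"
    by (intro null_setsI) (auto simp: emeasure_hausdorff1 hausdorff1_outer_singleton)
  have AE0: "AE x in hausdorff1. x \<noteq> (0::plane)" using AE_not_in[OF null0] by simp
  have j: "AE x in hausdorff1. x \<in> ?S \<longrightarrow> jump_triple u x (?vp x) (?vm x) (?n x)"
    using AE0
  proof eventually_elim
    case (elim x)
    show ?case
    proof
      assume "x \<in> ?S"
      then obtain k where k: "k \<in> {0, 1, 2}" "x \<in> ray r k" using approx_discont_u elim by (auto simp: rays_def)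
      then show "jump_triple u x (?vp x) (?vm x) (?n x)" using jump_triple_u[OF k] idx_ray[OF k] by simp
    qed
  qed
  have jeq: "AE x in hausdorff1. indicator ?S x *\<^sub>R ((?vp x - ?vm x) *\<^sub>R ?n x) = jvec x"
    using AE0
  proof eventually_elim
    case (elim x)
    have "x \<in> ?S \<longleftrightarrow> x \<in> rays" using approx_discont_u rays_approx_discont elim by auto
    then show ?case by (simp add: jvec_eq jmp_def indicator_def)
  qed
  \<comment> \<open>A function of \<open>idx\<close> is constant on each of three Borel sets, hence
    measurable whatever \<open>f\<close> is.\<close>
  have idm: "(\<lambda>x. f (idx x)) \<in> borel_measurable hausdorff1" for f :: "nat \<Rightarrow> 'c::topological_space"
    unfolding idx_def if_distrib[of f] by (subst measurable_cong_sets[OF sets_hausdorff1 refl]) measurable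
  have Sm: "?S \<in> sets hausdorff1" by simp
  have jm: "(\<lambda>x. indicator ?S x *\<^sub>R ((?vp x - ?vm x) *\<^sub>R ?n x)) \<in> borel_measurable hausdorff1"
    by (rule borel_measurable_scaleR[OF borel_measurable_indicator[OF Sm]
          idm[of "\<lambda>k. (av (Suc k) - av k) *\<^sub>R perp (dir k)"]])
  have jvm: "jvec \<in> borel_measurable hausdorff1" using jvec_measurable by (simp cong: measurable_cong_sets)
  have ji: "integrable hausdorff1 jvec" using hausdorff1_jvec(1)[of "\<lambda>_. 1" 1] by simp
  have int: "set_integrable hausdorff1 ?S (\<lambda>x. (?vp x - ?vm x) *\<^sub>R ?n x)"
    unfolding set_integrable_def
    by (rule integrable_cong_AE_imp[OF ji jm]) (use jeq in \<open>auto elim: eventually_mono\<close>)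
  have dm: "derivative_measure (ball 0 r) u B = (LINT x:B|lebesgue. ?G x) + (LINT x:(B \<inter> ?S)|hausdorff1. (?vp x - ?vm x) *\<^sub>R ?n x)"
    if B: "B \<in> sets borel" "B \<subseteq> ball 0 r" for B
  proof -
    have "AE x in lebesgue. indicator B x *\<^sub>R ?G x = 0"
      using approx_gradient_u by eventually_elim (use B in \<open>auto simp: indicator_def\<close>)
    moreover have "set_integrable lebesgue B ?G"
      by (rule set_integrable_subset[OF approx_gradient_u_integrable]) (use B in auto)
    ultimately have "(LINT x:B|lebesgue. ?G x) = 0"
      unfolding set_lebesgue_integral_def set_integrable_def
      by (subst integral_cong_AE[where g="\<lambda>_. 0"]) auto
    moreover have "(LINT x:(B \<inter> ?S)|hausdorff1. (?vp x - ?vm x) *\<^sub>R ?n x) = (\<integral>x. indicator B x *\<^sub>R jvec x \<partial>hausdorff1)"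
      unfolding set_lebesgue_integral_def
    proof (rule integral_cong_AE)
      have Bm: "B \<in> sets hausdorff1" using B by simp
      show "(\<lambda>x. indicator (B \<inter> ?S) x *\<^sub>R ((?vp x - ?vm x) *\<^sub>R ?n x)) \<in> borel_measurable hausdorff1"
        by (rule borel_measurable_scaleR[OF borel_measurable_indicator[OF sets.Int[OF Bm Sm]]
              idm[of "\<lambda>k. (av (Suc k) - av k) *\<^sub>R perp (dir k)"]])
      show "(\<lambda>x. indicator B x *\<^sub>R jvec x) \<in> borel_measurable hausdorff1"
        using jvm Bm by (intro borel_measurable_scaleR borel_measurable_indicator) auto
      show "AE x in hausdorff1. indicator (B \<inter> ?S) x *\<^sub>R ((?vp x - ?vm x) *\<^sub>R ?n x) = indicator B x *\<^sub>R jvec x"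
        using jeq by eventually_elim (auto simp: indicator_def split: if_splits)
    qed
    ultimately show ?thesis using derivative_measure_u[OF B] by simp
  qed
  show ?thesis
    unfolding SBV_def
    by (intro CollectI conjI exI[of _ ?vp] exI[of _ ?vm] exI[of _ ?n] u_BV j int ballI impI dm)
qed

lemma F0_u: "F0 (ball 0 r) u \<le> ennreal (3 * r)"
proof -
  have "(\<integral>\<^sup>+x\<in>ball 0 r. ennreal ((norm (approx_gradient (ball 0 r) u x))\<^sup>2) \<partial>lebesgue) = (\<integral>\<^sup>+x. 0 \<partial>(lebesgue :: plane measure))"
    by (rule nn_integral_cong_AE) (use approx_gradient_u in \<open>eventually_elim, auto simp: indicator_def\<close>)
  then show ?thesis unfolding F0_def using hausdorff1_approx_discont_u by simp
qed

end

section \<open>The calibration inequality\<close>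

text \<open>A competitor is Lebesgue measurable on the disk and arbitrary outside it. Mollification
  is set up for Borel functions integrable on the whole plane, hence this version of the extension
  by zero.\<close>

lemma borel_representative:
  fixes v :: "plane \<Rightarrow> real"
  assumes "set_integrable lebesgue \<Omega> v"
  obtains V where "integrable lborel V" "AE x in lborel. indicator \<Omega> x * v x = V x"
proof -
  have v: "integrable lebesgue (\<lambda>x. indicator \<Omega> x * v x)" using assms by (simp add: set_integrable_def)
  then obtain V where Vm: "V \<in> borel_measurable borel" and eq: "AE x in lborel. indicator \<Omega> x * v x = V x"
    using completion_ex_borel_measurable_real[of "\<lambda>x. indicator \<Omega> x * v x" lborel] by auto
  have "integrable lebesgue V"
    by (rule integrable_cong_AE_imp[OF v]) (use AE_completion[OF eq] Vm in \<open>auto elim: eventually_mono intro: measurable_completion\<close>)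
  then have "integrable lborel V" using Vm by (simp add: integrable_completion)
  then show ?thesis using eq by (rule that)
qed

lemma local_integral_eq:
  fixes v V :: "plane \<Rightarrow> real"
  assumes v: "set_integrable lebesgue \<Omega> v" and V: "integrable lborel V" "AE x in lborel. indicator \<Omega> x * v x = V x"
    and A: "A \<in> sets borel" "A \<subseteq> \<Omega>"
  shows "(LINT y:A|lebesgue. \<bar>v y - t\<bar>) = (\<integral>y. indicator A y * \<bar>V y - t\<bar> \<partial>lborel)"
proof -
  have [measurable]: "V \<in> borel_measurable borel" using V by auto
  note A(1)[measurable]
  have vm: "(\<lambda>x. indicator \<Omega> x * v x) \<in> borel_measurable lebesgue" using v by (auto simp: set_integrable_def)
  have "(LINT y:A|lebesgue. \<bar>v y - t\<bar>) = (\<integral>y. indicator A y * \<bar>indicator \<Omega> y * v y - t\<bar> \<partial>lebesgue)"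
    unfolding set_lebesgue_integral_def using A(2) by (intro Bochner_Integration.integral_cong) (auto simp: indicator_def)
  also have "\<dots> = (\<integral>y. indicator A y * \<bar>V y - t\<bar> \<partial>lebesgue)"
  proof (rule integral_cong_AE)
    show "(\<lambda>y. indicator A y * \<bar>indicator \<Omega> y * v y - t\<bar>) \<in> borel_measurable lebesgue"
      using A(1) by (intro borel_measurable_times[OF borel_measurable_indicator] borel_measurable_abs
          borel_measurable_diff[OF vm]) auto
    show "(\<lambda>y. indicator A y * \<bar>V y - t\<bar>) \<in> borel_measurable lebesgue" by (intro measurable_completion) measurable
    show "AE y in lebesgue. indicator A y * \<bar>indicator \<Omega> y * v y - t\<bar> = indicator A y * \<bar>V y - t\<bar>"
      using AE_completion[OF V(2)] by eventually_elim simp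
  qed
  also have "\<dots> = (\<integral>y. indicator A y * \<bar>V y - t\<bar> \<partial>lborel)" by (rule integral_completion) measurable
  finally show ?thesis .
qed

lemma eventually_ball_subset:
  assumes "open \<Omega>" "x \<in> \<Omega>"
  shows "eventually (\<lambda>\<rho>. ball x \<rho> \<subseteq> \<Omega>) (at_right (0::real))"
proof -
  obtain e where e: "0 < e" "ball x e \<subseteq> \<Omega>" using assms openE by blast
  show ?thesis
    using eventually_at_right_real[OF e(1)]
  proof eventually_elim
    case (elim \<rho>)
    then have "ball x \<rho> \<subseteq> ball x e" by (intro subset_ball) auto
    then show ?case using e(2) by (rule order_trans)
  qed
qed

lemma has_blow_up_approx_limit:
  assumes v: "set_integrable lebesgue \<Omega> v" and V: "integrable lborel V" "AE x in lborel. indicator \<Omega> x * v x = V x"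
    and \<Omega>: "open \<Omega>" "x \<in> \<Omega>" and lim: "approx_limit v x t"
  shows "has_blow_up V x (\<lambda>_. t)"
proof -
  have "eventually (\<lambda>\<rho>. (LINT y:ball x \<rho>|lebesgue. \<bar>v y - t\<bar>) / \<rho>\<^sup>2 = (\<integral>y. indicator (ball x \<rho>) y * \<bar>V y - t\<bar> \<partial>lborel) / \<rho>\<^sup>2) (at_right 0)"
    using eventually_ball_subset[OF \<Omega>] by eventually_elim (simp add: local_integral_eq[OF v V])
  then show ?thesis
    unfolding has_blow_up_def using lim unfolding approx_limit_def by (rule Lim_transform_eventually[rotated])
qed

text \<open>The two half disks cover the disk up to the dividing line, which is null, so the two
  one-sided limits add up to a single blow-up.\<close>

lemma has_blow_up_jump:
  assumes v: "set_integrable lebesgue \<Omega> v" and V: "integrable lborel V" "AE x in lborel. indicator \<Omega> x * v x = V x"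
    and \<Omega>: "open \<Omega>" "x \<in> \<Omega>" and jt: "jump_triple v x vp vm n"
  shows "has_blow_up V x (\<lambda>z. if 0 < z \<bullet> n then vp else vm)"
proof -
  have [measurable]: "V \<in> borel_measurable borel" using V by auto
  define P where "P = {y. (y - x) \<bullet> n > 0}"
  define Q where "Q = {y. (y - x) \<bullet> - n > 0}"
  have "open P" "open Q" unfolding P_def Q_def by (auto intro!: open_Collect_less continuous_intros)
  then have [measurable]: "ball x \<rho> \<inter> P \<in> sets borel" "ball x \<rho> \<inter> Q \<in> sets borel" for \<rho> by auto
  have [measurable]: "ball x \<rho> \<in> sets borel" for \<rho> by simp
  have "n \<noteq> 0" using jt by (auto simp: jump_triple_def)
  then have null: "{y. y \<bullet> n = x \<bullet> n} \<in> null_sets lborel" by (rule hyperplane_null_sets_lborel)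
  have int: "integrable lborel (\<lambda>y. indicator A y * \<bar>V y - t\<bar>)" if [measurable]: "A \<in> sets borel" and "A \<subseteq> ball x \<rho>" for A t \<rho>
  proof (rule Bochner_Integration.integrable_bound[where f="\<lambda>y. \<bar>V y\<bar> + \<bar>t\<bar> * indicator (ball x \<rho>) y"])
    show "integrable lborel (\<lambda>y. \<bar>V y\<bar> + \<bar>t\<bar> * indicator (ball x \<rho>) y)"
      using V(1) by (intro Bochner_Integration.integrable_add integrable_abs integrable_mult_right integrable_real_indicator)
        (auto simp: emeasure_lborel_ball_finite[unfolded infinity_ennreal_def])
    show "AE y in lborel. norm (indicator A y * \<bar>V y - t\<bar>) \<le> norm (\<bar>V y\<bar> + \<bar>t\<bar> * indicator (ball x \<rho>) y)"
    proof (rule AE_I2)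
      fix y
      show "norm (indicator A y * \<bar>V y - t\<bar>) \<le> norm (\<bar>V y\<bar> + \<bar>t\<bar> * indicator (ball x \<rho>) y)"
      proof (cases "y \<in> A")
        case True
        then have "y \<in> ball x \<rho>" using that by blast
        then show ?thesis using True by simp
      qed simp
    qed
  qed measurable
  have split: "(\<integral>y. indicator (ball x \<rho>) y * \<bar>V y - (if 0 < (y - x) \<bullet> n then vp else vm)\<bar> \<partial>lborel)
      = (\<integral>y. indicator (ball x \<rho> \<inter> P) y * \<bar>V y - vp\<bar> \<partial>lborel) + (\<integral>y. indicator (ball x \<rho> \<inter> Q) y * \<bar>V y - vm\<bar> \<partial>lborel)" for \<rho>
  proof -
    have "(\<integral>y. indicator (ball x \<rho>) y * \<bar>V y - (if 0 < (y - x) \<bullet> n then vp else vm)\<bar> \<partial>lborel)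
        = (\<integral>y. indicator (ball x \<rho> \<inter> P) y * \<bar>V y - vp\<bar> + indicator (ball x \<rho> \<inter> Q) y * \<bar>V y - vm\<bar> \<partial>lborel)"
    proof (rule integral_cong_AE)
      show "AE y in lborel. indicator (ball x \<rho>) y * \<bar>V y - (if 0 < (y - x) \<bullet> n then vp else vm)\<bar>
          = indicator (ball x \<rho> \<inter> P) y * \<bar>V y - vp\<bar> + indicator (ball x \<rho> \<inter> Q) y * \<bar>V y - vm\<bar>"
        using AE_not_in[OF null]
      proof eventually_elim
        case (elim y)
        then have "(y - x) \<bullet> n \<noteq> 0" by (simp add: inner_diff_left)
        then show ?case by (cases "y \<in> ball x \<rho>"; cases "0 < (y - x) \<bullet> n") (simp_all add: P_def Q_def indicator_def)
      qed
    qed measurable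
    also have "\<dots> = (\<integral>y. indicator (ball x \<rho> \<inter> P) y * \<bar>V y - vp\<bar> \<partial>lborel) + (\<integral>y. indicator (ball x \<rho> \<inter> Q) y * \<bar>V y - vm\<bar> \<partial>lborel)"
      by (intro Bochner_Integration.integral_add int[where \<rho>=\<rho>]) auto
    finally show ?thesis .
  qed
  have ev: "eventually (\<lambda>\<rho>. (LINT y:(ball x \<rho> \<inter> P)|lebesgue. \<bar>v y - vp\<bar>) / \<rho>\<^sup>2 + (LINT y:(ball x \<rho> \<inter> Q)|lebesgue. \<bar>v y - vm\<bar>) / \<rho>\<^sup>2
      = (\<integral>y. indicator (ball x \<rho>) y * \<bar>V y - (if 0 < (y - x) \<bullet> n then vp else vm)\<bar> \<partial>lborel) / \<rho>\<^sup>2) (at_right 0)"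
    using eventually_ball_subset[OF \<Omega>]
  proof eventually_elim
    case (elim \<rho>)
    have "(LINT y:(ball x \<rho> \<inter> P)|lebesgue. \<bar>v y - vp\<bar>) = (\<integral>y. indicator (ball x \<rho> \<inter> P) y * \<bar>V y - vp\<bar> \<partial>lborel)"
      "(LINT y:(ball x \<rho> \<inter> Q)|lebesgue. \<bar>v y - vm\<bar>) = (\<integral>y. indicator (ball x \<rho> \<inter> Q) y * \<bar>V y - vm\<bar> \<partial>lborel)"
      by (intro local_integral_eq[OF v V]; use elim in auto)+
    then show ?case unfolding split by (simp add: add_divide_distrib)
  qed
  have "((\<lambda>\<rho>. (LINT y:(ball x \<rho> \<inter> P)|lebesgue. \<bar>v y - vp\<bar>) / \<rho>\<^sup>2 + (LINT y:(ball x \<rho> \<inter> Q)|lebesgue. \<bar>v y - vm\<bar>) / \<rho>\<^sup>2) \<longlongrightarrow> 0 + 0) (at_right 0)"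
    using jt unfolding jump_triple_def approx_limit_side_def P_def Q_def by (intro tendsto_add) auto
  then show ?thesis
    unfolding has_blow_up_def using ev by (auto intro: Lim_transform_eventually)
qed

section \<open>Trapezoids, pointwise bounds and the calibration\<close>

text \<open>For \<open>0 < \<eta> \<le> h\<close> this is 1 on the interval from
  \<open>- h + \<eta>\<close> to \<open>h - \<eta>\<close>, 0 outside the one from
  \<open>- h\<close> to \<open>h\<close>, and affine in between.\<close>

definition trap :: "real \<Rightarrow> real \<Rightarrow> real \<Rightarrow> real" where
  "trap h \<eta> s = (max 0 (s + h) - max 0 (s + h - \<eta>) - max 0 (s - h + \<eta>) + max 0 (s - h)) / \<eta>"

text \<open>The primitive of \<open>trap\<close> that vanishes to the left of the band. Smoothing
  costs the amount \<open>\<eta>\<close>: the total increase is \<open>2 * h - \<eta>\<close>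
  instead of \<open>2 * h\<close>, a loss removed at the very end by letting \<open>\<eta>\<close>
  tend to 0.\<close>

definition trap_int :: "real \<Rightarrow> real \<Rightarrow> real \<Rightarrow> real" where
  "trap_int h \<eta> s = (pos_sq (s + h) - pos_sq (s + h - \<eta>) - pos_sq (s - h + \<eta>) + pos_sq (s - h)) / (2 * \<eta>)"

lemma DERIV_trap_int:
  assumes "0 < \<eta>"
  shows "(trap_int h \<eta> has_real_derivative trap h \<eta> s) (at s)"
proof -
  have d: "((\<lambda>t. pos_sq (t + c)) has_real_derivative 2 * max 0 (s + c) * (1 + 0)) (at s)" for c
    by (rule DERIV_chain2[OF DERIV_pos_sq]) (intro DERIV_add DERIV_ident DERIV_const)
  have "((\<lambda>s. (pos_sq (s + h) - pos_sq (s + (h - \<eta>)) - pos_sq (s + (\<eta> - h)) + pos_sq (s + - h)) / (2 * \<eta>)) has_real_derivative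
    (2 * max 0 (s + h) * (1 + 0) - 2 * max 0 (s + (h - \<eta>)) * (1 + 0) - 2 * max 0 (s + (\<eta> - h)) * (1 + 0) + 2 * max 0 (s + - h) * (1 + 0)) / (2 * \<eta>)) (at s)"
    by (intro DERIV_cdivide DERIV_add DERIV_diff d)
  moreover have "(\<lambda>s. (pos_sq (s + h) - pos_sq (s + (h - \<eta>)) - pos_sq (s + (\<eta> - h)) + pos_sq (s + - h)) / (2 * \<eta>)) = trap_int h \<eta>"
    by (simp add: trap_int_def fun_eq_iff algebra_simps)
  moreover have "(2 * max 0 (s + h) * (1 + 0) - 2 * max 0 (s + (h - \<eta>)) * (1 + 0) - 2 * max 0 (s + (\<eta> - h)) * (1 + 0) + 2 * max 0 (s + - h) * (1 + 0)) / (2 * \<eta>) = trap h \<eta> s"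
    using assms by (simp add: trap_def field_simps)
  ultimately show ?thesis by simp
qed

lemma continuous_on_trap: "0 < \<eta> \<Longrightarrow> continuous_on S (trap h \<eta>)"
  unfolding trap_def by (intro continuous_intros) auto

lemma trap_bounds:
  assumes "0 < \<eta>" "\<eta> \<le> h"
  shows "0 \<le> trap h \<eta> s" "trap h \<eta> s \<le> 1"
  using assms by (auto simp: trap_def max_def divide_le_eq)

lemma trap_eq_0:
  assumes "0 < \<eta>" "\<eta> \<le> h" "h \<le> \<bar>s\<bar>"
  shows "trap h \<eta> s = 0"
  using assms by (auto simp: trap_def max_def abs_if split: if_splits)

lemma trap_int_eq:
  assumes "0 < \<eta>" "\<eta> \<le> h"
  shows "s \<le> - h \<Longrightarrow> trap_int h \<eta> s = 0" "h \<le> s \<Longrightarrow> trap_int h \<eta> s = 2 * h - \<eta>"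
  using assms by (simp_all add: trap_int_def pos_sq_eq power2_eq_square field_simps)

lemma trap_int_mono:
  assumes "0 < \<eta>" "\<eta> \<le> h" "s \<le> t"
  shows "trap_int h \<eta> s \<le> trap_int h \<eta> t"
  using assms(3) by (rule DERIV_nonneg_imp_nondecreasing) (use DERIV_trap_int trap_bounds assms in blast)

lemma trap_int_bounds:
  assumes "0 < \<eta>" "\<eta> \<le> h"
  shows "0 \<le> trap_int h \<eta> s" "trap_int h \<eta> s \<le> 2 * h - \<eta>"
  using trap_int_mono[OF assms, of "min s (- h)" s] trap_int_mono[OF assms, of s "max s h"]
    trap_int_eq[OF assms, of "min s (- h)"] trap_int_eq[OF assms, of "max s h"] by auto

text \<open>At an angle of 120 degrees the squared length of the combination of
  \<open>\<nu>1\<close> and \<open>\<nu>2\<close> is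
  \<open>\<alpha>\<^sup>2 - \<alpha> * \<beta> + \<beta>\<^sup>2\<close>. For coefficients of equal
  sign the mixed term absorbs the smaller square, and the larger one is at most 1.\<close>

lemma two_directions_bound:
  fixes n \<nu>1 \<nu>2 :: plane
  assumes n: "norm n = 1" and \<nu>: "norm \<nu>1 = 1" "norm \<nu>2 = 1" "\<nu>1 \<bullet> \<nu>2 = - 1 / 2"
    and \<alpha>: "0 \<le> \<alpha> * \<beta>" "\<bar>\<alpha>\<bar> \<le> 1" "\<bar>\<beta>\<bar> \<le> 1"
  shows "\<alpha> * (n \<bullet> \<nu>1) + \<beta> * (n \<bullet> \<nu>2) \<le> 1"
proof -
  have "(norm (\<alpha> *\<^sub>R \<nu>1 + \<beta> *\<^sub>R \<nu>2))\<^sup>2 = \<alpha>\<^sup>2 * (norm \<nu>1)\<^sup>2 + 2 * (\<alpha> * \<beta>) * (\<nu>1 \<bullet> \<nu>2) + \<beta>\<^sup>2 * (norm \<nu>2)\<^sup>2"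
    unfolding power2_norm_eq_inner
    by (simp add: inner_add_left inner_add_right inner_commute[of \<nu>2 \<nu>1] power2_eq_square algebra_simps)
  also have "\<dots> = \<alpha>\<^sup>2 - \<alpha> * \<beta> + \<beta>\<^sup>2" using \<nu> by simp
  also have "\<dots> \<le> 1"
  proof (cases "\<bar>\<beta>\<bar> \<le> \<bar>\<alpha>\<bar>")
    case True
    have "\<bar>\<beta>\<bar> * \<bar>\<beta>\<bar> \<le> \<bar>\<alpha>\<bar> * \<bar>\<beta>\<bar>" using True by (intro mult_right_mono) auto
    then have "\<beta>\<^sup>2 \<le> \<alpha> * \<beta>" using \<alpha>(1) by (simp add: power2_eq_square abs_mult[symmetric])
    moreover have "\<alpha>\<^sup>2 \<le> 1" using \<alpha>(2) by (simp add: abs_square_le_1)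
    ultimately show ?thesis by linarith
  next
    case False
    have "\<bar>\<alpha>\<bar> * \<bar>\<alpha>\<bar> \<le> \<bar>\<alpha>\<bar> * \<bar>\<beta>\<bar>" using False by (intro mult_left_mono) auto
    then have "\<alpha>\<^sup>2 \<le> \<alpha> * \<beta>" using \<alpha>(1) by (simp add: power2_eq_square abs_mult[symmetric])
    moreover have "\<beta>\<^sup>2 \<le> 1" using \<alpha>(3) by (simp add: abs_square_le_1)
    ultimately show ?thesis by linarith
  qed
  finally have le: "norm (\<alpha> *\<^sub>R \<nu>1 + \<beta> *\<^sub>R \<nu>2) \<le> 1" by (simp add: power_le_one_iff)
  have "\<alpha> * (n \<bullet> \<nu>1) + \<beta> * (n \<bullet> \<nu>2) = n \<bullet> (\<alpha> *\<^sub>R \<nu>1 + \<beta> *\<^sub>R \<nu>2)" by (simp add: inner_add_right)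
  also have "\<dots> \<le> norm n * norm (\<alpha> *\<^sub>R \<nu>1 + \<beta> *\<^sub>R \<nu>2)" by (rule norm_cauchy_schwarz)
  finally show ?thesis using le n by simp
qed

text \<open>Nonnegativity of the squared norm of \<open>p - c *\<^sub>R \<nu>\<close> gives the
  bound for \<open>k = 1\<close>; for other weights both sides are scaled by \<open>k\<close> and
  the right one is enlarged again.\<close>

lemma quadratic_bound:
  fixes p \<nu> :: plane
  assumes "norm \<nu> = 1" "0 \<le> k" "k \<le> 1"
  shows "k * (2 * c * (p \<bullet> \<nu>) - c\<^sup>2) \<le> (norm p)\<^sup>2"
proof -
  have "0 \<le> (norm (p - c *\<^sub>R \<nu>))\<^sup>2" by simp
  also have "(norm (p - c *\<^sub>R \<nu>))\<^sup>2 = (norm p)\<^sup>2 - 2 * c * (p \<bullet> \<nu>) + c\<^sup>2 * (norm \<nu>)\<^sup>2"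
    unfolding power2_norm_eq_inner
    by (simp add: inner_diff_left inner_diff_right inner_commute[of \<nu> p] power2_eq_square algebra_simps)
  finally have *: "2 * c * (p \<bullet> \<nu>) - c\<^sup>2 \<le> (norm p)\<^sup>2" using assms(1) by simp
  have "k * (2 * c * (p \<bullet> \<nu>) - c\<^sup>2) \<le> k * (norm p)\<^sup>2" using * assms(2) by (rule mult_left_mono)
  also have "\<dots> \<le> 1 * (norm p)\<^sup>2" using assms(3) by (rule mult_right_mono) simp
  finally show ?thesis by simp
qed

text \<open>The chain rule, applied once for each band, produces the weights \<open>K1\<close> and
  \<open>K2\<close>. The coefficient \<open>c\<^sup>2\<close> of their Lebesgue integrals is
  \<open>2 * c\<close> times the slope \<open>c / 2\<close>. At a point of approximate continuity
  the separation hypothesis leaves at most one nonzero weight, so a single square has to be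
  completed; at a jump point both primitives change in the same direction, which is the sign
  condition of \<open>two_directions_bound\<close>.\<close>

lemma calibration_inequality:
  assumes v: "v \<in> SBV (ball 0 r)" and r: "0 < r"
    and V: "integrable lborel V" "AE x in lborel. indicator (ball 0 r) x * v x = V x"
    and tf: "test_function (ball 0 r) \<phi> g" and \<phi>: "\<And>x. 0 \<le> \<phi> x" "\<And>x. \<phi> x \<le> 1"
    and \<nu>: "norm \<nu>1 = 1" "norm \<nu>2 = 1" "\<nu>1 \<bullet> \<nu>2 = - 1 / 2"
    and \<eta>: "0 < \<eta>" "\<eta> \<le> h" and c: "0 < c" "4 * c * h = 1"
    and sep: "\<And>x t. norm x < r \<Longrightarrow> \<bar>t - (((c / 2) *\<^sub>R \<nu>1) \<bullet> x + d1)\<bar> < h \<Longrightarrow>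
      \<bar>t - (((c / 2) *\<^sub>R \<nu>2) \<bullet> x + d2)\<bar> < h \<Longrightarrow> False"
  shows "ennreal (- 2 * c * ((\<integral>x. (g x \<bullet> \<nu>1) * trap_int h \<eta> (V x - (((c / 2) *\<^sub>R \<nu>1) \<bullet> x + d1)) \<partial>lborel)
      + (\<integral>x. (g x \<bullet> \<nu>2) * trap_int h \<eta> (V x - (((c / 2) *\<^sub>R \<nu>2) \<bullet> x + d2)) \<partial>lborel))) \<le> F0 (ball 0 r) v"
proof (cases "F0 (ball 0 r) v = top")
  case False
  let ?\<Omega> = "ball (0::plane) r"
  let ?S = "approx_discont ?\<Omega> v"
  let ?l1 = "\<lambda>x. ((c / 2) *\<^sub>R \<nu>1) \<bullet> x + d1" and ?l2 = "\<lambda>x. ((c / 2) *\<^sub>R \<nu>2) \<bullet> x + d2"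
  let ?\<psi> = "trap h \<eta>" and ?\<Psi> = "trap_int h \<eta>"
  \<comment> \<open>Finite energy makes the discontinuity set Lebesgue null and the squared gradient
    integrable; for infinite energy the claim is trivial.\<close>
  have finS: "hausdorff1_outer ?S < top" and finG: "(\<integral>\<^sup>+x\<in>?\<Omega>. ennreal ((norm (approx_gradient ?\<Omega> v x))\<^sup>2) \<partial>lebesgue) < top"
    using False by (auto simp: F0_def less_top)
  have vBV: "v \<in> BV ?\<Omega>" using v by (simp add: SBV_def)
  then have vi: "set_integrable lebesgue ?\<Omega> v" by (simp add: BV_def)
  obtain vp vm n where jAE: "AE x in hausdorff1. x \<in> ?S \<longrightarrow> jump_triple v x (vp x) (vm x) (n x)"
    and ji: "set_integrable hausdorff1 ?S (\<lambda>x. (vp x - vm x) *\<^sub>R n x)"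
    and jD: "\<forall>B\<in>sets borel. B \<subseteq> ?\<Omega> \<longrightarrow> derivative_measure ?\<Omega> v B = (LINT x:B|lebesgue. approx_gradient ?\<Omega> v x) +
           (LINT x:(B \<inter> ?S)|hausdorff1. (vp x - vm x) *\<^sub>R n x)"
    using v unfolding SBV_def by (elim CollectE conjE exE) (rule that)
  obtain N where N: "N \<in> sets borel" "hausdorff1_outer N = 0" "\<And>x. x \<notin> N \<Longrightarrow> x \<in> ?S \<longrightarrow> jump_triple v x (vp x) (vm x) (n x)"
    by (rule AE_hausdorff1_E[OF jAE]) (rule that)
  \<comment> \<open>\<open>N\<close> is a Borel set of Hausdorff measure zero outside which all
    one-sided limits exist, so only a null part of the discontinuity set is lost.\<close>
  define J where "J = ?S - N"
  define G where "G x = indicator ?\<Omega> x *\<^sub>R approx_gradient ?\<Omega> v x" for x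
  define j where "j x = indicator ?S x *\<^sub>R ((vp x - vm x) *\<^sub>R n x)" for x
  have D: "is_derivative_measure ?\<Omega> v (derivative_measure ?\<Omega> v)" by (rule BV_derivative_measure[OF vBV])
  obtain \<mu> s where \<mu>: "finite_measure \<mu>" "sets \<mu> = sets borel" and s: "integrable \<mu> s"
    and sD: "\<And>B. B \<in> sets borel \<Longrightarrow> B \<subseteq> ?\<Omega> \<Longrightarrow> derivative_measure ?\<Omega> v B = (LINT x:B|\<mu>. s x)"
    and sT: "\<And>\<phi> g. test_function ?\<Omega> \<phi> g \<Longrightarrow> (LINT x:?\<Omega>|lebesgue. v x *\<^sub>R g x) = - (LINT x:?\<Omega>|\<mu>. \<phi> x *\<^sub>R s x)"
    by (rule is_derivative_measureE[OF D]) (rule that)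
  define s' where "s' x = indicator ?\<Omega> x *\<^sub>R s x" for x
  have s'i: "integrable \<mu> s'" unfolding s'_def using s \<mu>(2) by (intro integrable_mult_indicator) auto
  have Gi: "integrable lebesgue G"
    using approx_gradient_props[OF D] unfolding G_def set_integrable_def by simp
  have jint: "integrable hausdorff1 j" using ji unfolding j_def set_integrable_def .
  have jm: "j \<in> borel_measurable hausdorff1" using jint by auto
  have test: "(\<integral>x. V x *\<^sub>R g x \<partial>lborel) = - (\<integral>x. \<phi> x *\<^sub>R s' x \<partial>\<mu>)" if tf: "test_function ?\<Omega> \<phi> g" for \<phi> g
  proof -
    have [measurable]: "V \<in> borel_measurable borel" using V by auto
    have [measurable]: "g \<in> borel_measurable borel" using integrable_test_function(2)[OF tf] by auto
    have vm: "(\<lambda>x. indicator ?\<Omega> x * v x) \<in> borel_measurable lebesgue" using vi by (auto simp: set_integrable_def)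
    have "(\<integral>x. V x *\<^sub>R g x \<partial>lborel) = (\<integral>x. V x *\<^sub>R g x \<partial>lebesgue)" by (rule integral_completion[symmetric]) measurable
    also have "\<dots> = (\<integral>x. (indicator ?\<Omega> x * v x) *\<^sub>R g x \<partial>lebesgue)"
    proof (rule integral_cong_AE)
      show "(\<lambda>x. V x *\<^sub>R g x) \<in> borel_measurable lebesgue" by (intro measurable_completion) measurable
      show "(\<lambda>x. (indicator ?\<Omega> x * v x) *\<^sub>R g x) \<in> borel_measurable lebesgue"
        by (intro borel_measurable_scaleR[OF vm] measurable_completion) measurable
      show "AE x in lebesgue. V x *\<^sub>R g x = (indicator ?\<Omega> x * v x) *\<^sub>R g x"
        using AE_completion[OF V(2)] by eventually_elim simp
    qed
    also have "\<dots> = (LINT x:?\<Omega>|lebesgue. v x *\<^sub>R g x)" by (simp add: set_lebesgue_integral_def)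
    also have "\<dots> = - (LINT x:?\<Omega>|\<mu>. \<phi> x *\<^sub>R s x)" by (rule sT[OF tf])
    also have "\<dots> = - (\<integral>x. \<phi> x *\<^sub>R s' x \<partial>\<mu>)" by (simp add: set_lebesgue_integral_def s'_def mult.commute)
    finally show ?thesis .
  qed
  have decomp: "(\<integral>x. indicator B x *\<^sub>R s' x \<partial>\<mu>) = (\<integral>x. indicator B x *\<^sub>R G x \<partial>lebesgue) + (\<integral>x. indicator B x *\<^sub>R j x \<partial>hausdorff1)"
    if B: "B \<in> sets borel" for B
  proof -
    have BO: "B \<inter> ?\<Omega> \<in> sets borel" using B by auto
    have "(LINT x:B \<inter> ?\<Omega>|\<mu>. s x) = (LINT x:B \<inter> ?\<Omega>|lebesgue. approx_gradient ?\<Omega> v x) + (LINT x:((B \<inter> ?\<Omega>) \<inter> ?S)|hausdorff1. (vp x - vm x) *\<^sub>R n x)"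
      using sD[OF BO] jD BO by simp
    moreover have "(B \<inter> ?\<Omega>) \<inter> ?S = B \<inter> ?S" by (auto simp: approx_discont_def)
    ultimately show ?thesis
      unfolding set_lebesgue_integral_def s'_def G_def j_def by (simp only: indicator_inter_arith scaleR_scaleR mult.assoc)
  qed
  have Snull: "?S \<in> null_sets lebesgue" by (rule null_sets_lebesgue_if_hausdorff1_finite[OF finS])
  define al where "al x = (SOME a. approx_limit v x a)" for x
  have blow_a: "has_blow_up V x (\<lambda>_. al x)" if "x \<in> ?\<Omega> - ?S" for x
  proof -
    have "\<exists>t. approx_limit v x t" using that by (simp add: approx_discont_def)
    then have "approx_limit v x (al x)" unfolding al_def by (rule someI_ex)
    then show ?thesis using that by (intro has_blow_up_approx_limit[OF vi V open_ball]) auto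
  qed
  have JO: "J \<subseteq> ?\<Omega>" by (auto simp: J_def approx_discont_def)
  have jt: "jump_triple v x (vp x) (vm x) (n x)" if "x \<in> J" for x using N(3)[of x] that by (auto simp: J_def)
  have blow_J: "norm (n x) = 1 \<and> has_blow_up V x (\<lambda>z. if 0 < z \<bullet> n x then vp x else vm x)" if "x \<in> J" for x
    using has_blow_up_jump[OF vi V _ _ jt[OF that]] jt[OF that] that JO by (auto simp: jump_triple_def)
  have "N \<in> null_sets hausdorff1" using N by (intro null_setsI) (auto simp: emeasure_hausdorff1)
  then have AEN: "AE x in hausdorff1. x \<notin> N" by (rule AE_not_in)
  have jJ: "AE x in hausdorff1. j x \<noteq> 0 \<longrightarrow> x \<in> J"
    using AEN by eventually_elim (auto simp: j_def J_def indicator_def)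
  have G0: "G x = 0" if "x \<notin> ?\<Omega>" for x using that by (simp add: G_def)
  have psi: "continuous_on UNIV ?\<psi>" "\<And>t. \<bar>?\<psi> t\<bar> \<le> 1"
    using continuous_on_trap \<eta> trap_bounds[OF \<eta>] by auto
  have Psi: "\<And>t. (?\<Psi> has_real_derivative ?\<psi> t) (at t)" "\<And>t. \<bar>?\<Psi> t\<bar> \<le> 2 * h - \<eta>"
    using DERIV_trap_int \<eta> trap_int_bounds[OF \<eta>] by auto
  obtain K1 C1 where K1: "K1 \<in> borel_measurable borel" "\<And>x. \<bar>K1 x\<bar> \<le> C1" "\<And>x. x \<notin> ?\<Omega> \<Longrightarrow> K1 x = 0"
    "\<And>x. x \<in> ?\<Omega> - ?S \<Longrightarrow> K1 x = \<phi> x * ?\<psi> (al x - ?l1 x)"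
    "\<And>x. x \<in> J \<Longrightarrow> (vp x - vm x) * K1 x = \<phi> x * (?\<Psi> (vp x - ?l1 x) - ?\<Psi> (vm x - ?l1 x))"
    "- (\<integral>x. (g x \<bullet> \<nu>1) * ?\<Psi> (V x - ?l1 x) \<partial>lborel)
      = (\<integral>x. K1 x * (G x \<bullet> \<nu>1) \<partial>lebesgue) + (\<integral>x. K1 x * (j x \<bullet> \<nu>1) \<partial>hausdorff1) - (((c / 2) *\<^sub>R \<nu>1) \<bullet> \<nu>1) * (\<integral>x. K1 x \<partial>lebesgue)"
    by (rule chain_rule[OF open_ball V(1) \<mu>(1) s'i \<mu>(2) test Gi G0 jint jJ decomp Snull blow_a JO blow_J tf Psi psi,
          where c="(c / 2) *\<^sub>R \<nu>1" and d=d1 and \<nu>=\<nu>1]) (assumption | rule that)+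
  obtain K2 C2 where K2: "K2 \<in> borel_measurable borel" "\<And>x. \<bar>K2 x\<bar> \<le> C2" "\<And>x. x \<notin> ?\<Omega> \<Longrightarrow> K2 x = 0"
    "\<And>x. x \<in> ?\<Omega> - ?S \<Longrightarrow> K2 x = \<phi> x * ?\<psi> (al x - ?l2 x)"
    "\<And>x. x \<in> J \<Longrightarrow> (vp x - vm x) * K2 x = \<phi> x * (?\<Psi> (vp x - ?l2 x) - ?\<Psi> (vm x - ?l2 x))"
    "- (\<integral>x. (g x \<bullet> \<nu>2) * ?\<Psi> (V x - ?l2 x) \<partial>lborel)
      = (\<integral>x. K2 x * (G x \<bullet> \<nu>2) \<partial>lebesgue) + (\<integral>x. K2 x * (j x \<bullet> \<nu>2) \<partial>hausdorff1) - (((c / 2) *\<^sub>R \<nu>2) \<bullet> \<nu>2) * (\<integral>x. K2 x \<partial>lebesgue)"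
    by (rule chain_rule[OF open_ball V(1) \<mu>(1) s'i \<mu>(2) test Gi G0 jint jJ decomp Snull blow_a JO blow_J tf Psi psi,
          where c="(c / 2) *\<^sub>R \<nu>2" and d=d2 and \<nu>=\<nu>2]) (assumption | rule that)+
  have \<nu>\<nu>: "\<nu>1 \<bullet> \<nu>1 = 1" "\<nu>2 \<bullet> \<nu>2 = 1" using \<nu> by (simp_all add: dot_square_norm)
  have fin\<Omega>: "integrable lebesgue (indicator ?\<Omega> :: plane \<Rightarrow> real)"
    by (rule integrable_real_indicator) (auto simp: emeasure_lborel_ball_finite[unfolded infinity_ennreal_def])
  have ints: "integrable lebesgue K" "integrable lebesgue (\<lambda>x. K x * (G x \<bullet> w))" "integrable hausdorff1 (\<lambda>x. K x * (j x \<bullet> w))"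
    if Km: "K \<in> borel_measurable borel" and Kb: "\<And>x. \<bar>K x\<bar> \<le> C" and K0: "\<And>x. x \<notin> ?\<Omega> \<Longrightarrow> K x = 0" for K C w
  proof -
    have Kl: "K \<in> borel_measurable lebesgue" using Km by (intro measurable_completion) simp
    have Kh: "K \<in> borel_measurable hausdorff1" using Km by (simp cong: measurable_cong_sets)
    have "integrable lebesgue (\<lambda>x. K x *\<^sub>R (indicator ?\<Omega> x :: real))" by (rule integrable_mult_bounded[OF fin\<Omega> Kl Kb])
    also have "(\<lambda>x. K x *\<^sub>R (indicator ?\<Omega> x :: real)) = K" using K0 by (auto simp: indicator_def fun_eq_iff)
    finally show "integrable lebesgue K" .
    show "integrable lebesgue (\<lambda>x. K x * (G x \<bullet> w))"
      using integrable_mult_bounded[OF integrable_inner_left[OF Gi, of w] Kl Kb] by simp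
    show "integrable hausdorff1 (\<lambda>x. K x * (j x \<bullet> w))"
      using integrable_mult_bounded[OF integrable_inner_left[OF jint, of w] Kh Kb] by simp
  qed
  have slope: "((c / 2) *\<^sub>R \<nu>1) \<bullet> \<nu>1 = c / 2" "((c / 2) *\<^sub>R \<nu>2) \<bullet> \<nu>2 = c / 2" using \<nu>\<nu> by simp_all
  have gen: "- 2 * c * (X + Y) = 2 * c * ((- X) + (- Y))" for X Y by (simp add: algebra_simps)
  note i1 = ints[OF K1(1-3)] and i2 = ints[OF K2(1-3)]
  have "- 2 * c * ((\<integral>x. (g x \<bullet> \<nu>1) * ?\<Psi> (V x - ?l1 x) \<partial>lborel) + (\<integral>x. (g x \<bullet> \<nu>2) * ?\<Psi> (V x - ?l2 x) \<partial>lborel))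
      = 2 * c * ((\<integral>x. K1 x * (G x \<bullet> \<nu>1) \<partial>lebesgue) + (\<integral>x. K1 x * (j x \<bullet> \<nu>1) \<partial>hausdorff1) - (c / 2) * (\<integral>x. K1 x \<partial>lebesgue)
        + ((\<integral>x. K2 x * (G x \<bullet> \<nu>2) \<partial>lebesgue) + (\<integral>x. K2 x * (j x \<bullet> \<nu>2) \<partial>hausdorff1) - (c / 2) * (\<integral>x. K2 x \<partial>lebesgue)))"
    unfolding gen K1(6)[unfolded slope] K2(6)[unfolded slope] ..
  also have "\<dots> = (2 * c * (\<integral>x. K1 x * (G x \<bullet> \<nu>1) \<partial>lebesgue) - c\<^sup>2 * (\<integral>x. K1 x \<partial>lebesgue) + (2 * c * (\<integral>x. K2 x * (G x \<bullet> \<nu>2) \<partial>lebesgue) - c\<^sup>2 * (\<integral>x. K2 x \<partial>lebesgue)))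
      + (2 * c * (\<integral>x. K1 x * (j x \<bullet> \<nu>1) \<partial>hausdorff1) + 2 * c * (\<integral>x. K2 x * (j x \<bullet> \<nu>2) \<partial>hausdorff1))"
    by algebra
  also have "\<dots> = (\<integral>x. (2 * c * (K1 x * (G x \<bullet> \<nu>1)) - c\<^sup>2 * K1 x) + (2 * c * (K2 x * (G x \<bullet> \<nu>2)) - c\<^sup>2 * K2 x) \<partial>lebesgue)
      + (\<integral>x. 2 * c * (K1 x * (j x \<bullet> \<nu>1)) + 2 * c * (K2 x * (j x \<bullet> \<nu>2)) \<partial>hausdorff1)"
    using i1 i2 by simp
  finally have total: "- 2 * c * ((\<integral>x. (g x \<bullet> \<nu>1) * ?\<Psi> (V x - ?l1 x) \<partial>lborel) + (\<integral>x. (g x \<bullet> \<nu>2) * ?\<Psi> (V x - ?l2 x) \<partial>lborel))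
      = (\<integral>x. (2 * c * (K1 x * (G x \<bullet> \<nu>1)) - c\<^sup>2 * K1 x) + (2 * c * (K2 x * (G x \<bullet> \<nu>2)) - c\<^sup>2 * K2 x) \<partial>lebesgue)
      + (\<integral>x. 2 * c * (K1 x * (j x \<bullet> \<nu>1)) + 2 * c * (K2 x * (j x \<bullet> \<nu>2)) \<partial>hausdorff1)" .
  have Gm: "G \<in> borel_measurable lebesgue" using Gi by auto
  have GG: "(\<integral>\<^sup>+x\<in>?\<Omega>. ennreal ((norm (approx_gradient ?\<Omega> v x))\<^sup>2) \<partial>lebesgue) = (\<integral>\<^sup>+x. ennreal ((norm (G x))\<^sup>2) \<partial>lebesgue)"
    by (intro nn_integral_cong) (auto simp: G_def indicator_def)
  have G2: "integrable lebesgue (\<lambda>x. (norm (G x))\<^sup>2)"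
    using Gm finG unfolding GG by (intro integrableI_bounded) auto
  have ac: "(\<integral>x. (2 * c * (K1 x * (G x \<bullet> \<nu>1)) - c\<^sup>2 * K1 x) + (2 * c * (K2 x * (G x \<bullet> \<nu>2)) - c\<^sup>2 * K2 x) \<partial>lebesgue)
      \<le> (\<integral>x. (norm (G x))\<^sup>2 \<partial>lebesgue)"
  proof (rule integral_mono_AE)
    show "integrable lebesgue (\<lambda>x. (2 * c * (K1 x * (G x \<bullet> \<nu>1)) - c\<^sup>2 * K1 x) + (2 * c * (K2 x * (G x \<bullet> \<nu>2)) - c\<^sup>2 * K2 x))"
      using i1 i2 by auto
    show "AE x in lebesgue. (2 * c * (K1 x * (G x \<bullet> \<nu>1)) - c\<^sup>2 * K1 x) + (2 * c * (K2 x * (G x \<bullet> \<nu>2)) - c\<^sup>2 * K2 x) \<le> (norm (G x))\<^sup>2"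
      using AE_not_in[OF Snull]
    proof eventually_elim
      case (elim x)
      show ?case
      proof (cases "x \<in> ?\<Omega>")
        case True
        then have x: "x \<in> ?\<Omega> - ?S" using elim by blast
        have k: "0 \<le> \<phi> x * ?\<psi> t" "\<phi> x * ?\<psi> t \<le> 1" for t
          using \<phi>[of x] trap_bounds[OF \<eta>, of t] by (auto intro: mult_le_one)
        have q: "2 * c * (k * (G x \<bullet> w)) - c\<^sup>2 * k \<le> (norm (G x))\<^sup>2" if "norm w = 1" "0 \<le> k" "k \<le> 1" for k w
          using quadratic_bound[OF that, of c "G x"] by (simp add: algebra_simps)
        \<comment> \<open>The approximate limit cannot lie in both bands over \<open>x\<close>, so
          one of the two trapezoids vanishes there.\<close>
        have "?\<psi> (al x - ?l1 x) = 0 \<or> ?\<psi> (al x - ?l2 x) = 0"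
          using sep[of x "al x"] True trap_eq_0[OF \<eta>] by (meson mem_ball_0 not_le)
        then have "K1 x = 0 \<or> K2 x = 0" using K1(4)[OF x] K2(4)[OF x] by auto
        moreover have "2 * c * (K1 x * (G x \<bullet> \<nu>1)) - c\<^sup>2 * K1 x \<le> (norm (G x))\<^sup>2"
          by (rule q[OF \<nu>(1)]) (use K1(4)[OF x] k in auto)
        moreover have "2 * c * (K2 x * (G x \<bullet> \<nu>2)) - c\<^sup>2 * K2 x \<le> (norm (G x))\<^sup>2"
          by (rule q[OF \<nu>(2)]) (use K2(4)[OF x] k in auto)
        ultimately show ?thesis by auto
      next
        case False
        then show ?thesis using K1(3)[of x] K2(3)[of x] by simp
      qed
    qed
  qed (rule G2)
  \<comment> \<open>The discontinuity set is controlled by an outer measure, while comparing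
    integrals calls for a measurable set. \<open>E\<close> is Borel, being the set where a
    measurable density is nonzero, and it lies inside the discontinuity set.\<close>
  define E where "E = {x. j x \<noteq> 0}"
  have Eb: "E \<in> sets borel"
  proof -
    have "{x \<in> space hausdorff1. j x \<noteq> 0} \<in> sets hausdorff1" using jm by measurable
    then show ?thesis by (simp add: E_def)
  qed
  have ES: "E \<subseteq> ?S" by (auto simp: E_def j_def indicator_def split: if_splits)
  have emE: "emeasure hausdorff1 E \<le> hausdorff1_outer ?S"
    using hausdorff1_outer_mono[OF ES] Eb by (simp add: emeasure_hausdorff1)
  have Ei: "integrable hausdorff1 (indicator E :: plane \<Rightarrow> real)"
    using Eb emE finS by (intro integrable_real_indicator) (auto simp: le_less_trans)
  have jump: "(\<integral>x. 2 * c * (K1 x * (j x \<bullet> \<nu>1)) + 2 * c * (K2 x * (j x \<bullet> \<nu>2)) \<partial>hausdorff1) \<le> (\<integral>x. indicator E x \<partial>hausdorff1)"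
  proof (rule integral_mono_AE)
    show "integrable hausdorff1 (\<lambda>x. 2 * c * (K1 x * (j x \<bullet> \<nu>1)) + 2 * c * (K2 x * (j x \<bullet> \<nu>2)))" using i1 i2 by auto
    show "AE x in hausdorff1. 2 * c * (K1 x * (j x \<bullet> \<nu>1)) + 2 * c * (K2 x * (j x \<bullet> \<nu>2)) \<le> indicator E x"
      using jJ
    proof eventually_elim
      case (elim x)
      show ?case
      proof (cases "j x = 0")
        case False
        then have x: "x \<in> J" using elim by blast
        have nx: "norm (n x) = 1" using blow_J[OF x] by blast
        have jx: "j x = (vp x - vm x) *\<^sub>R n x" using x by (simp add: j_def J_def)
        define \<alpha> where "\<alpha> = 2 * c * (?\<Psi> (vp x - ?l1 x) - ?\<Psi> (vm x - ?l1 x))"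
        define \<beta> where "\<beta> = 2 * c * (?\<Psi> (vp x - ?l2 x) - ?\<Psi> (vm x - ?l2 x))"
        have "2 * c * (K1 x * (j x \<bullet> \<nu>1)) = 2 * c * ((vp x - vm x) * K1 x) * (n x \<bullet> \<nu>1)" by (simp add: jx)
        also have "\<dots> = \<phi> x * (\<alpha> * (n x \<bullet> \<nu>1))" unfolding K1(5)[OF x] \<alpha>_def by simp
        finally have e1: "2 * c * (K1 x * (j x \<bullet> \<nu>1)) = \<phi> x * (\<alpha> * (n x \<bullet> \<nu>1))" .
        have "2 * c * (K2 x * (j x \<bullet> \<nu>2)) = 2 * c * ((vp x - vm x) * K2 x) * (n x \<bullet> \<nu>2)" by (simp add: jx)
        also have "\<dots> = \<phi> x * (\<beta> * (n x \<bullet> \<nu>2))" unfolding K2(5)[OF x] \<beta>_def by simp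
        finally have e2: "2 * c * (K2 x * (j x \<bullet> \<nu>2)) = \<phi> x * (\<beta> * (n x \<bullet> \<nu>2))" .
        \<comment> \<open>This is where \<open>4 * c * h = 1\<close> enters: crossing a whole band
          contributes at most 1.\<close>
        have b1: "\<bar>2 * c * (?\<Psi> t - ?\<Psi> t')\<bar> \<le> 1" for t t'
        proof -
          have "\<bar>?\<Psi> t - ?\<Psi> t'\<bar> \<le> 2 * h" using trap_int_bounds[OF \<eta>, of t] trap_int_bounds[OF \<eta>, of t'] \<eta> by linarith
          then have "2 * c * \<bar>?\<Psi> t - ?\<Psi> t'\<bar> \<le> 2 * c * (2 * h)" using c by (intro mult_left_mono) auto
          also have "2 * c * (2 * h) = 1" using c(2) by (simp add: algebra_simps)
          finally show ?thesis using c(1) by (simp add: abs_mult)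
        qed
        have sgn: "0 \<le> \<alpha> * \<beta>"
        proof (cases "vm x \<le> vp x")
          case True
          then have "0 \<le> \<alpha>" "0 \<le> \<beta>" unfolding \<alpha>_def \<beta>_def using c trap_int_mono[OF \<eta>] by (auto intro!: mult_nonneg_nonneg)
          then show ?thesis by simp
        next
          case False
          then have "\<alpha> \<le> 0" "\<beta> \<le> 0" unfolding \<alpha>_def \<beta>_def using c trap_int_mono[OF \<eta>] by (auto intro!: mult_nonneg_nonpos)
          then show ?thesis by (simp add: mult_nonpos_nonpos)
        qed
        have "\<alpha> * (n x \<bullet> \<nu>1) + \<beta> * (n x \<bullet> \<nu>2) \<le> 1"
          by (rule two_directions_bound[OF nx \<nu> sgn]) (unfold \<alpha>_def \<beta>_def, rule b1, rule b1)
        then have "\<phi> x * (\<alpha> * (n x \<bullet> \<nu>1) + \<beta> * (n x \<bullet> \<nu>2)) \<le> \<phi> x * 1" using \<phi>(1) by (intro mult_left_mono)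
        then have "\<phi> x * (\<alpha> * (n x \<bullet> \<nu>1)) + \<phi> x * (\<beta> * (n x \<bullet> \<nu>2)) \<le> 1"
          using \<phi>(2)[of x] by (simp add: distrib_left)
        then show ?thesis unfolding e1 e2 using False by (simp add: E_def)
      qed simp
    qed
  qed (rule Ei)
  have "ennreal (- 2 * c * ((\<integral>x. (g x \<bullet> \<nu>1) * ?\<Psi> (V x - ?l1 x) \<partial>lborel) + (\<integral>x. (g x \<bullet> \<nu>2) * ?\<Psi> (V x - ?l2 x) \<partial>lborel)))
      \<le> ennreal ((\<integral>x. (norm (G x))\<^sup>2 \<partial>lebesgue) + (\<integral>x. indicator E x \<partial>hausdorff1))"
    unfolding total by (intro ennreal_leI add_mono ac jump)
  also have "\<dots> = ennreal (\<integral>x. (norm (G x))\<^sup>2 \<partial>lebesgue) + ennreal (\<integral>x. indicator E x \<partial>hausdorff1)"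
    by (intro ennreal_plus Bochner_Integration.integral_nonneg) auto
  also have "ennreal (\<integral>x. (norm (G x))\<^sup>2 \<partial>lebesgue) = (\<integral>\<^sup>+x. ennreal ((norm (G x))\<^sup>2) \<partial>lebesgue)"
    by (intro nn_integral_eq_integral[symmetric] G2) auto
  also have "ennreal (\<integral>x. indicator E x \<partial>hausdorff1) = (\<integral>\<^sup>+x. ennreal (indicator E x) \<partial>hausdorff1)"
    by (intro nn_integral_eq_integral[symmetric] Ei) auto
  also have "\<dots> = emeasure hausdorff1 E" using Eb by (simp add: ennreal_indicator)
  finally show ?thesis
    unfolding F0_def GG using emE by (meson add_left_mono order_trans)
qed simp

section \<open>Boundary terms and their dependence on the trace\<close>

text \<open>The cutoff falls from 1 to 0 while the norm runs from \<open>r - \<rho> / 2\<close> to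
  \<open>r - \<rho> / 4\<close>, so its support is compact in the open disk. For the squared norm
  this range has length at least \<open>\<rho> / 4 * r\<close>, and the slope of
  \<open>smooth_step\<close>, at most 2, turns this into the bound
  \<open>16 / \<rho>\<close>.\<close>

lemma radial_cutoff:
  assumes r: "0 < r" and \<rho>: "0 < \<rho>" "\<rho> \<le> r"
  obtains \<phi> g where "test_function (ball 0 r) \<phi> g" "\<And>x. 0 \<le> \<phi> x" "\<And>x. \<phi> x \<le> 1"
    "\<And>x. norm x \<le> r - \<rho> / 2 \<Longrightarrow> \<phi> x = 1"
    "\<And>x. norm (g x) \<le> 16 / \<rho> * indicator {y. r - \<rho> / 2 < norm y \<and> norm y < r} x"
proof -
  define s1 where "s1 = (r - \<rho> / 2)\<^sup>2"
  define s2 where "s2 = (r - \<rho> / 4)\<^sup>2"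
  define k where "k = 1 / (s2 - s1)"
  have d: "s2 - s1 = \<rho> / 4 * (2 * r - 3 / 4 * \<rho>)"
    by (simp add: s1_def s2_def power2_eq_square algebra_simps)
  have dge: "\<rho> / 4 * r \<le> s2 - s1" unfolding d using r \<rho> by (intro mult_left_mono) auto
  moreover have "0 < \<rho> / 4 * r" using r \<rho> by simp
  ultimately have dpos: "0 < s2 - s1" by linarith
  have k: "0 < k" "k * (s2 - s1) = 1" using dpos by (simp_all add: k_def)
  have kb: "4 * k * r \<le> 16 / \<rho>"
  proof -
    have "4 * k * r = 4 * r / (s2 - s1)" by (simp add: k_def)
    also have "\<dots> \<le> 4 * r / (\<rho> / 4 * r)" using dge r \<rho> by (intro divide_left_mono mult_pos_pos dpos) auto
    also have "\<dots> = 16 / \<rho>" using r by simp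
    finally show ?thesis .
  qed
  have s2: "s2 < r\<^sup>2" unfolding s2_def using r \<rho> by (intro power_strict_mono) auto
  let ?t = "\<lambda>x::plane. s2 * k - k * (x \<bullet> x)"
  have t: "?t x = k * (s2 - (norm x)\<^sup>2)" for x by (simp add: dot_square_norm algebra_simps)
  have t1: "1 \<le> ?t x" if "norm x \<le> r - \<rho> / 2" for x
  proof -
    have "(norm x)\<^sup>2 \<le> s1" unfolding s1_def using that by (intro power_mono) auto
    then have "k * (s2 - s1) \<le> k * (s2 - (norm x)\<^sup>2)" using k by (intro mult_left_mono) auto
    then show ?thesis unfolding t k(2) .
  qed
  have t0: "?t x \<le> 0" if "r \<le> norm x" for x
  proof -
    have "r\<^sup>2 \<le> (norm x)\<^sup>2" using that r by (intro power_mono) auto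
    then show ?thesis unfolding t using s2 k by (intro mult_nonneg_nonpos) auto
  qed
  show ?thesis
  proof (rule that)
    show "test_function (ball 0 r) (\<lambda>x. smooth_step (?t x)) (\<lambda>x. (- 2 * k * smooth_step' (?t x)) *\<^sub>R x)"
      by (rule test_function_radial[OF r k(1)]) (use k s2 in simp)
    show "smooth_step (?t x) = 1" if "norm x \<le> r - \<rho> / 2" for x by (rule smooth_step_eq(4)[OF t1[OF that]])
    show "norm ((- 2 * k * smooth_step' (?t x)) *\<^sub>R x) \<le> 16 / \<rho> * indicator {y. r - \<rho> / 2 < norm y \<and> norm y < r} x" for x
    proof (cases "r - \<rho> / 2 < norm x \<and> norm x < r")
      case True
      have "norm ((- 2 * k * smooth_step' (?t x)) *\<^sub>R x) = (2 * k) * (\<bar>smooth_step' (?t x)\<bar> * norm x)"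
        using k(1) by (simp add: abs_mult)
      also have "\<dots> \<le> (2 * k) * (2 * r)"
        using True k smooth_step'_bound[of "?t x"] by (intro mult_left_mono mult_mono) auto
      also have "\<dots> \<le> 16 / \<rho>" using kb by simp
      finally show ?thesis using True by simp
    next
      case False
      then have "smooth_step' (?t x) = 0" using t0[of x] t1[of x] by (intro smooth_step'_eq_0) linarith
      then show ?thesis using False by simp
    qed
  qed (rule smooth_step_bounds)+
qed

text \<open>As a primitive of a function with values between 0 and 1, \<open>trap_int\<close> is
  nondecreasing and does not increase distances; its total increase is below \<open>2 * h\<close>.
  Both bounds are kept because the averages near the boundary are controlled for bounded
  integrands.\<close>

lemma trap_int_diff_le:
  assumes "0 < \<eta>" "\<eta> \<le> h"
  shows "\<bar>trap_int h \<eta> s - trap_int h \<eta> t\<bar> \<le> min \<bar>s - t\<bar> (2 * h)"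
proof -
  have le: "trap_int h \<eta> y - trap_int h \<eta> x \<le> y - x" if "x \<le> y" for x y
  proof -
    have "x - trap_int h \<eta> x \<le> y - trap_int h \<eta> y"
    proof (rule DERIV_nonneg_imp_nondecreasing[OF that])
      fix z
      have "((\<lambda>z. z - trap_int h \<eta> z) has_real_derivative 1 - trap h \<eta> z) (at z)"
        by (intro DERIV_diff DERIV_ident DERIV_trap_int assms)
      then show "\<exists>D. ((\<lambda>z. z - trap_int h \<eta> z) has_real_derivative D) (at z) \<and> 0 \<le> D"
        using trap_bounds(2)[OF assms, of z] by (intro exI conjI) auto
    qed
    then show ?thesis by simp
  qed
  have "\<bar>trap_int h \<eta> s - trap_int h \<eta> t\<bar> \<le> \<bar>s - t\<bar>"
  proof (cases "s \<le> t")
    case True then show ?thesis using le[OF True] trap_int_mono[OF assms True] by linarith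
  next
    case False
    then have "t \<le> s" by simp
    then show ?thesis using le trap_int_mono[OF assms \<open>t \<le> s\<close>] by fastforce
  qed
  moreover have "\<bar>trap_int h \<eta> s - trap_int h \<eta> t\<bar> \<le> 2 * h"
    using trap_int_bounds[OF assms, of s] trap_int_bounds[OF assms, of t] assms by linarith
  ultimately show ?thesis by simp
qed

lemma trap_int_measurable [measurable]: "0 < \<eta> \<Longrightarrow> trap_int h \<eta> \<in> borel_measurable borel"
  by (rule borel_measurable_continuous_onI, rule DERIV_continuous_on) (rule has_field_derivative_at_within[OF DERIV_trap_int])

text \<open>Both functions have the trace \<open>T\<close>, so at almost every boundary point the
  triangle inequality through \<open>T x\<close> bounds the local averages of the difference;
  \<open>annulus_average_tendsto_0\<close> converts this into averages over thin annuli.\<close>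

lemma same_trace_average:
  assumes r: "0 < r" and st: "same_trace (ball 0 r) u v"
    and u: "set_integrable lebesgue (ball 0 r) u" and v: "set_integrable lebesgue (ball 0 r) v"
    and U: "integrable lborel U" "AE x in lborel. indicator (ball 0 r) x * u x = U x"
    and V: "integrable lborel V" "AE x in lborel. indicator (ball 0 r) x * v x = V x"
    and M: "0 \<le> M" and \<rho>: "\<And>n. 0 < \<rho> n" "\<And>n. \<rho> n \<le> r" "\<rho> \<longlonglongrightarrow> 0"
  shows "(\<lambda>n. (\<integral>y. indicator {y. r - \<rho> n / 2 < norm y \<and> norm y < r} y * min \<bar>V y - U y\<bar> M \<partial>lborel) / \<rho> n) \<longlonglongrightarrow> 0"
proof -
  let ?\<Omega> = "ball (0::plane) r"
  have [measurable]: "U \<in> borel_measurable borel" "V \<in> borel_measurable borel" using U V by auto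
  have [measurable]: "ball x e \<in> sets borel" for x :: plane and e by simp
  obtain T where "is_trace ?\<Omega> u T" "is_trace ?\<Omega> v T" using st by (auto simp: same_trace_def)
  then have "AE x in hausdorff1. (x \<in> frontier ?\<Omega> \<longrightarrow>
        ((\<lambda>\<rho>. (LINT y:(?\<Omega> \<inter> ball x \<rho>)|lebesgue. \<bar>u y - T x\<bar>) / \<rho>\<^sup>2) \<longlongrightarrow> 0) (at_right 0)) \<and>
      (x \<in> frontier ?\<Omega> \<longrightarrow>
        ((\<lambda>\<rho>. (LINT y:(?\<Omega> \<inter> ball x \<rho>)|lebesgue. \<bar>v y - T x\<bar>) / \<rho>\<^sup>2) \<longlongrightarrow> 0) (at_right 0))"
    unfolding is_trace_def by (rule AE_conjI)
  then obtain N where N: "N \<in> sets borel" "hausdorff1_outer N = 0"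
    and lim: "\<And>x. x \<notin> N \<Longrightarrow> (x \<in> frontier ?\<Omega> \<longrightarrow>
        ((\<lambda>\<rho>. (LINT y:(?\<Omega> \<inter> ball x \<rho>)|lebesgue. \<bar>u y - T x\<bar>) / \<rho>\<^sup>2) \<longlongrightarrow> 0) (at_right 0)) \<and>
      (x \<in> frontier ?\<Omega> \<longrightarrow>
        ((\<lambda>\<rho>. (LINT y:(?\<Omega> \<inter> ball x \<rho>)|lebesgue. \<bar>v y - T x\<bar>) / \<rho>\<^sup>2) \<longlongrightarrow> 0) (at_right 0))"
    by (rule AE_hausdorff1_E) (rule that)
  have i\<Omega>: "integrable lborel (indicator ?\<Omega> :: plane \<Rightarrow> real)"
    by (rule integrable_real_indicator) (auto simp: emeasure_lborel_ball_finite[unfolded infinity_ennreal_def])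
  have int: "integrable lborel (\<lambda>y. indicator (?\<Omega> \<inter> ball x e) y * \<bar>W y - t\<bar>)"
    if W: "integrable lborel W" for W x and t e :: real
  proof (rule Bochner_Integration.integrable_bound)
    have [measurable]: "W \<in> borel_measurable borel" using W by auto
    show "integrable lborel (\<lambda>y. \<bar>W y\<bar> + \<bar>t\<bar> * indicator ?\<Omega> y)" using W i\<Omega> by auto
    show "(\<lambda>y. indicator (?\<Omega> \<inter> ball x e) y * \<bar>W y - t\<bar>) \<in> borel_measurable lborel" by measurable
  qed (auto simp: indicator_def)
  show ?thesis
  proof (rule annulus_average_tendsto_0[OF _ _ _ r N _ \<rho>, where C=M])
    show "(\<lambda>y. min \<bar>V y - U y\<bar> M) \<in> borel_measurable borel" by measurable
    fix x :: plane assume x: "norm x = r" "x \<notin> N"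
    have fr: "x \<in> frontier ?\<Omega>" using x r by (simp add: frontier_ball)
    have e: "(LINT y:(?\<Omega> \<inter> ball x e)|lebesgue. \<bar>u y - T x\<bar>) = (\<integral>y. indicator (?\<Omega> \<inter> ball x e) y * \<bar>U y - T x\<bar> \<partial>lborel)"
      "(LINT y:(?\<Omega> \<inter> ball x e)|lebesgue. \<bar>v y - T x\<bar>) = (\<integral>y. indicator (?\<Omega> \<inter> ball x e) y * \<bar>V y - T x\<bar> \<partial>lborel)" for e
      by (rule local_integral_eq[OF u U] local_integral_eq[OF v V]; auto)+
    have L: "((\<lambda>e. (\<integral>y. indicator (?\<Omega> \<inter> ball x e) y * \<bar>U y - T x\<bar> \<partial>lborel) / e\<^sup>2 + (\<integral>y. indicator (?\<Omega> \<inter> ball x e) y * \<bar>V y - T x\<bar> \<partial>lborel) / e\<^sup>2) \<longlongrightarrow> 0 + 0) (at_right 0)"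
      using lim[OF x(2)] fr unfolding e by (intro tendsto_add) blast+
    show "((\<lambda>e. (\<integral>y. indicator (?\<Omega> \<inter> ball x e) y * min \<bar>V y - U y\<bar> M \<partial>lborel) / e\<^sup>2) \<longlongrightarrow> 0) (at_right 0)"
    proof (rule Lim_null_comparison[OF _ L[unfolded add_0_right]], rule always_eventually, rule allI)
      fix e :: real
      have "(\<integral>y. indicator (?\<Omega> \<inter> ball x e) y * min \<bar>V y - U y\<bar> M \<partial>lborel)
          \<le> (\<integral>y. indicator (?\<Omega> \<inter> ball x e) y * \<bar>U y - T x\<bar> + indicator (?\<Omega> \<inter> ball x e) y * \<bar>V y - T x\<bar> \<partial>lborel)"
      proof (rule integral_mono_AE')
        show "integrable lborel (\<lambda>y. indicator (?\<Omega> \<inter> ball x e) y * \<bar>U y - T x\<bar> + indicator (?\<Omega> \<inter> ball x e) y * \<bar>V y - T x\<bar>)"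
          by (intro Bochner_Integration.integrable_add int U V)
      qed (auto simp: indicator_def)
      also have "\<dots> = (\<integral>y. indicator (?\<Omega> \<inter> ball x e) y * \<bar>U y - T x\<bar> \<partial>lborel) + (\<integral>y. indicator (?\<Omega> \<inter> ball x e) y * \<bar>V y - T x\<bar> \<partial>lborel)"
        by (intro Bochner_Integration.integral_add int U V)
      finally have "(\<integral>y. indicator (?\<Omega> \<inter> ball x e) y * min \<bar>V y - U y\<bar> M \<partial>lborel) / e\<^sup>2
        \<le> ((\<integral>y. indicator (?\<Omega> \<inter> ball x e) y * \<bar>U y - T x\<bar> \<partial>lborel) + (\<integral>y. indicator (?\<Omega> \<inter> ball x e) y * \<bar>V y - T x\<bar> \<partial>lborel)) / e\<^sup>2"
        by (intro divide_right_mono) auto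
      moreover have "0 \<le> (\<integral>y. indicator (?\<Omega> \<inter> ball x e) y * min \<bar>V y - U y\<bar> M \<partial>lborel)"
        using M by (intro Bochner_Integration.integral_nonneg) auto
      ultimately show "norm ((\<integral>y. indicator (?\<Omega> \<inter> ball x e) y * min \<bar>V y - U y\<bar> M \<partial>lborel) / e\<^sup>2)
        \<le> (\<integral>y. indicator (?\<Omega> \<inter> ball x e) y * \<bar>U y - T x\<bar> \<partial>lborel) / e\<^sup>2 + (\<integral>y. indicator (?\<Omega> \<inter> ball x e) y * \<bar>V y - T x\<bar> \<partial>lborel) / e\<^sup>2"
        by (simp add: add_divide_distrib)
    qed
  qed (use M in auto)
qed

text \<open>The gradient of the cutoff lives on an annulus and has size at most
  \<open>16 / \<rho>\<close>, so the two boundary terms differ by at most a multiple of the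
  normalised annulus integral of the truncated difference of \<open>U\<close> and
  \<open>V\<close>.\<close>

lemma trap_int_boundary_difference:
  fixes g :: "plane \<Rightarrow> plane"
  assumes \<eta>: "0 < \<eta>" "\<eta> \<le> h" and \<rho>: "0 < \<rho>" and \<nu>: "norm \<nu> = 1"
    and UV[measurable]: "U \<in> borel_measurable borel" "V \<in> borel_measurable borel" "l \<in> borel_measurable borel"
    and g: "integrable lborel g" "\<And>x. norm (g x) \<le> 16 / \<rho> * indicator {y. r - \<rho> / 2 < norm y \<and> norm y < r} x"
  shows "\<bar>(\<integral>x. (g x \<bullet> \<nu>) * trap_int h \<eta> (V x - l x) \<partial>lborel) - (\<integral>x. (g x \<bullet> \<nu>) * trap_int h \<eta> (U x - l x) \<partial>lborel)\<bar>
    \<le> 16 * ((\<integral>y. indicator {y. r - \<rho> / 2 < norm y \<and> norm y < r} y * min \<bar>V y - U y\<bar> (2 * h) \<partial>lborel) / \<rho>)"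
proof -
  let ?A = "{y::plane. r - \<rho> / 2 < norm y \<and> norm y < r}"
  have [measurable]: "g \<in> borel_measurable borel" "trap_int h \<eta> \<in> borel_measurable borel" using g(1) \<eta>(1) by auto
  have [measurable]: "?A \<in> sets borel" by measurable
  have "emeasure lborel ?A \<le> emeasure lborel (ball (0::plane) r)" by (intro emeasure_mono) auto
  then have "emeasure lborel ?A < top" using emeasure_lborel_ball_finite[unfolded infinity_ennreal_def] by (rule le_less_trans)
  then have iA: "integrable lborel (indicator ?A :: plane \<Rightarrow> real)" by (intro integrable_real_indicator) auto
  have int: "integrable lborel (\<lambda>x. (g x \<bullet> \<nu>) * trap_int h \<eta> (W x - l x))"
    if [measurable]: "W \<in> borel_measurable borel" for W
  proof (rule Bochner_Integration.integrable_bound)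
    show "integrable lborel (\<lambda>x. norm (g x) * (2 * h))" by (intro integrable_mult_left integrable_norm g(1))
    show "AE x in lborel. norm ((g x \<bullet> \<nu>) * trap_int h \<eta> (W x - l x)) \<le> norm (norm (g x) * (2 * h))"
    proof (rule AE_I2)
      fix x
      have "\<bar>g x \<bullet> \<nu>\<bar> \<le> norm (g x)" using Cauchy_Schwarz_ineq2[of "g x" \<nu>] \<nu> by simp
      moreover have "\<bar>trap_int h \<eta> (W x - l x)\<bar> \<le> 2 * h" using trap_int_bounds[OF \<eta>, of "W x - l x"] \<eta> by linarith
      ultimately show "norm ((g x \<bullet> \<nu>) * trap_int h \<eta> (W x - l x)) \<le> norm (norm (g x) * (2 * h))"
        using \<eta> by (simp add: abs_mult mult_mono)
    qed
  qed measurable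
  have iM: "integrable lborel (\<lambda>y. 16 / \<rho> * (indicator ?A y * min \<bar>V y - U y\<bar> (2 * h)))"
  proof (rule Bochner_Integration.integrable_bound)
    show "integrable lborel (\<lambda>y. 16 / \<rho> * (2 * h) * indicator ?A y)" using iA by auto
    show "AE y in lborel. norm (16 / \<rho> * (indicator ?A y * min \<bar>V y - U y\<bar> (2 * h))) \<le> norm (16 / \<rho> * (2 * h) * indicator ?A y)"
      using \<eta> \<rho> by (intro AE_I2) (auto simp: indicator_def abs_mult divide_right_mono)
  qed measurable
  have "(\<integral>x. (g x \<bullet> \<nu>) * trap_int h \<eta> (V x - l x) \<partial>lborel) - (\<integral>x. (g x \<bullet> \<nu>) * trap_int h \<eta> (U x - l x) \<partial>lborel)
      = (\<integral>x. (g x \<bullet> \<nu>) * trap_int h \<eta> (V x - l x) - (g x \<bullet> \<nu>) * trap_int h \<eta> (U x - l x) \<partial>lborel)"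
    by (intro Bochner_Integration.integral_diff[symmetric] int UV)
  moreover have "\<bar>\<dots>\<bar> \<le> (\<integral>y. 16 / \<rho> * (indicator ?A y * min \<bar>V y - U y\<bar> (2 * h)) \<partial>lborel)"
  proof (rule order_trans[OF integral_abs_bound], rule integral_mono[OF _ iM])
    show "integrable lborel (\<lambda>x. \<bar>(g x \<bullet> \<nu>) * trap_int h \<eta> (V x - l x) - (g x \<bullet> \<nu>) * trap_int h \<eta> (U x - l x)\<bar>)"
      by (intro integrable_abs Bochner_Integration.integrable_diff int UV)
    fix x
    have "\<bar>g x \<bullet> \<nu>\<bar> \<le> 16 / \<rho> * indicator ?A x" using Cauchy_Schwarz_ineq2[of "g x" \<nu>] \<nu> g(2)[of x] by simp
    moreover have "\<bar>trap_int h \<eta> (V x - l x) - trap_int h \<eta> (U x - l x)\<bar> \<le> min \<bar>V x - U x\<bar> (2 * h)"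
      using trap_int_diff_le[OF \<eta>, of "V x - l x" "U x - l x"] by simp
    ultimately have "\<bar>g x \<bullet> \<nu>\<bar> * \<bar>trap_int h \<eta> (V x - l x) - trap_int h \<eta> (U x - l x)\<bar> \<le> (16 / \<rho> * indicator ?A x) * min \<bar>V x - U x\<bar> (2 * h)"
      using \<rho> by (intro mult_mono) auto
    then show "\<bar>(g x \<bullet> \<nu>) * trap_int h \<eta> (V x - l x) - (g x \<bullet> \<nu>) * trap_int h \<eta> (U x - l x)\<bar> \<le> 16 / \<rho> * (indicator ?A x * min \<bar>V x - U x\<bar> (2 * h))"
      unfolding right_diff_distrib[symmetric] abs_mult mult.assoc .
  qed
  moreover have "(\<integral>y. 16 / \<rho> * (indicator ?A y * min \<bar>V y - U y\<bar> (2 * h)) \<partial>lborel) = 16 * ((\<integral>y. indicator ?A y * min \<bar>V y - U y\<bar> (2 * h) \<partial>lborel) / \<rho>)"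
    by (simp add: field_simps)
  ultimately show ?thesis by simp
qed

section \<open>The flux of the three-valued function and the lower bound\<close>

context triple_junction
begin

lemma ray_integral_ge:
  assumes tf: "test_function (ball 0 r) \<phi> g" and \<phi>: "\<And>x. 0 \<le> \<phi> x" "\<And>x. \<phi> x \<le> 1" "\<And>x. norm x \<le> R \<Longrightarrow> \<phi> x = 1"
    and R: "0 \<le> R" "R < r"
  shows "R \<le> ray_integral \<phi> (dir k)"
proof -
  have [measurable]: "\<phi> \<in> borel_measurable borel" using integrable_test_function(1)[OF tf] by auto
  have "R = (\<integral>t. indicator {0<..R} t \<partial>lborel)" using R by simp
  also have "\<dots> \<le> (\<integral>t. indicator {0<..<r} t * \<phi> (t *\<^sub>R dir k) \<partial>lborel)"
  proof (rule integral_mono)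
    show "integrable lborel (indicator {0<..R} :: real \<Rightarrow> real)" using R by (intro integrable_real_indicator) auto
    show "integrable lborel (\<lambda>t. indicator {0<..<r} t * \<phi> (t *\<^sub>R dir k))"
    proof (rule Bochner_Integration.integrable_bound)
      show "integrable lborel (indicator {0<..<r} :: real \<Rightarrow> real)" using r by (intro integrable_real_indicator) auto
      show "AE t in lborel. norm (indicator {0<..<r} t * \<phi> (t *\<^sub>R dir k)) \<le> norm (indicator {0<..<r} t :: real)"
        using \<phi>(1,2) by (intro AE_I2) (auto simp: indicator_def)
    qed measurable
    show "indicator {0<..R} t \<le> indicator {0<..<r} t * \<phi> (t *\<^sub>R dir k)" for t
      using \<phi>(1)[of "t *\<^sub>R dir k"] \<phi>(3)[of "t *\<^sub>R dir k"] R by (auto simp: indicator_def)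
  qed
  finally show ?thesis unfolding ray_integral_eq[OF tf] .
qed

text \<open>In the applications the graph of \<open>u\<close> stays out of the band around
  \<open>l\<close>, where \<open>\<Psi>\<close> varies; this is the hypothesis on \<open>w\<close>.
  Although \<open>l\<close> is not constant, the composition is then constant on each sector, and
  the formula for cones applies.\<close>

lemma integral_composition_u:
  assumes tf: "test_function (ball 0 r) \<phi> g"
    and U: "integrable lborel U" "AE x in lborel. indicator (ball 0 r) x * u x = U x"
    and m[measurable]: "\<Psi> \<in> borel_measurable borel" "l \<in> borel_measurable borel"
    and w: "\<And>i x. i \<in> {1, 2, 3} \<Longrightarrow> x \<in> ball 0 r \<Longrightarrow> \<Psi> (a i - l x) = w i"
  shows "(\<integral>x. (g x \<bullet> \<nu>) * \<Psi> (U x - l x) \<partial>lborel) = (\<Sum>i\<in>{1, 2, 3}. w i *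
    ((ray_integral \<phi> (dir i) *\<^sub>R perp (dir i) - ray_integral \<phi> (dir (i - 1)) *\<^sub>R perp (dir (i - 1))) \<bullet> \<nu>))"
proof -
  let ?A = "\<lambda>i. cone_sector i \<inter> ball 0 r"
  have gi: "integrable lborel g" by (rule integrable_test_function(2)[OF tf])
  have [measurable]: "U \<in> borel_measurable borel" "g \<in> borel_measurable borel" using U gi by auto
  have A[measurable]: "?A i \<in> sets borel" for i by (auto simp: cone_sector_def)
  have iA: "integrable lborel (\<lambda>x. indicator (?A i) x *\<^sub>R g x)" for i
    by (intro integrable_mult_indicator gi) simp
  obtain K where K: "K \<subseteq> ball 0 r" "\<And>x. x \<notin> K \<Longrightarrow> g x = 0" using test_function_bounds[OF tf] by metis
  have null: "rays \<union> {0} \<in> null_sets lborel"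
    unfolding rays_def by (intro null_sets.Un ray_null) (auto simp: null_sets_def)
  have "(\<integral>x. (g x \<bullet> \<nu>) * \<Psi> (U x - l x) \<partial>lborel) = (\<integral>x. (\<Sum>i\<in>{1, 2, 3}. w i * ((indicator (?A i) x *\<^sub>R g x) \<bullet> \<nu>)) \<partial>lborel)"
  proof (rule integral_cong_AE)
    show "AE x in lborel. (g x \<bullet> \<nu>) * \<Psi> (U x - l x) = (\<Sum>i\<in>{1, 2, 3}. w i * ((indicator (?A i) x *\<^sub>R g x) \<bullet> \<nu>))"
      using AE_not_in[OF null] U(2)
    proof eventually_elim
      case (elim x)
      show ?case
      proof (cases "x \<in> ball 0 r")
        case True
        have nz: "x \<noteq> 0" and nr: "x \<notin> rays" using elim by auto
        have "\<exists>i\<in>{1, 2, 3}. x \<in> cone_sector i"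
        proof (rule plane_cover[OF True nz])
          fix k :: nat assume "k \<in> {0, 1, 2}" "x \<in> ray r k"
          then show ?thesis using nr by (auto simp: rays_def)
        qed (rule bexI)
        then obtain i where i: "i \<in> {1, 2, 3}" "x \<in> cone_sector i" by (rule bexE)
        have "U x = a i" using elim u_cone[OF i True] True by simp
        then have L: "(g x \<bullet> \<nu>) * \<Psi> (U x - l x) = w i * (g x \<bullet> \<nu>)" using w[OF i(1) True] by simp
        have "(\<Sum>k\<in>{1, 2, 3}. w k * ((indicator (?A k) x *\<^sub>R g x) \<bullet> \<nu>)) = (\<Sum>k\<in>{1, 2, 3}. if k = i then w i * (g x \<bullet> \<nu>) else 0)"
        proof (rule sum.cong[OF refl])
          fix k :: nat assume k: "k \<in> {1, 2, 3}"
          show "w k * ((indicator (?A k) x *\<^sub>R g x) \<bullet> \<nu>) = (if k = i then w i * (g x \<bullet> \<nu>) else 0)"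
            using cone_sector_disjoint[OF i(1) k _ i(2)] i True by (cases "k = i") auto
        qed
        also have "\<dots> = w i * (g x \<bullet> \<nu>)" using i(1) by (subst sum.delta) auto
        finally show ?thesis using L by simp
      next
        case False
        then have "g x = 0" using K by blast
        then show ?thesis by simp
      qed
    qed
  qed measurable
  also have "\<dots> = (\<Sum>i\<in>{1, 2, 3}. w i * ((\<integral>x. indicator (?A i) x *\<^sub>R g x \<partial>lborel) \<bullet> \<nu>))"
  proof -
    have "(\<integral>x. (\<Sum>i\<in>{1, 2, 3}. w i * ((indicator (?A i) x *\<^sub>R g x) \<bullet> \<nu>)) \<partial>lborel)
        = (\<Sum>i\<in>{1, 2, 3}. \<integral>x. w i * ((indicator (?A i) x *\<^sub>R g x) \<bullet> \<nu>) \<partial>lborel)"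
      by (rule Bochner_Integration.integral_sum) (intro integrable_mult_right integrable_inner_left iA)
    also have "\<dots> = (\<Sum>i\<in>{1, 2, 3}. w i * ((\<integral>x. indicator (?A i) x *\<^sub>R g x \<partial>lborel) \<bullet> \<nu>))"
      by (intro sum.cong refl) (simp only: integral_mult_right_zero integral_inner_left[OF iA])
    finally show ?thesis .
  qed
  also have "\<dots> = (\<Sum>i\<in>{1, 2, 3}. w i *
    ((ray_integral \<phi> (dir i) *\<^sub>R perp (dir i) - ray_integral \<phi> (dir (i - 1)) *\<^sub>R perp (dir (i - 1))) \<bullet> \<nu>))"
    by (intro sum.cong refl) (simp only: sector_gradient[OF tf])
  finally show ?thesis .
qed

text \<open>For \<open>u\<close> the flux is explicit: up to a common factor, each band contributes
  the integral of the cutoff over its own ray and half of the integral over the ray in direction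
  \<open>dir 0\<close>, the half being the size of the cosine of 120 degrees. The two halves add up,
  and the three ray integrals are each nearly \<open>r\<close>. Passing from \<open>u\<close> to
  \<open>v\<close> changes the flux by a multiple of the boundary error \<open>E n\<close>.\<close>

lemma F0_ge:
  assumes gap: "sqrt (2 * r) \<le> a 2 - a 1" "sqrt (2 * r) \<le> a 3 - a 2"
    and v: "v \<in> SBV (ball 0 r)" and st: "same_trace (ball 0 r) u v"
    and c: "c = 1 / sqrt (2 * r)" and h: "h = sqrt (2 * r) / 4" and \<eta>: "0 < \<eta>" "\<eta> \<le> h"
  shows "ennreal (2 * c * (2 * h - \<eta>) * (3 * r)) \<le> F0 (ball 0 r) v"
proof -
  let ?\<Omega> = "ball (0::plane) r"
  have sq: "0 < sqrt (2 * r)" "sqrt (2 * r) * sqrt (2 * r) = 2 * r" using r by simp_all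
  \<comment> \<open>The choice of constants makes the rise of a band over the radius,
    \<open>c / 2 * r\<close>, equal to its half height \<open>h\<close>.\<close>
  have c0: "0 < c" and h0: "0 < h" and ch: "4 * c * h = 1" and cr: "c / 2 * r = h"
    using sq r by (auto simp: c h field_simps)
  define \<nu>1 where "\<nu>1 = perp (dir 1)"
  define \<nu>2 where "\<nu>2 = perp (dir 2)"
  have \<nu>: "norm \<nu>1 = 1" "norm \<nu>2 = 1" "\<nu>1 \<bullet> \<nu>2 = - 1 / 2"
    using inner_dir_Suc[of 1] by (simp_all add: \<nu>1_def \<nu>2_def perp_inner_perp numeral_2_eq_2)
  define d1 where "d1 = (a 1 + a 2) / 2"
  define d2 where "d2 = (a 2 + a 3) / 2"
  define l1 where "l1 x = ((c / 2) *\<^sub>R \<nu>1) \<bullet> x + d1" for x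
  define l2 where "l2 x = ((c / 2) *\<^sub>R \<nu>2) \<bullet> x + d2" for x
  have lm[measurable]: "l1 \<in> borel_measurable borel" "l2 \<in> borel_measurable borel"
    unfolding l1_def l2_def by measurable
  have tilt: "\<bar>((c / 2) *\<^sub>R n) \<bullet> x\<bar> \<le> h" if "norm n = 1" "norm x < r" for n x :: plane
  proof -
    have "\<bar>((c / 2) *\<^sub>R n) \<bullet> x\<bar> \<le> norm ((c / 2) *\<^sub>R n) * norm x" by (rule Cauchy_Schwarz_ineq2)
    also have "\<dots> \<le> c / 2 * r" using that c0 by (intro mult_mono) auto
    finally show ?thesis using cr by simp
  qed
  have h4: "sqrt (2 * r) = 4 * h" by (simp add: h)
  \<comment> \<open>A gap of \<open>4 * h\<close> is just enough: \<open>h\<close> for the tilt and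
    \<open>h\<close> for the half height on each side of the midpoint.\<close>
  have band: "p + h \<le> t + (p + q) / 2 \<and> t + (p + q) / 2 \<le> q - h" if "\<bar>t\<bar> \<le> h" "4 * h \<le> q - p" for p q t
    using that by (simp add: field_simps abs_le_iff)
  have l12: "a 1 + h \<le> l1 x \<and> l1 x \<le> a 2 - h \<and> a 2 + h \<le> l2 x \<and> l2 x \<le> a 3 - h" if "norm x < r" for x
    using band[OF tilt[OF \<nu>(1) that] gap(1)[unfolded h4]] band[OF tilt[OF \<nu>(2) that] gap(2)[unfolded h4]]
    unfolding l1_def l2_def d1_def d2_def by blast
  then have l1b: "a 1 + h \<le> l1 x" "l1 x \<le> a 2 - h" and l2b: "a 2 + h \<le> l2 x" "l2 x \<le> a 3 - h" if "norm x < r" for x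
    using that by simp_all
  have sep: False if "norm x < r" "\<bar>t - (((c / 2) *\<^sub>R \<nu>1) \<bullet> x + d1)\<bar> < h" "\<bar>t - (((c / 2) *\<^sub>R \<nu>2) \<bullet> x + d2)\<bar> < h" for x t
    using that(2,3) l1b[OF that(1)] l2b[OF that(1)] unfolding l1_def l2_def by linarith
  have vi: "set_integrable lebesgue ?\<Omega> v" using v by (simp add: SBV_def BV_def)
  obtain V where V: "integrable lborel V" "AE x in lborel. indicator ?\<Omega> x * v x = V x" by (rule borel_representative[OF vi])
  obtain U where U: "integrable lborel U" "AE x in lborel. indicator ?\<Omega> x * u x = U x" by (rule borel_representative[OF u_integrable])
  have UVm: "U \<in> borel_measurable borel" "V \<in> borel_measurable borel" using U V by auto
  define \<rho> where "\<rho> n = r / real (Suc n)" for n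
  have \<rho>: "\<And>n. 0 < \<rho> n" "\<And>n. \<rho> n \<le> r"
    using r by (auto simp: \<rho>_def divide_le_eq)
  have \<rho>0: "\<rho> \<longlonglongrightarrow> 0" unfolding \<rho>_def by real_asymp
  let ?\<Psi> = "trap_int h \<eta>"
  define K where "K = 2 * h - \<eta>"
  have K: "0 \<le> K" using \<eta> h0 by (simp add: K_def)
  define E where "E n = (\<integral>y. indicator {y. r - \<rho> n / 2 < norm y \<and> norm y < r} y * min \<bar>V y - U y\<bar> (2 * h) \<partial>lborel) / \<rho> n" for n
  have E0: "E \<longlonglongrightarrow> 0"
    unfolding E_def using h0 by (intro same_trace_average[OF r st u_integrable vi U V _ \<rho> \<rho>0]) simp
  \<comment> \<open>The error \<open>64 * c * E n\<close> is the factor \<open>2 * c\<close> times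
    \<open>32 * E n\<close>, with \<open>16 * E n\<close> from each band.\<close>
  have step: "ennreal (2 * c * K * (3 * (r - \<rho> n / 2)) - 64 * c * E n) \<le> F0 ?\<Omega> v" for n
  proof -
    obtain \<phi> g where tf: "test_function ?\<Omega> \<phi> g" and \<phi>: "\<And>x. 0 \<le> \<phi> x" "\<And>x. \<phi> x \<le> 1"
      and \<phi>1: "\<And>x. norm x \<le> r - \<rho> n / 2 \<Longrightarrow> \<phi> x = 1"
      and g: "\<And>x. norm (g x) \<le> 16 / \<rho> n * indicator {y. r - \<rho> n / 2 < norm y \<and> norm y < r} x"
      by (rule radial_cutoff[OF r \<rho>]) (rule that)
    have gi: "integrable lborel g" by (rule integrable_test_function(2)[OF tf])
    define I where "I k = ray_integral \<phi> (dir k)" for k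
    define X1 where "X1 = (\<integral>x. (g x \<bullet> \<nu>1) * ?\<Psi> (V x - l1 x) \<partial>lborel)"
    define X2 where "X2 = (\<integral>x. (g x \<bullet> \<nu>2) * ?\<Psi> (V x - l2 x) \<partial>lborel)"
    define Y1 where "Y1 = (\<integral>x. (g x \<bullet> \<nu>1) * ?\<Psi> (U x - l1 x) \<partial>lborel)"
    define Y2 where "Y2 = (\<integral>x. (g x \<bullet> \<nu>2) * ?\<Psi> (U x - l2 x) \<partial>lborel)"
    have cal: "ennreal (- 2 * c * (X1 + X2)) \<le> F0 ?\<Omega> v"
      unfolding X1_def X2_def l1_def l2_def by (rule calibration_inequality[OF v r V tf \<phi> \<nu> \<eta> c0 ch sep])
    have XY1: "\<bar>X1 - Y1\<bar> \<le> 16 * E n"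
      unfolding X1_def Y1_def E_def by (rule trap_int_boundary_difference[OF \<eta> \<rho>(1) \<nu>(1) UVm lm(1) gi g])
    have XY2: "\<bar>X2 - Y2\<bar> \<le> 16 * E n"
      unfolding X2_def Y2_def E_def by (rule trap_int_boundary_difference[OF \<eta> \<rho>(1) \<nu>(2) UVm lm(2) gi g])
    have \<Psi>m: "?\<Psi> \<in> borel_measurable borel" using \<eta> by simp
    have I3: "I 3 = I 0" by (simp add: I_def dir_3)
    have P: "perp (dir 1) \<bullet> \<nu>1 = 1" "perp (dir 3) \<bullet> \<nu>1 = - 1 / 2" "perp (dir 2) \<bullet> \<nu>2 = 1" "perp (dir 3) \<bullet> \<nu>2 = - 1 / 2"
    proof -
      have s: "Suc 0 = 1" "Suc 2 = 3" by simp_all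
      have "dir 3 \<bullet> dir 1 = - 1 / 2" using inner_dir_Suc[of 0] unfolding s dir_3 .
      moreover have "dir 3 \<bullet> dir 2 = - 1 / 2" using inner_dir_Suc[of 2] unfolding s by (simp only: inner_commute)
      ultimately show "perp (dir 1) \<bullet> \<nu>1 = 1" "perp (dir 3) \<bullet> \<nu>1 = - 1 / 2" "perp (dir 2) \<bullet> \<nu>2 = 1" "perp (dir 3) \<bullet> \<nu>2 = - 1 / 2"
        unfolding \<nu>1_def \<nu>2_def perp_inner_perp by (simp_all add: dot_square_norm)
    qed
    \<comment> \<open>The first band lies between \<open>a 1\<close> and \<open>a 2\<close>, so that
      \<open>a 1\<close> is below it and the other two values are above; the second band separates
      \<open>a 3\<close> from the two smaller values in the same way.\<close>
    have "Y1 = (\<Sum>i\<in>{1, 2, 3}. (if i = 1 then 0 else K) * ((I i *\<^sub>R perp (dir i) - I (i - 1) *\<^sub>R perp (dir (i - 1))) \<bullet> \<nu>1))"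
      unfolding Y1_def I_def
    proof (rule integral_composition_u[OF tf U \<Psi>m lm(1)])
      fix i :: nat and x :: plane assume i: "i \<in> {1, 2, 3}" and x: "x \<in> ?\<Omega>"
      have "a 1 - l1 x \<le> - h" "h \<le> a 2 - l1 x" "h \<le> a 3 - l1 x" using l1b[of x] x a23 by auto
      then show "?\<Psi> (a i - l1 x) = (if i = 1 then 0 else K)"
        using i trap_int_eq[OF \<eta>] by (auto simp: K_def)
    qed
    also have "\<dots> = K * ((I 3 *\<^sub>R perp (dir 3) - I 1 *\<^sub>R perp (dir 1)) \<bullet> \<nu>1)"
      by (simp add: algebra_simps inner_diff_left)
    also have "\<dots> = - K * (I 0 / 2 + I 1)" by (simp only: inner_diff_left inner_scaleR_left P I3) (simp add: algebra_simps)
    finally have Y1: "Y1 = - K * (I 0 / 2 + I 1)" .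
    have "Y2 = (\<Sum>i\<in>{1, 2, 3}. (if i = 3 then K else 0) * ((I i *\<^sub>R perp (dir i) - I (i - 1) *\<^sub>R perp (dir (i - 1))) \<bullet> \<nu>2))"
      unfolding Y2_def I_def
    proof (rule integral_composition_u[OF tf U \<Psi>m lm(2)])
      fix i :: nat and x :: plane assume i: "i \<in> {1, 2, 3}" and x: "x \<in> ?\<Omega>"
      have "a 1 - l2 x \<le> - h" "a 2 - l2 x \<le> - h" "h \<le> a 3 - l2 x" using l2b[of x] x a12 by auto
      then show "?\<Psi> (a i - l2 x) = (if i = 3 then K else 0)"
        using i trap_int_eq[OF \<eta>] by (auto simp: K_def)
    qed
    also have "\<dots> = K * ((I 3 *\<^sub>R perp (dir 3) - I 2 *\<^sub>R perp (dir 2)) \<bullet> \<nu>2)"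
      by simp
    also have "\<dots> = - K * (I 0 / 2 + I 2)" by (simp only: inner_diff_left inner_scaleR_left P I3) (simp add: algebra_simps)
    finally have Y2: "Y2 = - K * (I 0 / 2 + I 2)" .
    have I: "r - \<rho> n / 2 \<le> I k" for k
      unfolding I_def by (rule ray_integral_ge[OF tf \<phi> \<phi>1]) (use \<rho>[of n] r in auto)
    have "2 * c * K * (3 * (r - \<rho> n / 2)) \<le> 2 * c * K * (I 0 + I 1 + I 2)"
      using I[of 0] I[of 1] I[of 2] c0 K by (intro mult_left_mono) auto
    also have "\<dots> = - 2 * c * (Y1 + Y2)" unfolding Y1 Y2 by (simp add: algebra_simps)
    finally have 1: "2 * c * K * (3 * (r - \<rho> n / 2)) \<le> - 2 * c * (Y1 + Y2)" .
    have "(X1 + X2) - (Y1 + Y2) \<le> 32 * E n" using XY1 XY2 by linarith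
    then have "2 * c * ((X1 + X2) - (Y1 + Y2)) \<le> 2 * c * (32 * E n)" using c0 by (intro mult_left_mono) auto
    then have "2 * c * K * (3 * (r - \<rho> n / 2)) - 64 * c * E n \<le> - 2 * c * (X1 + X2)" using 1 by (simp add: algebra_simps)
    then have "ennreal (2 * c * K * (3 * (r - \<rho> n / 2)) - 64 * c * E n) \<le> ennreal (- 2 * c * (X1 + X2))" by (rule ennreal_leI)
    then show ?thesis using cal by (rule order_trans)
  qed
  have "(\<lambda>n. 2 * c * K * (3 * (r - \<rho> n / 2)) - 64 * c * E n) \<longlonglongrightarrow> 2 * c * K * (3 * (r - 0 / 2)) - 64 * c * 0"
    by (intro tendsto_intros \<rho>0 E0) simp
  then have "(\<lambda>n. ennreal (2 * c * K * (3 * (r - \<rho> n / 2)) - 64 * c * E n)) \<longlonglongrightarrow> ennreal (2 * c * K * (3 * r))"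
    by (intro tendsto_ennrealI) simp
  then have "ennreal (2 * c * K * (3 * r)) \<le> F0 ?\<Omega> v"
    by (rule LIMSEQ_le_const2) (use step in blast)
  then show ?thesis by (simp add: K_def)
qed

text \<open>Letting \<open>\<eta>\<close> tend to 0 along \<open>h / (n + 1)\<close> recovers the
  full band height, and \<open>2 * c * (2 * h) = 1\<close> turns the lower bound into
  \<open>3 * r\<close>, which the energy of \<open>u\<close> does not exceed.\<close>

lemma dirichlet_minimizer_u:
  assumes gap: "sqrt (2 * r) \<le> a 2 - a 1" "sqrt (2 * r) \<le> a 3 - a 2"
  shows "dirichlet_minimizer (ball 0 r) u"
  unfolding dirichlet_minimizer_def
proof (intro conjI ballI impI u_SBV)
  fix v assume v: "v \<in> SBV (ball 0 r)" and st: "same_trace (ball 0 r) u v"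
  define c where "c = 1 / sqrt (2 * r)"
  define h where "h = sqrt (2 * r) / 4"
  have h: "0 < h" "2 * c * (2 * h) = 1" using r by (simp_all add: h_def c_def)
  have "(\<lambda>n. 2 * c * (2 * h - h / real (Suc n)) * (3 * r)) \<longlonglongrightarrow> 2 * c * (2 * h) * (3 * r)" by real_asymp
  then have "(\<lambda>n. ennreal (2 * c * (2 * h - h / real (Suc n)) * (3 * r))) \<longlonglongrightarrow> ennreal (3 * r)"
    unfolding h(2) by (intro tendsto_ennrealI) simp
  then have "ennreal (3 * r) \<le> F0 (ball 0 r) v"
  proof (rule LIMSEQ_le_const2, intro exI[of _ 0] allI impI)
    fix n :: nat
    show "ennreal (2 * c * (2 * h - h / real (Suc n)) * (3 * r)) \<le> F0 (ball 0 r) v"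
      by (rule F0_ge[OF gap v st c_def h_def]) (use h(1) in \<open>auto simp: divide_le_eq\<close>)
  qed
  then show "F0 (ball 0 r) u \<le> F0 (ball 0 r) v" using F0_u by (rule order_trans[rotated])
qed

end

theorem mainTheorem5:
  fixes r :: real and a :: "nat \<Rightarrow> real" and u :: "real^2 \<Rightarrow> real"
  assumes "r > 0"
    and "a 1 < a 2" and "a 2 < a 3"
    and "\<And>i. i \<in> {1, 2} \<Longrightarrow> a (i + 1) - a i \<ge> sqrt (2 * r)"
    and "\<And>i x. i \<in> {1, 2, 3} \<Longrightarrow> x \<in> sector r i \<Longrightarrow> x \<noteq> 0 \<Longrightarrow> u x = a i"
  shows "dirichlet_minimizer (ball 0 r) u"
proof -
  interpret triple_junction r a u
    using assms(1,2,3,5) by unfold_locales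
  show ?thesis
    using assms(4)[of 1] assms(4)[of 2] by (intro dirichlet_minimizer_u) (simp_all add: eval_nat_numeral)
qed

end
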